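(* Assume that $(X,d,T)$ has the $g$-almost product property and the uniform separation property, and let $\varphi\in C(X,\mathbb{R})$. Let $C\subset Y$. (1) If $C$ is not a subset of $\Xi(M(X,T))$, then $\{x\in X: C\subset A(\Xi L_n x)\}=\emptyset$. (2) If $C$ is a non-empty subset of $\Xi(M(X,T))$, then $$P(\Delta_{sub}(C),\varphi)=\inf_{y\in C}\ \sup_{\mu\in M(X,T),\ \Xi\mu=y}\left\{h(T,\mu)+\int\varphi\,d\mu\right\}=\inf_{y\in C}\Lambda(y,\varphi).$$
   Context: Setting. $(X,d)$ is a compact metric space and $T:X\to X$ is continuous. $M(X)$ is the set of Borel probability measures on $X$ with the weak* topology, $M(X,T)$ the subset of $T$-invariant ones, and $h(T,\mu)$ the metric (measure-theoretic) entropy. Fix a countable dense subset $\{f_1,f_2,\dots\}$ of $C(X,[0,1])$ and metrize $M(X)$ by $\rho(\mu,\nu)=\sum_{k\ge1}2^{-k}|\int f_k\,d\mu-\int f_k\,d\nu|$; the metric on $X$ is taken to be $d(x,y)=\rho(\delta_x,\delta_y)$ (equivalent to the original one). The $n$-th empirical measure is $L_nx=\frac1n\sum_{k=0}^{n-1}\delta_{T^kx}$. $Y$ is a real vector space with a metric $d'$ that is linearly compatible: $d'(x_1+x_2,y_1+y_2)\le d'(x_1,y_1)+d'(x_2,y_2)$ and $d'(\lambda x,\lambda y)\le|\lambda|d'(x,y)$ for all vectors in $Y$ and $\lambda\in\mathbb{R}$. $\Xi:M(X)\to Y$ is continuous and affine. $A(x_n)$ denotes the set of accumulation points (limits of subsequences)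 of a sequence $(x_n)$; $A(\Xi L_nx)$ is that of $(\Xi L_nx)_{n\ge1}$. $\Delta_{sub}(C)=\{x\in X:A(\Xi L_nx)\supset C\}$. For $y\in Y$, $\Lambda(y,\varphi)=\sup\{h(T,\mu)+\int\varphi\,d\mu:\mu\in M(X,T),\ \Xi\mu=y\}$ if $y\in\Xi(M(X,T))$, and $\Lambda(y,\varphi)=-\infty$ otherwise. $g$-almost product property: A blow-up function is a nondecreasing unbounded map $g:\mathbb{N}\to\mathbb{N}$ with $g(n)<n$ (for $n\ge1$; the value $0$ is allowed) and $g(n)/n\to0$. Let $\Lambda_n=\{0,\dots,n-1\}$ and $B_n(g;x,\epsilon)=\{y\in X:\exists\Lambda\subset\Lambda_n,\ \#(\Lambda_n\setminus\Lambda)\le g(n),\ \max\{d(T^jx,T^jy):j\in\Lambda\}\le\epsilon\}$. $(X,d,T)$ has the $g$-almost product property (with blow-up function $g$) if there is a nonincreasing $m:\mathbb{R}^+\to\mathbb{N}$ such that for all $k\ge1$, $x_1,\dots,x_k\in X$, $\epsilon_1,\dots,\epsilon_k>0$ and integers $n_j\ge m(\epsilon_j)$ ($n_j\geq 1$), $\bigcap_{j=1}^kT^{-M_{j-1}}B_{n_j}(g;x_j,\epsilon_j)\ne\emptyset$, where $M_0=0$, $M_i=n_1+\cdots+n_i$. Uniform separation property: Points $x,y$ are $(\delta,n,\epsilon)$-separated if $\#\{0\le j\le n-1:d(T^jx,T^jy)>\epsilon\}\ge\delta n$; a set is $(\delta,n,\epsilon)$-separated if any two distinct points of it are. For $F\subset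 M(X)$, $X_{n,F}=\{x:L_nx\in F\}$ and $N(F;\delta,n,\epsilon)$ is the maximal cardinality of a $(\delta,n,\epsilon)$-separated subset of $X_{n,F}$. The property holds if for every $\eta>0$ there are $\delta^*>0,\epsilon^*>0$ such that for every ergodic $\mu\in M(X,T)$ and every neighborhood $F\subset M(X)$ of $\mu$ there is $n^*_{F,\mu,\eta}$ with $N(F;\delta^*,n,\epsilon^* )\ge\exp(n(h(T,\mu)-\eta))$ for all $n\ge n^*_{F,\mu,\eta}$. Topological pressure of an arbitrary set $Z\subset X$: $B_n(x,\epsilon)=\{y:\max_{0\le i\le n-1}d(T^ix,T^iy)\le\epsilon\}$, $S_n\varphi=\sum_{i=0}^{n-1}\varphi\circ T^i$, $\Gamma_n(Z,\epsilon)$ is the collection of finite or countable covers of $Z$ by sets $B_m(x,\epsilon)$ with $m\ge n$; $M(Z,t,\varphi,n,\epsilon)=\inf_{\mathcal{C}\in\Gamma_n(Z,\epsilon)}\sum_{B_m(x,\epsilon)\in\mathcal{C}}\exp(-tm+\sup_{y\in B_m(x,\epsilon)}S_m\varphi(y))$, $M(Z,t,\varphi,\epsilon)=\lim_{n\to\infty}M(Z,t,\varphi,n,\epsilon)$, $P(Z,\varphi,\epsilon)=\inf\{t:M(Z,t,\varphi,\epsilon)=0\}=\sup\{t:M(Z,t,\varphi,\epsilon)=\infty\}$, $P(Z,\varphi)=\lim_{\epsilon\to0}P(Z,\varphi,\epsilon)$. *)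

theory Defs
  imports "HOL-Probability.Probability"
begin

section \<open>Invariant measures and the weak* topology\<close>

definition borel_prob :: "'a::topological_space measure set" where
  "borel_prob = {\<mu>. prob_space \<mu> \<and> sets \<mu> = sets borel}"

definition inv_prob :: "('a::topological_space \<Rightarrow> 'a) \<Rightarrow> 'a measure set" where
  "inv_prob T = {\<mu> \<in> borel_prob. distr \<mu> borel T = \<mu>}"

definition ergodic_prob :: "('a::topological_space \<Rightarrow> 'a) \<Rightarrow> 'a measure set" where
  "ergodic_prob T =
     {\<mu> \<in> inv_prob T. \<forall>A \<in> sets borel. T -` A = A \<longrightarrow> measure \<mu> A = 0 \<or> measure \<mu> A = 1}"

text \<open>The coarsest topology on the Borel probability measures that makes all integration maps of
  continuous real functions continuous; it is used on compact spaces, where these are bounded.\<close>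

definition weak_star :: "'a::topological_space measure topology" where
  "weak_star = topology_generated_by
     {{\<mu> \<in> borel_prob. integral\<^sup>L \<mu> h \<in> U} | h U.
        continuous_on UNIV (h :: 'a \<Rightarrow> real) \<and> open U}"

definition weak_star_nhd :: "'a::topological_space measure \<Rightarrow> 'a measure set \<Rightarrow> bool" where
  "weak_star_nhd \<mu> F \<longleftrightarrow> F \<subseteq> borel_prob \<and> (\<exists>U. openin weak_star U \<and> \<mu> \<in> U \<and> U \<subseteq> F)"

definition mix_measure :: "real \<Rightarrow> 'a::topological_space measure \<Rightarrow> 'a measure \<Rightarrow> 'a measure" where
  "mix_measure t \<mu> \<nu> =
     measure_of UNIV (sets borel) (\<lambda>A. ennreal t * emeasure \<mu> A + ennreal (1 - t) * emeasure \<nu> A)"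

lemma emeasure_mix_measure:
  assumes "\<mu> \<in> borel_prob" "\<nu> \<in> borel_prob" "A \<in> sets borel"
  shows "emeasure (mix_measure t \<mu> \<nu>) A
           = ennreal t * emeasure \<mu> A + ennreal (1 - t) * emeasure \<nu> A"
  unfolding mix_measure_def
proof (rule emeasure_measure_of_sigma)
  show "sigma_algebra UNIV (sets (borel :: 'a measure))"
    using sets.sigma_algebra_axioms[of "borel :: 'a measure"] by simp
  have s: "sets \<mu> = sets borel" "sets \<nu> = sets borel"
    using assms by (auto simp: borel_prob_def)
  show "countably_additive (sets borel)
          (\<lambda>A. ennreal t * emeasure \<mu> A + ennreal (1 - t) * emeasure \<nu> A)"
    by (auto simp: countably_additive_def suminf_add[symmetric] s suminf_emeasure image_subset_iff)
qed (use assms in \<open>auto simp: positive_def\<close>)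

definition affine_on_prob :: "('a::topological_space measure \<Rightarrow> 'b::real_vector) \<Rightarrow> bool" where
  "affine_on_prob \<Xi> \<longleftrightarrow>
     (\<forall>\<mu> \<in> borel_prob. \<forall>\<nu> \<in> borel_prob. \<forall>t \<in> {0..1}.
        \<Xi> (mix_measure t \<mu> \<nu>) = t *\<^sub>R \<Xi> \<mu> + (1 - t) *\<^sub>R \<Xi> \<nu>)"

text \<open>The sequence is indexed from 0, so that \<open>f k\<close> carries the weight \<open>2\<close> to the power \<open>-(k+1)\<close>.\<close>

definition dense_sequence :: "(nat \<Rightarrow> 'a::topological_space \<Rightarrow> real) \<Rightarrow> bool" where
  "dense_sequence f \<longleftrightarrow>
     (\<forall>k. continuous_on UNIV (f k) \<and> range (f k) \<subseteq> {0..1}) \<and>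
     (\<forall>h. continuous_on UNIV h \<and> range h \<subseteq> {0..1} \<longrightarrow>
        (\<forall>e>0. \<exists>k. \<forall>x. \<bar>f k x - h x\<bar> < e))"

definition rho :: "(nat \<Rightarrow> 'a::topological_space \<Rightarrow> real) \<Rightarrow> 'a measure \<Rightarrow> 'a measure \<Rightarrow> real" where
  "rho f \<mu> \<nu> = (\<Sum>k. (1/2) ^ Suc k * \<bar>integral\<^sup>L \<mu> (f k) - integral\<^sup>L \<nu> (f k)\<bar>)"

definition rho_dist :: "(nat \<Rightarrow> 'a::topological_space \<Rightarrow> real) \<Rightarrow> 'a \<Rightarrow> 'a \<Rightarrow> real" where
  "rho_dist f x y = rho f (return borel x) (return borel y)"

definition empirical :: "('a::topological_space \<Rightarrow> 'a) \<Rightarrow> nat \<Rightarrow> 'a \<Rightarrow> 'a measure" where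
  "empirical T n x = distr (uniform_count_measure {..<n}) borel (\<lambda>k. (T ^^ k) x)"

lemma emeasure_empirical:
  assumes "n \<ge> 1" "A \<in> sets borel"
  shows "emeasure (empirical T n x) A = ennreal (\<Sum>k<n. indicator A ((T ^^ k) x) / real n)"
proof -
  let ?S = "(\<lambda>k. (T ^^ k) x) -` A \<inter> {..<n}"
  have "emeasure (empirical T n x) A = ennreal (real (card ?S) / real n)"
    unfolding empirical_def using assms
    by (subst emeasure_distr)
       (auto simp: space_uniform_count_measure emeasure_uniform_count_measure measurable_def
             sets_uniform_count_measure)
  also have "real (card ?S) = (\<Sum>k<n. indicator A ((T ^^ k) x))"
    by (simp add: indicator_def sum.If_cases Int_def vimage_def conj_commute)
  finally show ?thesis
    by (simp add: sum_divide_distrib)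
qed

section \<open>Metric entropy\<close>

fun refine_partition :: "('a \<Rightarrow> 'a) \<Rightarrow> 'a set set \<Rightarrow> nat \<Rightarrow> 'a set set" where
  "refine_partition T P 0 = {UNIV}"
| "refine_partition T P (Suc n) =
     {A \<inter> (T ^^ n) -` B | A B. A \<in> refine_partition T P n \<and> B \<in> P}"

definition partition_entropy :: "'a measure \<Rightarrow> 'a set set \<Rightarrow> real" where
  "partition_entropy \<mu> P = - (\<Sum>A\<in>P. measure \<mu> A * ln (measure \<mu> A))"

definition metric_entropy :: "('a::topological_space \<Rightarrow> 'a) \<Rightarrow> 'a measure \<Rightarrow> ereal" where
  "metric_entropy T \<mu> =
     (SUP P \<in> {P. partition_on UNIV P \<and> finite P \<and> P \<subseteq> sets borel}.
        ereal (lim (\<lambda>n. partition_entropy \<mu> (refine_partition T P n) / real n)))"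

section \<open>The almost product property\<close>

definition blow_up :: "(nat \<Rightarrow> nat) \<Rightarrow> bool" where
  "blow_up g \<longleftrightarrow> mono g \<and> (\<forall>N. \<exists>n. N \<le> g n) \<and> (\<forall>n\<ge>1. g n < n) \<and>
     (\<lambda>n. real (g n) / real n) \<longlonglongrightarrow> 0"

definition g_ball ::
    "('a \<Rightarrow> 'a \<Rightarrow> real) \<Rightarrow> ('a \<Rightarrow> 'a) \<Rightarrow> (nat \<Rightarrow> nat) \<Rightarrow> nat \<Rightarrow> 'a \<Rightarrow> real \<Rightarrow> 'a set" where
  "g_ball d T g n x \<epsilon> =
     {y. \<exists>L \<subseteq> {..<n}. card ({..<n} - L) \<le> g n \<and> (\<forall>j\<in>L. d ((T ^^ j) x) ((T ^^ j) y) \<le> \<epsilon>)}"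

definition almost_product :: "('a \<Rightarrow> 'a \<Rightarrow> real) \<Rightarrow> ('a \<Rightarrow> 'a) \<Rightarrow> (nat \<Rightarrow> nat) \<Rightarrow> bool" where
  "almost_product d T g \<longleftrightarrow>
     (\<exists>m :: real \<Rightarrow> nat. antimono_on {0<..} m \<and>
        (\<forall>(k::nat) (x :: nat \<Rightarrow> 'a) (\<epsilon> :: nat \<Rightarrow> real) (n :: nat \<Rightarrow> nat).
           k \<ge> 1 \<and> (\<forall>j\<in>{1..k}. \<epsilon> j > 0 \<and> n j \<ge> m (\<epsilon> j) \<and> n j \<ge> 1) \<longrightarrow>
           (\<Inter>j\<in>{1..k}. (T ^^ (\<Sum>i\<in>{1..<j}. n i)) -` g_ball d T g (n j) (x j) (\<epsilon> j)) \<noteq> {}))"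

section \<open>Uniform separation\<close>

definition separated_pts ::
    "('a \<Rightarrow> 'a \<Rightarrow> real) \<Rightarrow> ('a \<Rightarrow> 'a) \<Rightarrow> real \<Rightarrow> nat \<Rightarrow> real \<Rightarrow> 'a \<Rightarrow> 'a \<Rightarrow> bool" where
  "separated_pts d T \<delta> n \<epsilon> x y \<longleftrightarrow>
     real (card {j. j < n \<and> d ((T ^^ j) x) ((T ^^ j) y) > \<epsilon>}) \<ge> \<delta> * real n"

definition separated_set ::
    "('a \<Rightarrow> 'a \<Rightarrow> real) \<Rightarrow> ('a \<Rightarrow> 'a) \<Rightarrow> real \<Rightarrow> nat \<Rightarrow> real \<Rightarrow> 'a set \<Rightarrow> bool" where
  "separated_set d T \<delta> n \<epsilon> E \<longleftrightarrow> pairwise (separated_pts d T \<delta> n \<epsilon>) E"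

definition emp_set :: "('a::topological_space \<Rightarrow> 'a) \<Rightarrow> nat \<Rightarrow> 'a measure set \<Rightarrow> 'a set" where
  "emp_set T n F = {x. empirical T n x \<in> F}"

text \<open>Extended-real valued: it is infinite if the cardinalities are unbounded.\<close>

definition sep_number :: "('a::topological_space \<Rightarrow> 'a \<Rightarrow> real) \<Rightarrow> ('a \<Rightarrow> 'a) \<Rightarrow>
    'a measure set \<Rightarrow> real \<Rightarrow> nat \<Rightarrow> real \<Rightarrow> ereal" where
  "sep_number d T F \<delta> n \<epsilon> =
     (SUP E \<in> {E. finite E \<and> E \<subseteq> emp_set T n F \<and> separated_set d T \<delta> n \<epsilon> E}.
        ereal (real (card E)))"

text \<open>The entropy may be infinite, so the exponential is needed on the extended reals.\<close>

definition exp_ereal :: "ereal \<Rightarrow> ereal" where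
  "exp_ereal z = (case z of ereal r \<Rightarrow> ereal (exp r) | PInfty \<Rightarrow> \<infinity> | MInfty \<Rightarrow> 0)"

definition uniform_separation ::
    "('a::topological_space \<Rightarrow> 'a \<Rightarrow> real) \<Rightarrow> ('a \<Rightarrow> 'a) \<Rightarrow> bool" where
  "uniform_separation d T \<longleftrightarrow>
     (\<forall>\<eta>>0. \<exists>\<delta>>0. \<exists>\<epsilon>>0. \<forall>\<mu> \<in> ergodic_prob T. \<forall>F. weak_star_nhd \<mu> F \<longrightarrow>
        (\<exists>N. \<forall>n\<ge>N. sep_number d T F \<delta> n \<epsilon>
                \<ge> exp_ereal (ereal (real n) * (metric_entropy T \<mu> - ereal \<eta>))))"

section \<open>Topological pressure of arbitrary sets\<close>

definition bowen_ball ::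
    "('a \<Rightarrow> 'a \<Rightarrow> real) \<Rightarrow> ('a \<Rightarrow> 'a) \<Rightarrow> nat \<Rightarrow> 'a \<Rightarrow> real \<Rightarrow> 'a set" where
  "bowen_ball d T n x \<epsilon> = {y. \<forall>i<n. d ((T ^^ i) x) ((T ^^ i) y) \<le> \<epsilon>}"

definition birkhoff_sum :: "('a \<Rightarrow> 'a) \<Rightarrow> ('a \<Rightarrow> real) \<Rightarrow> nat \<Rightarrow> 'a \<Rightarrow> real" where
  "birkhoff_sum T \<phi> n x = (\<Sum>i<n. \<phi> ((T ^^ i) x))"

text \<open>A cover is recorded by the pairs \<open>(m, x)\<close> of length and centre of its balls, since the
  weight of a ball depends on \<open>m\<close> and not only on the underlying set.\<close>

definition ball_covers :: "('a \<Rightarrow> 'a \<Rightarrow> real) \<Rightarrow> ('a \<Rightarrow> 'a) \<Rightarrow> 'a set \<Rightarrow> nat \<Rightarrow> real \<Rightarrow>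
    (nat \<times> 'a) set set" where
  "ball_covers d T Z n \<epsilon> =
     {K. countable K \<and> (\<forall>(m, x)\<in>K. m \<ge> n) \<and> Z \<subseteq> (\<Union>(m, x)\<in>K. bowen_ball d T m x \<epsilon>)}"

definition cover_mass_at :: "('a \<Rightarrow> 'a \<Rightarrow> real) \<Rightarrow> ('a \<Rightarrow> 'a) \<Rightarrow> 'a set \<Rightarrow> real \<Rightarrow> ('a \<Rightarrow> real) \<Rightarrow>
    nat \<Rightarrow> real \<Rightarrow> ennreal" where
  "cover_mass_at d T Z t \<phi> n \<epsilon> =
     (INF K \<in> ball_covers d T Z n \<epsilon>.
        \<Sum>\<^sub>\<infinity>(m, x)\<in>K.
          ennreal (exp (- t * real m + (SUP y\<in>bowen_ball d T m x \<epsilon>. birkhoff_sum T \<phi> m y))))"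

definition cover_mass :: "('a \<Rightarrow> 'a \<Rightarrow> real) \<Rightarrow> ('a \<Rightarrow> 'a) \<Rightarrow> 'a set \<Rightarrow> real \<Rightarrow> ('a \<Rightarrow> real) \<Rightarrow>
    real \<Rightarrow> ennreal" where
  "cover_mass d T Z t \<phi> \<epsilon> = lim (\<lambda>n. cover_mass_at d T Z t \<phi> n \<epsilon>)"

definition pressure_at :: "('a \<Rightarrow> 'a \<Rightarrow> real) \<Rightarrow> ('a \<Rightarrow> 'a) \<Rightarrow> 'a set \<Rightarrow> ('a \<Rightarrow> real) \<Rightarrow>
    real \<Rightarrow> ereal" where
  "pressure_at d T Z \<phi> \<epsilon> = (INF t \<in> {t. cover_mass d T Z t \<phi> \<epsilon> = 0}. ereal t)"

definition top_pressure :: "('a \<Rightarrow> 'a \<Rightarrow> real) \<Rightarrow> ('a \<Rightarrow> 'a) \<Rightarrow> 'a set \<Rightarrow> ('a \<Rightarrow> real) \<Rightarrow> ereal" where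
  "top_pressure d T Z \<phi> = Lim (at_right 0) (\<lambda>\<epsilon>. pressure_at d T Z \<phi> \<epsilon>)"

section \<open>Accumulation points of empirical measures\<close>

definition accumulation_points :: "(nat \<Rightarrow> 'b::topological_space) \<Rightarrow> 'b set" where
  "accumulation_points s = {l. \<exists>r. strict_mono r \<and> (s \<circ> r) \<longlonglongrightarrow> l}"

text \<open>The shift by one makes the sequence of empirical measures start at \<open>n = 1\<close>.\<close>

definition emp_accumulation :: "('a::topological_space \<Rightarrow> 'a) \<Rightarrow>
    ('a measure \<Rightarrow> 'b::topological_space) \<Rightarrow> 'a \<Rightarrow> 'b set" where
  "emp_accumulation T \<Xi> x = accumulation_points (\<lambda>n. \<Xi> (empirical T (Suc n) x))"

definition Delta_sub :: "('a::topological_space \<Rightarrow> 'a) \<Rightarrow>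
    ('a measure \<Rightarrow> 'b::topological_space) \<Rightarrow> 'b set \<Rightarrow> 'a set" where
  "Delta_sub T \<Xi> C = {x. C \<subseteq> emp_accumulation T \<Xi> x}"

definition Lambda_fun :: "('a::topological_space \<Rightarrow> 'a) \<Rightarrow> ('a measure \<Rightarrow> 'b) \<Rightarrow>
    ('a \<Rightarrow> real) \<Rightarrow> 'b \<Rightarrow> ereal" where
  "Lambda_fun T \<Xi> \<phi> y =
     (if y \<in> \<Xi> ` inv_prob T
      then SUP \<mu> \<in> {\<mu> \<in> inv_prob T. \<Xi> \<mu> = y}. metric_entropy T \<mu> + ereal (integral\<^sup>L \<mu> \<phi>)
      else - \<infinity>)"

end

theory Submission
  imports Defs "HOL-Library.Diagonal_Subsequence"
begin

text \<open>The upper bound is local: near an invariant measure \<open>\<mu>\<close>, Misiurewicz's argument bounds the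
  cardinality of the separated sets of orbit segments whose empirical measure is close to \<open>\<mu>\<close> by
  \<open>exp (n (h + \<eta>))\<close>. A point with \<open>y\<close> as an accumulation point of \<open>\<Xi> L\<^sub>n x\<close> has infinitely many such
  segments for some \<open>\<mu>\<close> in the compact set of invariant measures with \<open>\<Xi> \<mu> = y\<close>, so covering that set
  by finitely many neighbourhoods gives the estimate.

  For the lower bound, a countable family of invariant measures suffices to approximate one good
  measure over each \<open>y \<in> C\<close>. Each is approximated by convex combinations of ergodic measures,
  uniform separation provides many separated orbit segments following these, and the almost product
  property glues them. Running through the countable family in stages of rapidly growing length, each
  measure infinitely often, yields a Cantor-like set of points whose empirical measures accumulate at
  all the chosen measures; a product measure on it bounds the pressure from below.\<close>

section \<open>The Riesz representation theorem on a compact metric space\<close>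

text \<open>The constants of uniform separation depend on the tolerance \<eta> only and not on the
  measure. This shapes the lower bound: although infinitely many measures occur, all stages use
  letters separated at one common scale, and the same set of orbits bounds the pressure at every
  smaller radius. \<open>Delta_sub\<close> asks for an inclusion only, so the averages are
  controlled at the ends of the stages and may wander in between; this lets \<open>C\<close> be an
  arbitrary non-empty subset of the image. Every letter of every stage has entropy plus Birkhoff sum
  at least \<open>t - 6 * \<eta>\<close> per unit of time, where \<open>t\<close> is below the
  infimum over \<open>C\<close>; the matching upper bound comes from any single \<open>y\<close> in
  \<open>C\<close>. Entropies may be infinite, so the lower estimates carry the finite entropy of
  one labelling. In the upper bound the local covers have exponentially small sums; countably many
  representatives with a geometric budget then take the place of a finite subcover.\<close>

lemma borel_prob_space: "\<mu> \<in> borel_prob \<Longrightarrow> space \<mu> = UNIV"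
  using sets_eq_imp_space_eq[of \<mu> borel] by (simp add: borel_prob_def)

text \<open>\<open>L\<close> acts on all real functions, so its laws are asked for continuous
  arguments only. The locale is entered twice: with limits of integrals, where the measure is still
  unknown, and with integration against a given measure, where \<open>jordan\<close> singles out
  sets on which weak* convergence can be tested.\<close>

locale mean_functional =
  fixes L :: "('a::metric_space \<Rightarrow> real) \<Rightarrow> real"
  assumes cpt: "compact (UNIV :: 'a set)"
    and L_add: "\<And>f g. continuous_on UNIV f \<Longrightarrow> continuous_on UNIV g \<Longrightarrow> L (\<lambda>x. f x + g x) = L f + L g"
    and L_scale: "\<And>f c. continuous_on UNIV f \<Longrightarrow> L (\<lambda>x. c * f x) = c * L f"
    and L_pos: "\<And>f. continuous_on UNIV f \<Longrightarrow> (\<And>x. 0 \<le> f x) \<Longrightarrow> 0 \<le> L f"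
    and L_one: "L (\<lambda>_. 1) = 1"
begin

lemma L_const: "L (\<lambda>_. c) = c"
  using L_scale[of "\<lambda>_. 1" c] L_one by simp

lemma L_uminus: "continuous_on UNIV f \<Longrightarrow> L (\<lambda>x. - f x) = - L f"
  using L_scale[of f "-1"] by simp

lemma L_diff: "continuous_on UNIV f \<Longrightarrow> continuous_on UNIV g \<Longrightarrow> L (\<lambda>x. f x - g x) = L f - L g"
  using L_add[of f "\<lambda>x. - g x"] L_uminus[of g] by (simp add: continuous_on_minus)

lemma L_mono:
  assumes "continuous_on UNIV f" "continuous_on UNIV g" "\<And>x. f x \<le> g x"
  shows "L f \<le> L g"
  using L_pos[of "\<lambda>x. g x - f x"] L_diff[of g f] assms by (auto simp: continuous_on_diff)

lemma L_sum:
  assumes "finite I" "\<And>i. i \<in> I \<Longrightarrow> continuous_on UNIV (f i)"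
  shows "L (\<lambda>x. \<Sum>i\<in>I. f i x) = (\<Sum>i\<in>I. L (f i))"
  using assms
proof (induction I rule: finite_induct)
  case empty then show ?case using L_const[of 0] by simp
next
  case (insert i I)
  then show ?case by (simp add: L_add continuous_on_sum)
qed

text \<open>All but countably many sublevel sets of a continuous function are of this kind, hence these sets
  generate the Borel sets although in general not every open set is among them.\<close>

definition jordan :: "'a set set" where
  "jordan = {A. \<forall>e>0. \<exists>f g. continuous_on UNIV f \<and> continuous_on UNIV g \<and>
      (\<forall>x. f x \<le> indicator A x \<and> indicator A x \<le> g x) \<and> L g - L f < e}"

definition lower_fns :: "'a set \<Rightarrow> ('a \<Rightarrow> real) set" where
  "lower_fns A = {f. continuous_on UNIV f \<and> (\<forall>x. f x \<le> indicator A x)}"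

text \<open>A supremum over minorants alone. On arbitrary disjoint sets it is superadditive; on
  Jordan sets continuous majorants reach the same value, and that gives the subadditive
  half.\<close>

definition inner_mass :: "'a set \<Rightarrow> real" where
  "inner_mass A = (SUP f \<in> lower_fns A. L f)"

lemma lower_fns_nonempty: "(\<lambda>_. 0) \<in> lower_fns A"
  by (auto simp: lower_fns_def)

lemma L_le_upper:
  assumes "f \<in> lower_fns A" "continuous_on UNIV g" "\<And>x. indicator A x \<le> g x"
  shows "L f \<le> L g"
  using assms by (intro L_mono) (auto simp: lower_fns_def intro: order_trans)

lemma bdd_lower: "bdd_above (L ` lower_fns A)"
proof (rule bdd_aboveI2)
  fix f assume "f \<in> lower_fns A"
  then show "L f \<le> 1" using L_le_upper[of f A "\<lambda>_. 1"] L_one by (auto simp: indicator_def)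
qed

lemma L_le_inner_mass: "f \<in> lower_fns A \<Longrightarrow> L f \<le> inner_mass A"
  unfolding inner_mass_def by (intro cSUP_upper bdd_lower)

lemma inner_mass_le:
  assumes "continuous_on UNIV g" "\<And>x. indicator A x \<le> g x"
  shows "inner_mass A \<le> L g"
  unfolding inner_mass_def
proof (rule cSUP_least)
  show "lower_fns A \<noteq> {}" using lower_fns_nonempty by blast
qed (rule L_le_upper[OF _ assms])

lemma inner_mass_nonneg: "0 \<le> inner_mass A"
  using L_le_inner_mass[OF lower_fns_nonempty] L_const[of 0] by simp

lemma inner_mass_mono: "A \<subseteq> B \<Longrightarrow> inner_mass A \<le> inner_mass B"
  unfolding inner_mass_def
proof (intro cSUP_subset_mono bdd_lower)
  assume "A \<subseteq> B"
  then have "indicator A x \<le> (indicator B x :: real)" for x by (auto simp: indicator_def)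
  then show "lower_fns A \<subseteq> lower_fns B" by (auto simp: lower_fns_def intro: order_trans)
  show "lower_fns A \<noteq> {}" using lower_fns_nonempty by blast
qed simp

lemma inner_mass_approx:
  assumes "e > 0"
  obtains f where "f \<in> lower_fns A" "L f > inner_mass A - e"
proof -
  have "inner_mass A - e < (SUP f \<in> lower_fns A. L f)"
    using assms by (simp add: inner_mass_def)
  then show ?thesis
    using less_cSUP_iff[OF _ bdd_lower] lower_fns_nonempty that by (metis empty_iff)
qed

lemma jordan_upper:
  assumes "A \<in> jordan" "e > 0"
  obtains g where "continuous_on UNIV g" "\<And>x. indicator A x \<le> g x" "L g < inner_mass A + e"
proof -
  obtain f g where fg: "continuous_on UNIV f" "continuous_on UNIV g"
      "\<And>x. f x \<le> indicator A x \<and> indicator A x \<le> g x" "L g - L f < e"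
    using assms by (auto simp: jordan_def)
  then have "L f \<le> inner_mass A" by (intro L_le_inner_mass) (auto simp: lower_fns_def)
  with fg that show ?thesis by fastforce
qed

lemma jordanI:
  assumes "\<And>e. e > 0 \<Longrightarrow> \<exists>f g. continuous_on UNIV f \<and> continuous_on UNIV g \<and>
      (\<forall>x. f x \<le> indicator A x \<and> indicator A x \<le> g x) \<and> L g - L f < e"
  shows "A \<in> jordan"
  using assms by (auto simp: jordan_def)

lemma jordan_UNIV: "UNIV \<in> jordan"
  by (rule jordanI, rule exI[of _ "\<lambda>_. 1"], rule exI[of _ "\<lambda>_. 1"]) auto

lemma jordan_Compl:
  assumes "A \<in> jordan" shows "- A \<in> jordan"
proof (rule jordanI)
  fix e :: real assume "e > 0"
  then obtain f g where fg: "continuous_on UNIV f" "continuous_on UNIV g"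
      "\<And>x. f x \<le> indicator A x \<and> indicator A x \<le> g x" "L g - L f < e"
    using assms by (auto simp: jordan_def)
  have c: "continuous_on UNIV (\<lambda>x. 1 - f x)" "continuous_on UNIV (\<lambda>x. 1 - g x)"
    using fg by (auto intro!: continuous_intros)
  have L: "L (\<lambda>x. 1 - f x) = 1 - L f" "L (\<lambda>x. 1 - g x) = 1 - L g"
    using fg by (auto simp: L_diff L_one)
  have "1 - g x \<le> indicator (- A) x \<and> indicator (- A) x \<le> 1 - f x" for x
    using fg(3)[of x] by (auto simp: indicator_def split: if_splits)
  then show "\<exists>f g. continuous_on UNIV f \<and> continuous_on UNIV g \<and>
      (\<forall>x. f x \<le> indicator (-A) x \<and> indicator (-A) x \<le> g x) \<and> L g - L f < e"
    using c L fg(4) by (intro exI[of _ "\<lambda>x. 1 - g x"] exI[of _ "\<lambda>x. 1 - f x"]) auto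
qed

lemma jordan_Int:
  assumes "A \<in> jordan" "B \<in> jordan" shows "A \<inter> B \<in> jordan"
proof (rule jordanI)
  fix e :: real assume e: "e > 0"
  obtain f g where fg: "continuous_on UNIV f" "continuous_on UNIV g"
      "\<And>x. f x \<le> indicator A x \<and> indicator A x \<le> g x" "L g - L f < e / 2"
    using assms(1) half_gt_zero[OF e] unfolding jordan_def mem_Collect_eq by metis
  obtain f' g' where fg': "continuous_on UNIV f'" "continuous_on UNIV g'"
      "\<And>x. f' x \<le> indicator B x \<and> indicator B x \<le> g' x" "L g' - L f' < e / 2"
    using assms(2) half_gt_zero[OF e] unfolding jordan_def mem_Collect_eq by metis
  let ?f = "\<lambda>x. min (f x) (f' x)" and ?g = "\<lambda>x. min (g x) (g' x)"
  have c: "continuous_on UNIV ?f" "continuous_on UNIV ?g"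
    using fg fg' by (auto intro!: continuous_intros)
  have b: "?f x \<le> indicator (A \<inter> B) x \<and> indicator (A \<inter> B) x \<le> ?g x" for x
    using fg(3)[of x] fg'(3)[of x] by (cases "x \<in> A"; cases "x \<in> B") auto
  \<comment> \<open>The gap between the two minima is at most one of the two original gaps, and both
    are nonnegative.\<close>
  have d: "?g x - ?f x \<le> (g x - f x) + (g' x - f' x)" for x
    using fg(3)[of x] fg'(3)[of x] by (auto simp: min_def)
  have "L ?g - L ?f = L (\<lambda>x. ?g x - ?f x)" using c by (simp add: L_diff)
  also have "\<dots> \<le> L (\<lambda>x. (g x - f x) + (g' x - f' x))"
    using c fg fg' d by (intro L_mono) (auto intro!: continuous_intros)
  also have "\<dots> = (L g - L f) + (L g' - L f')"
    using fg fg' by (subst L_add) (auto simp: L_diff intro!: continuous_intros)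
  also have "\<dots> < e" using fg fg' by auto
  finally show "\<exists>f g. continuous_on UNIV f \<and> continuous_on UNIV g \<and>
      (\<forall>x. f x \<le> indicator (A \<inter> B) x \<and> indicator (A \<inter> B) x \<le> g x) \<and> L g - L f < e"
    using c b by blast
qed

lemma algebra_jordan: "algebra UNIV jordan"
proof -
  have "{} \<in> jordan" using jordan_Compl[OF jordan_UNIV] by simp
  moreover have "A \<union> B \<in> jordan" if "A \<in> jordan" "B \<in> jordan" for A B
    using jordan_Compl[OF jordan_Int[OF jordan_Compl[OF that(1)] jordan_Compl[OF that(2)]]] by simp
  moreover have "UNIV - A \<in> jordan" if "A \<in> jordan" for A
    using jordan_Compl[OF that] by (simp add: Compl_eq_Diff_UNIV)
  ultimately show ?thesis by (auto simp: algebra_iff_Un)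
qed

section \<open>Countable additivity of the inner mass\<close>

lemma inner_mass_disjoint_sum:
  assumes "finite I" "disjoint_family_on A I" "(\<Union>i\<in>I. A i) \<subseteq> U"
  shows "(\<Sum>i\<in>I. inner_mass (A i)) \<le> inner_mass U"
proof (rule field_le_epsilon)
  fix e :: real assume e: "e > 0"
  \<comment> \<open>One share of \<open>e\<close> per set, with an added one that keeps the
    denominator positive for empty \<open>I\<close>. Disjointness makes the sum of minorants a
    minorant of the union.\<close>
  define d where "d = e / (card I + 1)"
  have d: "d > 0" using e by (simp add: d_def)
  have "\<forall>i. \<exists>f. f \<in> lower_fns (A i) \<and> L f > inner_mass (A i) - d"
    using inner_mass_approx[OF d] by metis
  then obtain f where f: "\<And>i. f i \<in> lower_fns (A i)" "\<And>i. L (f i) > inner_mass (A i) - d" by metis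
  have "(\<Sum>i\<in>I. f i x) \<le> indicator U x" for x
  proof -
    have "(\<Sum>i\<in>I. f i x) \<le> (\<Sum>i\<in>I. indicator (A i) x)"
      using f(1) by (intro sum_mono) (auto simp: lower_fns_def)
    also have "\<dots> = indicator (\<Union>i\<in>I. A i) x"
      by (rule indicator_UN_disjoint[OF assms(1,2), symmetric])
    also have "\<dots> \<le> indicator U x" using assms(3) by (auto simp: indicator_def)
    finally show ?thesis .
  qed
  then have "(\<lambda>x. \<Sum>i\<in>I. f i x) \<in> lower_fns U"
    using f(1) by (auto simp: lower_fns_def intro!: continuous_on_sum)
  then have "(\<Sum>i\<in>I. L (f i)) \<le> inner_mass U"
    using L_le_inner_mass[of "\<lambda>x. \<Sum>i\<in>I. f i x" U] f(1) assms(1) by (subst (asm) L_sum) (auto simp: lower_fns_def)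
  moreover have "(\<Sum>i\<in>I. inner_mass (A i)) \<le> (\<Sum>i\<in>I. L (f i) + d)"
    using f(2) by (intro sum_mono) (smt (verit))
  moreover have "(\<Sum>i\<in>I. L (f i) + d) \<le> (\<Sum>i\<in>I. L (f i)) + e"
  proof -
    have "(\<Sum>i\<in>I. d) \<le> e" using e by (simp add: d_def field_simps)
    then show ?thesis by (simp add: sum.distrib)
  qed
  ultimately show "(\<Sum>i\<in>I. inner_mass (A i)) \<le> inner_mass U + e" by linarith
qed

text \<open>Countable subadditivity is where compactness enters: a continuous function below the
  union is, up to \<open>e\<close>, below a finite partial sum of upper functions.\<close>

lemma inner_mass_countable:
  assumes A: "range A \<subseteq> jordan" "U \<subseteq> (\<Union>i. A i)" and e: "e > 0"
  obtains n :: nat where "inner_mass U \<le> (\<Sum>i<n. inner_mass (A i)) + e"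
proof -
  obtain f where f: "f \<in> lower_fns U" "L f > inner_mass U - e / 3"
    using inner_mass_approx[of "e/3" U] e by auto
  have "\<forall>i. \<exists>g. continuous_on UNIV g \<and> (\<forall>x. indicator (A i) x \<le> g x) \<and> L g < inner_mass (A i) + e / 3 * (1/2)^Suc i"
  proof
    fix i :: nat
    have "e / 3 * (1/2)^Suc i > 0" using e by simp
    moreover have "A i \<in> jordan" using A by auto
    ultimately obtain g where "continuous_on UNIV g" "\<And>x. indicator (A i) x \<le> g x"
      "L g < inner_mass (A i) + e / 3 * (1/2)^Suc i" using jordan_upper by blast
    then show "\<exists>g. continuous_on UNIV g \<and> (\<forall>x. indicator (A i) x \<le> g x) \<and> L g < inner_mass (A i) + e / 3 * (1/2)^Suc i" by blast
  qed
  then obtain g where g: "\<And>i. continuous_on UNIV (g i)" "\<And>i x. indicator (A i) x \<le> g i x"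
      "\<And>i. L (g i) < inner_mass (A i) + e / 3 * (1/2)^Suc i" by metis
  have g0: "0 \<le> g i x" for i x using g(2)[where i=i and x=x] by (rule order_trans[rotated]) simp
  let ?G = "\<lambda>n x. \<Sum>i<n. g i x"
  let ?O = "\<lambda>n. {x. f x < ?G n x + e / 3}"
  have op: "open (?O n)" for n
    using g(1) f(1) by (intro open_Collect_less) (auto intro!: continuous_intros simp: lower_fns_def)
  \<comment> \<open>On \<open>U\<close> one majorant already reaches 1; off \<open>U\<close> the
    minorant \<open>f\<close> is at most 0, so the empty sum suffices. The slack
    \<open>e / 3\<close> makes the inequality strict and hence the condition open.\<close>
  have cov: "UNIV \<subseteq> (\<Union>n. ?O n)"
  proof
    fix x
    show "x \<in> (\<Union>n. ?O n)"
    proof (cases "x \<in> U")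
      case True
      then obtain i where i: "x \<in> A i" using A by auto
      have "1 \<le> g i x" using g(2)[where i=i and x=x] i by simp
      also have "\<dots> \<le> ?G (Suc i) x" using g0 by (simp add: sum_nonneg)
      finally have "f x < ?G (Suc i) x + e / 3"
        using f(1) True e by (auto simp: lower_fns_def dest!: spec[of _ x])
      then show ?thesis by blast
    next
      case False
      then have "f x < ?G 0 x + e / 3" using f(1) e by (auto simp: lower_fns_def dest!: spec[of _ x])
      then show ?thesis by blast
    qed
  qed
  obtain D where D: "finite D" "UNIV \<subseteq> (\<Union>n\<in>D. ?O n)"
    by (rule compactE_image[OF cpt, of UNIV ?O]) (use op cov in auto)
  obtain n where n: "\<forall>i\<in>D. i \<le> n" using D(1) finite_nat_set_iff_bounded_le by auto
  have "f x \<le> ?G n x + e / 3" for x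
  proof -
    obtain i where "i \<in> D" "f x < ?G i x + e/3" using D by blast
    moreover have "?G i x \<le> ?G n x" using n \<open>i \<in> D\<close> g0 by (intro sum_mono2) auto
    ultimately show ?thesis by linarith
  qed
  then have "L f \<le> L (\<lambda>x. ?G n x + e / 3)"
    using f(1) g(1) by (intro L_mono) (auto intro!: continuous_intros simp: lower_fns_def)
  also have "\<dots> = (\<Sum>i<n. L (g i)) + e / 3"
    using g(1) by (simp add: L_add L_sum L_const continuous_on_sum)
  also have "(\<Sum>i<n. L (g i)) \<le> (\<Sum>i<n. inner_mass (A i) + e / 3 * (1/2)^Suc i)"
    using g(3) by (intro sum_mono) (auto intro: less_imp_le)
  also have "\<dots> = (\<Sum>i<n. inner_mass (A i)) + e / 3 * (\<Sum>i<n. (1/2)^Suc i)"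
    by (simp add: sum.distrib sum_distrib_left)
  also have "(\<Sum>i<n. (1/2)^Suc i) \<le> (1::real)"
  proof -
    have "(\<Sum>i<n. (1/2)^Suc i) = 1 - (1/2::real)^n" by (induction n) auto
    then show ?thesis by simp
  qed
  finally have "inner_mass U \<le> (\<Sum>i<n. inner_mass (A i)) + e"
    using f(2) e by (simp add: mult_left_mono)
  then show ?thesis using that by blast
qed

lemma countably_additive_inner_mass: "countably_additive jordan (\<lambda>A. ennreal (inner_mass A))"
proof (rule countably_additiveI)
  fix A :: "nat \<Rightarrow> 'a set"
  assume A: "range A \<subseteq> jordan" "disjoint_family A" "(\<Union>i. A i) \<in> jordan"
  have le: "(\<Sum>i<n. inner_mass (A i)) \<le> inner_mass (\<Union>i. A i)" for n
    using A(2) by (intro inner_mass_disjoint_sum) (auto simp: disjoint_family_on_def)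
  have "(\<lambda>n. \<Sum>i<n. inner_mass (A i)) \<longlonglongrightarrow> inner_mass (\<Union>i. A i)"
  proof (rule LIMSEQ_I)
    fix e :: real assume e: "e > 0"
    then obtain n where n: "inner_mass (\<Union>i. A i) \<le> (\<Sum>i<n. inner_mass (A i)) + e / 2"
      using inner_mass_countable[OF A(1), of "\<Union>i. A i" "e/2"] by auto
    have "norm ((\<Sum>i<m. inner_mass (A i)) - inner_mass (\<Union>i. A i)) < e" if "m \<ge> n" for m
    proof -
      have "(\<Sum>i<n. inner_mass (A i)) \<le> (\<Sum>i<m. inner_mass (A i))"
        using that inner_mass_nonneg by (intro sum_mono2) auto
      then show ?thesis using n le[of m] e by auto
    qed
    then show "\<exists>no. \<forall>n\<ge>no. norm ((\<Sum>i<n. inner_mass (A i)) - inner_mass (\<Union>i. A i)) < e" by blast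
  qed
  then have "(\<lambda>i. inner_mass (A i)) sums inner_mass (\<Union>i. A i)" by (simp add: sums_def)
  then show "(\<Sum>i. ennreal (inner_mass (A i))) = ennreal (inner_mass (\<Union>i. A i))"
    using inner_mass_nonneg by (metis suminf_ennreal_eq)
qed

text \<open>A monotone function of the level has at most countably many discontinuities. At a
  continuity level the masses of the two sublevel sets at distance \<open>d / 2\<close> from
  \<open>c\<close> are close, and the set at level \<open>c\<close> is squeezed between a minorant
  of the smaller and a ramp below the indicator of the larger.\<close>

lemma jordan_sublevel:
  fixes h :: "'a \<Rightarrow> real"
  assumes h: "continuous_on UNIV h"
  obtains N where "countable N" "\<And>c. c \<notin> N \<Longrightarrow> {x. h x < c} \<in> jordan"
proof -
  let ?m = "\<lambda>c::real. inner_mass {x. h x < c}"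
  have m: "mono ?m" by (auto intro!: monoI inner_mass_mono)
  have "{x. h x < c} \<in> jordan" if c: "isCont ?m c" for c
  proof (rule jordanI)
    fix e :: real assume e: "e > 0"
    then obtain d where d: "d > 0" "\<And>c'. dist c' c < d \<Longrightarrow> dist (?m c') (?m c) < e / 3"
      using c unfolding continuous_at_eps_delta by (metis divide_pos_pos zero_less_numeral)
    let ?b = "c + d / 2" and ?a = "c - d / 2"
    have ab: "?m ?b - ?m ?a < 2 * e / 3"
    proof -
      have "dist ?b c < d" "dist ?a c < d" using d(1) by (auto simp: dist_real_def)
      from d(2)[OF this(1)] d(2)[OF this(2)] show ?thesis
        unfolding dist_real_def by (simp only: abs_less_iff) linarith
    qed
    obtain f where f: "f \<in> lower_fns {x. h x < ?a}" "L f > ?m ?a - e / 3"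
      using inner_mass_approx[of "e/3"] e by (metis divide_pos_pos zero_less_numeral)
    \<comment> \<open>The ramp is 1 where \<open>h\<close> is at most \<open>c\<close> and 0 from
      \<open>c + d / 2\<close> on, so it majorises the middle set and minorises the larger
      one.\<close>
    let ?g = "\<lambda>x. max 0 (min 1 ((?b - h x) / (d / 2)))"
    have gc: "continuous_on UNIV ?g" using h d(1) by (auto intro!: continuous_intros)
    have "?g x \<le> indicator {x. h x < ?b} x" for x
    proof (cases "h x < ?b")
      case False
      then have "(?b - h x) / (d / 2) \<le> 0" using d(1) by (intro divide_nonpos_pos) auto
      then show ?thesis using False by simp
    qed simp
    then have "L ?g \<le> ?m ?b" using gc by (intro L_le_inner_mass) (auto simp: lower_fns_def)
    then have "L ?g - L f < e" using f ab by linarith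
    moreover have "f x \<le> indicator {x. h x < c} x \<and> indicator {x. h x < c} x \<le> ?g x" for x
    proof -
      have "f x \<le> indicator {x. h x < ?a} x" using f(1) by (auto simp: lower_fns_def)
      also have "\<dots> \<le> indicator {x. h x < c} x" using d(1) by (auto simp: indicator_def)
      finally have "f x \<le> indicator {x. h x < c} x" .
      moreover have "1 \<le> (?b - h x) / (d / 2)" if "h x < c" using that d(1) by (simp add: field_simps)
      ultimately show ?thesis by (auto simp: indicator_def)
    qed
    ultimately show "\<exists>f g. continuous_on UNIV f \<and> continuous_on UNIV g \<and>
      (\<forall>y. f y \<le> indicator {x. h x < c} y \<and> indicator {x. h x < c} y \<le> g y) \<and> L g - L f < e"
      using f(1) gc by (intro exI[of _ f] exI[of _ ?g]) (auto simp: lower_fns_def)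
  qed
  then show ?thesis using mono_ctble_discont[OF m] that[of "{c. \<not> isCont ?m c}"] by blast
qed

lemma good_level_between:
  fixes a b :: real
  assumes "countable N" "a < b"
  obtains c where "a < c" "c < b" "c \<notin> N"
proof -
  have "uncountable {a<..<b}" using assms(2) by (simp add: uncountable_open_interval)
  then have "\<not> {a<..<b} \<subseteq> N" using assms(1) countable_subset by blast
  then obtain c where "c \<in> {a<..<b}" "c \<notin> N" by blast
  then show ?thesis using that[of c] by simp
qed

text \<open>An open set is exhausted by sublevel sets of minus the distance to its complement. The
  levels tend to 0 from below and avoid the countable exceptional set. The whole space is separate
  because the distance to the empty set is 0 by convention.\<close>

lemma borel_subset_jordan: "sets borel \<subseteq> sigma_sets UNIV jordan"
proof -
  have "U \<in> sigma_sets UNIV jordan" if U: "open U" for U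
  proof (cases "U = UNIV")
    case True then show ?thesis using sigma_sets_top[of UNIV jordan] by simp
  next
    case False
    let ?h = "\<lambda>x. - infdist x (- U)"
    have h: "continuous_on UNIV ?h" by (intro continuous_intros)
    have h': "x \<in> U \<longleftrightarrow> ?h x < 0" for x
      using U False in_closed_iff_infdist_zero[of "- U" x] infdist_nonneg[of x "- U"] by (auto simp: closed_Compl less_le)
    obtain N where N: "countable N" "\<And>c. c \<notin> N \<Longrightarrow> {x. ?h x < c} \<in> jordan"
      using jordan_sublevel[OF h] by blast
    have "\<forall>n::nat. \<exists>c. - inverse (real (Suc n)) < c \<and> c < 0 \<and> c \<notin> N"
    proof
      fix n :: nat
      have "- inverse (real (Suc n)) < 0" by simp
      then show "\<exists>c. - inverse (real (Suc n)) < c \<and> c < 0 \<and> c \<notin> N"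
        using good_level_between[OF N(1)] by metis
    qed
    then obtain c where c: "\<And>n::nat. - inverse (real (Suc n)) < c n" "\<And>n. c n < 0" "\<And>n. c n \<notin> N" by metis
    have "U = (\<Union>n. {x. ?h x < c n})"
    proof (intro set_eqI iffI)
      fix x assume "x \<in> U"
      then have "?h x < 0" by (simp add: h')
      then obtain n where "inverse (real (Suc n)) < - ?h x" using reals_Archimedean[of "- ?h x"] by auto
      then have "?h x < c n" using c(1)[of n] by linarith
      then show "x \<in> (\<Union>n. {x. ?h x < c n})" by blast
    next
      fix x assume "x \<in> (\<Union>n. {x. ?h x < c n})"
      then obtain n where "?h x < c n" by blast
      with c(2)[of n] show "x \<in> U" unfolding h' by linarith
    qed
    moreover have "(\<Union>n. {x. ?h x < c n}) \<in> sigma_sets UNIV jordan"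
      by (rule sigma_sets.Union, rule sigma_sets.Basic, rule N(2), rule c(3))
    ultimately show ?thesis by (simp only:)
  qed
  then have "sigma_sets UNIV {U. open U} \<subseteq> sigma_sets UNIV jordan"
    by (intro sigma_sets_mono) auto
  then show ?thesis by (simp add: borel_def)
qed

section \<open>Extension to a Borel measure and recovery of the functional\<close>

definition riesz_measure :: "'a measure" where
  "riesz_measure = (SOME M. M \<in> borel_prob \<and> (\<forall>A\<in>jordan \<inter> sets borel. measure M A = inner_mass A))"

text \<open>Jordan sets need not be Borel; any subset of a set of content zero is one.
  Caratheodory's theorem therefore yields a measure on a possibly larger sigma-algebra, which is
  then restricted to the Borel sets.\<close>

lemma riesz_measure:
  shows riesz_borel_prob: "riesz_measure \<in> borel_prob"
    and measure_riesz: "A \<in> jordan \<Longrightarrow> A \<in> sets borel \<Longrightarrow> measure riesz_measure A = inner_mass A"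
proof -
  interpret algebra UNIV jordan by (rule algebra_jordan)
  have "positive jordan (\<lambda>A. ennreal (inner_mass A))"
    using inner_mass_le[of "\<lambda>_. 0" "{}"] inner_mass_nonneg[of "{}"] L_const[of 0] by (auto simp: positive_def)
  then obtain \<nu> where \<nu>: "\<And>s. s \<in> jordan \<Longrightarrow> \<nu> s = ennreal (inner_mass s)" "measure_space UNIV (sigma_sets UNIV jordan) \<nu>"
    using caratheodory'[OF _ countably_additive_inner_mass] by metis
  have ms: "measure_space UNIV (sets borel) \<nu>"
    using measure_down[OF \<nu>(2) _ borel_subset_jordan] sets.sigma_algebra_axioms[of "borel :: 'a measure"] by simp
  let ?M = "measure_of UNIV (sets borel) \<nu>"
  have s: "sets ?M = sets borel" "space ?M = UNIV"
    using sets.sigma_algebra_axioms[of "borel :: 'a measure"]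
    using sets.sigma_sets_eq[of "borel :: 'a measure"] by (simp_all add: space_measure_of_conv)
  have em: "emeasure ?M A = \<nu> A" if "A \<in> sets borel" for A
    using ms that by (intro emeasure_measure_of_sigma) (auto simp: measure_space_def)
  have "inner_mass UNIV = 1"
    using inner_mass_le[of "\<lambda>_. 1" UNIV] L_le_inner_mass[of "\<lambda>_. 1" UNIV] L_one by (auto simp: lower_fns_def)
  then have "prob_space ?M"
    using em[of UNIV] \<nu>(1)[OF jordan_UNIV] s by (intro prob_spaceI) auto
  then have "?M \<in> borel_prob" using s by (simp add: borel_prob_def)
  moreover have "\<forall>A\<in>jordan \<inter> sets borel. measure ?M A = inner_mass A"
    using em \<nu>(1) inner_mass_nonneg by (auto simp: measure_def)
  ultimately have *: "riesz_measure \<in> borel_prob \<and> (\<forall>A\<in>jordan \<inter> sets borel. measure riesz_measure A = inner_mass A)"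
    unfolding riesz_measure_def by (intro someI[of "\<lambda>M. M \<in> borel_prob \<and> (\<forall>A\<in>jordan \<inter> sets borel. measure M A = inner_mass A)" ?M] conjI)
  from * show "riesz_measure \<in> borel_prob" by (rule conjunct1)
  show "measure riesz_measure A = inner_mass A" if "A \<in> jordan" "A \<in> sets borel"
    using * that by blast
qed

lemma bounded_cont:
  fixes h :: "'a \<Rightarrow> real"
  assumes "continuous_on UNIV h"
  obtains B where "B > 0" "\<And>x. \<bar>h x\<bar> \<le> B"
proof -
  have "bounded (range h)" by (rule compact_imp_bounded[OF compact_continuous_image[OF assms cpt]])
  then obtain B where "B > 0" "\<forall>y\<in>range h. norm y \<le> B"
    using bounded_pos by blast
  then show ?thesis using that[of B] by simp
qed

text \<open>Layer-cake argument. \<open>h\<close> is the sum of \<open>n\<close> slices of height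
  \<open>1 / n\<close>, and \<open>n\<close> times slice \<open>i\<close> is a minorant of the set
  where \<open>h\<close> is at least \<open>c i\<close>. The measure of that set is known because
  \<open>c i\<close> is a good level just below \<open>i / n\<close>.\<close>

lemma riesz_le:
  assumes h: "continuous_on UNIV h" "\<And>x. 0 \<le> h x" "\<And>x. h x \<le> 1"
  shows "L h \<le> integral\<^sup>L riesz_measure h"
proof (rule field_le_epsilon)
  interpret prob_space riesz_measure using riesz_borel_prob by (simp add: borel_prob_def)
  have sb[measurable_cong]: "sets riesz_measure = sets borel" using riesz_borel_prob by (simp add: borel_prob_def)
  have hm[measurable]: "h \<in> borel_measurable borel" using h(1) by (simp add: borel_measurable_continuous_onI)
  fix e :: real assume e: "e > 0"
  obtain n :: nat where n: "n > 0" "2 / real n < e"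
    using reals_Archimedean2[of "2/e"] e
    by (metis divide_less_eq divide_pos_pos less_trans mult.commute of_nat_0_less_iff zero_less_numeral)
  obtain N where N: "countable N" "\<And>c. c \<notin> N \<Longrightarrow> {x. h x < c} \<in> jordan"
    using jordan_sublevel[OF h(1)] by blast
  have "\<forall>i::nat. \<exists>c. (real i - 1) / n < c \<and> c < real i / n \<and> c \<notin> N"
  proof
    fix i :: nat
    have "(real i - 1) / n < real i / n" using n(1) by (simp add: divide_strict_right_mono)
    then show "\<exists>c. (real i - 1) / n < c \<and> c < real i / n \<and> c \<notin> N"
      using good_level_between[OF N(1)] by metis
  qed
  then obtain c where c: "\<And>i::nat. (real i - 1) / n < c i" "\<And>i. c i < real i / n" "\<And>i. c i \<notin> N" by metis
  let ?A = "\<lambda>i. - {x. h x < c i}"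
  let ?k = "\<lambda>i x. max 0 (min (h x - real i / n) (1 / n))"
  have dec: "(\<Sum>i<m. ?k i x) = min (h x) (real m / n)" for m x
  proof (induction m)
    case 0 then show ?case using h(2)[of x] by simp
  next
    case (Suc m)
    have "real (Suc m) / n = real m / n + 1 / n" by (simp add: add_divide_distrib)
    moreover have "0 < 1 / real n" using n(1) by simp
    moreover have "min a b + max 0 (min (a - b) d) = min a (b + d)" if "0 < d" for a b d :: real
      using that by (auto simp: min_def max_def)
    ultimately show ?case unfolding sum.lessThan_Suc Suc by (simp only:)
  qed
  have hk: "h = (\<lambda>x. \<Sum>i<n. ?k i x)" using dec[of _ n] h(3) n(1) by (auto simp: min_def)
  have kc: "continuous_on UNIV (?k i)" for i using h(1) by (auto intro!: continuous_intros)
  have Lk: "L (?k i) \<le> measure riesz_measure (?A i) / n" for i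
  proof -
    have "(\<lambda>x. real n * ?k i x) \<in> lower_fns (?A i)"
    proof -
      have "real n * ?k i x \<le> indicator (?A i) x" for x
      proof (cases "h x < c i")
        case True
        then have "h x - real i / n \<le> 0" using c(2)[of i] by simp
        then show ?thesis using True by simp
      next
        case False
        have "real n * ?k i x \<le> real n * (1 / n)" by (intro mult_left_mono) auto
        then show ?thesis using False n(1) by simp
      qed
      then show ?thesis using kc by (auto simp: lower_fns_def intro!: continuous_intros kc)
    qed
    then have "L (\<lambda>x. real n * ?k i x) \<le> inner_mass (?A i)" by (rule L_le_inner_mass)
    also have "\<dots> = measure riesz_measure (?A i)"
      using N(2)[OF c(3)[of i]] by (intro measure_riesz[symmetric] jordan_Compl) auto
    finally show ?thesis using n(1) L_scale[OF kc, of "real n" i] by (simp add: field_simps)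
  qed
  have "L h = (\<Sum>i<n. L (?k i))" by (subst hk, subst L_sum) (auto intro: kc)
  also have "\<dots> \<le> (\<Sum>i<n. measure riesz_measure (?A i) / n)" by (intro sum_mono Lk)
  also have "\<dots> = (\<Sum>i<n. integral\<^sup>L riesz_measure (\<lambda>x. indicator (?A i) x / n))"
    using riesz_borel_prob by (intro sum.cong) (auto simp: borel_prob_space)
  also have "\<dots> = integral\<^sup>L riesz_measure (\<lambda>x. \<Sum>i<n. indicator (?A i) x / n)"
    by (rule Bochner_Integration.integral_sum[symmetric], rule integrable_const_bound[where B=1])
       (use n(1) in \<open>auto simp: indicator_def\<close>)
  also have "\<dots> \<le> integral\<^sup>L riesz_measure (\<lambda>x. h x + 2 / n)"
  proof (rule integral_mono)
    show "integrable riesz_measure (\<lambda>x. \<Sum>i<n. indicator (?A i) x / real n)"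
      by (rule Bochner_Integration.integrable_sum, rule integrable_const_bound[where B=1])
         (use n(1) in \<open>auto simp: indicator_def\<close>)
    show "integrable riesz_measure (\<lambda>x. h x + 2 / n)"
      by (rule integrable_const_bound[where B="1 + 2/n"]) (use h in auto)
    fix x
    \<comment> \<open>A level \<open>c i\<close> below \<open>h x\<close> forces
      \<open>i < n * h x + 1\<close>. Rounding the count up costs one more unit, which is the origin
      of the error \<open>2 / n\<close>.\<close>
    have "{i. i < n \<and> c i \<le> h x} \<subseteq> {..< nat \<lceil>n * h x + 1\<rceil>}"
    proof
      fix i assume "i \<in> {i. i < n \<and> c i \<le> h x}"
      then have "(real i - 1) / n < h x" using c(1)[of i] by auto
      then have "real i < n * h x + 1" using n(1) by (simp add: field_simps)
      then have "int i < \<lceil>n * h x + 1\<rceil>" by (simp only: less_ceiling_iff of_int_of_nat_eq)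
      then show "i \<in> {..< nat \<lceil>n * h x + 1\<rceil>}" by (simp only: lessThan_iff zless_nat_eq_int_zless)
    qed
    from card_mono[OF finite_lessThan this]
    have "card {i. i < n \<and> c i \<le> h x} \<le> nat \<lceil>n * h x + 1\<rceil>" by (simp only: card_lessThan)
    moreover have "real (nat \<lceil>n * h x + 1\<rceil>) \<le> n * h x + 2" 
    proof -
      have "0 \<le> n * h x + 1" using h(2)[of x] by simp
      then show ?thesis by linarith
    qed
    ultimately have *: "real (card {i. i < n \<and> c i \<le> h x}) \<le> n * h x + 2" by linarith
    have "(\<Sum>i<n. indicator (?A i) x / real n) = (\<Sum>i<n. if c i \<le> h x then 1 / real n else 0)"
      by (intro sum.cong) (auto simp: indicator_def)
    also have "\<dots> = real (card {i. i < n \<and> c i \<le> h x}) / n"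
      by (simp add: sum.If_cases Int_def)
    also have "\<dots> \<le> h x + 2 / n" using * n(1) by (simp add: field_simps)
    finally show "(\<Sum>i<n. indicator (?A i) x / real n) \<le> h x + 2 / real n" .
  qed
  also have "\<dots> = integral\<^sup>L riesz_measure h + 2 / n"
  proof -
    have "integrable riesz_measure h" by (rule integrable_const_bound[where B="1"]) (use h in auto)
    then show ?thesis using prob_space by simp
  qed
  also have "\<dots> \<le> integral\<^sup>L riesz_measure h + e" using n by simp
  finally show "L h \<le> integral\<^sup>L riesz_measure h + e" .
qed

text \<open>Rescaling to values in [0,1] extends the inequality to all continuous functions; the
  same inequality for \<open>- h\<close> reverses it.\<close>

lemma riesz_integral:
  assumes h: "continuous_on UNIV h"
  shows "integral\<^sup>L riesz_measure h = L h"
proof -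
  interpret prob_space riesz_measure using riesz_borel_prob by (simp add: borel_prob_def)
  have sb[measurable_cong]: "sets riesz_measure = sets borel" using riesz_borel_prob by (simp add: borel_prob_def)
  have le: "L h \<le> integral\<^sup>L riesz_measure h" if h: "continuous_on UNIV h" for h :: "'a \<Rightarrow> real"
  proof -
    have hm[measurable]: "h \<in> borel_measurable borel" using h(1) by (simp add: borel_measurable_continuous_onI)
    obtain B where B: "B > 0" "\<And>x. \<bar>h x\<bar> \<le> B" using bounded_cont[OF h] by blast
    have int: "integrable riesz_measure h" by (rule integrable_const_bound[where B=B]) (use B in auto)
    let ?k = "\<lambda>x. 1/2 + (1 / (2*B)) * h x"
    have kb: "0 \<le> ?k x \<and> ?k x \<le> 1" for x
    proof -
      have "\<bar>(1 / (2*B)) * h x\<bar> \<le> 1 / (2*B) * B"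
        using B(1) B(2)[of x] by (subst abs_mult) (intro mult_mono, auto)
      also have "\<dots> = 1 / 2" using B(1) by simp
      finally show ?thesis by linarith
    qed
    have "L ?k \<le> integral\<^sup>L riesz_measure ?k"
    proof (rule riesz_le)
      show "continuous_on UNIV ?k" using h B(1) by (auto intro!: continuous_intros)
    qed (use kb in auto)
    moreover have "L ?k = 1/2 + (1 / (2*B)) * L h"
    proof -
      have "continuous_on UNIV (\<lambda>x. (1 / (2*B)) * h x)" using h by (intro continuous_intros)
      then show ?thesis using L_add[of "\<lambda>_. 1/2" "\<lambda>x. (1 / (2*B)) * h x"] L_const[of "1/2"] L_scale[OF h, of "1 / (2*B)"]
        by (simp only: continuous_on_const)
    qed
    moreover have "integral\<^sup>L riesz_measure ?k = 1/2 + (1 / (2*B)) * integral\<^sup>L riesz_measure h"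
      using int prob_space by simp
    ultimately show ?thesis using B(1) by (simp add: divide_le_cancel)
  qed
  show ?thesis using le[OF h] le[of "\<lambda>x. - h x"] L_uminus[OF h] h by (simp add: continuous_on_minus)
qed

end

theorem riesz_representation:
  assumes "mean_functional L"
  obtains \<mu> where "\<mu> \<in> borel_prob" "\<And>h. continuous_on UNIV h \<Longrightarrow> integral\<^sup>L \<mu> h = L h"
  using mean_functional.riesz_borel_prob[OF assms] mean_functional.riesz_integral[OF assms] by blast

section \<open>Weak* convergence on a compact metric space\<close>

lemma integrable_bounded:
  fixes h :: "'a::topological_space \<Rightarrow> real"
  assumes "\<mu> \<in> borel_prob" "h \<in> borel_measurable borel" "\<And>x. \<bar>h x\<bar> \<le> B"
  shows "integrable \<mu> h"
proof -
  interpret prob_space \<mu> using assms(1) by (simp add: borel_prob_def)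
  have [measurable_cong]: "sets \<mu> = sets borel" using assms(1) by (simp add: borel_prob_def)
  show ?thesis by (rule integrable_const_bound[where B=B]) (use assms in auto)
qed

lemma integral_const_prob: "\<mu> \<in> borel_prob \<Longrightarrow> integral\<^sup>L \<mu> (\<lambda>_. c) = (c::real)"
  using prob_space.prob_space[of \<mu>] by (simp add: borel_prob_def)

lemma integral_abs_diff_le:
  fixes h k :: "'a::topological_space \<Rightarrow> real"
  assumes "\<mu> \<in> borel_prob" "integrable \<mu> h" "integrable \<mu> k" "\<And>x. \<bar>h x - k x\<bar> \<le> e"
  shows "\<bar>integral\<^sup>L \<mu> h - integral\<^sup>L \<mu> k\<bar> \<le> e"
proof -
  have "\<bar>integral\<^sup>L \<mu> h - integral\<^sup>L \<mu> k\<bar> = \<bar>integral\<^sup>L \<mu> (\<lambda>x. h x - k x)\<bar>"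
    using assms by (simp add: Bochner_Integration.integral_diff)
  also have "\<dots> \<le> integral\<^sup>L \<mu> (\<lambda>x. \<bar>h x - k x\<bar>)" by (rule integral_abs_bound)
  also have "\<dots> \<le> integral\<^sup>L \<mu> (\<lambda>x. e)"
    using assms by (intro integral_mono integrable_abs Bochner_Integration.integrable_diff)
      (auto intro!: integrable_bounded[where B="\<bar>e\<bar>"])
  also have "\<dots> = e" by (rule integral_const_prob[OF assms(1)])
  finally show ?thesis .
qed

text \<open>Weak* convergence of sequences is handled through integrals. The passage to the topology
  \<open>weak_star\<close> is made in one direction only, where continuity of \<Xi> has to be
  applied.\<close>

definition wconv :: "(nat \<Rightarrow> 'a::topological_space measure) \<Rightarrow> 'a measure \<Rightarrow> bool" where
  "wconv \<mu>s \<mu> \<longleftrightarrow> (\<forall>h. continuous_on UNIV h \<longrightarrow> (\<lambda>n. integral\<^sup>L (\<mu>s n) h) \<longlonglongrightarrow> (integral\<^sup>L \<mu> h :: real))"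

lemma wconv_subseq: "wconv \<mu>s \<mu> \<Longrightarrow> strict_mono r \<Longrightarrow> wconv (\<lambda>n. \<mu>s (r n)) \<mu>"
  unfolding wconv_def by (auto intro: LIMSEQ_subseq_LIMSEQ[unfolded o_def])

lemma topspace_weak_star: "topspace weak_star = borel_prob"
proof -
  have "borel_prob \<in> {{\<mu> \<in> borel_prob. integral\<^sup>L \<mu> h \<in> U} | h U.
        continuous_on UNIV (h :: 'a \<Rightarrow> real) \<and> open U}"
    by (rule CollectI, rule exI[of _ "\<lambda>_. 0"], rule exI[of _ UNIV]) auto
  then show ?thesis unfolding weak_star_def topology_generated_by_topspace by blast
qed

lemma limitin_weak_star:
  assumes "wconv \<mu>s \<mu>" "\<mu> \<in> borel_prob" "\<And>n. \<mu>s n \<in> borel_prob"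
  shows "limitin weak_star \<mu>s \<mu> sequentially"
proof -
  have "\<mu> \<in> U \<longrightarrow> eventually (\<lambda>n. \<mu>s n \<in> U) sequentially"
    if "generate_topology_on {{\<mu> \<in> borel_prob. integral\<^sup>L \<mu> h \<in> U} | h U.
        continuous_on UNIV (h :: 'a \<Rightarrow> real) \<and> open U} U" for U
    using that
  proof induction
    case (Int a b)
    then show ?case by (auto intro: eventually_conj simp: eventually_conj_iff)
  next
    case (UN K)
    show ?case
    proof
      assume "\<mu> \<in> \<Union>K"
      then obtain k where "k \<in> K" "\<mu> \<in> k" by blast
      with UN have "eventually (\<lambda>n. \<mu>s n \<in> k) sequentially" by blast
      then show "eventually (\<lambda>n. \<mu>s n \<in> \<Union>K) sequentially"
        by (rule eventually_mono) (use \<open>k \<in> K\<close> in blast)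
    qed
  next
    case (Basis s)
    then obtain h U where hU: "continuous_on UNIV (h :: 'a \<Rightarrow> real)" "open U"
      "s = {\<mu> \<in> borel_prob. integral\<^sup>L \<mu> h \<in> U}" by blast
    then have "(\<lambda>n. integral\<^sup>L (\<mu>s n) h) \<longlonglongrightarrow> integral\<^sup>L \<mu> h" using assms(1) by (auto simp: wconv_def)
    then show ?case using hU assms(3) by (auto dest: topological_tendstoD)
  qed simp
  then show ?thesis
    unfolding limitin_def topspace_weak_star using assms(2)
    by (auto simp: weak_star_def openin_topology_generated_by_iff)
qed

lemma weak_star_nhdI:
  fixes \<mu> :: "'a::topological_space measure"
  assumes "finite H" "\<And>h. h \<in> H \<Longrightarrow> continuous_on UNIV (h :: 'a \<Rightarrow> real)" "\<mu> \<in> borel_prob" "e > 0"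
  shows "weak_star_nhd \<mu> {\<nu> \<in> borel_prob. \<forall>h\<in>H. \<bar>integral\<^sup>L \<nu> h - integral\<^sup>L \<mu> h\<bar> < e}"
proof -
  have "openin weak_star {\<nu> \<in> borel_prob. \<forall>h\<in>H. \<bar>integral\<^sup>L \<nu> h - integral\<^sup>L \<mu> h\<bar> < e}"
    using assms(1,2)
  proof (induction H rule: finite_induct)
    case empty
    then show ?case using openin_topspace[of "weak_star :: 'a measure topology"] by (simp add: topspace_weak_star)
  next
    case (insert h H)
    have "openin weak_star {\<nu> \<in> borel_prob. integral\<^sup>L \<nu> h \<in> ball (integral\<^sup>L \<mu> h) e}"
      unfolding weak_star_def using insert.prems
      by (intro topology_generated_by_Basis CollectI exI[of _ h] exI[of _ "ball (integral\<^sup>L \<mu> h) e"]) auto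
    with insert have "openin weak_star ({\<nu> \<in> borel_prob. integral\<^sup>L \<nu> h \<in> ball (integral\<^sup>L \<mu> h) e} \<inter>
      {\<nu> \<in> borel_prob. \<forall>h\<in>H. \<bar>integral\<^sup>L \<nu> h - integral\<^sup>L \<mu> h\<bar> < e})" by (intro openin_Int) auto
    moreover have "({\<nu> \<in> borel_prob. integral\<^sup>L \<nu> h \<in> ball (integral\<^sup>L \<mu> h) e} \<inter>
      {\<nu> \<in> borel_prob. \<forall>h\<in>H. \<bar>integral\<^sup>L \<nu> h - integral\<^sup>L \<mu> h\<bar> < e}) =
      {\<nu> \<in> borel_prob. \<forall>h\<in>insert h H. \<bar>integral\<^sup>L \<nu> h - integral\<^sup>L \<mu> h\<bar> < e}"
      by (auto simp: dist_real_def abs_minus_commute)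
    ultimately show ?case by simp
  qed
  then show ?thesis using assms unfolding weak_star_nhd_def by auto
qed

lemma mono_limit_real_le_iff:
  fixes a :: "nat \<Rightarrow> real"
  assumes "summable a" "\<And>n. 0 \<le> a n"
  shows "suminf a \<le> c \<longleftrightarrow> (\<forall>n. (\<Sum>i<n. a i) \<le> c)"
proof
  assume "suminf a \<le> c"
  then show "\<forall>n. (\<Sum>i<n. a i) \<le> c" using sum_le_suminf[OF assms(1), of "{..<n}" for n] assms(2)
    by (meson finite_lessThan order_trans)
qed (use suminf_le_const[OF assms(1)] in blast)

locale compact_system =
  fixes T :: "'a::metric_space \<Rightarrow> 'a" and f :: "nat \<Rightarrow> 'a \<Rightarrow> real"
  assumes cpt: "compact (UNIV :: 'a set)"
    and cont_T: "continuous_on UNIV T"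
    and dense_f: "dense_sequence f"
begin

lemma cont_f: "continuous_on UNIV (f k)" and f_range: "0 \<le> f k x" "f k x \<le> 1"
  using dense_f unfolding dense_sequence_def by (simp_all add: image_subset_iff)

lemma bounded_cont:
  fixes h :: "'a \<Rightarrow> real"
  assumes "continuous_on UNIV h"
  obtains B where "B > 0" "\<And>x. \<bar>h x\<bar> \<le> B"
proof -
  have "bounded (range h)" by (rule compact_imp_bounded[OF compact_continuous_image[OF assms cpt]])
  then obtain B where "B > 0" "\<forall>y\<in>range h. norm y \<le> B" using bounded_pos by blast
  then show ?thesis using that[of B] by simp
qed

lemma borel_cont: "continuous_on UNIV (h :: 'a \<Rightarrow> real) \<Longrightarrow> h \<in> borel_measurable borel"
  by (rule borel_measurable_continuous_onI)

lemma integrable_cont: "\<mu> \<in> borel_prob \<Longrightarrow> continuous_on UNIV (h :: 'a \<Rightarrow> real) \<Longrightarrow> integrable \<mu> h"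
  using bounded_cont[of h] integrable_bounded[of \<mu> h] borel_cont[of h] by metis

text \<open>The sequence is dense only among functions with values in [0,1]. Shifting and scaling by
  a bound \<open>B\<close> of \<open>h\<close> gives the affine form with \<open>a = - B\<close> and
  \<open>b = 2 * B\<close>.\<close>

lemma approx_by_f:
  assumes h: "continuous_on UNIV (h :: 'a \<Rightarrow> real)" and e: "e > 0"
  obtains a b k where "\<And>x. \<bar>h x - (a + b * f k x)\<bar> \<le> e" "b > 0"
proof -
  obtain B where B: "B > 0" "\<And>x. \<bar>h x\<bar> \<le> B" using bounded_cont[OF h] by blast
  let ?h = "\<lambda>x. (h x + B) / (2 * B)"
  have "continuous_on UNIV ?h" using h B by (auto intro!: continuous_intros)
  moreover have "range ?h \<subseteq> {0..1}"
  proof (clarify, unfold atLeastAtMost_iff)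
    fix x show "0 \<le> ?h x \<and> ?h x \<le> 1" using B(1) B(2)[of x] by (auto simp: divide_le_eq)
  qed
  moreover have "e / (2 * B) > 0" using e B by simp
  ultimately obtain k where k: "\<And>x. \<bar>f k x - ?h x\<bar> < e / (2 * B)"
    using dense_f unfolding dense_sequence_def by meson
  have "\<bar>h x - (- B + 2 * B * f k x)\<bar> \<le> e" for x
  proof -
    have "h x - (- B + 2 * B * f k x) = - (2 * B) * (f k x - ?h x)" using B(1) by (simp add: field_simps)
    then have "\<bar>h x - (- B + 2 * B * f k x)\<bar> = 2 * B * \<bar>f k x - ?h x\<bar>" using B(1) by (simp add: abs_mult)
    also have "\<dots> \<le> 2 * B * (e / (2 * B))" using k[of x] B(1) by (intro mult_left_mono) auto
    finally show ?thesis using B(1) by simp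
  qed
  then show ?thesis using that[of "-B" "2*B" k] B(1) by simp
qed

section \<open>Limits of measures and sequential compactness\<close>

lemma Cauchy_integrals:
  assumes "\<And>n. \<mu>s n \<in> borel_prob" "\<And>k. convergent (\<lambda>n. integral\<^sup>L (\<mu>s n) (f k))"
    and h: "continuous_on UNIV h"
  shows "convergent (\<lambda>n. integral\<^sup>L (\<mu>s n) h :: real)"
proof -
  have "Cauchy (\<lambda>n. integral\<^sup>L (\<mu>s n) h)"
  proof (rule metric_CauchyI)
    fix e :: real assume e: "e > 0"
    then obtain a b k where abk: "\<And>x. \<bar>h x - (a + b * f k x)\<bar> \<le> e / 4" "b > 0"
      using approx_by_f[OF h, of "e/4"] by auto
    have i: "integral\<^sup>L (\<mu>s n) (\<lambda>x. a + b * f k x) = a + b * integral\<^sup>L (\<mu>s n) (f k)" for n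
      using integrable_cont[OF assms(1)[of n] cont_f[of k]] integral_const_prob[OF assms(1)[of n], of a]
        integrable_bounded[OF assms(1)[of n], of "\<lambda>_. a" "\<bar>a\<bar>"] by simp
    have d: "\<bar>integral\<^sup>L (\<mu>s n) h - (a + b * integral\<^sup>L (\<mu>s n) (f k))\<bar> \<le> e / 4" for n
      unfolding i[symmetric] using h cont_f abk
      by (intro integral_abs_diff_le assms integrable_cont) (auto intro!: continuous_intros)
    have "Cauchy (\<lambda>n. integral\<^sup>L (\<mu>s n) (f k))" using assms(2) by (rule convergent_Cauchy)
    moreover have "e / (4 * b) > 0" using e abk by simp
    ultimately obtain M where M: "\<And>m n. m \<ge> M \<Longrightarrow> n \<ge> M \<Longrightarrow> dist (integral\<^sup>L (\<mu>s m) (f k)) (integral\<^sup>L (\<mu>s n) (f k)) < e / (4 * b)"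
      unfolding Cauchy_def by meson
    have "dist (integral\<^sup>L (\<mu>s m) h) (integral\<^sup>L (\<mu>s n) h) < e" if "m \<ge> M" "n \<ge> M" for m n
    proof -
      have "b * \<bar>integral\<^sup>L (\<mu>s m) (f k) - integral\<^sup>L (\<mu>s n) (f k)\<bar> < b * (e / (4 * b))"
        using M[OF that] abk by (intro mult_strict_left_mono) (auto simp: dist_real_def)
      then have "\<bar>b * integral\<^sup>L (\<mu>s m) (f k) - b * integral\<^sup>L (\<mu>s n) (f k)\<bar> < e / 4"
        using abk(2) by (simp add: abs_mult flip: right_diff_distrib)
      then show ?thesis using d[of m] d[of n] e unfolding dist_real_def by linarith
    qed
    then show "\<exists>M. \<forall>m\<ge>M. \<forall>n\<ge>M. dist (integral\<^sup>L (\<mu>s m) h) (integral\<^sup>L (\<mu>s n) h) < e" by blast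
  qed
  then show ?thesis by (simp add: Cauchy_convergent_iff)
qed

text \<open>The limit of the integrals is a positive normalised functional of the test function, and
  the Riesz theorem turns it into a measure; no candidate for the limit has to be known
  beforehand.\<close>

lemma limit_measure:
  assumes \<mu>s: "\<And>n. \<mu>s n \<in> borel_prob" and c: "\<And>k. convergent (\<lambda>n. integral\<^sup>L (\<mu>s n) (f k))"
  obtains \<mu> where "\<mu> \<in> borel_prob" "wconv \<mu>s \<mu>"
proof -
  define L where "L h = lim (\<lambda>n. integral\<^sup>L (\<mu>s n) h)" for h :: "'a \<Rightarrow> real"
  have L: "(\<lambda>n. integral\<^sup>L (\<mu>s n) h) \<longlonglongrightarrow> L h" if "continuous_on UNIV h" for h
    using Cauchy_integrals[OF \<mu>s c that] unfolding L_def by (simp add: convergent_LIMSEQ_iff)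
  have "mean_functional L"
  proof
    show "compact (UNIV::'a set)" by (rule cpt)
    show "L (\<lambda>x. h x + k x) = L h + L k" if "continuous_on UNIV h" "continuous_on UNIV k" for h k
    proof -
      have "(\<lambda>n. integral\<^sup>L (\<mu>s n) (\<lambda>x. h x + k x)) \<longlonglongrightarrow> L h + L k"
        using tendsto_add[OF L[OF that(1)] L[OF that(2)]] integrable_cont[OF \<mu>s] that by simp
      then show ?thesis using L[of "\<lambda>x. h x + k x"] that LIMSEQ_unique by (blast intro: continuous_on_add)
    qed
    show "L (\<lambda>x. a * h x) = a * L h" if "continuous_on UNIV h" for h a
    proof -
      have "(\<lambda>n. integral\<^sup>L (\<mu>s n) (\<lambda>x. a * h x)) \<longlonglongrightarrow> a * L h"
        using tendsto_mult[OF tendsto_const L[OF that]] by simp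
      then show ?thesis using L[of "\<lambda>x. a * h x"] that LIMSEQ_unique by (blast intro: continuous_on_mult_left)
    qed
    show "0 \<le> L h" if "continuous_on UNIV h" "\<And>x. 0 \<le> h x" for h
      using L[OF that(1)] by (rule LIMSEQ_le_const) (use that in auto)
    show "L (\<lambda>_. 1) = 1"
      using L[of "\<lambda>_. 1"] integral_const_prob[OF \<mu>s, of _ 1] by (simp add: LIMSEQ_const_iff)
  qed
  then obtain \<mu> where "\<mu> \<in> borel_prob" "\<And>h. continuous_on UNIV h \<Longrightarrow> integral\<^sup>L \<mu> h = L h"
    using riesz_representation by blast
  then show ?thesis using that[of \<mu>] L by (simp add: wconv_def)
qed

lemma wconvI:
  assumes \<mu>s: "\<And>n. \<mu>s n \<in> borel_prob" and \<mu>: "\<mu> \<in> borel_prob"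
    and c: "\<And>k. (\<lambda>n. integral\<^sup>L (\<mu>s n) (f k)) \<longlonglongrightarrow> integral\<^sup>L \<mu> (f k)"
  shows "wconv \<mu>s \<mu>"
  unfolding wconv_def
proof (intro allI impI LIMSEQ_I)
  fix h :: "'a \<Rightarrow> real" and e :: real assume h: "continuous_on UNIV h" and e: "e > 0"
  then obtain a b k where abk: "\<And>x. \<bar>h x - (a + b * f k x)\<bar> \<le> e / 4" "b > 0"
    using approx_by_f[OF h, of "e/4"] by auto
  have d: "\<bar>integral\<^sup>L \<nu> h - (a + b * integral\<^sup>L \<nu> (f k))\<bar> \<le> e / 4" if \<nu>: "\<nu> \<in> borel_prob" for \<nu>
  proof -
    have i: "integral\<^sup>L \<nu> (\<lambda>x. a + b * f k x) = a + b * integral\<^sup>L \<nu> (f k)"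
      using integrable_cont[OF \<nu> cont_f[of k]] integral_const_prob[OF \<nu>, of a]
        integrable_bounded[OF \<nu>, of "\<lambda>_. a" "\<bar>a\<bar>"] by simp
    show ?thesis
      unfolding i[symmetric] using h cont_f abk
      by (intro integral_abs_diff_le \<nu> integrable_cont) (auto intro!: continuous_intros)
  qed
  have "e / (4 * b) > 0" using e abk by simp
  then obtain M where M: "\<And>n. n \<ge> M \<Longrightarrow> norm (integral\<^sup>L (\<mu>s n) (f k) - integral\<^sup>L \<mu> (f k)) < e / (4 * b)"
    using LIMSEQ_D[OF c[of k]] by blast
  have "norm (integral\<^sup>L (\<mu>s n) h - integral\<^sup>L \<mu> h) < e" if "n \<ge> M" for n
  proof -
    have "b * \<bar>integral\<^sup>L (\<mu>s n) (f k) - integral\<^sup>L \<mu> (f k)\<bar> < b * (e / (4 * b))"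
      using M[OF that] abk by (intro mult_strict_left_mono) (auto simp: dist_real_def)
    then have "\<bar>b * integral\<^sup>L (\<mu>s n) (f k) - b * integral\<^sup>L \<mu> (f k)\<bar> < e / 4"
      using abk(2) by (simp add: abs_mult flip: right_diff_distrib)
    then show ?thesis using d[OF \<mu>s[of n]] d[OF \<mu>] e unfolding real_norm_def by linarith
  qed
  then show "\<exists>no. \<forall>n\<ge>no. norm (integral\<^sup>L (\<mu>s n) h - integral\<^sup>L \<mu> h) < e" by blast
qed

lemma integral_f_range:
  assumes "\<mu> \<in> borel_prob" shows "0 \<le> integral\<^sup>L \<mu> (f k)" "integral\<^sup>L \<mu> (f k) \<le> 1"
proof -
  show "0 \<le> integral\<^sup>L \<mu> (f k)" using f_range by (intro integral_nonneg_AE) auto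
  have "integral\<^sup>L \<mu> (f k) \<le> integral\<^sup>L \<mu> (\<lambda>_. 1)"
    using f_range by (intro integral_mono integrable_cont assms cont_f) auto
  then show "integral\<^sup>L \<mu> (f k) \<le> 1" using integral_const_prob[OF assms, of 1] by simp
qed

text \<open>Diagonal extraction over the countably many integrals of the \<open>f k\<close>, all of
  which lie in [0,1].\<close>

lemma borel_prob_seq_compact:
  fixes \<mu>s :: "nat \<Rightarrow> 'a measure"
  assumes \<mu>s: "\<And>n::nat. \<mu>s n \<in> borel_prob"
  obtains r \<mu> where "strict_mono r" "\<mu> \<in> borel_prob" "wconv (\<lambda>n. \<mu>s (r n)) \<mu>"
proof -
  let ?P = "\<lambda>k (s::nat \<Rightarrow> nat). convergent (\<lambda>n. integral\<^sup>L (\<mu>s (s n)) (f k))"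
  interpret subseqs ?P
  proof
    fix k and s :: "nat \<Rightarrow> nat"
    have "seq_compact {0..1::real}" by (simp add: compact_imp_seq_compact)
    moreover have "\<forall>n. integral\<^sup>L (\<mu>s (s n)) (f k) \<in> {0..1}" using integral_f_range[OF \<mu>s] by simp
    ultimately obtain l r where "strict_mono r" "((\<lambda>n. integral\<^sup>L (\<mu>s (s n)) (f k)) \<circ> r) \<longlonglongrightarrow> l"
      by (rule seq_compactE)
    then show "\<exists>r'. strict_mono r' \<and> convergent (\<lambda>n. integral\<^sup>L (\<mu>s ((s \<circ> r') n)) (f k))"
      by (auto simp: o_def convergent_def)
  qed
  have c: "convergent (\<lambda>n. integral\<^sup>L (\<mu>s (diagseq n)) (f k))" for k
  proof -
    \<comment> \<open>After its first \<open>k + 1\<close> terms the diagonal sequence is a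
      subsequence of the one that was chosen for \<open>f k\<close>.\<close>
    have "?P k (diagseq \<circ> (+) (Suc k))"
      by (rule diagseq_holds) (auto simp: convergent_def dest: LIMSEQ_subseq_LIMSEQ[unfolded o_def])
    then have "convergent (\<lambda>n. integral\<^sup>L (\<mu>s (diagseq (n + Suc k))) (f k))" by (simp add: o_def add.commute)
    then show ?thesis by (rule iffD1[OF convergent_ignore_initial_segment[of "\<lambda>n. integral\<^sup>L (\<mu>s (diagseq n)) (f k)" "Suc k"]])
  qed
  obtain \<mu> where "\<mu> \<in> borel_prob" "wconv (\<lambda>n. \<mu>s (diagseq n)) \<mu>"
    using limit_measure[OF _ c] \<mu>s by blast
  then show ?thesis using that subseq_diagseq by blast
qed

section \<open>Measures of closed sets and uniqueness of the measure with given integrals\<close>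

lemma indicator_closed_limit:
  fixes C :: "'a set"
  assumes "closed C" "C \<noteq> {}"
  shows "(\<lambda>n. max 0 (1 - real n * infdist x C)) \<longlonglongrightarrow> indicator C x"
proof (cases "x \<in> C")
  case True then show ?thesis by simp
next
  case False
  then have d: "infdist x C > 0" using assms in_closed_iff_infdist_zero[of C x] infdist_nonneg[of x C] by (simp add: less_le)
  obtain N :: nat where N: "1 / infdist x C < real N" using reals_Archimedean2 by blast
  have "max 0 (1 - real n * infdist x C) = 0" if "n \<ge> N" for n
  proof -
    have "1 < real N * infdist x C" using N d by (simp add: divide_less_eq)
    also have "\<dots> \<le> real n * infdist x C" using that d by (intro mult_right_mono) auto
    finally show ?thesis by simp
  qed
  then have "eventually (\<lambda>n. max 0 (1 - real n * infdist x C) = indicator C x) sequentially"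
    using False by (auto simp: eventually_sequentially)
  then show ?thesis by (rule tendsto_eventually)
qed

lemma measure_closed_limit:
  fixes C :: "'a set"
  assumes "closed C" "C \<noteq> {}" "\<mu> \<in> borel_prob"
  shows "(\<lambda>n. integral\<^sup>L \<mu> (\<lambda>x. max 0 (1 - real n * infdist x C))) \<longlonglongrightarrow> measure \<mu> C"
proof -
  have [measurable_cong]: "sets \<mu> = sets borel" using assms(3) by (simp add: borel_prob_def)
  have [measurable]: "C \<in> sets borel" using assms(1) by simp
  have m: "(\<lambda>x. max 0 (1 - real n * infdist x C)) \<in> borel_measurable \<mu>" for n
    unfolding measurable_cong_sets[OF \<open>sets \<mu> = sets borel\<close> refl] by (intro borel_cont continuous_intros)
  have "(\<lambda>n. integral\<^sup>L \<mu> (\<lambda>x. max 0 (1 - real n * infdist x C))) \<longlonglongrightarrow> integral\<^sup>L \<mu> (indicator C)"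
  proof (rule integral_dominated_convergence[where w="\<lambda>_. 1"])
    show "integrable \<mu> (\<lambda>_. 1 :: real)" using assms(3) by (rule integrable_bounded[where B=1]) auto
    show "AE x in \<mu>. (\<lambda>i. max 0 (1 - real i * infdist x C)) \<longlonglongrightarrow> indicator C x"
      using indicator_closed_limit[OF assms(1,2)] by simp
    show "AE x in \<mu>. norm (max 0 (1 - real n * infdist x C)) \<le> 1" for n
      by (intro AE_I2) (simp add: infdist_nonneg)
  qed (use m in auto)
  then show ?thesis using assms(3) by (simp add: borel_prob_space)
qed

lemma borel_prob_eqI:
  assumes "\<mu> \<in> borel_prob" "\<nu> \<in> borel_prob"
    and eq: "\<And>h. continuous_on UNIV (h :: 'a \<Rightarrow> real) \<Longrightarrow> integral\<^sup>L \<mu> h = integral\<^sup>L \<nu> h"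
  shows "\<mu> = \<nu>"
proof (rule measure_eqI_generator_eq[where E="Collect closed" and A="\<lambda>_. UNIV" and \<Omega>=UNIV])
  interpret \<mu>: prob_space \<mu> using assms(1) by (simp add: borel_prob_def)
  interpret \<nu>: prob_space \<nu> using assms(2) by (simp add: borel_prob_def)
  show "Int_stable (Collect closed)" by (auto simp: Int_stable_def)
  show "sets \<mu> = sigma_sets UNIV (Collect closed)" "sets \<nu> = sigma_sets UNIV (Collect closed)"
    using assms(1,2) by (simp_all add: borel_prob_def borel_eq_closed)
  show "emeasure \<mu> C = emeasure \<nu> C" if "C \<in> Collect closed" for C
  proof (cases "C = {}")
    case False
    have "continuous_on UNIV (\<lambda>x. max 0 (1 - real n * infdist x C))" for n by (intro continuous_intros)
    then have "measure \<mu> C = measure \<nu> C"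
      using measure_closed_limit[of C \<mu>] measure_closed_limit[of C \<nu>] assms that False eq
      by (simp add: LIMSEQ_unique)
    then show ?thesis by (simp add: \<mu>.emeasure_eq_measure \<nu>.emeasure_eq_measure)
  qed simp
  show "range (\<lambda>_. UNIV) \<subseteq> Collect closed" by auto
  show "emeasure \<mu> UNIV \<noteq> \<infinity>" by simp
qed auto

lemma Xi_wconv:
  assumes "continuous_map weak_star euclidean \<Xi>" "wconv \<mu>s \<mu>" "\<mu> \<in> borel_prob" "\<And>n. \<mu>s n \<in> borel_prob"
  shows "(\<lambda>n. \<Xi> (\<mu>s n)) \<longlonglongrightarrow> \<Xi> \<mu>"
  using continuous_map_limit[OF assms(1) limitin_weak_star[OF assms(2-4)]] by (simp add: o_def)

text \<open>A uniform approximation of \<open>h\<close> by one function \<open>a + b * f P\<close>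
  is valid for all measures at once, so a single test integral controls the integral of
  \<open>h\<close>.\<close>

lemma integral_approx_compare:
  assumes h: "continuous_on UNIV (h :: 'a \<Rightarrow> real)" and e: "e > 0"
  obtains P d where "d > 0" "\<And>\<mu> \<nu>. \<mu> \<in> borel_prob \<Longrightarrow> \<nu> \<in> borel_prob \<Longrightarrow>
     \<bar>integral\<^sup>L \<mu> (f P) - integral\<^sup>L \<nu> (f P)\<bar> \<le> d \<Longrightarrow> \<bar>integral\<^sup>L \<mu> h - integral\<^sup>L \<nu> h\<bar> \<le> e"
proof -
  obtain a b k where abk: "\<And>x. \<bar>h x - (a + b * f k x)\<bar> \<le> e / 4" "b > 0"
    using approx_by_f[OF h, of "e/4"] e by auto
  have d: "\<bar>integral\<^sup>L \<nu> h - (a + b * integral\<^sup>L \<nu> (f k))\<bar> \<le> e / 4" if \<nu>: "\<nu> \<in> borel_prob" for \<nu>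
  proof -
    have i: "integral\<^sup>L \<nu> (\<lambda>x. a + b * f k x) = a + b * integral\<^sup>L \<nu> (f k)"
      using integrable_cont[OF \<nu> cont_f[of k]] integral_const_prob[OF \<nu>, of a]
        integrable_bounded[OF \<nu>, of "\<lambda>_. a" "\<bar>a\<bar>"] by simp
    show ?thesis
      unfolding i[symmetric] using h cont_f abk
      by (intro integral_abs_diff_le \<nu> integrable_cont) (auto intro!: continuous_intros)
  qed
  show ?thesis
  proof (rule that[of "e / (4 * b)" k])
    show "e / (4 * b) > 0" using e abk by simp
    fix \<mu> \<nu> :: "'a measure" assume m: "\<mu> \<in> borel_prob" "\<nu> \<in> borel_prob"
      and le: "\<bar>integral\<^sup>L \<mu> (f k) - integral\<^sup>L \<nu> (f k)\<bar> \<le> e / (4 * b)"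
    have "b * \<bar>integral\<^sup>L \<mu> (f k) - integral\<^sup>L \<nu> (f k)\<bar> \<le> b * (e / (4 * b))"
      using le abk by (intro mult_left_mono) auto
    then have "\<bar>b * integral\<^sup>L \<mu> (f k) - b * integral\<^sup>L \<nu> (f k)\<bar> \<le> e / 4"
      using abk(2) by (simp add: abs_mult flip: right_diff_distrib)
    then show "\<bar>integral\<^sup>L \<mu> h - integral\<^sup>L \<nu> h\<bar> \<le> e" using d[OF m(1)] d[OF m(2)] e by linarith
  qed
qed

text \<open>Separability in elementary form: measures are classified by the integer parts of
  \<open>P\<close> times their first \<open>P\<close> test integrals. There are countably many
  classes, and measures of one class have integrals closer than \<open>1 / P\<close>. The
  representatives belong to \<open>D\<close> itself, so they inherit its defining property.\<close>

lemma countable_representatives: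
  assumes "P \<ge> 1"
  obtains D' where "countable D'" "D' \<subseteq> D"
    "\<And>\<mu>. \<mu> \<in> D \<Longrightarrow> \<exists>\<nu>\<in>D'. \<forall>p<P. \<bar>integral\<^sup>L \<nu> (f p) - integral\<^sup>L \<mu> (f p)\<bar> < 1 / real P"
proof -
  define key where "key \<mu> = map (\<lambda>p. \<lfloor>real P * integral\<^sup>L \<mu> (f p)\<rfloor>) [0..<P]" for \<mu> :: "'a measure"
  define D' where "D' = (\<lambda>k. SOME \<mu>. \<mu> \<in> D \<and> key \<mu> = k) ` (key ` D)"
  have some: "(SOME \<nu>. \<nu> \<in> D \<and> key \<nu> = key \<mu>) \<in> D \<and> key (SOME \<nu>. \<nu> \<in> D \<and> key \<nu> = key \<mu>) = key \<mu>" if "\<mu> \<in> D" for \<mu>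
    by (rule someI[of "\<lambda>\<nu>. \<nu> \<in> D \<and> key \<nu> = key \<mu>" \<mu>]) (use that in simp)
  show ?thesis
  proof (rule that[of D'])
    show "countable D'" unfolding D'_def by (rule countable_image, rule countableI_type)
    show "D' \<subseteq> D" unfolding D'_def using some by auto
    fix \<mu> assume \<mu>: "\<mu> \<in> D"
    let ?\<nu> = "SOME \<nu>. \<nu> \<in> D \<and> key \<nu> = key \<mu>"
    have "\<bar>integral\<^sup>L ?\<nu> (f p) - integral\<^sup>L \<mu> (f p)\<bar> < 1 / real P" if "p < P" for p
    proof -
      have "key ?\<nu> ! p = key \<mu> ! p" using some[OF \<mu>] by simp
      then have "\<lfloor>real P * integral\<^sup>L ?\<nu> (f p)\<rfloor> = \<lfloor>real P * integral\<^sup>L \<mu> (f p)\<rfloor>" using that by (simp add: key_def)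
      then have "\<bar>real P * integral\<^sup>L ?\<nu> (f p) - real P * integral\<^sup>L \<mu> (f p)\<bar> < 1" by linarith
      then have "real P * \<bar>integral\<^sup>L ?\<nu> (f p) - integral\<^sup>L \<mu> (f p)\<bar> < 1"
        using assms by (simp add: abs_mult flip: right_diff_distrib)
      then show ?thesis using assms by (simp add: field_simps)
    qed
    then show "\<exists>\<nu>\<in>D'. \<forall>p<P. \<bar>integral\<^sup>L \<nu> (f p) - integral\<^sup>L \<mu> (f p)\<bar> < 1 / real P"
      unfolding D'_def using \<mu> by blast
  qed
qed

subsection \<open>Empirical measures\<close>

lemma empirical_borel_prob: "n \<ge> 1 \<Longrightarrow> empirical T n x \<in> borel_prob"
  unfolding borel_prob_def empirical_def
  using lessThan_empty_iff[of n]
  by (auto simp del: lessThan_empty_iff intro!: prob_space.prob_space_distr prob_space_uniform_count_measure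
      simp: measurable_def space_uniform_count_measure sets_uniform_count_measure)

lemma integral_empirical:
  fixes h :: "'a \<Rightarrow> real"
  assumes "n \<ge> 1" "h \<in> borel_measurable borel"
  shows "integral\<^sup>L (empirical T n x) h = (\<Sum>k<n. h ((T ^^ k) x)) / n"
proof -
  have "integral\<^sup>L (empirical T n x) h = integral\<^sup>L (uniform_count_measure {..<n}) (\<lambda>k. h ((T ^^ k) x))"
    unfolding empirical_def using assms
    by (intro integral_distr) (auto simp: measurable_def space_uniform_count_measure sets_uniform_count_measure)
  also have "\<dots> = (\<Sum>k<n. h ((T ^^ k) x)) / n"
    unfolding uniform_count_measure_def using assms(1)
    by (subst lebesgue_integral_point_measure_finite) (auto simp: sum_divide_distrib)
  finally show ?thesis .
qed

lemma integral_empirical_birkhoff: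
  assumes "n \<ge> 1" "continuous_on UNIV h"
  shows "integral\<^sup>L (empirical T n x) h = birkhoff_sum T h n x / n"
  using integral_empirical[OF assms(1) borel_cont[OF assms(2)]] by (simp add: birkhoff_sum_def)

lemma T_measurable[measurable]: "T \<in> borel \<rightarrow>\<^sub>M borel"
  using cont_T by (rule borel_measurable_continuous_onI)

lemma cont_iter: "continuous_on UNIV (T ^^ k)"
proof (induction k)
  case (Suc k)
  then show ?case using continuous_on_compose2[OF cont_T, of UNIV "T ^^ k"] by (simp add: o_def)
qed (simp add: id_def)

lemma cont_comp_iter: "continuous_on UNIV h \<Longrightarrow> continuous_on UNIV (\<lambda>x. h ((T ^^ k) x))"
  using continuous_on_compose2[OF _ cont_iter, of UNIV h] by simp

lemma inv_probI:
  assumes "\<mu> \<in> borel_prob" "\<And>h. continuous_on UNIV (h :: 'a \<Rightarrow> real) \<Longrightarrow> integral\<^sup>L \<mu> (\<lambda>x. h (T x)) = integral\<^sup>L \<mu> h"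
  shows "\<mu> \<in> inv_prob T"
proof -
  have s: "sets \<mu> = sets borel" using assms(1) by (simp add: borel_prob_def)
  have T: "T \<in> measurable \<mu> borel" unfolding measurable_cong_sets[OF s refl] by (rule T_measurable)
  have "distr \<mu> borel T \<in> borel_prob"
    using assms(1) T by (auto simp: borel_prob_def intro: prob_space.prob_space_distr)
  moreover have "integral\<^sup>L (distr \<mu> borel T) h = integral\<^sup>L \<mu> h" if "continuous_on UNIV (h :: 'a \<Rightarrow> real)" for h
    using integral_distr[OF T borel_cont[OF that]] assms(2)[OF that] by simp
  ultimately have "distr \<mu> borel T = \<mu>" using borel_prob_eqI assms(1) by blast
  then show ?thesis using assms(1) by (simp add: inv_prob_def)
qed

lemma inv_prob_borel_prob: "\<mu> \<in> inv_prob T \<Longrightarrow> \<mu> \<in> borel_prob"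
  by (simp add: inv_prob_def)

lemma iter_measurable: "T ^^ k \<in> borel \<rightarrow>\<^sub>M borel"
  using cont_iter by (rule borel_measurable_continuous_onI)

lemma distr_iter:
  assumes "\<mu> \<in> inv_prob T" shows "distr \<mu> borel (T ^^ k) = \<mu>"
proof (induction k)
  case 0
  have s: "sets \<mu> = sets borel" using assms by (simp add: inv_prob_def borel_prob_def)
  show ?case using distr_id2[OF s[symmetric]] by (simp add: id_def)
next
  case (Suc k)
  have s: "sets \<mu> = sets borel" using assms by (simp add: inv_prob_def borel_prob_def)
  have "distr \<mu> borel (T ^^ Suc k) = distr (distr \<mu> borel (T ^^ k)) borel T"
    using iter_measurable[of k] s by (subst distr_distr) (auto simp: measurable_cong_sets[OF s refl])
  then show ?case using Suc assms by (simp add: inv_prob_def comp_def)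
qed

lemma integral_iter:
  assumes "\<mu> \<in> inv_prob T" "(h :: 'a \<Rightarrow> real) \<in> borel_measurable borel"
  shows "integral\<^sup>L \<mu> (\<lambda>x. h ((T ^^ k) x)) = integral\<^sup>L \<mu> h"
proof -
  have s: "sets \<mu> = sets borel" using assms by (simp add: inv_prob_def borel_prob_def)
  have "integral\<^sup>L (distr \<mu> borel (T ^^ k)) h = integral\<^sup>L \<mu> (\<lambda>x. h ((T ^^ k) x))"
    using iter_measurable[of k] assms(2) by (intro integral_distr) (auto simp: measurable_cong_sets[OF s refl])
  then show ?thesis by (simp add: distr_iter[OF assms(1)])
qed

lemma birkhoff_sum_Suc_shift: "birkhoff_sum T h n (T x) = birkhoff_sum T h n x + h ((T ^^ n) x) - h x"
  by (induction n) (simp_all add: birkhoff_sum_def funpow_swap1)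

lemma almost_invariant_limit:
  assumes w: "wconv \<mu>s \<mu>" "\<mu> \<in> borel_prob"
    and inv: "\<And>h. continuous_on UNIV (h :: 'a \<Rightarrow> real) \<Longrightarrow>
      (\<lambda>n. integral\<^sup>L (\<mu>s n) (\<lambda>x. h (T x)) - integral\<^sup>L (\<mu>s n) h) \<longlonglongrightarrow> 0"
  shows "\<mu> \<in> inv_prob T"
proof (rule inv_probI[OF w(2)])
  fix h :: "'a \<Rightarrow> real" assume h: "continuous_on UNIV h"
  have "continuous_on UNIV (\<lambda>x. h (T x))" using cont_comp_iter[OF h, of 1] by simp
  then have "(\<lambda>n. integral\<^sup>L (\<mu>s n) (\<lambda>x. h (T x)) - integral\<^sup>L (\<mu>s n) h) \<longlonglongrightarrow> integral\<^sup>L \<mu> (\<lambda>x. h (T x)) - integral\<^sup>L \<mu> h"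
    using w(1) h unfolding wconv_def by (intro tendsto_diff) auto
  with inv[OF h] show "integral\<^sup>L \<mu> (\<lambda>x. h (T x)) = integral\<^sup>L \<mu> h" using LIMSEQ_unique by fastforce
qed

lemma empirical_almost_invariant:
  assumes h: "continuous_on UNIV (h :: 'a \<Rightarrow> real)" "\<And>x. \<bar>h x\<bar> \<le> B" and n: "n \<ge> 1"
  shows "\<bar>integral\<^sup>L (empirical T n x) (\<lambda>x. h (T x)) - integral\<^sup>L (empirical T n x) h\<bar> \<le> 2 * B / n"
proof -
  have hT: "continuous_on UNIV (\<lambda>x. h (T x))" using cont_comp_iter[OF h(1), of 1] by simp
  have "birkhoff_sum T (\<lambda>x. h (T x)) n x = birkhoff_sum T h n (T x)"
    by (simp add: birkhoff_sum_def funpow_swap1)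
  then have "integral\<^sup>L (empirical T n x) (\<lambda>x. h (T x)) - integral\<^sup>L (empirical T n x) h = (h ((T ^^ n) x) - h x) / n"
    unfolding integral_empirical_birkhoff[OF n h(1)] integral_empirical_birkhoff[OF n hT]
    by (simp add: birkhoff_sum_Suc_shift diff_divide_distrib add_divide_distrib)
  moreover have "\<bar>h ((T ^^ n) x) - h x\<bar> \<le> 2 * B" using h(2)[of "(T ^^ n) x"] h(2)[of x] by linarith
  ultimately show ?thesis using n by (simp add: divide_right_mono)
qed

lemma empirical_limit_invariant:
  assumes r: "filterlim r at_top sequentially" "\<And>n. r n \<ge> 1"
    and w: "wconv (\<lambda>n. empirical T (r n) (x n)) \<mu>" "\<mu> \<in> borel_prob"
  shows "\<mu> \<in> inv_prob T"
proof (rule almost_invariant_limit[OF w])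
  fix h :: "'a \<Rightarrow> real" assume h: "continuous_on UNIV h"
  then obtain B where B: "B > 0" "\<And>x. \<bar>h x\<bar> \<le> B" using bounded_cont by blast
  have "(\<lambda>n. 2 * B / real (r n)) \<longlonglongrightarrow> 0"
    by (intro tendsto_divide_0[OF tendsto_const] filterlim_at_top_imp_at_infinity
       filterlim_compose[OF filterlim_real_sequentially r(1)])
  then show "(\<lambda>n. integral\<^sup>L (empirical T (r n) (x n)) (\<lambda>x. h (T x)) - integral\<^sup>L (empirical T (r n) (x n)) h) \<longlonglongrightarrow> 0"
    by (rule Lim_null_comparison[rotated]) (use empirical_almost_invariant[OF h B(2) r(2)] in auto)
qed

text \<open>The codomain of \<Xi> carries no compactness, so the limit is extracted among the
  measures and its image identified by uniqueness of limits. This contains the first claim of the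
  theorem: accumulation points are images of invariant measures.\<close>

lemma emp_accumulation_limit:
  assumes \<Xi>: "continuous_map weak_star euclidean \<Xi>" and y: "y \<in> emp_accumulation T \<Xi> x"
  obtains r \<mu> where "strict_mono r" "\<And>n. r n \<ge> 1" "wconv (\<lambda>n. empirical T (r n) x) \<mu>" "\<mu> \<in> inv_prob T" "\<Xi> \<mu> = (y :: 'b :: metric_space)"
proof -
  obtain r where r: "strict_mono r" "(\<lambda>n. \<Xi> (empirical T (Suc (r n)) x)) \<longlonglongrightarrow> y"
    using y by (auto simp: emp_accumulation_def accumulation_points_def o_def)
  obtain s \<mu> where s: "strict_mono s" "\<mu> \<in> borel_prob" "wconv (\<lambda>n. empirical T (Suc (r (s n))) x) \<mu>"
    by (rule borel_prob_seq_compact[of "\<lambda>n. empirical T (Suc (r n)) x"]) (auto intro: empirical_borel_prob)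
  have m: "strict_mono (\<lambda>n. Suc (r (s n)))" using r s by (auto simp: strict_mono_def)
  have inv: "\<mu> \<in> inv_prob T"
    by (rule empirical_limit_invariant[OF _ _ s(3,2)]) (auto intro: filterlim_subseq m)
  have "(\<lambda>n. \<Xi> (empirical T (Suc (r (s n))) x)) \<longlonglongrightarrow> \<Xi> \<mu>"
    by (rule Xi_wconv[OF \<Xi> s(3,2)]) (auto intro: empirical_borel_prob)
  moreover have "(\<lambda>n. \<Xi> (empirical T (Suc (r (s n))) x)) \<longlonglongrightarrow> y"
    using LIMSEQ_subseq_LIMSEQ[OF r(2) s(1)] by (simp only: comp_def)
  ultimately have "\<Xi> \<mu> = y" by (rule LIMSEQ_unique)
  show ?thesis
    by (rule that[of "\<lambda>n. Suc (r (s n))" \<mu>]) (use m s(3) inv \<open>\<Xi> \<mu> = y\<close> in simp_all)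
qed

subsection \<open>The metric induced by the dense sequence\<close>

lemma rho_dist_eq: "rho_dist f x y = (\<Sum>k. (1/2) ^ Suc k * \<bar>f k x - f k y\<bar>)"
  unfolding rho_dist_def rho_def using borel_cont[OF cont_f] by (simp add: integral_return)

lemma summable_rho: "summable (\<lambda>k. (1/2) ^ Suc k * \<bar>f k x - f k y\<bar>)"
proof (rule summable_comparison_test)
  show "summable (\<lambda>k. (1/2::real) ^ Suc k)" using summable_mult[OF summable_geometric[of "1/2::real"], of "1/2"] by simp
  have "\<bar>f k x - f k y\<bar> \<le> 1" for k using f_range[of k x] f_range[of k y] by linarith
  then show "\<exists>N. \<forall>n\<ge>N. norm ((1/2) ^ Suc n * \<bar>f n x - f n y\<bar>) \<le> (1/2) ^ Suc n"
    by (auto simp: abs_mult mult_left_le)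
qed

lemma rho_refl[simp]: "rho_dist f x x = 0"
  by (simp add: rho_dist_eq)

lemma rho_sym: "rho_dist f x y = rho_dist f y x"
  by (simp add: rho_dist_eq abs_minus_commute)

lemma rho_triangle: "rho_dist f x z \<le> rho_dist f x y + rho_dist f y z"
  unfolding rho_dist_eq suminf_add[OF summable_rho summable_rho]
proof (rule suminf_le[OF _ summable_rho summable_add[OF summable_rho summable_rho]])
  fix k
  have "\<bar>f k x - f k z\<bar> \<le> \<bar>f k x - f k y\<bar> + \<bar>f k y - f k z\<bar>" by linarith
  then show "(1/2) ^ Suc k * \<bar>f k x - f k z\<bar> \<le> (1/2) ^ Suc k * \<bar>f k x - f k y\<bar> + (1/2) ^ Suc k * \<bar>f k y - f k z\<bar>"
    unfolding distrib_left[symmetric] by (intro mult_left_mono) auto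
qed

text \<open>The terms of the series are nonnegative, so the bound on the sum is an intersection of
  closed conditions on partial sums. Closedness later allows infinitely many shadowing conditions to
  be met by compactness.\<close>

lemma closed_rho_ball: "closed {y. rho_dist f x y \<le> e}"
proof -
  have eq: "{y. rho_dist f x y \<le> e} = (\<Inter>n. {y. (\<Sum>k<n. (1/2) ^ Suc k * \<bar>f k x - f k y\<bar>) \<le> e})"
    unfolding rho_dist_eq by (subst mono_limit_real_le_iff[OF summable_rho]) auto
  have cl: "closed {y. (\<Sum>k<n. (1/2) ^ Suc k * \<bar>f k x - f k y\<bar>) \<le> e}" for n
    using cont_f by (intro closed_Collect_le) (auto intro!: continuous_intros)
  show ?thesis unfolding eq by (intro closed_INT ballI cl)
qed

lemma f_diff_le_rho: "\<bar>f k x - f k y\<bar> \<le> 2 ^ Suc k * rho_dist f x y"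
proof -
  have "(\<Sum>i\<in>{k}. (1/2) ^ Suc i * \<bar>f i x - f i y\<bar>) \<le> rho_dist f x y"
    unfolding rho_dist_eq by (rule sum_le_suminf[OF summable_rho]) auto
  then have "2 ^ Suc k * ((1/2) ^ Suc k * \<bar>f k x - f k y\<bar>) \<le> 2 ^ Suc k * rho_dist f x y"
    by (intro mult_left_mono) auto
  then show ?thesis by (simp add: power_one_over)
qed

text \<open>Together with \<open>rho_small\<close> this is the equivalence of the two metrics in
  quantitative form. One \<open>f k\<close> that approximates \<open>h\<close> suffices, and
  \<open>rho_dist\<close> controls it up to the factor \<open>2 ^ Suc k\<close>.\<close>

lemma cont_rho_modulus:
  assumes h: "continuous_on UNIV (h :: 'a \<Rightarrow> real)" and e: "e > 0"
  obtains d where "d > 0" "\<And>x y. rho_dist f x y \<le> d \<Longrightarrow> \<bar>h x - h y\<bar> \<le> e"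
proof -
  obtain a b k where abk: "\<And>x. \<bar>h x - (a + b * f k x)\<bar> \<le> e / 4" "b > 0"
    using approx_by_f[OF h, of "e/4"] e by auto
  let ?d = "e / (4 * b * 2 ^ Suc k)"
  show ?thesis
  proof (rule that[of ?d])
    show "?d > 0" using e abk by simp
    fix x y assume "rho_dist f x y \<le> ?d"
    then have "2 ^ Suc k * rho_dist f x y \<le> 2 ^ Suc k * ?d" by (intro mult_left_mono) auto
    also have "2 ^ Suc k * ?d = e / (4 * b)" by simp
    finally have "\<bar>f k x - f k y\<bar> \<le> e / (4 * b)" using f_diff_le_rho[of k x y] by linarith
    then have "b * \<bar>f k x - f k y\<bar> \<le> b * (e / (4 * b))" using abk(2) by (intro mult_left_mono) auto
    then have "\<bar>b * f k x - b * f k y\<bar> \<le> e / 4" using abk(2) by (simp add: abs_mult flip: right_diff_distrib)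
    then show "\<bar>h x - h y\<bar> \<le> e" using abk(1)[of x] abk(1)[of y] e by linarith
  qed
qed

lemma rho_small:
  assumes e: "e > 0"
  obtains d where "d > 0" "\<And>x y. dist x y < d \<Longrightarrow> rho_dist f x y \<le> e"
proof -
  \<comment> \<open>The tail of the series from \<open>K\<close> on is at most
    \<open>(1/2) ^ K\<close>; the finitely many remaining terms are handled by uniform
    continuity.\<close>
  obtain K where K: "(1/2::real) ^ K < e / 2" using real_arch_pow_inv[of "e/2" "1/2"] e by auto
  have "\<forall>k. \<exists>d>0. \<forall>x y. dist x y < d \<longrightarrow> \<bar>f k x - f k y\<bar> < e / 2"
  proof
    fix k
    have "uniformly_continuous_on UNIV (f k)" using compact_uniformly_continuous[OF cont_f cpt] .
    then show "\<exists>d>0. \<forall>x y. dist x y < d \<longrightarrow> \<bar>f k x - f k y\<bar> < e / 2"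
      unfolding uniformly_continuous_on_def using e by (metis UNIV_I dist_commute dist_real_def half_gt_zero)
  qed
  then obtain d where d: "\<And>k. d k > 0" "\<And>k x y. dist x y < d k \<Longrightarrow> \<bar>f k x - f k y\<bar> < e / 2" by metis
  let ?d = "Min (insert 1 (d ` {..<K}))"
  show ?thesis
  proof (rule that[of ?d])
    show "?d > 0" using d(1) by (subst Min_gr_iff) auto
    fix x y :: 'a assume xy: "dist x y < ?d"
    have fk: "\<bar>f k x - f k y\<bar> \<le> e / 2" if "k < K" for k
    proof -
      have "?d \<le> d k" using that by (intro Min_le) auto
      then have "dist x y < d k" using xy by linarith
      from d(2)[OF this] show ?thesis by simp
    qed
    have geo: "(\<Sum>k<n. (1/2) ^ Suc k) = 1 - (1/2::real) ^ n" for n by (induction n) auto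
    have "(\<Sum>k<n. (1/2) ^ Suc k * \<bar>f k x - f k y\<bar>) \<le> e" for n
    proof -
      have "(1/2) ^ Suc k * \<bar>f k x - f k y\<bar> \<le> e / 2 * (1/2) ^ Suc k + (if k < K then 0 else (1/2) ^ Suc k)" for k
      proof (cases "k < K")
        case True
        then show ?thesis using mult_left_mono[OF fk[OF True], of "(1/2)^Suc k"] by (simp add: mult.commute)
      next
        case False
        have "\<bar>f k x - f k y\<bar> \<le> 1" using f_range[of k x] f_range[of k y] by linarith
        then have "(1/2) ^ Suc k * \<bar>f k x - f k y\<bar> \<le> (1/2) ^ Suc k" by (intro mult_left_le) auto
        then show ?thesis using False e by (simp add: add_increasing)
      qed
      then have "(\<Sum>k<n. (1/2) ^ Suc k * \<bar>f k x - f k y\<bar>) \<le>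
          (\<Sum>k<n. e / 2 * (1/2) ^ Suc k + (if k < K then 0 else (1/2) ^ Suc k))" by (intro sum_mono)
      also have "\<dots> = e / 2 * (\<Sum>k<n. (1/2) ^ Suc k) + (\<Sum>k<n. if k < K then 0 else (1/2) ^ Suc k)"
        by (simp only: sum.distrib sum_distrib_left)
      also have "(\<Sum>k<n. if k < K then 0 else (1/2::real) ^ Suc k) \<le> (1/2) ^ K"
      proof -
        have "(\<Sum>k<n. if k < K then 0 else (1/2::real) ^ Suc k) \<le> (\<Sum>k\<in>{..<K+n}. if k < K then 0 else (1/2) ^ Suc k)"
          by (intro sum_mono2) auto
        also have "\<dots> = (\<Sum>k<K+n. (1/2) ^ Suc k) - (\<Sum>k<K. (1/2) ^ Suc k)"
        proof -
          have "(\<Sum>k<K+n. (1/2::real) ^ Suc k) = (\<Sum>k<K+n. if k < K then (1/2) ^ Suc k else 0) + (\<Sum>k<K+n. if k < K then 0 else (1/2) ^ Suc k)"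
            unfolding sum.distrib[symmetric] by (intro sum.cong) auto
          moreover have "(\<Sum>k<K+n. if k < K then (1/2::real) ^ Suc k else 0) = (\<Sum>k<K. (1/2) ^ Suc k)"
            by (intro sum.mono_neutral_cong_right) auto
          ultimately show ?thesis by simp
        qed
        also have "\<dots> \<le> (1/2) ^ K" unfolding geo by simp
        finally show ?thesis .
      qed
      also have "e / 2 * (\<Sum>k<n. (1/2) ^ Suc k) \<le> e / 2" unfolding geo using e by (intro mult_left_le) auto
      finally show ?thesis using K by linarith
    qed
    then show "rho_dist f x y \<le> e"
      unfolding rho_dist_eq by (subst mono_limit_real_le_iff[OF summable_rho]) auto
  qed
qed

text \<open>There are finitely many admissible sets of good times, so the ball is a finite union of
  closed sets.\<close>

lemma closed_g_ball: "closed (g_ball (rho_dist f) T g n x \<epsilon>)"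
proof -
  let ?S = "{L. L \<subseteq> {..<n} \<and> card ({..<n} - L) \<le> g n}"
  have "g_ball (rho_dist f) T g n x \<epsilon> = (\<Union>L\<in>?S. \<Inter>j\<in>L. (T ^^ j) -` {y. rho_dist f ((T ^^ j) x) y \<le> \<epsilon>})"
    unfolding g_ball_def by auto
  moreover have "finite ?S" by (rule finite_subset[of _ "Pow {..<n}"]) auto
  moreover have "closed ((T ^^ j) -` {y. rho_dist f ((T ^^ j) x) y \<le> \<epsilon>})" for j
    using continuous_closed_vimage[OF closed_rho_ball, of "T ^^ j"] cont_iter[of j]
    by (simp add: continuous_on_eq_continuous_at)
  ultimately show ?thesis by (auto intro!: closed_UN closed_INT)
qed

end

section \<open>Entropy of finite-valued maps\<close>

definition eta :: "real \<Rightarrow> real" where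
  "eta x = - (x * ln x)"

lemma eta_0[simp]: "eta 0 = 0" and eta_1[simp]: "eta 1 = 0"
  by (simp_all add: eta_def)

lemma eta_nonneg: "0 \<le> x \<Longrightarrow> x \<le> 1 \<Longrightarrow> 0 \<le> eta x"
  by (cases "x = 0") (auto simp: eta_def mult_nonneg_nonpos ln_le_zero_iff)

text \<open>This tangent-line bound yields subadditivity, concavity and the cardinality bound below.\<close>

lemma eta_tangent:
  assumes "0 \<le> x" "0 \<le> m" "m = 0 \<Longrightarrow> x = 0"
  shows "eta x + x * ln m \<le> m - x"
proof (cases "x = 0")
  case False
  then have x: "x > 0" "m > 0" using assms by (auto simp: less_le)
  then have "ln (m / x) \<le> m / x - 1" by (intro ln_le_minus_one) auto
  then have "x * ln (m / x) \<le> x * (m / x - 1)" using x by (intro mult_left_mono) auto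
  moreover have "x * (m / x - 1) = m - x" using x by (simp add: field_simps)
  moreover have "x * ln (m / x) = eta x + x * ln m" using x by (simp add: eta_def ln_div right_diff_distrib)
  ultimately show ?thesis by linarith
qed (use assms in simp)

lemma continuous_eta: "continuous_on {0..} eta"
proof -
  have "continuous (at x within {0..}) eta" if "x \<ge> 0" for x
  proof (cases "x = 0")
    case True
    have "((\<lambda>x::real. - (x * ln x)) \<longlongrightarrow> 0) (at_right 0)" by real_asymp
    then show ?thesis using True unfolding continuous_within by (simp add: eta_def[abs_def] at_within_Ici_at_right)
  next
    case False
    then have "isCont eta x" unfolding eta_def[abs_def] by (intro continuous_intros) auto
    then show ?thesis by (rule continuous_at_imp_continuous_at_within)
  qed
  then show ?thesis by (simp add: continuous_on_eq_continuous_within)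
qed

lemma eta_sum_le:
  assumes "finite I" "\<And>i. i \<in> I \<Longrightarrow> 0 \<le> p i"
  shows "eta (\<Sum>i\<in>I. p i) \<le> (\<Sum>i\<in>I. eta (p i))"
proof -
  let ?s = "\<Sum>i\<in>I. p i"
  have "- (p i * ln ?s) \<le> eta (p i)" if i: "i \<in> I" for i
  proof (cases "p i = 0")
    case False
    then have "0 < p i" using assms i by force
    moreover have "p i \<le> ?s" using assms i by (intro member_le_sum) auto
    ultimately have "ln (p i) \<le> ln ?s" by (simp add: ln_mono)
    then show ?thesis using \<open>0 < p i\<close> by (simp add: eta_def)
  qed simp
  then have "(\<Sum>i\<in>I. - (p i * ln ?s)) \<le> (\<Sum>i\<in>I. eta (p i))" by (rule sum_mono)
  then show ?thesis by (simp add: eta_def sum_negf sum_distrib_right)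
qed

lemma eta_mult: "0 \<le> a \<Longrightarrow> 0 \<le> p \<Longrightarrow> eta (a * p) = a * eta p + p * eta a"
  by (cases "a = 0"; cases "p = 0") (auto simp: eta_def ln_mult algebra_simps)

lemma sum_eta_le_ln_card:
  assumes "finite I" "I \<noteq> {}" "\<And>i. i \<in> I \<Longrightarrow> 0 \<le> p i" "(\<Sum>i\<in>I. p i) = 1"
  shows "(\<Sum>i\<in>I. eta (p i)) \<le> ln (card I)"
proof -
  have N: "real (card I) > 0" using assms by (simp add: card_gt_0_iff)
  have "(\<Sum>i\<in>I. eta (p i) + p i * ln (1 / card I)) \<le> (\<Sum>i\<in>I. 1 / card I - p i)"
    using assms N by (intro sum_mono eta_tangent) auto
  also have "\<dots> = 0" using assms N by (simp add: sum_subtractf)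
  finally have "(\<Sum>i\<in>I. eta (p i)) + (\<Sum>i\<in>I. p i) * ln (1 / card I) \<le> 0"
    by (simp only: sum.distrib sum_distrib_right)
  then show ?thesis using assms(4) N by (simp add: ln_div)
qed

lemma eta_concave:
  assumes "finite I" "\<And>i. i \<in> I \<Longrightarrow> 0 \<le> a i" "(\<Sum>i\<in>I. a i) = 1" "\<And>i. i \<in> I \<Longrightarrow> 0 \<le> p i"
  shows "(\<Sum>i\<in>I. a i * eta (p i)) \<le> eta (\<Sum>i\<in>I. a i * p i)"
proof -
  let ?m = "\<Sum>i\<in>I. a i * p i"
  have nn: "0 \<le> a i * p i" if "i \<in> I" for i using assms that by simp
  have m: "0 \<le> ?m" using nn by (rule sum_nonneg)
  have "a i * eta (p i) + a i * p i * ln ?m \<le> a i * ?m - a i * p i" if i: "i \<in> I" for i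
  proof (cases "a i = 0")
    case False
    have "?m = 0 \<Longrightarrow> p i = 0" using sum_nonneg_eq_0_iff[of I "\<lambda>i. a i * p i"] assms(1) nn i False by auto
    then have "eta (p i) + p i * ln ?m \<le> ?m - p i" using assms i m by (intro eta_tangent) auto
    then have "a i * (eta (p i) + p i * ln ?m) \<le> a i * (?m - p i)" using assms i by (intro mult_left_mono) auto
    then show ?thesis by (simp only: right_diff_distrib distrib_left mult.assoc)
  qed simp
  then have "(\<Sum>i\<in>I. a i * eta (p i) + a i * p i * ln ?m) \<le> (\<Sum>i\<in>I. a i * ?m - a i * p i)" by (rule sum_mono)
  also have "\<dots> = (\<Sum>i\<in>I. a i) * ?m - ?m" by (simp only: sum_subtractf sum_distrib_right)
  finally have "(\<Sum>i\<in>I. a i * eta (p i)) + ?m * ln ?m \<le> 0"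
    using assms(3) by (simp only: sum.distrib sum_distrib_right)
  then show ?thesis by (simp add: eta_def)
qed

text \<open>Nonnegativity of mutual information. For each pair the tangent is taken at the product
  of the two marginals, and the linear terms cancel because both distributions have total mass
  one.\<close>

lemma eta_joint_le:
  assumes "finite A" "finite B" "\<And>u v. 0 \<le> p u v" "(\<Sum>u\<in>A. \<Sum>v\<in>B. p u v) = 1"
  shows "(\<Sum>u\<in>A. \<Sum>v\<in>B. eta (p u v)) \<le> (\<Sum>u\<in>A. eta (\<Sum>v\<in>B. p u v)) + (\<Sum>v\<in>B. eta (\<Sum>u\<in>A. p u v))"
proof -
  let ?a = "\<lambda>u. \<Sum>v\<in>B. p u v" and ?b = "\<lambda>v. \<Sum>u\<in>A. p u v"
  have t: "eta (p u v) + p u v * ln (?a u) + p u v * ln (?b v) \<le> ?a u * ?b v - p u v"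
    if "u \<in> A" "v \<in> B" for u v
  proof (cases "p u v = 0")
    case True
    then show ?thesis using assms by (simp add: sum_nonneg)
  next
    case False
    then have p: "0 < p u v" using assms(3)[of u v] by simp
    have "p u v \<le> ?a u" "p u v \<le> ?b v" using assms that by (auto intro!: member_le_sum[where f="\<lambda>v. p u v"] member_le_sum[where f="\<lambda>u. p u v"])
    with p have ab: "0 < ?a u" "0 < ?b v" by auto
    then have "eta (p u v) + p u v * ln (?a u * ?b v) \<le> ?a u * ?b v - p u v"
      using p by (intro eta_tangent) auto
    then show ?thesis using ab by (simp add: ln_mult distrib_left)
  qed
  have "(\<Sum>u\<in>A. \<Sum>v\<in>B. eta (p u v) + p u v * ln (?a u) + p u v * ln (?b v))
      \<le> (\<Sum>u\<in>A. \<Sum>v\<in>B. ?a u * ?b v - p u v)" by (intro sum_mono t)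
  also have "\<dots> = (\<Sum>u\<in>A. ?a u) * (\<Sum>v\<in>B. ?b v) - 1"
  proof -
    have "(\<Sum>u\<in>A. \<Sum>v\<in>B. ?a u * ?b v) = (\<Sum>u\<in>A. ?a u) * (\<Sum>v\<in>B. ?b v)" by (rule sum_product[symmetric])
    then show ?thesis using assms(4) by (simp only: sum_subtractf)
  qed
  also have "(\<Sum>v\<in>B. ?b v) = 1" using assms(4) sum.swap[of p B A] by simp
  finally have le: "(\<Sum>u\<in>A. \<Sum>v\<in>B. eta (p u v) + p u v * ln (?a u) + p u v * ln (?b v)) \<le> 0"
    using assms(4) by simp
  have "(\<Sum>u\<in>A. \<Sum>v\<in>B. p u v * ln (?a u)) = (\<Sum>u\<in>A. ?a u * ln (?a u))" by (simp only: sum_distrib_right)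
  moreover have "(\<Sum>u\<in>A. \<Sum>v\<in>B. p u v * ln (?b v)) = (\<Sum>v\<in>B. ?b v * ln (?b v))"
    by (subst sum.swap) (simp only: sum_distrib_right)
  ultimately have "(\<Sum>u\<in>A. \<Sum>v\<in>B. eta (p u v)) + (\<Sum>u\<in>A. ?a u * ln (?a u)) + (\<Sum>v\<in>B. ?b v * ln (?b v)) \<le> 0"
    using le by (simp only: sum.distrib)
  then show ?thesis by (simp add: eta_def sum_negf)
qed

text \<open>Finite Borel partitions encoded by maps: joins become pairs, pull-backs become
  compositions, and empty cells never enter the range.\<close>

definition labelling :: "('a::topological_space \<Rightarrow> 'l) \<Rightarrow> bool" where
  "labelling X \<longleftrightarrow> finite (range X) \<and> (\<forall>v. X -` {v} \<in> sets borel)"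

definition ent :: "'a::topological_space measure \<Rightarrow> ('a \<Rightarrow> 'l) \<Rightarrow> real" where
  "ent \<mu> X = (\<Sum>v\<in>range X. eta (measure \<mu> (X -` {v})))"

lemma labelling_vimage:
  assumes "labelling X" shows "X -` V \<in> sets borel"
proof -
  have "X -` V = (\<Union>v\<in>V \<inter> range X. X -` {v})" by auto
  also have "\<dots> \<in> sets borel" using assms by (intro sets.finite_UN) (auto simp: labelling_def)
  finally show ?thesis .
qed

lemma labelling_finite: "labelling X \<Longrightarrow> finite (range X)"
  by (simp add: labelling_def)

lemma labelling_comp: 
  assumes "labelling X" shows "labelling (\<lambda>x. g (X x))"
  unfolding labelling_def
proof
  show "finite (range (\<lambda>x. g (X x)))"
    using finite_imageI[OF labelling_finite[OF assms], of g] by (simp add: image_image)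
  have "(\<lambda>x. g (X x)) -` {v} = X -` (g -` {v})" for v by auto
  then show "\<forall>v. (\<lambda>x. g (X x)) -` {v} \<in> sets borel" using labelling_vimage[OF assms] by simp
qed

lemma labelling_pair:
  assumes "labelling X" "labelling Y" shows "labelling (\<lambda>x. (X x, Y x))"
  unfolding labelling_def
proof
  have "range (\<lambda>x. (X x, Y x)) \<subseteq> range X \<times> range Y" by auto
  then show "finite (range (\<lambda>x. (X x, Y x)))"
    by (rule finite_subset) (use assms in \<open>simp add: labelling_def\<close>)
  have "(\<lambda>x. (X x, Y x)) -` {v} = X -` {fst v} \<inter> Y -` {snd v}" for v by auto
  then show "\<forall>v. (\<lambda>x. (X x, Y x)) -` {v} \<in> sets borel" using assms by (auto simp: labelling_def)
qed

lemma ent_eq_sum: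
  assumes "finite S" "range X \<subseteq> S"
  shows "ent \<mu> X = (\<Sum>v\<in>S. eta (measure \<mu> (X -` {v})))"
  unfolding ent_def
proof (rule sum.mono_neutral_left[OF assms], rule ballI)
  fix v assume "v \<in> S - range X"
  then have "X -` {v} = {}" by auto
  then show "eta (measure \<mu> (X -` {v})) = 0" by simp
qed

lemma measure_le_1: "\<mu> \<in> borel_prob \<Longrightarrow> measure \<mu> A \<le> 1"
  using prob_space.prob_le_1[of \<mu> A] by (simp add: borel_prob_def)

lemma measure_UNIV: "\<mu> \<in> borel_prob \<Longrightarrow> measure \<mu> UNIV = 1"
  using prob_space.prob_space[of \<mu>] by (simp add: borel_prob_space borel_prob_def)

lemma ent_nonneg: "\<mu> \<in> borel_prob \<Longrightarrow> 0 \<le> ent \<mu> X"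
  unfolding ent_def by (intro sum_nonneg eta_nonneg) (auto intro: measure_le_1)

lemma measure_fibres:
  assumes "\<mu> \<in> borel_prob" "labelling X" "finite S" "range X \<subseteq> S" "A \<in> sets borel"
  shows "measure \<mu> A = (\<Sum>v\<in>S. measure \<mu> (A \<inter> X -` {v}))"
proof -
  interpret prob_space \<mu> using assms(1) by (simp add: borel_prob_def)
  have s: "sets \<mu> = sets borel" using assms(1) by (simp add: borel_prob_def)
  have "measure \<mu> (\<Union>v\<in>S. A \<inter> X -` {v}) = (\<Sum>v\<in>S. measure \<mu> (A \<inter> X -` {v}))"
    using assms by (intro finite_measure_finite_Union) (auto simp: s labelling_def disjoint_family_on_def)
  moreover have "(\<Union>v\<in>S. A \<inter> X -` {v}) = A" using assms(4) by auto
  ultimately show ?thesis by simp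
qed

lemma sum_fibres:
  assumes "\<mu> \<in> borel_prob" "labelling X" "finite S" "range X \<subseteq> S"
  shows "(\<Sum>v\<in>S. measure \<mu> (X -` {v})) = 1"
  using measure_fibres[OF assms, of UNIV] measure_UNIV[OF assms(1)] by simp

lemma ent_le_ln_card:
  assumes "\<mu> \<in> borel_prob" "labelling X"
  shows "ent \<mu> X \<le> ln (card (range X))"
  unfolding ent_def using sum_fibres[OF assms labelling_finite[OF assms(2)]] assms(2)
  by (intro sum_eta_le_ln_card) (auto simp: labelling_def)

lemma ent_pair_le:
  assumes "\<mu> \<in> borel_prob" "labelling X" "labelling Y"
  shows "ent \<mu> (\<lambda>x. (X x, Y x)) \<le> ent \<mu> X + ent \<mu> Y"
proof -
  let ?p = "\<lambda>u v. measure \<mu> (X -` {u} \<inter> Y -` {v})"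
  note fin = labelling_finite[OF assms(2)] labelling_finite[OF assms(3)]
  have X: "measure \<mu> (X -` {u}) = (\<Sum>v\<in>range Y. ?p u v)" for u
    using assms by (intro measure_fibres) (auto simp: labelling_def)
  have Y: "measure \<mu> (Y -` {v}) = (\<Sum>u\<in>range X. ?p u v)" for v
    using measure_fibres[OF assms(1,2) fin(1) order_refl, of "Y -` {v}"] assms(3) by (simp add: labelling_def Int_commute)
  have "ent \<mu> (\<lambda>x. (X x, Y x)) = (\<Sum>w\<in>range X \<times> range Y. eta (measure \<mu> ((\<lambda>x. (X x, Y x)) -` {w})))"
    using fin by (intro ent_eq_sum) auto
  also have "\<dots> = (\<Sum>w\<in>range X \<times> range Y. eta (?p (fst w) (snd w)))"
    by (intro sum.cong arg_cong[of _ _ eta] arg_cong[of _ _ "measure \<mu>"]) auto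
  also have "\<dots> = (\<Sum>u\<in>range X. \<Sum>v\<in>range Y. eta (?p u v))" by (simp add: sum.cartesian_product case_prod_beta)
  also have "\<dots> \<le> (\<Sum>u\<in>range X. eta (\<Sum>v\<in>range Y. ?p u v)) + (\<Sum>v\<in>range Y. eta (\<Sum>u\<in>range X. ?p u v))"
    using sum_fibres[OF assms(1,2) fin(1) order_refl] fin by (intro eta_joint_le) (simp_all add: X)
  also have "\<dots> = ent \<mu> X + ent \<mu> Y" by (simp add: ent_def X Y)
  finally show ?thesis .
qed

lemma ent_comp_le:
  assumes "\<mu> \<in> borel_prob" "labelling X"
  shows "ent \<mu> (\<lambda>x. g (X x)) \<le> ent \<mu> X"
proof -
  interpret prob_space \<mu> using assms(1) by (simp add: borel_prob_def)
  have s: "sets \<mu> = sets borel" using assms(1) by (simp add: borel_prob_def)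
  have r: "range (\<lambda>x. g (X x)) = g ` range X" by auto
  have "eta (measure \<mu> ((\<lambda>x. g (X x)) -` {w})) \<le> (\<Sum>v\<in>{v \<in> range X. g v = w}. eta (measure \<mu> (X -` {v})))" for w
  proof -
    have "(\<lambda>x. g (X x)) -` {w} = (\<Union>v\<in>{v \<in> range X. g v = w}. X -` {v})" by auto
    also have "measure \<mu> \<dots> = (\<Sum>v\<in>{v \<in> range X. g v = w}. measure \<mu> (X -` {v}))"
      using assms(2) by (intro finite_measure_finite_Union) (auto simp: s labelling_def disjoint_family_on_def)
    finally show ?thesis using labelling_finite[OF assms(2)] by (simp add: eta_sum_le)
  qed
  then have "ent \<mu> (\<lambda>x. g (X x)) \<le> (\<Sum>w\<in>g ` range X. \<Sum>v\<in>{v \<in> range X. g v = w}. eta (measure \<mu> (X -` {v})))"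
    unfolding ent_def r by (intro sum_mono)
  also have "\<dots> = ent \<mu> X" unfolding ent_def
    by (rule sum.image_gen[symmetric, OF labelling_finite[OF assms(2)]])
  finally show ?thesis .
qed

text \<open>Splitting \<open>eta (a * p)\<close> isolates the entropy of the weights, which is at
  most \<open>ln (card I)\<close>. For words of length \<open>n\<close> this excess does not depend
  on \<open>n\<close>, so it vanishes in the entropy per unit of time.\<close>

lemma ent_mix_upper:
  assumes "finite I" "I \<noteq> {}" "\<And>i. i \<in> I \<Longrightarrow> 0 \<le> a i" "(\<Sum>i\<in>I. a i) = 1" "\<And>i. i \<in> I \<Longrightarrow> \<mu>s i \<in> borel_prob"
    and X: "labelling X" and mix: "\<And>v. measure \<mu> (X -` {v}) = (\<Sum>i\<in>I. a i * measure (\<mu>s i) (X -` {v}))"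
  shows "ent \<mu> X \<le> (\<Sum>i\<in>I. a i * ent (\<mu>s i) X) + ln (card I)"
proof -
  have "ent \<mu> X \<le> (\<Sum>v\<in>range X. \<Sum>i\<in>I. eta (a i * measure (\<mu>s i) (X -` {v})))"
    unfolding ent_def mix using assms by (intro sum_mono eta_sum_le) auto
  also have "\<dots> = (\<Sum>v\<in>range X. \<Sum>i\<in>I. a i * eta (measure (\<mu>s i) (X -` {v})) + measure (\<mu>s i) (X -` {v}) * eta (a i))"
    using assms(3) by (intro sum.cong eta_mult) auto
  also have "\<dots> = (\<Sum>i\<in>I. a i * (\<Sum>v\<in>range X. eta (measure (\<mu>s i) (X -` {v})))) + (\<Sum>i\<in>I. (\<Sum>v\<in>range X. measure (\<mu>s i) (X -` {v})) * eta (a i))"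
    by (subst sum.swap) (simp only: sum.distrib sum_distrib_left sum_distrib_right)
  also have "(\<Sum>i\<in>I. (\<Sum>v\<in>range X. measure (\<mu>s i) (X -` {v})) * eta (a i)) = (\<Sum>i\<in>I. eta (a i))"
    using sum_fibres[OF assms(5) X labelling_finite[OF X]] by (intro sum.cong) auto
  also have "(\<Sum>i\<in>I. eta (a i)) \<le> ln (card I)" using assms by (intro sum_eta_le_ln_card) auto
  finally show ?thesis by (simp add: ent_def)
qed

lemma ent_mix_lower:
  assumes "finite I" "\<And>i. i \<in> I \<Longrightarrow> 0 \<le> a i" "(\<Sum>i\<in>I. a i) = 1"
    and mix: "\<And>v. measure \<mu> (X -` {v}) = (\<Sum>i\<in>I. a i * measure (\<mu>s i) (X -` {v}))"
  shows "(\<Sum>i\<in>I. a i * ent (\<mu>s i) X) \<le> ent \<mu> X"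
proof -
  have "(\<Sum>i\<in>I. a i * ent (\<mu>s i) X) = (\<Sum>v\<in>range X. \<Sum>i\<in>I. a i * eta (measure (\<mu>s i) (X -` {v})))"
    unfolding ent_def by (subst sum.swap) (simp only: sum_distrib_left)
  also have "\<dots> \<le> ent \<mu> X" unfolding ent_def mix using assms by (intro sum_mono eta_concave) auto
  finally show ?thesis .
qed

section \<open>Entropy of a transformation with respect to a labelling\<close>

lemma fekete:
  fixes a :: "nat \<Rightarrow> real"
  assumes sub: "\<And>m n. a (m + n) \<le> a m + a n" and nn: "\<And>n. 0 \<le> a n"
  shows "(\<lambda>n. a n / n) \<longlonglongrightarrow> (INF n\<in>{1..}. a n / real n)"
proof (rule LIMSEQ_I)
  fix e :: real assume e: "e > 0"
  let ?L = "INF n\<in>{1..}. a n / real n"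
  have bdd: "bdd_below ((\<lambda>n. a n / real n) ` {1..})" using nn by (intro bdd_belowI2[of _ 0]) auto
  have "?L < ?L + e / 2" using e by simp
  then have "\<exists>q\<in>{1..}. a q / real q < ?L + e / 2"
    by (subst (asm) cINF_less_iff[OF _ bdd]) auto
  then obtain q :: nat where q: "q \<ge> 1" "a q / q < ?L + e / 2" by auto
  \<comment> \<open>Bounds the contribution of the remainder modulo \<open>q\<close>, which takes
    finitely many values.\<close>
  define B where "B = Max (a ` {..<q})"
  have B: "a r \<le> B" if "r < q" for r unfolding B_def using that by (intro Max_ge) auto
  have B0: "0 \<le> B" using B[of 0] nn[of 0] q by simp
  have mult: "a (k * q) \<le> k * a q" if "k \<ge> 1" for k
    using that
  proof (induction k rule: dec_induct)
    case (step k)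
    then show ?case using sub[of q "k * q"] by (simp add: distrib_right)
  qed simp
  obtain N :: nat where N: "2 * B / e < N" using reals_Archimedean2 by blast
  have "norm (a n / n - ?L) < e" if n: "n \<ge> max (Suc N) q" for n
  proof -
    have n0: "n \<ge> 1" and nq: "n \<ge> q" using n q by auto
    have "?L \<le> a n / n" using n0 bdd by (intro cINF_lower) auto
    moreover have "a n / n < ?L + e"
    proof -
      have k: "n div q \<ge> 1" using nq q by (simp add: div_greater_zero_iff Suc_leI)
      have "a n = a (n div q * q + n mod q)" by simp
      also have "\<dots> \<le> a (n div q * q) + a (n mod q)" by (rule sub)
      also have "\<dots> \<le> (n div q) * a q + B" using mult[OF k] B[of "n mod q"] q by auto
      also have "real (n div q) * a q \<le> (real n / q) * a q"
        using nn[of q] by (intro mult_right_mono) (auto simp: of_nat_div_le_of_nat)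
      finally have "a n / n \<le> ((real n / q) * a q + B) / n" using n0 by (intro divide_right_mono) auto
      also have "\<dots> = a q / q + B / n" using n0 q by (simp add: field_simps)
      also have "B / n < e / 2"
      proof -
        have "2 * B < e * N" using N e by (simp add: field_simps)
        also have "\<dots> \<le> e * n" using n e by (intro mult_left_mono) auto
        finally show ?thesis using n0 by (simp add: field_simps)
      qed
      finally show ?thesis using q by simp
    qed
    ultimately show ?thesis by auto
  qed
  then show "\<exists>no. \<forall>n\<ge>no. norm (a n / real n - ?L) < e" by blast
qed

section \<open>Words along orbits and the translation of partitions into labellings\<close>

definition word :: "('a \<Rightarrow> 'a) \<Rightarrow> ('a \<Rightarrow> 'l) \<Rightarrow> nat \<Rightarrow> 'a \<Rightarrow> 'l list" where
  "word T c n x = map (\<lambda>k. c ((T ^^ k) x)) [0..<n]"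

lemma length_word[simp]: "length (word T c n x) = n"
  by (simp add: word_def)

lemma word_Suc: "word T c (Suc n) x = word T c n x @ [c ((T ^^ n) x)]"
  by (simp add: word_def)

lemma word_add: "word T c (m + n) x = word T c m x @ word T c n ((T ^^ m) x)"
proof (induction n)
  case (Suc n)
  have "(T ^^ (m + n)) x = (T ^^ n) ((T ^^ m) x)" by (simp add: add.commute[of m] funpow_add)
  then show ?case using Suc by (simp add: word_Suc)
qed (simp add: word_def)

lemma finite_range_word:
  assumes "finite (range c)"
  shows "finite (range (word T c n))" "card (range (word T c n)) \<le> card (range c) ^ n"
proof -
  have sub: "range (word T c n) \<subseteq> {xs. set xs \<subseteq> range c \<and> length xs = n}" by (auto simp: word_def)
  show "finite (range (word T c n))" by (rule finite_subset[OF sub finite_lists_length_eq[OF assms]])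
  show "card (range (word T c n)) \<le> card (range c) ^ n"
    using card_mono[OF finite_lists_length_eq[OF assms] sub] card_lists_length_eq[OF assms] by simp
qed

text \<open>\<open>lim\<close> is informative only where the quotients converge; for invariant
  measures subadditivity ensures this.\<close>

definition label_entropy :: "('a::topological_space \<Rightarrow> 'a) \<Rightarrow> 'a measure \<Rightarrow> ('a \<Rightarrow> 'l) \<Rightarrow> real" where
  "label_entropy T \<mu> c = lim (\<lambda>n. ent \<mu> (word T c n) / n)"

definition part_label :: "'a set set \<Rightarrow> 'a \<Rightarrow> 'a set" where
  "part_label P x = (THE A. A \<in> P \<and> x \<in> A)"

lemma part_label:
  assumes "partition_on UNIV P"
  shows part_label_in: "part_label P x \<in> P" "x \<in> part_label P x"
    and part_label_eq: "A \<in> P \<Longrightarrow> x \<in> A \<Longrightarrow> part_label P x = A"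
    and part_label_iff: "A \<in> P \<Longrightarrow> x \<in> A \<longleftrightarrow> part_label P x = A"
proof -
  have "\<exists>!A. A \<in> P \<and> x \<in> A"
  proof -
    obtain A where A: "A \<in> P" "x \<in> A" using partition_onD1[OF assms] by blast
    show ?thesis
    proof (rule ex1I[of _ A])
      fix B assume "B \<in> P \<and> x \<in> B"
      then show "B = A" using disjointD[OF partition_onD2[OF assms], of B A] A by blast
    qed (use A in simp)
  qed
  then have "part_label P x \<in> P \<and> x \<in> part_label P x" unfolding part_label_def by (rule theI')
  then show 1: "part_label P x \<in> P" "x \<in> part_label P x" by auto
  show 2: "part_label P x = A" if "A \<in> P" "x \<in> A" for A
    unfolding part_label_def by (rule the1_equality[OF \<open>\<exists>!A. A \<in> P \<and> x \<in> A\<close>]) (use that in simp)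
  show "x \<in> A \<longleftrightarrow> part_label P x = A" if "A \<in> P" using 1 2[OF that] by blast
qed

lemma labelling_part_label:
  assumes "partition_on UNIV P" "finite P" "P \<subseteq> sets borel"
  shows "labelling (part_label P)"
  unfolding labelling_def
proof
  show "finite (range (part_label P))"
    by (rule finite_subset[OF _ assms(2)]) (use part_label_in(1)[OF assms(1)] in auto)
  show "\<forall>v. part_label P -` {v} \<in> sets borel"
  proof
    fix v
    show "part_label P -` {v} \<in> sets borel"
    proof (cases "v \<in> P")
      case True
      then have "part_label P -` {v} = v" using part_label_iff[OF assms(1) True] by auto
      then show ?thesis using assms True by auto
    next
      case False
      then have "part_label P -` {v} = {}" using part_label_in(1)[OF assms(1)] by auto
      then show ?thesis by simp
    qed
  qed
qed

text \<open>Successive intersections may produce the empty set, which is no fibre over the range of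
  the word map. Dropping it does not change the entropy because its measure is 0.\<close>

lemma refine_partition_fibres:
  assumes "partition_on UNIV P"
  shows "refine_partition T P n - {{}} = (\<lambda>x. {y. word T (part_label P) n y = word T (part_label P) n x}) ` UNIV"
proof (induction n)
  case 0 then show ?case by (auto simp: word_def)
next
  case (Suc n)
  let ?c = "part_label P"
  show ?case
  proof (intro set_eqI iffI)
    fix D assume "D \<in> refine_partition T P (Suc n) - {{}}"
    then obtain A B x where D: "D = A \<inter> (T ^^ n) -` B" "A \<in> refine_partition T P n" "B \<in> P" "x \<in> D" by auto
    then have "A \<in> refine_partition T P n - {{}}" by auto
    then obtain x' where "A = {y. word T ?c n y = word T ?c n x'}" using Suc by blast
    then have A: "A = {y. word T ?c n y = word T ?c n x}" using D by auto
    have "?c ((T ^^ n) x) = B" using D by (intro part_label_eq[OF assms]) auto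
    then have "(T ^^ n) -` B = {y. ?c ((T ^^ n) y) = ?c ((T ^^ n) x)}"
      using part_label_iff[OF assms D(3)] by auto
    then have "D = {y. word T ?c (Suc n) y = word T ?c (Suc n) x}" using D(1) A by (auto simp: word_Suc)
    then show "D \<in> range (\<lambda>x. {y. word T ?c (Suc n) y = word T ?c (Suc n) x})" by blast
  next
    fix D assume "D \<in> range (\<lambda>x. {y. word T ?c (Suc n) y = word T ?c (Suc n) x})"
    then obtain x where D: "D = {y. word T ?c (Suc n) y = word T ?c (Suc n) x}" by blast
    let ?A = "{y. word T ?c n y = word T ?c n x}" and ?B = "?c ((T ^^ n) x)"
    have B: "?B \<in> P" by (rule part_label_in(1)[OF assms])
    have A: "?A \<in> refine_partition T P n" using Suc by blast
    have "D = ?A \<inter> (T ^^ n) -` ?B" unfolding D using part_label_iff[OF assms B] by (auto simp: word_Suc)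
    moreover have "x \<in> D" unfolding D by simp
    ultimately show "D \<in> refine_partition T P (Suc n) - {{}}" using A B by auto
  qed
qed

lemma partition_entropy_refine:
  assumes "partition_on UNIV P" "finite P"
  shows "partition_entropy \<mu> (refine_partition T P n) = ent \<mu> (word T (part_label P) n)"
proof -
  let ?w = "word T (part_label P) n" and ?R = "refine_partition T P n"
  have fl: "finite (range (part_label P))"
    by (rule finite_subset[OF _ assms(2)]) (use part_label_in(1)[OF assms(1)] in auto)
  have R: "?R - {{}} = (\<lambda>v. ?w -` {v}) ` range ?w"
    unfolding refine_partition_fibres[OF assms(1)] by auto
  have "finite (?R - {{}})" unfolding R using finite_range_word(1)[OF fl] by simp
  then have fin: "finite ?R" by simp
  have inj: "inj_on (\<lambda>v. ?w -` {v}) (range ?w)" by (auto simp: inj_on_def)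
  have "(\<Sum>A\<in>?R. measure \<mu> A * ln (measure \<mu> A)) = (\<Sum>A\<in>?R - {{}}. measure \<mu> A * ln (measure \<mu> A))"
    by (intro sum.mono_neutral_right fin) auto
  also have "\<dots> = (\<Sum>v\<in>range ?w. measure \<mu> (?w -` {v}) * ln (measure \<mu> (?w -` {v})))"
    unfolding R by (subst sum.reindex[OF inj]) simp
  finally show ?thesis by (simp add: partition_entropy_def ent_def eta_def sum_negf)
qed

lemma metric_entropy_eq:
  "metric_entropy T \<mu> = (SUP P \<in> {P. partition_on UNIV P \<and> finite P \<and> P \<subseteq> sets borel}.
     ereal (label_entropy T \<mu> (part_label P)))"
  unfolding metric_entropy_def label_entropy_def
  by (intro SUP_cong refl) (simp add: partition_entropy_refine)

context compact_system
begin

lemma labelling_iter: "labelling X \<Longrightarrow> labelling (\<lambda>x. X ((T ^^ k) x))"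
proof -
  assume X: "labelling X"
  have "(\<lambda>x. X ((T ^^ k) x)) -` {v} = (T ^^ k) -` (X -` {v}) \<inter> space borel" for v by auto
  moreover have "(T ^^ k) -` (X -` {v}) \<inter> space borel \<in> sets borel" for v
    using X by (intro measurable_sets[OF iter_measurable]) (auto simp: labelling_def)
  moreover have "finite (range (\<lambda>x. X ((T ^^ k) x)))"
    by (rule finite_subset[OF _ labelling_finite[OF X]]) auto
  ultimately show ?thesis by (simp add: labelling_def)
qed

lemma labelling_word: "labelling c \<Longrightarrow> labelling (word T c n)"
proof (induction n)
  case 0
  have "word T c 0 = (\<lambda>x. [])" by (simp add: word_def fun_eq_iff)
  then show ?case by (simp add: labelling_def vimage_const)
next
  case (Suc n)
  have "word T c (Suc n) = (\<lambda>x. (\<lambda>(u, v). u @ [v]) (word T c n x, c ((T ^^ n) x)))" by (simp add: word_Suc fun_eq_iff)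
  then show ?case
    using labelling_comp[OF labelling_pair[OF Suc.IH[OF Suc.prems] labelling_iter[OF Suc.prems]], of "\<lambda>(u, v). u @ [v]"] by simp
qed

lemma ent_iter:
  assumes "\<mu> \<in> inv_prob T" "labelling X"
  shows "ent \<mu> (\<lambda>x. X ((T ^^ k) x)) = ent \<mu> X"
proof -
  have s: "sets \<mu> = sets borel" using assms by (simp add: inv_prob_def borel_prob_def)
  have "measure \<mu> ((\<lambda>x. X ((T ^^ k) x)) -` {v}) = measure \<mu> (X -` {v})" for v
  proof -
    have "measure \<mu> (X -` {v}) = measure (distr \<mu> borel (T ^^ k)) (X -` {v})" by (simp add: distr_iter[OF assms(1)])
    also have "\<dots> = measure \<mu> ((T ^^ k) -` (X -` {v}) \<inter> space \<mu>)"
      using assms(2) iter_measurable[of k] by (intro measure_distr) (auto simp: labelling_def measurable_cong_sets[OF s refl])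
    finally show ?thesis using borel_prob_space[OF inv_prob_borel_prob[OF assms(1)]] by (simp add: vimage_def)
  qed
  moreover have "ent \<mu> (\<lambda>x. X ((T ^^ k) x)) = (\<Sum>v\<in>range X. eta (measure \<mu> ((\<lambda>x. X ((T ^^ k) x)) -` {v})))"
    using labelling_finite[OF assms(2)] by (intro ent_eq_sum) auto
  ultimately show ?thesis by (simp add: ent_def)
qed

lemma ent_word_add_le:
  assumes "\<mu> \<in> borel_prob" "labelling c"
  shows "ent \<mu> (word T c (m + n)) \<le> ent \<mu> (word T c m) + ent \<mu> (\<lambda>x. word T c n ((T ^^ m) x))"
proof -
  have "word T c (m + n) = (\<lambda>x. (\<lambda>(u, v). u @ v) (word T c m x, word T c n ((T ^^ m) x)))" by (simp add: word_add fun_eq_iff)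
  then have "ent \<mu> (word T c (m + n)) \<le> ent \<mu> (\<lambda>x. (word T c m x, word T c n ((T ^^ m) x)))"
    using ent_comp_le[OF assms(1) labelling_pair[OF labelling_word[OF assms(2)] labelling_iter[OF labelling_word[OF assms(2)]]], of "\<lambda>(u, v). u @ v"] by simp
  also have "\<dots> \<le> ent \<mu> (word T c m) + ent \<mu> (\<lambda>x. word T c n ((T ^^ m) x))"
    using assms by (intro ent_pair_le labelling_word labelling_iter)
  finally show ?thesis .
qed

lemma ent_word_le:
  assumes "\<mu> \<in> borel_prob" "labelling c"
  shows "ent \<mu> (\<lambda>x. word T c n ((T ^^ k) x)) \<le> n * ln (card (range c))"
proof -
  have f: "finite (range c)" using labelling_finite[OF assms(2)] .
  have c: "card (range c) \<ge> 1" using f by (simp add: Suc_leI card_gt_0_iff)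
  have sub: "range (\<lambda>x. word T c n ((T ^^ k) x)) \<subseteq> range (word T c n)" by auto
  have "card (range (\<lambda>x. word T c n ((T ^^ k) x))) \<le> card (range c) ^ n"
    using card_mono[OF finite_range_word(1)[OF f] sub] finite_range_word(2)[OF f] order_trans by blast
  moreover have "0 < card (range (\<lambda>x. word T c n ((T ^^ k) x)))"
    using finite_subset[OF sub finite_range_word(1)[OF f]] by (simp add: card_gt_0_iff)
  ultimately have "ln (card (range (\<lambda>x. word T c n ((T ^^ k) x)))) \<le> ln (real (card (range c) ^ n))"
    using c by (subst ln_le_cancel_iff) (auto simp del: of_nat_power)
  also have "\<dots> = n * ln (card (range c))" using c by (simp add: ln_realpow)
  finally show ?thesis
    using ent_le_ln_card[OF assms(1) labelling_iter[OF labelling_word[OF assms(2), of n], of k]] by simp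
qed

text \<open>Invariance gives a shifted word the entropy of the unshifted one, so
  \<open>ent_word_add_le\<close> becomes subadditivity. By Fekete's lemma the limit is an infimum,
  whence the bound by any single \<open>q\<close>.\<close>

lemma label_entropy_lim:
  assumes "\<mu> \<in> inv_prob T" "labelling c"
  shows "(\<lambda>n. ent \<mu> (word T c n) / n) \<longlonglongrightarrow> label_entropy T \<mu> c"
    and "q \<ge> 1 \<Longrightarrow> label_entropy T \<mu> c \<le> ent \<mu> (word T c q) / q"
    and "0 \<le> label_entropy T \<mu> c"
proof -
  note \<mu> = inv_prob_borel_prob[OF assms(1)]
  have nn: "0 \<le> ent \<mu> (word T c n)" for n by (rule ent_nonneg[OF \<mu>])
  have *: "(\<lambda>n. ent \<mu> (word T c n) / n) \<longlonglongrightarrow> (INF n\<in>{1..}. ent \<mu> (word T c n) / real n)"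
    using ent_word_add_le[OF \<mu> assms(2)] ent_iter[OF assms(1) labelling_word[OF assms(2)]] nn
    by (intro fekete) auto
  then have eq: "label_entropy T \<mu> c = (INF n\<in>{1..}. ent \<mu> (word T c n) / real n)"
    unfolding label_entropy_def by (rule limI)
  show "(\<lambda>n. ent \<mu> (word T c n) / n) \<longlonglongrightarrow> label_entropy T \<mu> c" using * eq by simp
  have bdd: "bdd_below ((\<lambda>n. ent \<mu> (word T c n) / real n) ` {1..})" using nn by (intro bdd_belowI2[of _ 0]) auto
  show "label_entropy T \<mu> c \<le> ent \<mu> (word T c q) / q" if "q \<ge> 1" unfolding eq using that bdd by (intro cINF_lower) auto
  show "0 \<le> label_entropy T \<mu> c" unfolding eq using nn by (intro cINF_greatest) auto
qed

end

section \<open>The ergodic decomposition\<close>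

context compact_system
begin

section \<open>Birkhoff's pointwise ergodic theorem\<close>

lemma birkhoff_sum_add: "birkhoff_sum T u (m + n) x = birkhoff_sum T u m x + birkhoff_sum T u n ((T ^^ m) x)"
proof (induction n)
  case (Suc n)
  have "(T ^^ (m + n)) x = (T ^^ n) ((T ^^ m) x)" by (simp add: add.commute[of m] funpow_add)
  then show ?case using Suc by (simp add: birkhoff_sum_def)
qed (simp add: birkhoff_sum_def)

lemma measurable_birkhoff_sum: "u \<in> borel_measurable borel \<Longrightarrow> birkhoff_sum T u n \<in> borel_measurable borel"
proof -
  assume u: "u \<in> borel_measurable borel"
  have "(\<lambda>x. u ((T ^^ i) x)) \<in> borel_measurable borel" for i
    using measurable_compose[OF iter_measurable u] .
  then show ?thesis unfolding birkhoff_sum_def[abs_def] by (intro borel_measurable_sum) auto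
qed

lemma integral_birkhoff_sum:
  assumes "\<mu> \<in> inv_prob T" "u \<in> borel_measurable borel" "\<And>x. \<bar>u x\<bar> \<le> B"
  shows "integral\<^sup>L \<mu> (birkhoff_sum T u n) = n * integral\<^sup>L \<mu> u"
proof -
  have "integrable \<mu> (\<lambda>x. u ((T ^^ i) x))" for i
    using assms measurable_compose[OF iter_measurable assms(2)]
    by (intro integrable_bounded[where B=B] inv_prob_borel_prob) auto
  then show ?thesis
    unfolding birkhoff_sum_def[abs_def] using integral_iter[OF assms(1,2)] by (simp add: Bochner_Integration.integral_sum)
qed

text \<open>Cutting orbits greedily into blocks on which the averages of \<open>u\<close> are at least \<open>v - e\<close>; the
  modification \<open>w\<close> of \<open>u\<close> makes all blocks shorter than \<open>M\<close>.\<close>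

lemma limsup_average_le:
  assumes \<mu>: "\<mu> \<in> inv_prob T"
    and u: "u \<in> borel_measurable borel" "\<And>x. 0 \<le> u x" "\<And>x. u x \<le> 1"
    and v: "v \<in> borel_measurable borel" "\<And>x. 0 \<le> v x" "\<And>x. v x \<le> 1" "\<And>x. v (T x) = v x"
    and uv: "\<And>x e. e > 0 \<Longrightarrow> \<exists>n\<ge>1. birkhoff_sum T u n x \<ge> n * (v x - e)"
  shows "integral\<^sup>L \<mu> v \<le> (integral\<^sup>L \<mu> u :: real)"
proof (rule field_le_epsilon)
  fix e :: real assume "e > 0"
  then have e: "e / 3 > 0" by simp
  note \<mu>' = inv_prob_borel_prob[OF \<mu>]
  interpret prob_space \<mu> using \<mu>' by (simp add: borel_prob_def)
  have s: "sets \<mu> = sets borel" using \<mu>' by (simp add: borel_prob_def)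
  note [measurable] = u(1) v(1) measurable_birkhoff_sum[OF u(1)]
  \<comment> \<open>Points without a good block of length at most \<open>M\<close>. These sets
    decrease to the empty set, so some finite \<open>M\<close> makes their measure small.\<close>
  let ?B = "\<lambda>M. {x. \<forall>n\<in>{1..M}. birkhoff_sum T u n x < n * (v x - e / 3)}"
  have Bm: "?B M \<in> sets borel" for M by measurable
  have "(\<lambda>M. measure \<mu> (?B M)) \<longlonglongrightarrow> measure \<mu> (\<Inter>M. ?B M)"
    using Bm by (intro finite_Lim_measure_decseq) (auto simp: s decseq_def)
  moreover have "(\<Inter>M. ?B M) = {}"
  proof -
    { fix x
      obtain n where "n \<ge> 1" "birkhoff_sum T u n x \<ge> n * (v x - e / 3)" using uv[OF e] by blast
      then have "x \<notin> ?B n" by force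
      then have "x \<notin> (\<Inter>M. ?B M)" by blast }
    then show ?thesis by blast
  qed
  ultimately have "(\<lambda>M. measure \<mu> (?B M)) \<longlonglongrightarrow> 0" by simp
  then have "eventually (\<lambda>M. measure \<mu> (?B M) < e / 3) sequentially" using e by (rule order_tendstoD)
  then obtain M where M: "measure \<mu> (?B M) < e / 3" by (auto simp: eventually_sequentially)
  \<comment> \<open>On the exceptional set the value 1 makes a block of length one good, since
    \<open>v\<close> is at most 1. The integral grows by at most the measure of that set.\<close>
  define w where "w x = (if x \<in> ?B M then 1 else u x)" for x
  have w: "w \<in> borel_measurable borel" "\<And>x. 0 \<le> w x" "\<And>x. w x \<le> 1" "\<And>x. u x \<le> w x"
    unfolding w_def[abs_def] using u Bm by (auto intro!: measurable_If_set simp: borel_measurable_const)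
  have vT: "v ((T ^^ n) x) = v x" for n x by (induction n) (auto simp: v)
  have wn: "0 \<le> birkhoff_sum T w n x" for n x by (simp add: birkhoff_sum_def sum_nonneg w)
  \<comment> \<open>The term \<open>M\<close> pays for the last incomplete stretch, whose length is
    at most \<open>M\<close>; invariance of \<open>v\<close> keeps the target value constant along
    the orbit.\<close>
  have block: "L * (v x - e / 3) - M \<le> birkhoff_sum T w L x" for L x
  proof (induction L arbitrary: x rule: less_induct)
    case (less L)
    show ?case
    proof (cases "L \<le> M")
      case True
      have "real L * (v x - e / 3) \<le> real L * 1" using v(3)[of x] e by (intro mult_left_mono) auto
      then show ?thesis using wn[of L x] True by simp
    next
      case False
      have "\<exists>n. 1 \<le> n \<and> n \<le> L \<and> n * (v x - e / 3) \<le> birkhoff_sum T w n x"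
      proof (cases "x \<in> ?B M")
        case True
        then have "birkhoff_sum T w 1 x = 1" by (simp add: birkhoff_sum_def w_def)
        then show ?thesis using v(3)[of x] e False by (intro exI[of _ 1]) auto
      next
        case notB: False
        then obtain n where n: "n \<in> {1..M}" "birkhoff_sum T u n x \<ge> n * (v x - e / 3)" by force
        have "birkhoff_sum T u n x \<le> birkhoff_sum T w n x"
          unfolding birkhoff_sum_def by (intro sum_mono w)
        then show ?thesis using n False by (intro exI[of _ n]) auto
      qed
      then obtain n where n: "1 \<le> n" "n \<le> L" "n * (v x - e / 3) \<le> birkhoff_sum T w n x" by blast
      have "(L - n) * (v ((T ^^ n) x) - e / 3) - M \<le> birkhoff_sum T w (L - n) ((T ^^ n) x)"
        using n by (intro less) auto
      moreover have "birkhoff_sum T w L x = birkhoff_sum T w n x + birkhoff_sum T w (L - n) ((T ^^ n) x)"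
        using birkhoff_sum_add[of w n "L - n" x] n by simp
      moreover have "real (L - n) = real L - real n" using n by simp
      ultimately show ?thesis using n(3) by (simp add: vT left_diff_distrib)
    qed
  qed
  have iw: "integrable \<mu> w" and iu: "integrable \<mu> u" and iv: "integrable \<mu> v"
    using w u v by (auto intro!: integrable_bounded[OF \<mu>', where B=1])
  have "integral\<^sup>L \<mu> v - e / 3 \<le> integral\<^sup>L \<mu> w"
  proof (rule LIMSEQ_le_const2)
    show "(\<lambda>L. integral\<^sup>L \<mu> v - e / 3 - M / real L) \<longlonglongrightarrow> integral\<^sup>L \<mu> v - e / 3"
      using tendsto_diff[OF tendsto_const lim_const_over_n[of "real M"], of "integral\<^sup>L \<mu> v - e / 3"] by simp
    show "\<exists>N. \<forall>L\<ge>N. integral\<^sup>L \<mu> v - e / 3 - M / real L \<le> integral\<^sup>L \<mu> w"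
    proof (intro exI[of _ 1] allI impI)
      fix L :: nat assume L: "L \<ge> 1"
      have iv': "integrable \<mu> (\<lambda>x. L * (v x - e / 3) - M)" using iv by auto
      have "integrable \<mu> (birkhoff_sum T w L)"
      proof (rule integrable_bounded[OF \<mu>' measurable_birkhoff_sum[OF w(1)]])
        fix x
        have "birkhoff_sum T w L x \<le> (\<Sum>i<L. 1)" unfolding birkhoff_sum_def by (intro sum_mono w)
        then show "\<bar>birkhoff_sum T w L x\<bar> \<le> L" using wn[of L x] by simp
      qed
      then have "integral\<^sup>L \<mu> (\<lambda>x. L * (v x - e / 3) - M) \<le> integral\<^sup>L \<mu> (birkhoff_sum T w L)"
        using iv' block by (intro integral_mono)
      also have "integral\<^sup>L \<mu> (birkhoff_sum T w L) = L * integral\<^sup>L \<mu> w"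
        using w by (intro integral_birkhoff_sum[OF \<mu>, where B=1]) auto
      also have "integral\<^sup>L \<mu> (\<lambda>x. L * (v x - e / 3) - M) = L * (integral\<^sup>L \<mu> v - e / 3) - M"
        using iv prob_space by simp
      finally show "integral\<^sup>L \<mu> v - e / 3 - M / real L \<le> integral\<^sup>L \<mu> w" using L by (simp add: field_simps)
    qed
  qed
  moreover have "integral\<^sup>L \<mu> w \<le> integral\<^sup>L \<mu> u + e / 3"
  proof -
    have ii: "integrable \<mu> (indicator (?B M) :: 'a \<Rightarrow> real)"
      using Bm by (intro integrable_bounded[OF \<mu>', where B=1]) (auto simp: indicator_def)
    have "integral\<^sup>L \<mu> w \<le> integral\<^sup>L \<mu> (\<lambda>x. u x + indicator (?B M) x)"
      by (rule integral_mono[OF iw Bochner_Integration.integrable_add[OF iu ii]]) (use u(2) in \<open>auto simp: w_def\<close>)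
    also have "\<dots> = integral\<^sup>L \<mu> u + measure \<mu> (?B M)"
      using iu ii Bm[of M] s sets.sets_into_space[of "?B M" borel] borel_prob_space[OF \<mu>'] by simp
    finally show ?thesis using M by simp
  qed
  ultimately show "integral\<^sup>L \<mu> v \<le> integral\<^sup>L \<mu> u + e" using e by simp
qed

definition ulim :: "('a \<Rightarrow> real) \<Rightarrow> 'a \<Rightarrow> ereal" where
  "ulim u x = limsup (\<lambda>n. ereal (birkhoff_sum T u n x / n))"

lemma ulim_props:
  assumes u: "u \<in> borel_measurable borel" "\<And>x. 0 \<le> u x" "\<And>x. u x \<le> 1"
  shows "ulim u \<in> borel_measurable borel" "0 \<le> ulim u x" "ulim u x \<le> 1" "ulim u (T x) = ulim u x"
proof -
  show "ulim u \<in> borel_measurable borel"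
    unfolding ulim_def[abs_def] using measurable_birkhoff_sum[OF u(1)] by measurable
  have b: "0 \<le> birkhoff_sum T u n x / n" "birkhoff_sum T u n x / n \<le> 1" for n x
  proof -
    have "birkhoff_sum T u n x \<le> (\<Sum>i<n. 1)" unfolding birkhoff_sum_def by (intro sum_mono u)
    then show "birkhoff_sum T u n x / n \<le> 1" by (cases "n = 0") (auto simp: divide_le_eq)
    show "0 \<le> birkhoff_sum T u n x / n" by (simp add: birkhoff_sum_def sum_nonneg u)
  qed
  have "liminf (\<lambda>n. ereal (birkhoff_sum T u n x / n)) \<le> ulim u x"
    unfolding ulim_def by (intro Liminf_le_Limsup) auto
  moreover have "0 \<le> liminf (\<lambda>n. ereal (birkhoff_sum T u n x / n))"
    using b by (intro Liminf_bounded) (auto simp: zero_ereal_def)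
  ultimately show "0 \<le> ulim u x" by simp
  show "ulim u x \<le> 1" unfolding ulim_def using b by (intro Limsup_bounded) (auto simp: one_ereal_def)
  have "(\<lambda>n. (u ((T ^^ n) x) - u x) / n) \<longlonglongrightarrow> 0"
  proof (rule Lim_null_comparison)
    show "(\<lambda>n. 1 / real n) \<longlonglongrightarrow> 0" by (rule lim_const_over_n)
    have "\<bar>u ((T ^^ n) x) - u x\<bar> \<le> 1" for n using u(2,3)[of x] u(2,3)[of "(T ^^ n) x"] by linarith
    then show "\<forall>\<^sub>F n in sequentially. norm ((u ((T ^^ n) x) - u x) / real n) \<le> 1 / real n"
      by (auto intro!: always_eventually divide_right_mono)
  qed
  then have "(\<lambda>n. ereal ((u ((T ^^ n) x) - u x) / n)) \<longlonglongrightarrow> 0" by (simp add: zero_ereal_def)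
  then have "limsup (\<lambda>n. ereal ((u ((T ^^ n) x) - u x) / n) + ereal (birkhoff_sum T u n x / n)) = 0 + ulim u x"
    unfolding ulim_def by (intro ereal_limsup_lim_add) auto
  moreover have "ereal ((u ((T ^^ n) x) - u x) / n) + ereal (birkhoff_sum T u n x / n) = ereal (birkhoff_sum T u n (T x) / n)" for n
    by (simp add: birkhoff_sum_Suc_shift add_divide_distrib diff_divide_distrib)
  ultimately show "ulim u (T x) = ulim u x" by (simp add: ulim_def)
qed

lemma integral_ulim_le:
  assumes \<mu>: "\<mu> \<in> inv_prob T" and u: "u \<in> borel_measurable borel" "\<And>x. 0 \<le> u x" "\<And>x. u x \<le> 1"
  shows "integral\<^sup>L \<mu> (\<lambda>x. real_of_ereal (ulim u x)) \<le> integral\<^sup>L \<mu> u"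
proof (rule limsup_average_le[OF \<mu> u])
  note p = ulim_props[OF u]
  show "(\<lambda>x. real_of_ereal (ulim u x)) \<in> borel_measurable borel" using p(1) by measurable
  fix x
  obtain r where r: "ulim u x = ereal r" using p(2,3)[of x] by (cases "ulim u x") auto
  show "0 \<le> real_of_ereal (ulim u x)" "real_of_ereal (ulim u x) \<le> 1" using p(2,3)[of x] r by auto
  show "real_of_ereal (ulim u (T x)) = real_of_ereal (ulim u x)" using p(4) by simp
  fix e :: real assume e: "e > 0"
  show "\<exists>n\<ge>1. real n * (real_of_ereal (ulim u x) - e) \<le> birkhoff_sum T u n x"
  proof (rule ccontr)
    assume "\<not> ?thesis"
    then have "birkhoff_sum T u n x / n < r - e" if "n \<ge> 1" for n
      using that r by (force simp: divide_less_eq mult.commute)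
    then have "ulim u x \<le> ereal (r - e)"
      unfolding ulim_def by (intro Limsup_bounded) (auto simp: eventually_sequentially intro!: exI[of _ 1] less_imp_le)
    then show False using r e by simp
  qed
qed

text \<open>Applied to \<open>u\<close> and to \<open>1 - u\<close>, \<open>integral_ulim_le\<close>
  bounds the integral of the upper limit from above and that of the lower limit from below by the
  same number, so the two limits agree almost everywhere.\<close>

theorem birkhoff_convergent:
  assumes \<mu>: "\<mu> \<in> inv_prob T" and u: "u \<in> borel_measurable borel" "\<And>x. 0 \<le> u x" "\<And>x. u x \<le> 1"
  shows "AE x in \<mu>. convergent (\<lambda>n. birkhoff_sum T u n x / n)"
proof -
  note \<mu>' = inv_prob_borel_prob[OF \<mu>]
  interpret prob_space \<mu> using \<mu>' by (simp add: borel_prob_def)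
  let ?u' = "\<lambda>x. 1 - u x"
  have u': "?u' \<in> borel_measurable borel" "\<And>x. 0 \<le> ?u' x" "\<And>x. ?u' x \<le> 1" using u by auto
  note p = ulim_props[OF u] and p' = ulim_props[OF u']
  let ?a = "\<lambda>x. real_of_ereal (ulim u x)" and ?b = "\<lambda>x. real_of_ereal (ulim ?u' x)"
  have fin: "\<bar>ulim u x\<bar> \<noteq> \<infinity>" "\<bar>ulim ?u' x\<bar> \<noteq> \<infinity>" for x using p(2,3)[of x] p'(2,3)[of x] by auto
  have ab: "0 \<le> ?a x \<and> ?a x \<le> 1 \<and> 0 \<le> ?b x \<and> ?b x \<le> 1" for x
    using p(2,3)[of x] p'(2,3)[of x] by (cases "ulim u x"; cases "ulim ?u' x") auto
  have b: "1 + - ulim ?u' x = liminf (\<lambda>n. ereal (birkhoff_sum T u n x / n))" for x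
  proof -
    have "ulim ?u' x = limsup (\<lambda>n. ereal 1 + - ereal (birkhoff_sum T u n x / n))"
      unfolding ulim_def
    proof (rule Limsup_eq)
      show "\<forall>\<^sub>F n in sequentially. ereal (birkhoff_sum T ?u' n x / n) = ereal 1 + - ereal (birkhoff_sum T u n x / n)"
        unfolding eventually_sequentially
        by (intro exI[of _ 1]) (auto simp: birkhoff_sum_def sum_subtractf diff_divide_distrib)
    qed
    also have "\<dots> = ereal 1 + limsup (\<lambda>n. - ereal (birkhoff_sum T u n x / n))"
      by (rule ereal_limsup_lim_add[OF tendsto_const]) simp
    also have "limsup (\<lambda>n. - ereal (birkhoff_sum T u n x / n)) = - liminf (\<lambda>n. ereal (birkhoff_sum T u n x / n))"
      by (rule ereal_Limsup_uminus)
    also have "ereal 1 = 1" by (simp add: one_ereal_def)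
    finally have "ulim ?u' x = 1 + - liminf (\<lambda>n. ereal (birkhoff_sum T u n x / n))" .
    then show ?thesis using fin(2)[of x]
      by (cases "liminf (\<lambda>n. ereal (birkhoff_sum T u n x / n))") (auto simp: one_ereal_def)
  qed
  have im: "integrable \<mu> ?a" "integrable \<mu> ?b"
  proof -
    have "\<bar>?a x\<bar> \<le> 1" "\<bar>?b x\<bar> \<le> 1" for x using ab[of x] by linarith+
    then show "integrable \<mu> ?a" "integrable \<mu> ?b"
      using p(1) p'(1) by (blast intro: integrable_bounded[OF \<mu>'] borel_measurable_real_of_ereal)+
  qed
  have ge: "0 \<le> ?a x + ?b x - 1" for x
  proof -
    have "liminf (\<lambda>n. ereal (birkhoff_sum T u n x / n)) \<le> ulim u x"
      unfolding ulim_def by (intro Liminf_le_Limsup) auto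
    then have "1 + - ulim ?u' x \<le> ulim u x" by (simp add: b)
    then show ?thesis using fin[of x] by (cases "ulim u x"; cases "ulim ?u' x") (auto simp: one_ereal_def)
  qed
  have iu: "integrable \<mu> u" using u by (intro integrable_bounded[OF \<mu>', where B=1]) auto
  have "integral\<^sup>L \<mu> (\<lambda>x. ?a x + ?b x - 1) = integral\<^sup>L \<mu> ?a + integral\<^sup>L \<mu> ?b - 1" using im prob_space by simp
  also have "\<dots> \<le> integral\<^sup>L \<mu> u + integral\<^sup>L \<mu> ?u' - 1"
    using integral_ulim_le[OF \<mu> u] integral_ulim_le[OF \<mu> u'] by simp
  also have "\<dots> = 0" using iu prob_space by simp
  finally have "integral\<^sup>L \<mu> (\<lambda>x. ?a x + ?b x - 1) \<le> 0" .
  then have "integral\<^sup>L \<mu> (\<lambda>x. ?a x + ?b x - 1) = 0" using ge by (intro antisym integral_nonneg_AE) auto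
  then have "AE x in \<mu>. ?a x + ?b x - 1 = 0"
    using im ge by (subst (asm) integral_nonneg_eq_0_iff_AE) auto
  then show ?thesis
  proof (rule AE_mp, intro AE_I2 impI)
    fix x assume eq: "?a x + ?b x - 1 = 0"
    have "liminf (\<lambda>n. ereal (birkhoff_sum T u n x / n)) = ulim u x"
      unfolding b[symmetric] using eq fin[of x] by (cases "ulim u x"; cases "ulim ?u' x") (auto simp: one_ereal_def)
    then have "(\<lambda>n. ereal (birkhoff_sum T u n x / n)) \<longlonglongrightarrow> ulim u x"
      unfolding ulim_def by (intro Liminf_eq_Limsup) auto
    moreover have "ereal (?a x) = ulim u x" using fin[of x] by (simp add: ereal_real)
    ultimately have "(\<lambda>n. ereal (birkhoff_sum T u n x / n)) \<longlonglongrightarrow> ereal (?a x)" by (simp only:)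
    then have "(\<lambda>n. birkhoff_sum T u n x / n) \<longlonglongrightarrow> ?a x" by (simp only: lim_ereal)
    then show "convergent (\<lambda>n. birkhoff_sum T u n x / n)" by (auto simp: convergent_def)
  qed
qed

end

section \<open>Conditional measures on the cells of a finite labelling\<close>

lemma cond_measure:
  fixes \<mu> :: "'a::topological_space measure"
  assumes \<mu>: "\<mu> \<in> borel_prob" and A: "A \<in> sets borel" "measure \<mu> A > 0"
  shows cond_borel_prob: "uniform_measure \<mu> A \<in> borel_prob"
    and integral_cond: "u \<in> borel_measurable borel \<Longrightarrow>
      integral\<^sup>L (uniform_measure \<mu> A) u = integral\<^sup>L \<mu> (\<lambda>x. indicator A x * u x) / (measure \<mu> A :: real)"
    and AE_cond: "AE x in \<mu>. P x \<Longrightarrow> AE x in uniform_measure \<mu> A. x \<in> A \<and> P x"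
    and measure_cond_self: "measure (uniform_measure \<mu> A) A = 1"
proof -
  interpret prob_space \<mu> using \<mu> by (simp add: borel_prob_def)
  have s: "sets \<mu> = sets borel" using \<mu> by (simp add: borel_prob_def)
  have As: "A \<in> sets \<mu>" using A s by simp
  have e: "emeasure \<mu> A \<noteq> 0" "emeasure \<mu> A \<noteq> \<infinity>" using A(2) by (auto simp: emeasure_eq_measure)
  show "uniform_measure \<mu> A \<in> borel_prob"
    using prob_space_uniform_measure[OF e] s by (simp add: borel_prob_def)
  show "measure (uniform_measure \<mu> A) A = 1"
    using A(2) As e by (subst measure_uniform_measure) auto
  show "AE x in uniform_measure \<mu> A. x \<in> A \<and> P x" if "AE x in \<mu>. P x"
    by (rule AE_uniform_measureI[OF As]) (use that in auto)
  show "integral\<^sup>L (uniform_measure \<mu> A) u = integral\<^sup>L \<mu> (\<lambda>x. indicator A x * u x) / measure \<mu> A"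
    if u: "u \<in> borel_measurable borel"
  proof -
    have "uniform_measure \<mu> A = density \<mu> (\<lambda>x. ennreal (indicator A x / measure \<mu> A))"
      unfolding uniform_measure_def emeasure_eq_measure using A(2)
      by (intro arg_cong[of _ _ "density \<mu>"] ext) (auto simp: indicator_def divide_ennreal ennreal_1[symmetric] simp del: ennreal_1)
    moreover have "integral\<^sup>L (density \<mu> (\<lambda>x. ennreal (indicator A x / measure \<mu> A))) u
        = integral\<^sup>L \<mu> (\<lambda>x. (indicator A x / measure \<mu> A) *\<^sub>R u x)"
    proof (rule integral_density)
      show "u \<in> borel_measurable \<mu>" using u by (simp add: measurable_cong_sets[OF s refl])
      show "(\<lambda>x. indicator A x / measure \<mu> A) \<in> borel_measurable \<mu>" using As by measurable
    qed simp
    ultimately show ?thesis by simp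
  qed
qed

text \<open>Null cells are left out of \<open>I\<close>, since conditioning on them gives no
  probability measure; they contribute nothing to the integral.\<close>

lemma cell_decomposition:
  fixes Y :: "'a::topological_space \<Rightarrow> 'l"
  assumes \<mu>: "\<mu> \<in> borel_prob" and Y: "labelling Y"
  defines "I \<equiv> {v \<in> range Y. measure \<mu> (Y -` {v}) > 0}"
  shows "finite I" "(\<Sum>v\<in>I. measure \<mu> (Y -` {v})) = 1" "I \<noteq> {}"
    and "u \<in> borel_measurable borel \<Longrightarrow> (\<And>x. \<bar>u x\<bar> \<le> B) \<Longrightarrow>
      integral\<^sup>L \<mu> u = (\<Sum>v\<in>I. measure \<mu> (Y -` {v}) * integral\<^sup>L (uniform_measure \<mu> (Y -` {v})) u :: real)"
proof -
  interpret prob_space \<mu> using \<mu> by (simp add: borel_prob_def)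
  have s: "sets \<mu> = sets borel" using \<mu> by (simp add: borel_prob_def)
  note fin = labelling_finite[OF Y]
  have Yb: "Y -` {v} \<in> sets borel" for v using Y by (simp add: labelling_def)
  show fI: "finite I" using fin by (simp add: I_def)
  have zero: "measure \<mu> (Y -` {v}) = 0" if "v \<in> range Y - I" for v
    using that measure_nonneg[of \<mu> "Y -` {v}"] by (auto simp: I_def less_le)
  have "(\<Sum>v\<in>I. measure \<mu> (Y -` {v})) = (\<Sum>v\<in>range Y. measure \<mu> (Y -` {v}))"
    using zero by (intro sum.mono_neutral_left fin) (auto simp: I_def)
  then show one: "(\<Sum>v\<in>I. measure \<mu> (Y -` {v})) = 1" using sum_fibres[OF \<mu> Y fin order_refl] by simp
  then show "I \<noteq> {}" by auto
  assume u: "u \<in> borel_measurable borel" "\<And>x. \<bar>u x\<bar> \<le> B"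
  have um: "u \<in> borel_measurable \<mu>" using u(1) by (simp add: measurable_cong_sets[OF s refl])
  have ii: "integrable \<mu> (\<lambda>x. indicator (Y -` {v}) x * u x)" for v
  proof (rule integrable_bounded[OF \<mu>])
    show "(\<lambda>x. indicator (Y -` {v}) x * u x) \<in> borel_measurable borel" using u(1) Yb[of v] by measurable
    show "\<bar>indicator (Y -` {v}) x * u x\<bar> \<le> \<bar>B\<bar>" for x using u(2)[of x] by (auto simp: indicator_def)
  qed
  have "integral\<^sup>L \<mu> u = integral\<^sup>L \<mu> (\<lambda>x. \<Sum>v\<in>range Y. indicator (Y -` {v}) x * u x)"
  proof (rule Bochner_Integration.integral_cong[OF refl])
    fix x
    have "(\<Sum>v\<in>range Y. indicator (Y -` {v}) x * u x) = (\<Sum>v\<in>{Y x}. indicator (Y -` {v}) x * u x)"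
      by (intro sum.mono_neutral_right fin) (auto simp: indicator_def)
    then show "u x = (\<Sum>v\<in>range Y. indicator (Y -` {v}) x * u x)" by simp
  qed
  also have "\<dots> = (\<Sum>v\<in>range Y. integral\<^sup>L \<mu> (\<lambda>x. indicator (Y -` {v}) x * u x))"
    using ii by (rule Bochner_Integration.integral_sum)
  also have "\<dots> = (\<Sum>v\<in>I. integral\<^sup>L \<mu> (\<lambda>x. indicator (Y -` {v}) x * u x))"
  proof (intro sum.mono_neutral_right fin ballI)
    fix v assume "v \<in> range Y - I"
    then have "AE x in \<mu>. x \<notin> Y -` {v}" using zero Yb[of v] s by (intro AE_not_in) (auto simp: null_sets_def emeasure_eq_measure)
    then have "AE x in \<mu>. indicator (Y -` {v}) x * u x = 0" by (rule AE_mp) (auto intro!: AE_I2)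
    then show "integral\<^sup>L \<mu> (\<lambda>x. indicator (Y -` {v}) x * u x) = 0" by (rule integral_eq_zero_AE)
  qed (auto simp: I_def)
  also have "\<dots> = (\<Sum>v\<in>I. measure \<mu> (Y -` {v}) * integral\<^sup>L (uniform_measure \<mu> (Y -` {v})) u)"
    using integral_cond[OF \<mu> Yb] u(1) by (intro sum.cong) (auto simp: I_def)
  finally show "integral\<^sup>L \<mu> u = (\<Sum>v\<in>I. measure \<mu> (Y -` {v}) * integral\<^sup>L (uniform_measure \<mu> (Y -` {v})) u)" .
qed

text \<open>Rounding to multiples of \<open>s\<close> gives a finite partition on whose cells every
  \<open>u j\<close> varies by at most \<open>s\<close>. The label is a function that is 0 off
  \<open>J\<close>, which keeps the range finite.\<close>

lemma floor_labelling:
  fixes u :: "'j \<Rightarrow> 'a::topological_space \<Rightarrow> real"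
  assumes J: "finite J" and u: "\<And>j. j \<in> J \<Longrightarrow> u j \<in> borel_measurable borel" "\<And>j x. j \<in> J \<Longrightarrow> \<bar>u j x\<bar> \<le> B" and s: "s > 0"
  defines "Y \<equiv> \<lambda>x j. if j \<in> J then \<lfloor>u j x / s\<rfloor> else 0"
  shows "labelling Y"
    and "\<And>x y j. Y x = Y y \<Longrightarrow> j \<in> J \<Longrightarrow> \<bar>u j x - u j y\<bar> \<le> s"
proof -
  show "\<bar>u j x - u j y\<bar> \<le> s" if "Y x = Y y" "j \<in> J" for x y j
  proof -
    have "\<lfloor>u j x / s\<rfloor> = \<lfloor>u j y / s\<rfloor>" using fun_cong[OF that(1), of j] that(2) by (simp add: Y_def)
    then have "\<bar>u j x / s - u j y / s\<bar> \<le> 1" by linarith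
    then have "\<bar>u j x - u j y\<bar> / s \<le> 1" using s by (simp add: diff_divide_distrib[symmetric])
    then show ?thesis using s by (simp add: divide_le_eq)
  qed
  let ?K = "{\<lfloor>- B / s\<rfloor>..\<lfloor>B / s\<rfloor>}"
  have "range Y \<subseteq> {g. \<forall>j. (j \<in> J \<longrightarrow> g j \<in> ?K) \<and> (j \<notin> J \<longrightarrow> g j = 0)}"
  proof clarify
    fix x j
    have "\<lfloor>u j x / s\<rfloor> \<in> ?K" if "j \<in> J"
    proof -
      have "- B \<le> u j x" "u j x \<le> B" using u(2)[OF that, of x] by auto
      then have "- B / s \<le> u j x / s" "u j x / s \<le> B / s"
        by - (rule divide_right_mono, assumption, use s in simp)+
      then show ?thesis using floor_mono[of "- B / s" "u j x / s"] floor_mono[of "u j x / s" "B / s"] by simp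
    qed
    then show "(j \<in> J \<longrightarrow> Y x j \<in> ?K) \<and> (j \<notin> J \<longrightarrow> Y x j = 0)" by (simp add: Y_def)
  qed
  then have "finite (range Y)" by (rule finite_subset) (intro finite_set_of_finite_funs J, simp)
  moreover have "Y -` {g} \<in> sets borel" for g
  proof -
    have "Y -` {g} = (if \<forall>j. j \<notin> J \<longrightarrow> g j = 0 then {x \<in> space borel. \<forall>j\<in>J. \<lfloor>u j x / s\<rfloor> = g j} else {})"
      by (auto simp: Y_def fun_eq_iff)
    moreover have "{x \<in> space borel. \<forall>j\<in>J. \<lfloor>u j x / s\<rfloor> = g j} \<in> sets borel"
    proof (rule sets.sets_Collect_finite_All[OF _ J])
      fix j assume "j \<in> J"
      then have [measurable]: "u j \<in> borel_measurable borel" by (rule u(1))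
      have "{x \<in> space borel. \<lfloor>u j x / s\<rfloor> = g j} = {x \<in> space borel. of_int (g j) \<le> u j x / s \<and> u j x / s < of_int (g j) + 1}"
        by (simp add: floor_eq_iff)
      also have "\<dots> \<in> sets borel" by measurable
      finally show "{x \<in> space borel. \<lfloor>u j x / s\<rfloor> = g j} \<in> sets borel" .
    qed
    ultimately show ?thesis by simp
  qed
  ultimately show "labelling Y" by (simp add: labelling_def)
qed

context compact_system
begin

lemma borel_prob_eqI_f:
  assumes "\<mu> \<in> borel_prob" "\<nu> \<in> borel_prob" "\<And>k. integral\<^sup>L \<mu> (f k) = integral\<^sup>L \<nu> (f k)"
  shows "\<mu> = \<nu>"
proof (rule borel_prob_eqI[OF assms(1,2)])
  fix h :: "'a \<Rightarrow> real" assume h: "continuous_on UNIV h"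
  have "wconv (\<lambda>_. \<mu>) \<nu>" using assms by (intro wconvI) auto
  then have "(\<lambda>n::nat. integral\<^sup>L \<mu> h) \<longlonglongrightarrow> integral\<^sup>L \<nu> h" using h by (simp add: wconv_def)
  then show "integral\<^sup>L \<mu> h = integral\<^sup>L \<nu> h" by (simp add: LIMSEQ_const_iff)
qed

lemma cond_inv_prob:
  assumes \<mu>: "\<mu> \<in> inv_prob T" and A: "A \<in> sets borel" "T -` A = A" "measure \<mu> A > 0"
  shows "uniform_measure \<mu> A \<in> inv_prob T"
proof (rule inv_probI)
  note \<mu>' = inv_prob_borel_prob[OF \<mu>]
  show "uniform_measure \<mu> A \<in> borel_prob" by (rule cond_borel_prob[OF \<mu>' A(1,3)])
  fix h :: "'a \<Rightarrow> real" assume h: "continuous_on UNIV h"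
  have hT: "continuous_on UNIV (\<lambda>x. h (T x))" using cont_comp_iter[OF h, of 1] by simp
  have m: "(\<lambda>x. indicator A x * h x) \<in> borel_measurable borel" using borel_cont[OF h] A(1) by measurable
  have "indicator A (T x) = (indicator A x :: real)" for x using A(2) by (auto simp: indicator_def)
  then have "integral\<^sup>L \<mu> (\<lambda>x. indicator A x * h (T x)) = integral\<^sup>L \<mu> (\<lambda>x. indicator A x * h x)"
    using integral_iter[OF \<mu> m, of 1] by simp
  then show "integral\<^sup>L (uniform_measure \<mu> A) (\<lambda>x. h (T x)) = integral\<^sup>L (uniform_measure \<mu> A) h"
    using integral_cond[OF \<mu>' A(1,3)] borel_cont[OF h] borel_cont[OF hT] by simp
qed

section \<open>Limits of empirical measures along almost every orbit\<close>

definition regular :: "'a set" where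
  "regular = {x. \<forall>k. convergent (\<lambda>n. birkhoff_sum T (f k) n x / n)}"

text \<open>By Birkhoff's theorem the limit exists for almost every point, and almost every limit is ergodic,
  so that \<open>kappa\<close> is the ergodic decomposition. Outside \<open>regular\<close> any Borel probability measure would do.\<close>

definition kappa :: "'a \<Rightarrow> 'a measure" where
  "kappa x = (if x \<in> regular then SOME \<nu>. \<nu> \<in> borel_prob \<and> wconv (\<lambda>n. empirical T (Suc n) x) \<nu>
     else return borel undefined)"

text \<open>Convergence is tested on the countable sequence \<open>f\<close> only, which makes
  \<open>regular\<close> a Borel set and a set of full measure; for other continuous functions it
  follows by density.\<close>

lemma regular_borel: "regular \<in> sets borel"
proof -
  have [measurable]: "birkhoff_sum T (f k) n \<in> borel_measurable borel" for k n
    by (intro measurable_birkhoff_sum borel_cont cont_f)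
  have "{x \<in> space borel. Cauchy (\<lambda>n. birkhoff_sum T (f k) n x / n)} \<in> sets borel" for k by measurable
  moreover have "regular = (\<Inter>k. {x \<in> space borel. Cauchy (\<lambda>n. birkhoff_sum T (f k) n x / n)})"
    by (auto simp: regular_def Cauchy_convergent_iff)
  ultimately show ?thesis by (auto intro: sets.countable_INT)
qed

lemma regular_AE: "\<mu> \<in> inv_prob T \<Longrightarrow> AE x in \<mu>. x \<in> regular"
  using birkhoff_convergent[of \<mu>] borel_cont[OF cont_f] f_range
  by (auto simp: regular_def AE_all_countable)

lemma birkhoff_shift_limit:
  assumes "continuous_on UNIV (h :: 'a \<Rightarrow> real)"
  shows "(\<lambda>n. birkhoff_sum T h n (T x) / n - birkhoff_sum T h n x / n) \<longlonglongrightarrow> 0"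
proof -
  obtain B where B: "B > 0" "\<And>x. \<bar>h x\<bar> \<le> B" using bounded_cont[OF assms] by blast
  show ?thesis
  proof (rule Lim_null_comparison)
  show "(\<lambda>n. 2 * B / real n) \<longlonglongrightarrow> 0" by (rule lim_const_over_n)
  have "birkhoff_sum T h n (T x) / n - birkhoff_sum T h n x / n = (h ((T ^^ n) x) - h x) / n" for n
    by (simp add: birkhoff_sum_Suc_shift add_divide_distrib diff_divide_distrib)
  moreover have "\<bar>h ((T ^^ n) x) - h x\<bar> \<le> 2 * B" for n using B(2)[of x] B(2)[of "(T ^^ n) x"] by linarith
  ultimately show "\<forall>\<^sub>F n in sequentially. norm (birkhoff_sum T h n (T x) / n - birkhoff_sum T h n x / n) \<le> 2 * B / n"
    by (auto intro!: always_eventually divide_right_mono)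
  qed
qed

lemma regular_T: "T x \<in> regular \<longleftrightarrow> x \<in> regular"
proof -
  have "convergent (\<lambda>n. birkhoff_sum T (f k) n (T x) / n) \<longleftrightarrow> convergent (\<lambda>n. birkhoff_sum T (f k) n x / n)" for k
  proof
    note z = birkhoff_shift_limit[OF cont_f[of k], of x]
    { assume "convergent (\<lambda>n. birkhoff_sum T (f k) n (T x) / n)"
      then obtain l where l: "(\<lambda>n. birkhoff_sum T (f k) n (T x) / n) \<longlonglongrightarrow> l" by (auto simp: convergent_def)
      from tendsto_diff[OF l z] show "convergent (\<lambda>n. birkhoff_sum T (f k) n x / n)" by (auto simp: convergent_def) }
    { assume "convergent (\<lambda>n. birkhoff_sum T (f k) n x / n)"
      then obtain l where l: "(\<lambda>n. birkhoff_sum T (f k) n x / n) \<longlonglongrightarrow> l" by (auto simp: convergent_def)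
      from tendsto_add[OF l z] show "convergent (\<lambda>n. birkhoff_sum T (f k) n (T x) / n)" by (auto simp: convergent_def) }
  qed
  then show ?thesis by (simp add: regular_def)
qed

lemma kappa_limit:
  assumes "x \<in> regular"
  shows "kappa x \<in> borel_prob" "wconv (\<lambda>n. empirical T (Suc n) x) (kappa x)"
proof -
  have "convergent (\<lambda>n. integral\<^sup>L (empirical T (Suc n) x) (f k))" for k
  proof -
    have "convergent (\<lambda>n. birkhoff_sum T (f k) n x / n)" using assms by (simp add: regular_def)
    then have "convergent (\<lambda>n. birkhoff_sum T (f k) (n + 1) x / real (n + 1))"
      by (rule iffD2[OF convergent_ignore_initial_segment[of "\<lambda>n. birkhoff_sum T (f k) n x / n" 1]])
    then show ?thesis by (simp add: integral_empirical_birkhoff[OF _ cont_f])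
  qed
  then obtain \<nu> where "\<nu> \<in> borel_prob" "wconv (\<lambda>n. empirical T (Suc n) x) \<nu>"
    by (rule limit_measure[of "\<lambda>n. empirical T (Suc n) x", rotated]) (auto intro: empirical_borel_prob)
  then have "kappa x \<in> borel_prob \<and> wconv (\<lambda>n. empirical T (Suc n) x) (kappa x)"
    unfolding kappa_def if_P[OF assms]
    by (intro someI[of "\<lambda>\<nu>. \<nu> \<in> borel_prob \<and> wconv (\<lambda>n. empirical T (Suc n) x) \<nu>"] conjI)
  then show "kappa x \<in> borel_prob" "wconv (\<lambda>n. empirical T (Suc n) x) (kappa x)" by auto
qed

lemma kappa_borel_prob: "kappa x \<in> borel_prob"
proof (cases "x \<in> regular")
  case False
  then show ?thesis by (simp add: kappa_def borel_prob_def prob_space_return)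
qed (rule kappa_limit)

lemma kappa_birkhoff:
  assumes "x \<in> regular" "continuous_on UNIV h"
  shows "(\<lambda>n. birkhoff_sum T h n x / n) \<longlonglongrightarrow> integral\<^sup>L (kappa x) h"
proof -
  have "(\<lambda>n. integral\<^sup>L (empirical T (Suc n) x) h) \<longlonglongrightarrow> integral\<^sup>L (kappa x) h"
    using kappa_limit(2)[OF assms(1)] assms(2) by (simp add: wconv_def)
  then have "(\<lambda>n. birkhoff_sum T h (Suc n) x / real (Suc n)) \<longlonglongrightarrow> integral\<^sup>L (kappa x) h"
    by (simp add: integral_empirical_birkhoff[OF _ assms(2)])
  then show ?thesis by (rule LIMSEQ_imp_Suc)
qed

lemma kappa_inv_prob: "x \<in> regular \<Longrightarrow> kappa x \<in> inv_prob T"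
  by (rule empirical_limit_invariant[OF filterlim_Suc _ kappa_limit(2,1)]) auto

text \<open>Makes every function of \<open>kappa x\<close> invariant, so the cells built from such
  functions can be conditioned on without leaving the invariant measures.\<close>

lemma kappa_T: "kappa (T x) = kappa x"
proof (cases "x \<in> regular")
  case True
  then have T: "T x \<in> regular" by (simp add: regular_T)
  show ?thesis
  proof (rule borel_prob_eqI_f[OF kappa_borel_prob kappa_borel_prob])
    fix k
    have "(\<lambda>n. birkhoff_sum T (f k) n (T x) / n) \<longlonglongrightarrow> integral\<^sup>L (kappa x) (f k)"
      using tendsto_add[OF kappa_birkhoff[OF True cont_f[of k]] birkhoff_shift_limit[OF cont_f[of k], of x]] by simp
    then show "integral\<^sup>L (kappa (T x)) (f k) = integral\<^sup>L (kappa x) (f k)"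
      using kappa_birkhoff[OF T cont_f[of k]] LIMSEQ_unique by blast
  qed
next
  case False
  then show ?thesis by (simp add: kappa_def regular_T)
qed

lemma measurable_integral_kappa_cont:
  assumes "continuous_on UNIV h"
  shows "(\<lambda>x. integral\<^sup>L (kappa x) h :: real) \<in> borel_measurable borel"
proof -
  have [measurable]: "birkhoff_sum T h n \<in> borel_measurable borel" for n
    by (intro measurable_birkhoff_sum borel_cont assms)
  have "(\<lambda>x. if x \<in> regular then lim (\<lambda>n. birkhoff_sum T h n x / real n) else integral\<^sup>L (return borel undefined) h) \<in> borel_measurable borel"
    by (intro measurable_If_set) (use regular_borel in \<open>simp_all, measurable\<close>)
  moreover have "(\<lambda>x. integral\<^sup>L (kappa x) h) = (\<lambda>x. if x \<in> regular then lim (\<lambda>n. birkhoff_sum T h n x / real n) else integral\<^sup>L (return borel undefined) h)"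
    using limI[OF kappa_birkhoff[OF _ assms]] by (auto simp: kappa_def fun_eq_iff)
  ultimately show ?thesis by simp
qed

text \<open>Measurability into \<open>prob_algebra\<close> makes \<open>kappa\<close> a kernel that
  can be integrated with \<open>\<bind>\<close>. Closed sets suffice, and their measures are limits
  of integrals of continuous functions.\<close>

lemma measurable_kappa: "kappa \<in> borel \<rightarrow>\<^sub>M prob_algebra borel"
proof (rule measurable_prob_algebra_generated[where \<Omega>=UNIV and G="Collect closed"])
  show "sets (borel :: 'a measure) = sigma_sets UNIV (Collect closed)" by (simp add: borel_eq_closed)
  show "Int_stable (Collect closed :: 'a set set)" by (auto simp: Int_stable_def)
  show "prob_space (kappa x)" "sets (kappa x) = sets borel" for x
    using kappa_borel_prob[of x] by (auto simp: borel_prob_def)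
  fix C :: "'a set" assume "C \<in> Collect closed"
  then have C: "closed C" by simp
  have "(\<lambda>x. measure (kappa x) C) \<in> borel_measurable borel"
  proof (cases "C = {}")
    case False
    show ?thesis
      by (rule borel_measurable_LIMSEQ_real[OF measure_closed_limit[OF C False kappa_borel_prob]])
        (intro measurable_integral_kappa_cont continuous_intros)
  qed simp
  moreover have "emeasure (kappa x) C = ennreal (measure (kappa x) C)" for x
  proof -
    interpret prob_space "kappa x" using kappa_borel_prob[of x] by (simp add: borel_prob_def)
    show ?thesis by (rule emeasure_eq_measure)
  qed
  ultimately show "(\<lambda>x. emeasure (kappa x) C) \<in> borel_measurable borel" by simp
qed auto

lemma measurable_integral_kappa:
  assumes "u \<in> borel_measurable borel"
  shows "(\<lambda>x. integral\<^sup>L (kappa x) u :: real) \<in> borel_measurable borel"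
  using measurable_compose[OF measurable_prob_algebraD[OF measurable_kappa] integral_measurable_subprob_algebra[OF assms]] .

lemma measurable_measure_kappa:
  assumes "A \<in> sets borel"
  shows "(\<lambda>x. measure (kappa x) A) \<in> borel_measurable borel"
proof -
  have "measure (kappa x) A = integral\<^sup>L (kappa x) (indicator A)" for x by (simp add: borel_prob_space[OF kappa_borel_prob])
  then show ?thesis using measurable_integral_kappa[of "indicator A"] assms by simp
qed

lemma abs_integral_le:
  assumes "\<mu> \<in> borel_prob" "u \<in> borel_measurable borel" "\<And>x. \<bar>u x\<bar> \<le> (B::real)"
  shows "\<bar>integral\<^sup>L \<mu> u\<bar> \<le> B"
  using integral_abs_diff_le[OF assms(1) integrable_bounded[OF assms], of "\<lambda>_. 0" B] assms(3) by simp

text \<open>For continuous functions this is dominated convergence of the Birkhoff averages together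
  with invariance. It identifies the mixture \<open>\<mu> \<bind> kappa\<close> with \<mu>, and the
  identity then passes to bounded Borel functions, for which \<open>kappa\<close> is not known to
  give the Birkhoff limit.\<close>

lemma kappa_disintegration:
  assumes \<mu>: "\<mu> \<in> inv_prob T" and u: "u \<in> borel_measurable borel" "\<And>x. \<bar>u x\<bar> \<le> (B::real)"
  shows "integral\<^sup>L \<mu> (\<lambda>x. integral\<^sup>L (kappa x) u) = integral\<^sup>L \<mu> u"
proof -
  note \<mu>' = inv_prob_borel_prob[OF \<mu>]
  interpret prob_space \<mu> using \<mu>' by (simp add: borel_prob_def)
  have s: "sets \<mu> = sets borel" using \<mu>' by (simp add: borel_prob_def)
  have K: "kappa \<in> measurable \<mu> (subprob_algebra borel)"
    using measurable_prob_algebraD[OF measurable_kappa] by (simp add: measurable_cong_sets[OF s refl])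
  have pk: "prob_space (kappa x)" for x using kappa_borel_prob[of x] by (simp add: borel_prob_def)
  have bi: "integral\<^sup>L (\<mu> \<bind> kappa) w = integral\<^sup>L \<mu> (\<lambda>x. integral\<^sup>L (kappa x) w)"
    if "w \<in> borel_measurable borel" "\<And>x. \<bar>w x\<bar> \<le> b" for w :: "'a \<Rightarrow> real" and b
    by (rule integral_bind[OF that(1) _ K, where B'=1]) (use that pk in \<open>auto simp: prob_space.emeasure_space_1 intro: finite_measure_axioms\<close>)
  have "\<mu> \<bind> kappa = \<mu>"
  proof (rule borel_prob_eqI[OF _ \<mu>'])
    have "sets (\<mu> \<bind> kappa) = sets borel" by (rule sets_bind_measurable[OF K]) (simp add: not_empty)
    then show "\<mu> \<bind> kappa \<in> borel_prob"
      using prob_space_bind[OF _ K] pk by (simp add: borel_prob_def)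
    fix h :: "'a \<Rightarrow> real" assume h: "continuous_on UNIV h"
    obtain b where b: "b > 0" "\<And>x. \<bar>h x\<bar> \<le> b" using bounded_cont[OF h] by blast
    have hm: "birkhoff_sum T h n \<in> borel_measurable \<mu>" for n
      using measurable_birkhoff_sum[OF borel_cont[OF h]] by (simp add: measurable_cong_sets[OF s refl])
    have "(\<lambda>n. integral\<^sup>L \<mu> (\<lambda>x. birkhoff_sum T h n x / n)) \<longlonglongrightarrow> integral\<^sup>L \<mu> (\<lambda>x. integral\<^sup>L (kappa x) h)"
    proof (rule integral_dominated_convergence[where w="\<lambda>_. b"])
      show "(\<lambda>x. integral\<^sup>L (kappa x) h) \<in> borel_measurable \<mu>"
        using measurable_integral_kappa_cont[OF h] by (simp add: measurable_cong_sets[OF s refl])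
      show "(\<lambda>x. birkhoff_sum T h n x / real n) \<in> borel_measurable \<mu>" for n using hm[of n] by measurable
      show "AE x in \<mu>. (\<lambda>n. birkhoff_sum T h n x / real n) \<longlonglongrightarrow> integral\<^sup>L (kappa x) h"
        using regular_AE[OF \<mu>] by (rule AE_mp) (auto intro!: AE_I2 kappa_birkhoff h)
      show "AE x in \<mu>. norm (birkhoff_sum T h n x / real n) \<le> b" for n
      proof (intro AE_I2)
        fix x
        have "\<bar>birkhoff_sum T h n x\<bar> \<le> (\<Sum>i<n. \<bar>h ((T ^^ i) x)\<bar>)" unfolding birkhoff_sum_def by (rule sum_abs)
        also have "\<dots> \<le> (\<Sum>i<n. b)" by (intro sum_mono b)
        finally show "norm (birkhoff_sum T h n x / real n) \<le> b"
          using b(1) by (cases "n = 0") (auto simp: divide_le_eq mult.commute)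
      qed
    qed simp
    moreover have "integral\<^sup>L \<mu> (\<lambda>x. birkhoff_sum T h n x / n) = integral\<^sup>L \<mu> h" if "n \<ge> 1" for n
      using integral_birkhoff_sum[OF \<mu> borel_cont[OF h] b(2), of n] that by simp
    then have "(\<lambda>n. integral\<^sup>L \<mu> (\<lambda>x. birkhoff_sum T h n x / n)) \<longlonglongrightarrow> integral\<^sup>L \<mu> h"
      by (intro tendsto_eventually) (auto simp: eventually_sequentially)
    ultimately have "integral\<^sup>L \<mu> (\<lambda>x. integral\<^sup>L (kappa x) h) = integral\<^sup>L \<mu> h" by (rule LIMSEQ_unique)
    then show "integral\<^sup>L (\<mu> \<bind> kappa) h = integral\<^sup>L \<mu> h" using bi[OF borel_cont[OF h] b(2)] by simp
  qed
  then show ?thesis using bi[OF u] by simp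
qed

text \<open>If the averages have constant limits, conditioning on an invariant set of positive
  measure leaves all test integrals unchanged. The conditional measure is then the measure itself,
  so the set has measure 1.\<close>

lemma ergodic_probI:
  assumes m: "m \<in> inv_prob T"
    and lim: "\<And>k. AE z in m. (\<lambda>n. birkhoff_sum T (f k) n z / n) \<longlonglongrightarrow> integral\<^sup>L m (f k)"
  shows "m \<in> ergodic_prob T"
proof -
  note m' = inv_prob_borel_prob[OF m]
  interpret prob_space m using m' by (simp add: borel_prob_def)
  have s: "sets m = sets borel" using m' by (simp add: borel_prob_def)
  have "measure m A = 1" if A: "A \<in> sets borel" "T -` A = A" and "measure m A \<noteq> 0" for A
  proof -
    have mA: "measure m A > 0" using that(3) measure_nonneg[of m A] by (simp add: less_le)
    have AT: "(T ^^ i) x \<in> A \<longleftrightarrow> x \<in> A" for i x using A(2) by (induction i) auto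
    have "integral\<^sup>L (uniform_measure m A) (f k) = integral\<^sup>L m (f k)" for k
    proof -
      let ?u = "\<lambda>x. indicator A x * f k x"
      have um: "?u \<in> borel_measurable borel" using A(1) borel_cont[OF cont_f] by measurable
      have ub: "\<bar>?u x\<bar> \<le> 1" for x using f_range[of k x] by (auto simp: indicator_def)
      have bu: "birkhoff_sum T ?u n x = indicator A x * birkhoff_sum T (f k) n x" for n x
        by (simp add: birkhoff_sum_def AT sum_distrib_left indicator_def)
      have "(\<lambda>n. integral\<^sup>L m (\<lambda>x. indicator A x * (birkhoff_sum T (f k) n x / n))) \<longlonglongrightarrow> integral\<^sup>L m (\<lambda>x. indicator A x * integral\<^sup>L m (f k))"
      proof (rule integral_dominated_convergence[where w="\<lambda>_. 1"])
        show "(\<lambda>x. indicator A x * integral\<^sup>L m (f k)) \<in> borel_measurable m" using A(1) s by (intro borel_measurable_times) auto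
        show "(\<lambda>x. indicator A x * (birkhoff_sum T (f k) n x / real n)) \<in> borel_measurable m" for n
          unfolding measurable_cong_sets[OF s refl]
          using A(1) measurable_birkhoff_sum[OF borel_cont[OF cont_f], of k n] by measurable
        show "AE x in m. (\<lambda>n. indicator A x * (birkhoff_sum T (f k) n x / n)) \<longlonglongrightarrow> indicator A x * integral\<^sup>L m (f k)"
          using lim[of k] by (rule AE_mp) (intro AE_I2 impI tendsto_mult tendsto_const)
        show "AE x in m. norm (indicator A x * (birkhoff_sum T (f k) n x / real n)) \<le> 1" for n
        proof (intro AE_I2)
          fix x
          have "0 \<le> birkhoff_sum T (f k) n x" by (simp add: birkhoff_sum_def sum_nonneg f_range)
          moreover have "birkhoff_sum T (f k) n x \<le> (\<Sum>i<n. 1)" unfolding birkhoff_sum_def by (intro sum_mono f_range)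
          ultimately show "norm (indicator A x * (birkhoff_sum T (f k) n x / real n)) \<le> 1"
            by (cases "n = 0") (auto simp: indicator_def divide_le_eq)
        qed
      qed simp
      moreover have "integral\<^sup>L m (\<lambda>x. indicator A x * (birkhoff_sum T (f k) n x / n)) = integral\<^sup>L m ?u" if "n \<ge> 1" for n
        using integral_birkhoff_sum[OF m um ub, of n] that unfolding bu[abs_def] by simp
      then have "(\<lambda>n. integral\<^sup>L m (\<lambda>x. indicator A x * (birkhoff_sum T (f k) n x / n))) \<longlonglongrightarrow> integral\<^sup>L m ?u"
        by (intro tendsto_eventually) (auto simp: eventually_sequentially)
      ultimately have "integral\<^sup>L m (\<lambda>x. indicator A x * integral\<^sup>L m (f k)) = integral\<^sup>L m ?u" by (rule LIMSEQ_unique)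
      moreover have "integral\<^sup>L m (\<lambda>x. indicator A x * integral\<^sup>L m (f k)) = measure m A * integral\<^sup>L m (f k)"
        by (simp add: borel_prob_space[OF m'])
      ultimately show ?thesis using mA integral_cond[OF m' A(1) mA borel_cont[OF cont_f[of k]]] by simp
    qed
    then have "uniform_measure m A = m" by (rule borel_prob_eqI_f[OF cond_borel_prob[OF m' A(1) mA] m'])
    then show ?thesis using measure_cond_self[OF m' A(1) mA] by simp
  qed
  then show ?thesis using m unfolding ergodic_prob_def by blast
qed

text \<open>Variance argument. Disintegration of \<open>kappa x\<close> itself shows that
  \<open>F k\<close> has mean \<open>F k x\<close> under \<open>kappa x\<close>; disintegration of
  \<nu> shows that the variance \<open>V\<close> has integral zero. So for almost every
  \<open>x\<close> the limit \<open>F k\<close> of the averages is constant almost everywhere under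
  \<open>kappa x\<close>, for all \<open>k\<close> at once.\<close>

theorem kappa_ergodic:
  assumes \<nu>: "\<nu> \<in> inv_prob T"
  shows "AE x in \<nu>. kappa x \<in> ergodic_prob T"
proof -
  note \<nu>' = inv_prob_borel_prob[OF \<nu>]
  have s: "sets \<nu> = sets borel" using \<nu>' by (simp add: borel_prob_def)
  define F where "F k x = integral\<^sup>L (kappa x) (f k)" for k x
  have Fm: "F k \<in> borel_measurable borel" for k
    unfolding F_def[abs_def] by (rule measurable_integral_kappa_cont[OF cont_f])
  have Fb: "0 \<le> F k x" "F k x \<le> 1" for k x
    unfolding F_def by (rule integral_f_range[OF kappa_borel_prob])+
  have F2m: "(\<lambda>z. (F k z)\<^sup>2) \<in> borel_measurable borel" for k using Fm[of k] by measurable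
  have F2b: "\<bar>(F k z)\<^sup>2\<bar> \<le> 1" for k z using Fb[of k z] by (simp add: power_le_one)
  have fb: "\<bar>f k x\<bar> \<le> 1" "\<bar>F k x\<bar> \<le> 1" for k x using f_range[of k x] Fb[of k x] by auto
  have const: "AE x in \<nu>. AE z in kappa x. F k z = F k x" for k
  proof -
    define V where "V x = integral\<^sup>L (kappa x) (\<lambda>z. (F k z)\<^sup>2) - (F k x)\<^sup>2" for x
    have sq: "integral\<^sup>L (kappa x) (\<lambda>z. (F k z - F k x)\<^sup>2) = V x"
      and isq: "integrable (kappa x) (\<lambda>z. (F k z - F k x)\<^sup>2)" if x: "x \<in> regular" for x
    proof -
      have i1: "integrable (kappa x) (F k)" "integrable (kappa x) (\<lambda>z. (F k z)\<^sup>2)" "integrable (kappa x) (\<lambda>z. (F k x)\<^sup>2)"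
        using F2b F2m Fm fb by (auto intro!: integrable_bounded[OF kappa_borel_prob, where B=1])
      have e: "(F k z - F k x)\<^sup>2 = (F k z)\<^sup>2 - 2 * F k x * F k z + (F k x)\<^sup>2" for z
        by (simp add: power2_diff algebra_simps)
      show "integrable (kappa x) (\<lambda>z. (F k z - F k x)\<^sup>2)" unfolding e using i1 by auto
      have "integral\<^sup>L (kappa x) (F k) = F k x"
        using kappa_disintegration[OF kappa_inv_prob[OF x] borel_cont[OF cont_f[of k]] fb(1)] by (simp add: F_def[abs_def])
      then have "integral\<^sup>L (kappa x) (\<lambda>z. (F k z)\<^sup>2 - 2 * F k x * F k z + (F k x)\<^sup>2)
          = integral\<^sup>L (kappa x) (\<lambda>z. (F k z)\<^sup>2) - 2 * F k x * F k x + (F k x)\<^sup>2"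
        using i1 integral_const_prob[OF kappa_borel_prob[of x]] by simp
      then show "integral\<^sup>L (kappa x) (\<lambda>z. (F k z - F k x)\<^sup>2) = V x"
        unfolding e V_def by (simp add: power2_eq_square)
    qed
    have Vm: "(\<lambda>x. integral\<^sup>L (kappa x) (\<lambda>z. (F k z)\<^sup>2)) \<in> borel_measurable borel"
      by (rule measurable_integral_kappa[OF F2m])
    have i2: "integrable \<nu> (\<lambda>x. integral\<^sup>L (kappa x) (\<lambda>z. (F k z)\<^sup>2))" "integrable \<nu> (\<lambda>x. (F k x)\<^sup>2)"
      using F2b F2m Vm by (auto intro!: integrable_bounded[OF \<nu>', where B=1] abs_integral_le[OF kappa_borel_prob])
    have iV: "integrable \<nu> V" unfolding V_def[abs_def] using i2 by auto
    have "integral\<^sup>L \<nu> V = 0"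
      unfolding V_def[abs_def] using i2 kappa_disintegration[OF \<nu> F2m F2b] by simp
    moreover have "AE x in \<nu>. 0 \<le> V x"
      using regular_AE[OF \<nu>]
      by (rule AE_mp) (auto intro!: AE_I2 integral_nonneg_AE simp flip: sq)
    ultimately have "AE x in \<nu>. V x = 0" using integral_nonneg_eq_0_iff_AE[OF iV] by blast
    with regular_AE[OF \<nu>] show ?thesis
    proof (eventually_elim)
      fix x assume x: "x \<in> regular" "V x = 0"
      then have "AE z in kappa x. (F k z - F k x)\<^sup>2 = 0"
        using integral_nonneg_eq_0_iff_AE[OF isq[OF x(1)]] sq[OF x(1)] by auto
      then show "AE z in kappa x. F k z = F k x" by eventually_elim simp
    qed
  qed
  then have "AE x in \<nu>. \<forall>k. AE z in kappa x. F k z = F k x" by (simp add: AE_all_countable)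
  with regular_AE[OF \<nu>] show ?thesis
  proof eventually_elim
    fix x assume x: "x \<in> regular" "\<forall>k. AE z in kappa x. F k z = F k x"
    show "kappa x \<in> ergodic_prob T"
    proof (rule ergodic_probI[OF kappa_inv_prob[OF x(1)]])
      fix k
      have "AE z in kappa x. F k z = F k x" using x(2) by simp
      with regular_AE[OF kappa_inv_prob[OF x(1)]]
      show "AE z in kappa x. (\<lambda>n. birkhoff_sum T (f k) n z / n) \<longlonglongrightarrow> integral\<^sup>L (kappa x) (f k)"
      proof eventually_elim
        fix z assume z: "z \<in> regular" "F k z = F k x"
        show "(\<lambda>n. birkhoff_sum T (f k) n z / n) \<longlonglongrightarrow> integral\<^sup>L (kappa x) (f k)"
          using kappa_birkhoff[OF z(1) cont_f[of k]] z(2) by (simp add: F_def)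
      qed
    qed
  qed
qed

subsection \<open>Entropy along the ergodic decomposition\<close>

lemma measurable_ent_kappa:
  assumes "labelling X" shows "(\<lambda>x. ent (kappa x) X) \<in> borel_measurable borel"
proof -
  have [measurable]: "(\<lambda>x. measure (kappa x) (X -` {v})) \<in> borel_measurable borel" for v
    using assms by (intro measurable_measure_kappa) (simp add: labelling_def)
  show ?thesis unfolding ent_def eta_def by measurable
qed

lemma ent_bounds:
  assumes "\<mu> \<in> borel_prob" "labelling X" shows "\<bar>ent \<mu> X\<bar> \<le> ln (card (range X))"
  using ent_le_ln_card[OF assms] ent_nonneg[OF assms(1), of X] by simp

lemma label_entropy_mix:
  assumes "finite I" "I \<noteq> {}" "\<And>i. i \<in> I \<Longrightarrow> 0 \<le> a i" "(\<Sum>i\<in>I. a i) = 1" "\<And>i. i \<in> I \<Longrightarrow> \<mu>s i \<in> inv_prob T"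
    and \<mu>: "\<mu> \<in> inv_prob T" and c: "labelling c"
    and mix: "\<And>A. A \<in> sets borel \<Longrightarrow> measure \<mu> A = (\<Sum>i\<in>I. a i * measure (\<mu>s i) A)"
  shows "label_entropy T \<mu> c \<le> (\<Sum>i\<in>I. a i * label_entropy T (\<mu>s i) c)"
proof (rule LIMSEQ_le)
  show "(\<lambda>n. ent \<mu> (word T c n) / n) \<longlonglongrightarrow> label_entropy T \<mu> c" by (rule label_entropy_lim[OF \<mu> c])
  have "(\<lambda>n. (\<Sum>i\<in>I. a i * (ent (\<mu>s i) (word T c n) / n)) + ln (card I) / real n) \<longlonglongrightarrow> (\<Sum>i\<in>I. a i * label_entropy T (\<mu>s i) c) + 0"
    by (intro tendsto_add tendsto_sum tendsto_mult tendsto_const label_entropy_lim(1) assms c lim_const_over_n)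
  then show "(\<lambda>n. (\<Sum>i\<in>I. a i * (ent (\<mu>s i) (word T c n) / n)) + ln (card I) / real n) \<longlonglongrightarrow> (\<Sum>i\<in>I. a i * label_entropy T (\<mu>s i) c)"
    by simp
  have "ent \<mu> (word T c n) / n \<le> (\<Sum>i\<in>I. a i * (ent (\<mu>s i) (word T c n) / n)) + ln (card I) / real n" for n
  proof -
    have "ent \<mu> (word T c n) \<le> (\<Sum>i\<in>I. a i * ent (\<mu>s i) (word T c n)) + ln (card I)"
    proof (rule ent_mix_upper[OF assms(1-4) inv_prob_borel_prob[OF assms(5)] labelling_word[OF c]])
      show "measure \<mu> (word T c n -` {v}) = (\<Sum>i\<in>I. a i * measure (\<mu>s i) (word T c n -` {v}))" for v
        using labelling_word[OF c, of n] by (intro mix) (simp add: labelling_def)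
    qed
    then have "ent \<mu> (word T c n) / n \<le> ((\<Sum>i\<in>I. a i * ent (\<mu>s i) (word T c n)) + ln (card I)) / n"
      by (rule divide_right_mono) simp
    then show ?thesis by (simp add: add_divide_distrib sum_divide_distrib)
  qed
  then show "\<exists>N. \<forall>n\<ge>N. ent \<mu> (word T c n) / n \<le> (\<Sum>i\<in>I. a i * (ent (\<mu>s i) (word T c n) / n)) + ln (card I) / real n" by blast
qed

lemma integral_AE_close:
  assumes "\<mu> \<in> borel_prob" "u \<in> borel_measurable borel" "\<And>x. \<bar>u x\<bar> \<le> (B::real)" "AE x in \<mu>. \<bar>u x - c\<bar> \<le> s"
  shows "\<bar>integral\<^sup>L \<mu> u - c\<bar> \<le> s"
proof -
  have i: "integrable \<mu> u" by (rule integrable_bounded[OF assms(1-3)])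
  have k: "integrable \<mu> (\<lambda>x. k)" for k :: real by (rule integrable_bounded[OF assms(1), where B="\<bar>k\<bar>"]) auto
  have "integral\<^sup>L \<mu> u - c = integral\<^sup>L \<mu> (\<lambda>x. u x - c)" using i k integral_const_prob[OF assms(1), of c] by simp
  also have "\<bar>\<dots>\<bar> \<le> integral\<^sup>L \<mu> (\<lambda>x. \<bar>u x - c\<bar>)" by (rule integral_abs_bound)
  also have "\<dots> \<le> integral\<^sup>L \<mu> (\<lambda>x. s)" using i k assms(4) by (intro integral_mono_AE integrable_abs Bochner_Integration.integrable_diff)
  also have "\<dots> = s" by (rule integral_const_prob[OF assms(1)])
  finally show ?thesis .
qed

text \<open>Entropy is concave, so for a continuous mixture the comparison with the mean goes the
  wrong way. It is repaired by finitely many invariant cells on which the word distribution under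
  \<open>kappa x\<close> is almost constant: across the cells \<open>label_entropy_mix\<close> loses
  nothing, and inside a cell uniform continuity of \<open>eta\<close> costs at most
  \<open>e\<close>.\<close>

lemma label_entropy_le_integral_ent:
  assumes \<mu>: "\<mu> \<in> inv_prob T" and c: "labelling c" and q: "q \<ge> 1"
  shows "label_entropy T \<mu> c \<le> integral\<^sup>L \<mu> (\<lambda>x. ent (kappa x) (word T c q)) / q"
proof (rule field_le_epsilon)
  fix e :: real assume e: "e > 0"
  note \<mu>' = inv_prob_borel_prob[OF \<mu>]
  let ?X = "word T c q"
  define W where "W = range ?X"
  note X = labelling_word[OF c, of q]
  have fW: "finite W" "W \<noteq> {}" using labelling_finite[OF X] by (auto simp: W_def)
  have Xv: "?X -` {w} \<in> sets borel" for w using X by (simp add: labelling_def)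
  have "uniformly_continuous_on {0..1} eta"
    by (intro compact_uniformly_continuous continuous_on_subset[OF continuous_eta]) auto
  moreover have "e / card W > 0" using e fW by (simp add: card_gt_0_iff)
  ultimately obtain d where d: "d > 0" "\<And>p p'. p \<in> {0..1} \<Longrightarrow> p' \<in> {0..1} \<Longrightarrow> dist p' p < d \<Longrightarrow> dist (eta p') (eta p) < e / card W"
    unfolding uniformly_continuous_on_def by metis
  let ?u = "\<lambda>w x. measure (kappa x) (?X -` {w})"
  have um: "?u w \<in> borel_measurable borel" for w by (rule measurable_measure_kappa[OF Xv])
  have ub: "\<bar>?u w x\<bar> \<le> 1" for w x using measure_le_1[OF kappa_borel_prob] by simp
  have d2: "d / 2 > 0" using d by simp
  define Y where "Y = (\<lambda>x w. if w \<in> W then \<lfloor>?u w x / (d / 2)\<rfloor> else 0)"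
  have Y: "labelling Y" "\<And>x y w. Y x = Y y \<Longrightarrow> w \<in> W \<Longrightarrow> \<bar>?u w x - ?u w y\<bar> \<le> d / 2"
    using floor_labelling[OF fW(1), of ?u 1 "d/2", OF um ub d2] unfolding Y_def by blast+
  \<comment> \<open>Makes the cells invariant, and with them the conditional measures, as
    \<open>label_entropy_mix\<close> demands.\<close>
  have YT: "Y (T x) = Y x" for x unfolding Y_def kappa_T by (rule refl)
  define I where "I = {v \<in> range Y. measure \<mu> (Y -` {v}) > 0}"
  define a where "a v = measure \<mu> (Y -` {v})" for v
  define \<mu>s where "\<mu>s v = uniform_measure \<mu> (Y -` {v})" for v
  note cd = cell_decomposition[OF \<mu>' Y(1), folded I_def a_def \<mu>s_def]
  have Yb: "Y -` {v} \<in> sets borel" for v using Y(1) by (simp add: labelling_def)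
  have apos: "a v > 0" if "v \<in> I" for v using that by (simp add: I_def a_def)
  have inv: "\<mu>s v \<in> inv_prob T" if "v \<in> I" for v
    unfolding \<mu>s_def using that YT by (intro cond_inv_prob[OF \<mu> Yb]) (auto simp: I_def)
  have mix: "measure \<mu> A = (\<Sum>v\<in>I. a v * measure (\<mu>s v) A)" if A: "A \<in> sets borel" for A
  proof -
    have "measure \<mu> A = integral\<^sup>L \<mu> (indicator A)" by (simp add: borel_prob_space[OF \<mu>'])
    also have "\<dots> = (\<Sum>v\<in>I. a v * integral\<^sup>L (\<mu>s v) (indicator A))"
      by (rule cd(4)[where B=1]) (use A in \<open>auto simp: indicator_def\<close>)
    also have "\<dots> = (\<Sum>v\<in>I. a v * measure (\<mu>s v) A)"
      using borel_prob_space[OF inv_prob_borel_prob[OF inv]] by (intro sum.cong) auto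
    finally show ?thesis .
  qed
  have em: "(\<lambda>x. ent (kappa x) ?X) \<in> borel_measurable borel" by (rule measurable_ent_kappa[OF X])
  have eb: "\<bar>ent (kappa x) ?X\<bar> \<le> ln (card W)" for x using ent_bounds[OF kappa_borel_prob X] by (simp add: W_def)
  have cell: "ent (\<mu>s v) ?X / q \<le> (integral\<^sup>L (\<mu>s v) (\<lambda>x. ent (kappa x) ?X) + e) / q" if v: "v \<in> I" for v
  proof -
    note i = inv[OF v] and b = inv_prob_borel_prob[OF inv[OF v]]
    have AE: "AE x in \<mu>s v. Y x = v"
      using AE_cond[OF \<mu>' Yb[of v], of "\<lambda>_. True"] v unfolding \<mu>s_def I_def by auto
    \<comment> \<open>By disintegration a word probability under the conditional measure is the mean
      of those under \<open>kappa\<close>, which differ by at most \<open>d / 2\<close> within the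
      cell.\<close>
    have close: "\<bar>measure (\<mu>s v) (?X -` {w}) - ?u w x\<bar> \<le> d / 2" if x: "Y x = v" and w: "w \<in> W" for x w
    proof -
      have "integral\<^sup>L (\<mu>s v) (\<lambda>z. integral\<^sup>L (kappa z) (indicator (?X -` {w}))) = integral\<^sup>L (\<mu>s v) (indicator (?X -` {w}) :: 'a \<Rightarrow> real)"
        by (rule kappa_disintegration[OF i, where B=1]) (use Xv in \<open>auto simp: indicator_def\<close>)
      then have "measure (\<mu>s v) (?X -` {w}) = integral\<^sup>L (\<mu>s v) (?u w)"
        by (simp add: borel_prob_space[OF b] borel_prob_space[OF kappa_borel_prob])
      moreover have "\<bar>integral\<^sup>L (\<mu>s v) (?u w) - ?u w x\<bar> \<le> d / 2"
      proof (rule integral_AE_close[OF b um ub])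
        show "AE z in \<mu>s v. \<bar>?u w z - ?u w x\<bar> \<le> d / 2"
          using AE by eventually_elim (rule Y(2)[OF _ w], use x in simp)
      qed
      ultimately show ?thesis by simp
    qed
    have "ent (\<mu>s v) ?X \<le> ent (kappa x) ?X + e" if x: "Y x = v" for x
    proof -
      have "ent (\<mu>s v) ?X \<le> (\<Sum>w\<in>W. eta (?u w x) + e / card W)"
        unfolding ent_def W_def[symmetric]
      proof (rule sum_mono)
        fix w assume w: "w \<in> W"
        have "dist (measure (\<mu>s v) (?X -` {w})) (?u w x) < d" using close[OF x w] d(1) by (simp add: dist_real_def)
        from d(2)[OF _ _ this] have "dist (eta (measure (\<mu>s v) (?X -` {w}))) (eta (?u w x)) < e / card W"
          using measure_le_1[OF b] measure_le_1[OF kappa_borel_prob] by simp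
        then show "eta (measure (\<mu>s v) (?X -` {w})) \<le> eta (?u w x) + e / card W" unfolding dist_real_def by linarith
      qed
      also have "\<dots> = ent (kappa x) ?X + e" using fW by (simp add: sum.distrib ent_def W_def[symmetric])
      finally show ?thesis .
    qed
    then have "AE x in \<mu>s v. ent (\<mu>s v) ?X \<le> ent (kappa x) ?X + e" using AE by (auto elim: eventually_mono)
    moreover have ie: "integrable (\<mu>s v) (\<lambda>x. ent (kappa x) ?X)" by (rule integrable_bounded[OF b em eb])
    moreover have k: "integrable (\<mu>s v) (\<lambda>x. k)" for k :: real by (rule integrable_bounded[OF b, where B="\<bar>k\<bar>"]) auto
    ultimately have "integral\<^sup>L (\<mu>s v) (\<lambda>x. ent (\<mu>s v) ?X) \<le> integral\<^sup>L (\<mu>s v) (\<lambda>x. ent (kappa x) ?X + e)"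
      by (intro integral_mono_AE Bochner_Integration.integrable_add)
    also have "\<dots> = integral\<^sup>L (\<mu>s v) (\<lambda>x. ent (kappa x) ?X) + e" using ie k integral_const_prob[OF b, of e] by simp
    finally show ?thesis unfolding integral_const_prob[OF b] by (rule divide_right_mono) simp
  qed
  have "label_entropy T \<mu> c \<le> (\<Sum>v\<in>I. a v * label_entropy T (\<mu>s v) c)"
    using cd(1-3) apos inv mix by (intro label_entropy_mix \<mu> c) (auto intro: less_imp_le)
  also have "\<dots> \<le> (\<Sum>v\<in>I. a v * (ent (\<mu>s v) ?X / q))"
    using apos label_entropy_lim(2)[OF inv c q] by (intro sum_mono mult_left_mono) (auto intro: less_imp_le)
  also have "\<dots> \<le> (\<Sum>v\<in>I. a v * ((integral\<^sup>L (\<mu>s v) (\<lambda>x. ent (kappa x) ?X) + e) / q))"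
    using apos cell by (intro sum_mono mult_left_mono) (auto intro: less_imp_le)
  also have "\<dots> = ((\<Sum>v\<in>I. a v * integral\<^sup>L (\<mu>s v) (\<lambda>x. ent (kappa x) ?X)) + (\<Sum>v\<in>I. a v) * e) / q"
    by (simp add: sum_divide_distrib sum_distrib_right sum.distrib[symmetric] distrib_left)
  also have "\<dots> = (integral\<^sup>L \<mu> (\<lambda>x. ent (kappa x) ?X) + e) / q"
    unfolding cd(4)[OF em eb, symmetric] cd(2) by simp
  also have "\<dots> \<le> integral\<^sup>L \<mu> (\<lambda>x. ent (kappa x) ?X) / q + e"
  proof -
    have "e / q \<le> e" using q e by (simp add: divide_le_eq)
    then show ?thesis by (simp add: add_divide_distrib)
  qed
  finally show "label_entropy T \<mu> c \<le> integral\<^sup>L \<mu> (\<lambda>x. ent (kappa x) (word T c q)) / q + e" .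
qed

lemma ent_word_quotient_bound:
  assumes "\<mu> \<in> borel_prob" "labelling c"
  shows "\<bar>ent \<mu> (word T c q) / q\<bar> \<le> ln (card (range c))"
proof -
  have "card (range c) \<ge> 1" using labelling_finite[OF assms(2)] by (simp add: Suc_leI card_gt_0_iff)
  then have l: "0 \<le> ln (card (range c))" by simp
  show ?thesis
    using ent_word_le[OF assms, of q 0] ent_nonneg[OF assms(1), of "word T c q"] l
    by (cases "q = 0") (auto simp: divide_le_eq mult.commute)
qed

text \<open>For the last claim \<open>q\<close> tends to infinity in
  \<open>label_entropy_le_integral_ent\<close>; the quotients are bounded by the logarithm of the
  number of labels. It is the half of the affinity of entropy that lets ergodic components take over
  the entropy of the mixture.\<close>

lemma label_entropy_kappa:
  assumes \<mu>: "\<mu> \<in> inv_prob T" and c: "labelling c"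
  shows measurable_label_entropy_kappa: "(\<lambda>x. label_entropy T (kappa x) c) \<in> borel_measurable borel"
    and label_entropy_kappa_bound: "x \<in> regular \<Longrightarrow> \<bar>label_entropy T (kappa x) c\<bar> \<le> ln (card (range c))"
    and label_entropy_le_integral: "label_entropy T \<mu> c \<le> integral\<^sup>L \<mu> (\<lambda>x. label_entropy T (kappa x) c)"
proof -
  note \<mu>' = inv_prob_borel_prob[OF \<mu>]
  have s: "sets \<mu> = sets borel" using \<mu>' by (simp add: borel_prob_def)
  have em: "(\<lambda>x. ent (kappa x) (word T c q) / q) \<in> borel_measurable borel" for q
    using measurable_ent_kappa[OF labelling_word[OF c, of q]] by measurable
  show m: "(\<lambda>x. label_entropy T (kappa x) c) \<in> borel_measurable borel"
    unfolding label_entropy_def by (rule borel_measurable_lim_metric[OF em])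
  show "\<bar>label_entropy T (kappa x) c\<bar> \<le> ln (card (range c))" if "x \<in> regular"
    by (rule LIMSEQ_le_const2[OF tendsto_rabs[OF label_entropy_lim(1)[OF kappa_inv_prob[OF that] c]]])
      (use ent_word_quotient_bound[OF kappa_borel_prob c] in blast)
  have "(\<lambda>q. integral\<^sup>L \<mu> (\<lambda>x. ent (kappa x) (word T c q) / q)) \<longlonglongrightarrow> integral\<^sup>L \<mu> (\<lambda>x. label_entropy T (kappa x) c)"
  proof (rule integral_dominated_convergence[where w="\<lambda>_. ln (card (range c))"])
    show "(\<lambda>x. label_entropy T (kappa x) c) \<in> borel_measurable \<mu>" using m by (simp only: measurable_cong_sets[OF s refl])
    show "(\<lambda>x. ent (kappa x) (word T c q) / q) \<in> borel_measurable \<mu>" for q using em[of q] by (simp only: measurable_cong_sets[OF s refl])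
    show "integrable \<mu> (\<lambda>_. ln (card (range c)))" by (rule integrable_bounded[OF \<mu>', where B="\<bar>ln (card (range c))\<bar>"]) auto
    show "AE x in \<mu>. (\<lambda>q. ent (kappa x) (word T c q) / q) \<longlonglongrightarrow> label_entropy T (kappa x) c"
      using regular_AE[OF \<mu>] by (rule AE_mp) (intro AE_I2 impI label_entropy_lim kappa_inv_prob c)
    show "AE x in \<mu>. norm (ent (kappa x) (word T c q) / q) \<le> ln (card (range c))" for q
      unfolding real_norm_def by (intro AE_I2 ent_word_quotient_bound[OF kappa_borel_prob c])
  qed
  then show "label_entropy T \<mu> c \<le> integral\<^sup>L \<mu> (\<lambda>x. label_entropy T (kappa x) c)"
  proof (rule LIMSEQ_le_const)
    show "\<exists>N. \<forall>n\<ge>N. label_entropy T \<mu> c \<le> integral\<^sup>L \<mu> (\<lambda>x. ent (kappa x) (word T c n) / n)"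
      using label_entropy_le_integral_ent[OF \<mu> c] by (intro exI[of _ 1]) simp
  qed
qed

text \<open>On each cell where the test integrals of \<open>kappa x\<close> vary by at most
  \<open>z\<close>, some point has an ergodic \<open>kappa\<close> with entropy at least the mean
  over the cell, because a function cannot lie strictly below its mean almost everywhere. One such
  component per cell, weighted by the cell, loses no entropy.\<close>

theorem ergodic_approximation:
  assumes \<mu>: "\<mu> \<in> inv_prob T" and c: "labelling c"
    and H: "finite H" "\<And>h. h \<in> H \<Longrightarrow> continuous_on UNIV (h :: 'a \<Rightarrow> real)" and z: "z > 0"
  obtains I :: "(('a \<Rightarrow> real) \<Rightarrow> int) set" and a \<nu> where
    "finite I" "I \<noteq> {}" "\<And>i. i \<in> I \<Longrightarrow> a i > 0" "(\<Sum>i\<in>I. a i) = 1" "\<And>i. i \<in> I \<Longrightarrow> \<nu> i \<in> ergodic_prob T"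
    "\<And>h. h \<in> H \<Longrightarrow> \<bar>(\<Sum>i\<in>I. a i * integral\<^sup>L (\<nu> i) h) - integral\<^sup>L \<mu> h\<bar> \<le> z"
    "label_entropy T \<mu> c \<le> (\<Sum>i\<in>I. a i * label_entropy T (\<nu> i) c)"
proof -
  note \<mu>' = inv_prob_borel_prob[OF \<mu>]
  have "\<forall>h. \<exists>B. h \<in> H \<longrightarrow> B > 0 \<and> (\<forall>x. \<bar>h x\<bar> \<le> B)" using bounded_cont H(2) by metis
  then obtain Bf where Bf: "\<And>h. h \<in> H \<Longrightarrow> Bf h > 0" "\<And>h x. h \<in> H \<Longrightarrow> \<bar>h x\<bar> \<le> Bf h" by metis
  define B where "B = (\<Sum>h\<in>H. Bf h)"
  have hB: "\<bar>h x\<bar> \<le> B" if "h \<in> H" for h x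
    using Bf(2)[OF that, of x] member_le_sum[OF that, of Bf] Bf(1) H(1) unfolding B_def by (force intro: less_imp_le)
  let ?u = "\<lambda>h x. integral\<^sup>L (kappa x) h"
  have um: "?u h \<in> borel_measurable borel" if "h \<in> H" for h by (rule measurable_integral_kappa_cont[OF H(2)[OF that]])
  have ub: "\<bar>?u h x\<bar> \<le> B" if "h \<in> H" for h x
    using abs_integral_le[OF kappa_borel_prob borel_cont[OF H(2)[OF that]] hB[OF that]] .
  define Y where "Y = (\<lambda>x h. if h \<in> H then \<lfloor>?u h x / z\<rfloor> else 0)"
  have Y: "labelling Y" "\<And>x y h. Y x = Y y \<Longrightarrow> h \<in> H \<Longrightarrow> \<bar>?u h x - ?u h y\<bar> \<le> z"
    using floor_labelling[OF H(1), of ?u B z, OF um ub z] unfolding Y_def by blast+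
  define I where "I = {v \<in> range Y. measure \<mu> (Y -` {v}) > 0}"
  define a where "a v = measure \<mu> (Y -` {v})" for v
  define \<mu>s where "\<mu>s v = uniform_measure \<mu> (Y -` {v})" for v
  note cd = cell_decomposition[OF \<mu>' Y(1), folded I_def a_def \<mu>s_def]
  have Yb: "Y -` {v} \<in> sets borel" for v using Y(1) by (simp add: labelling_def)
  have apos: "a v > 0" if "v \<in> I" for v using that by (simp add: I_def a_def)
  \<comment> \<open>Off \<open>regular\<close> the limit that defines the entropy is not controlled;
    the value 0 makes the function bounded everywhere.\<close>
  define E where "E x = (if x \<in> regular then label_entropy T (kappa x) c else 0)" for x
  have Em: "E \<in> borel_measurable borel"
    unfolding E_def[abs_def] using regular_borel measurable_label_entropy_kappa[OF \<mu> c] by (intro measurable_If_set) auto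
  have "card (range c) \<ge> 1" using labelling_finite[OF c] by (simp add: Suc_leI card_gt_0_iff)
  then have Eb: "\<bar>E x\<bar> \<le> ln (card (range c))" for x using label_entropy_kappa_bound[OF \<mu> c, of x] by (simp add: E_def)
  have EE: "integral\<^sup>L \<mu> (\<lambda>x. label_entropy T (kappa x) c) = integral\<^sup>L \<mu> E"
  proof (rule integral_cong_AE)
    have s: "sets \<mu> = sets borel" using \<mu>' by (simp add: borel_prob_def)
    show "(\<lambda>x. label_entropy T (kappa x) c) \<in> borel_measurable \<mu>" "E \<in> borel_measurable \<mu>"
      using Em measurable_label_entropy_kappa[OF \<mu> c] by (simp_all only: measurable_cong_sets[OF s refl])
    show "AE x in \<mu>. label_entropy T (kappa x) c = E x"
      using regular_AE[OF \<mu>] by eventually_elim (simp add: E_def)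
  qed
  have ex: "\<exists>x. Y x = v \<and> x \<in> regular \<and> kappa x \<in> ergodic_prob T \<and> integral\<^sup>L (\<mu>s v) E \<le> E x" if v: "v \<in> I" for v
  proof (rule ccontr)
    assume no: "\<not> ?thesis"
    have b: "\<mu>s v \<in> borel_prob" unfolding \<mu>s_def using v by (intro cond_borel_prob[OF \<mu>' Yb]) (simp add: I_def)
    then interpret prob_space "\<mu>s v" by (simp add: borel_prob_def)
    have "AE x in \<mu>. x \<in> regular \<and> kappa x \<in> ergodic_prob T" using regular_AE[OF \<mu>] kappa_ergodic[OF \<mu>] by auto
    then have "AE x in \<mu>s v. x \<in> Y -` {v} \<and> x \<in> regular \<and> kappa x \<in> ergodic_prob T"
      unfolding \<mu>s_def using v by (intro AE_cond[OF \<mu>' Yb]) (auto simp: I_def)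
    then have "AE x in \<mu>s v. E x < integral\<^sup>L (\<mu>s v) E" by eventually_elim (use no in force)
    then have "integral\<^sup>L (\<mu>s v) E < integral\<^sup>L (\<mu>s v) E"
      by (rule expectation_less[OF integrable_bounded[OF b Em Eb]])
    then show False by simp
  qed
  then obtain xs where xs: "\<And>v. v \<in> I \<Longrightarrow> Y (xs v) = v \<and> xs v \<in> regular \<and> kappa (xs v) \<in> ergodic_prob T \<and> integral\<^sup>L (\<mu>s v) E \<le> E (xs v)"
    by metis
  show ?thesis
  proof (rule that[of I a "\<lambda>v. kappa (xs v)"])
    show "finite I" "I \<noteq> {}" "(\<Sum>i\<in>I. a i) = 1" by (fact cd)+
    show "a v > 0" if "v \<in> I" for v by (rule apos[OF that])
    show "kappa (xs v) \<in> ergodic_prob T" if "v \<in> I" for v using xs[OF that] by simp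
    show "\<bar>(\<Sum>i\<in>I. a i * integral\<^sup>L (kappa (xs i)) h) - integral\<^sup>L \<mu> h\<bar> \<le> z" if h: "h \<in> H" for h
    proof -
      have "integral\<^sup>L \<mu> h = (\<Sum>v\<in>I. a v * integral\<^sup>L (\<mu>s v) (?u h))"
        using cd(4)[OF um[OF h] ub[OF h]] kappa_disintegration[OF \<mu> borel_cont[OF H(2)[OF h]] hB[OF h]] by simp
      then have "(\<Sum>i\<in>I. a i * integral\<^sup>L (kappa (xs i)) h) - integral\<^sup>L \<mu> h = (\<Sum>v\<in>I. a v * (?u h (xs v) - integral\<^sup>L (\<mu>s v) (?u h)))"
        by (simp add: right_diff_distrib sum_subtractf)
      also have "\<bar>\<dots>\<bar> \<le> (\<Sum>v\<in>I. \<bar>a v * (?u h (xs v) - integral\<^sup>L (\<mu>s v) (?u h))\<bar>)" by (rule sum_abs)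
      also have "\<dots> \<le> (\<Sum>v\<in>I. a v * z)"
      proof (rule sum_mono)
        fix v assume v: "v \<in> I"
        have b: "\<mu>s v \<in> borel_prob" unfolding \<mu>s_def using v by (intro cond_borel_prob[OF \<mu>' Yb]) (simp add: I_def)
        have "AE x in \<mu>s v. Y x = v"
          using AE_cond[OF \<mu>' Yb[of v], of "\<lambda>_. True"] v unfolding \<mu>s_def I_def by auto
        then have "AE x in \<mu>s v. \<bar>?u h x - ?u h (xs v)\<bar> \<le> z"
          by eventually_elim (use xs[OF v] h in \<open>simp add: Y(2)\<close>)
        then have "\<bar>integral\<^sup>L (\<mu>s v) (?u h) - ?u h (xs v)\<bar> \<le> z" by (rule integral_AE_close[OF b um[OF h] ub[OF h]])
        then have "a v * \<bar>?u h (xs v) - integral\<^sup>L (\<mu>s v) (?u h)\<bar> \<le> a v * z"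
          using apos[OF v] by (intro mult_left_mono) (auto simp: abs_minus_commute)
        then show "\<bar>a v * (?u h (xs v) - integral\<^sup>L (\<mu>s v) (?u h))\<bar> \<le> a v * z" using apos[OF v] by (simp add: abs_mult)
      qed
      also have "\<dots> = z" using cd(2) by (simp add: sum_distrib_right[symmetric])
      finally show ?thesis .
    qed
    have "label_entropy T \<mu> c \<le> integral\<^sup>L \<mu> E" using label_entropy_le_integral[OF \<mu> c] EE by simp
    also have "\<dots> = (\<Sum>v\<in>I. a v * integral\<^sup>L (\<mu>s v) E)" by (rule cd(4)[OF Em Eb])
    also have "\<dots> \<le> (\<Sum>v\<in>I. a v * label_entropy T (kappa (xs v)) c)"
    proof (intro sum_mono mult_left_mono)
      fix v assume v: "v \<in> I"
      then have "E (xs v) = label_entropy T (kappa (xs v)) c" using xs by (simp add: E_def)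
      then show "integral\<^sup>L (\<mu>s v) E \<le> label_entropy T (kappa (xs v)) c" using xs[OF v] by (simp only:)
      show "0 \<le> a v" using apos[OF v] by simp
    qed
    finally show "label_entropy T \<mu> c \<le> (\<Sum>i\<in>I. a i * label_entropy T (kappa (xs i)) c)" .
  qed
qed

end

section \<open>Upper bound for the pressure\<close>

lemma (in compact_system) mean_functional_integral:
  assumes "\<mu> \<in> borel_prob"
  shows "mean_functional (\<lambda>h::'a \<Rightarrow> real. integral\<^sup>L \<mu> h)"
proof
  show "compact (UNIV :: 'a set)" by (rule cpt)
  show "integral\<^sup>L \<mu> (\<lambda>x. h x + k x) = integral\<^sup>L \<mu> h + integral\<^sup>L \<mu> k"
    if "continuous_on UNIV h" "continuous_on UNIV k" for h k :: "'a \<Rightarrow> real"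
    using integrable_cont[OF assms] that by simp
  show "integral\<^sup>L \<mu> (\<lambda>x. c * h x) = c * integral\<^sup>L \<mu> h" for h :: "'a \<Rightarrow> real" and c by simp
  show "0 \<le> integral\<^sup>L \<mu> h" if "\<And>x. 0 \<le> h x" for h :: "'a \<Rightarrow> real"
    using that by (intro integral_nonneg_AE) auto
  show "integral\<^sup>L \<mu> (\<lambda>_. 1 :: real) = 1" by (rule integral_const_prob[OF assms])
qed

text \<open>The supremum runs over partitions, so labels are replaced by their fibres. The map
  \<open>g\<close> recovers a label from its cell by picking a point there, which makes the words of
  \<open>c\<close> functions of the words of cells.\<close>

lemma label_entropy_le_metric_entropy:
  assumes "compact_system T f" "\<mu> \<in> inv_prob T" "labelling c"
  shows "ereal (label_entropy T \<mu> c) \<le> metric_entropy T \<mu>"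
proof -
  interpret compact_system T f by fact
  define P where "P = (\<lambda>v. c -` {v}) ` range c"
  have P: "partition_on UNIV P" by (rule partition_onI) (auto simp: P_def disjnt_iff)
  have fP: "finite P" "P \<subseteq> sets borel" using assms(3) by (auto simp: P_def labelling_def)
  have lab: "labelling (part_label P)" by (rule labelling_part_label[OF P fP])
  have pl: "part_label P x = c -` {c x}" for x by (rule part_label_eq[OF P]) (auto simp: P_def)
  define g where "g A = c (SOME x. x \<in> A)" for A
  have g: "g (part_label P x) = c x" for x
  proof -
    have "(SOME y. y \<in> c -` {c x}) \<in> c -` {c x}" by (rule someI[of _ x]) simp
    then show ?thesis by (simp add: g_def pl)
  qed
  have "word T c n = (\<lambda>x. map g (word T (part_label P) n x))" for n
    by (simp add: word_def g fun_eq_iff)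
  then have le: "ent \<mu> (word T c n) \<le> ent \<mu> (word T (part_label P) n)" for n
    using ent_comp_le[OF inv_prob_borel_prob[OF assms(2)] labelling_word[OF lab, of n], of "map g"] by simp
  have "label_entropy T \<mu> c \<le> label_entropy T \<mu> (part_label P)"
    by (rule LIMSEQ_le[OF label_entropy_lim(1)[OF assms(2,3)] label_entropy_lim(1)[OF assms(2) lab]])
      (intro exI[of _ 0] allI impI divide_right_mono le, simp)
  then have "ereal (label_entropy T \<mu> c) \<le> ereal (label_entropy T \<mu> (part_label P))" by simp
  also have "\<dots> \<le> metric_entropy T \<mu>"
    unfolding metric_entropy_eq using P fP by (intro SUP_upper) auto
  finally show ?thesis .
qed

section \<open>Misiurewicz's inequality for finite sets of orbit segments\<close>

definition point_average :: "'i set \<Rightarrow> ('i \<Rightarrow> 'a::topological_space) \<Rightarrow> 'a measure" where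
  "point_average I p = distr (uniform_count_measure I) borel p"

lemma point_average:
  assumes "finite I" "I \<noteq> {}"
  shows point_average_borel_prob: "point_average I p \<in> borel_prob"
    and integral_point_average: "h \<in> borel_measurable borel \<Longrightarrow>
      integral\<^sup>L (point_average I p) h = (\<Sum>i\<in>I. h (p i) :: real) / card I"
    and measure_point_average: "A \<in> sets borel \<Longrightarrow> measure (point_average I p) A = card {i \<in> I. p i \<in> A} / card I"
proof -
  show b: "point_average I p \<in> borel_prob"
    unfolding borel_prob_def point_average_def using assms
    by (auto intro!: prob_space.prob_space_distr prob_space_uniform_count_measure
        simp: measurable_def space_uniform_count_measure sets_uniform_count_measure)
  show *: "integral\<^sup>L (point_average I p) h = (\<Sum>i\<in>I. h (p i) :: real) / card I"
    if "h \<in> borel_measurable borel" for h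
  proof -
    have "integral\<^sup>L (point_average I p) h = integral\<^sup>L (uniform_count_measure I) (\<lambda>i. h (p i))"
      unfolding point_average_def using that
      by (intro integral_distr) (auto simp: measurable_def space_uniform_count_measure sets_uniform_count_measure)
    also have "\<dots> = (\<Sum>i\<in>I. h (p i)) / card I"
      unfolding uniform_count_measure_def using assms(1)
      by (subst lebesgue_integral_point_measure_finite) (auto simp: sum_divide_distrib)
    finally show ?thesis .
  qed
  show "measure (point_average I p) A = card {i \<in> I. p i \<in> A} / card I" if "A \<in> sets borel"
  proof -
    have "measure (point_average I p) A = integral\<^sup>L (point_average I p) (indicator A)"
      by (simp add: borel_prob_space[OF b])
    also have "\<dots> = (\<Sum>i\<in>I. indicator A (p i)) / card I" using that by (intro *) simp
    also have "(\<Sum>i\<in>I. indicator A (p i)) = real (card {i \<in> I. p i \<in> A})"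
      using assms(1) by (simp add: indicator_def sum.If_cases Int_def)
    finally show ?thesis .
  qed
qed

lemma sum_lessThan_split:
  fixes a :: "nat \<Rightarrow> real"
  shows "(\<Sum>k<m + n. a k) = (\<Sum>k<m. a k) + (\<Sum>k<n. a (k + m))"
proof (induction n)
  case (Suc n)
  have "m + Suc n = Suc (m + n)" by simp
  then show ?case using Suc by (simp add: add.commute[of n m])
qed simp

context compact_system
begin

lemma ent_point_average:
  assumes "finite E" "E \<noteq> {}" "labelling X"
  shows "ent (point_average E (T ^^ k)) X = ent (point_average E id) (\<lambda>x. X ((T ^^ k) x))"
proof -
  have "ent (point_average E id) (\<lambda>x. X ((T ^^ k) x)) =
      (\<Sum>v\<in>range X. eta (measure (point_average E id) ((\<lambda>x. X ((T ^^ k) x)) -` {v})))"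
    using labelling_finite[OF assms(3)] by (intro ent_eq_sum) auto
  also have "\<dots> = ent (point_average E (T ^^ k)) X"
    unfolding ent_def using labelling_iter[OF assms(3), of k] assms(3)
    by (intro sum.cong refl arg_cong[of _ _ eta])
      (simp add: measure_point_average[OF assms(1,2)] labelling_def)
  finally show ?thesis by simp
qed

text \<open>Misiurewicz's inequality. With \<open>a k\<close> the entropy of the letters from \<open>k\<close> to \<open>n\<close>, the
  relation \<open>a k \<le> p k + a (k + q)\<close> telescopes and no bookkeeping of residues mod \<open>q\<close> is needed.\<close>

lemma misiurewicz:
  assumes E: "finite E" "E \<noteq> {}" and c: "labelling c" and n: "n \<ge> 1"
    and inj: "inj_on (word T c n) E"
  shows "q * ln (card E) \<le> n * ent (point_average (E \<times> {..<n}) (\<lambda>(x, k). (T ^^ k) x)) (word T c q)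
      + (real q)\<^sup>2 * ln (card (range c))"
proof -
  \<comment> \<open>Under the uniform measure on \<open>E\<close> the word of length
    \<open>n\<close> has entropy \<open>ln (card E)\<close>, as it codes \<open>E\<close>
    injectively. The measure is not invariant, so the starting time \<open>k\<close> has to be
    kept.\<close>
  define \<sigma> where "\<sigma> = point_average E (id :: 'a \<Rightarrow> 'a)"
  have \<sigma>: "\<sigma> \<in> borel_prob" unfolding \<sigma>_def by (rule point_average_borel_prob[OF E])
  define a where "a k = ent \<sigma> (\<lambda>x. word T c (n - k) ((T ^^ k) x))" for k
  define p where "p k = ent \<sigma> (\<lambda>x. word T c q ((T ^^ k) x))" for k
  define l where "l = ln (real (card (range c)))"
  have "card (range c) \<ge> 1" using labelling_finite[OF c] by (simp add: Suc_leI card_gt_0_iff)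
  then have l0: "0 \<le> l" by (simp add: l_def)
  have a0: "a k = 0" if "k \<ge> n" for k
  proof -
    have "(\<lambda>x. word T c (n - k) ((T ^^ k) x)) = (\<lambda>x. [])" using that by (simp add: word_def fun_eq_iff)
    then show ?thesis using measure_UNIV[OF \<sigma>] by (simp add: a_def ent_def vimage_const)
  qed
  have pnn: "0 \<le> p k" for k unfolding p_def by (rule ent_nonneg[OF \<sigma>])
  have split: "ent \<sigma> (\<lambda>x. word T c (i + j) ((T ^^ k) x)) \<le>
      ent \<sigma> (\<lambda>x. word T c i ((T ^^ k) x)) + ent \<sigma> (\<lambda>x. word T c j ((T ^^ (k + i)) x))" for i j k
  proof -
    have eq: "(\<lambda>x. word T c (i + j) ((T ^^ k) x)) =
      (\<lambda>x. (\<lambda>(u, v). u @ v) (word T c i ((T ^^ k) x), word T c j ((T ^^ (k + i)) x)))"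
      by (simp add: word_add fun_eq_iff add.commute[of k i] funpow_add)
    show ?thesis
      unfolding eq
      by (rule order_trans[OF ent_comp_le[OF \<sigma> labelling_pair] ent_pair_le[OF \<sigma>]])
        (intro labelling_iter labelling_word c)+
  qed
  have step: "a k \<le> p k + a (k + q)" for k
  proof (cases "k + q \<le> n")
    case True
    then have "n - k = q + (n - (k + q))" by simp
    then show ?thesis unfolding a_def p_def using split[of q "n - (k + q)" k] by simp
  next
    case False
    then have le: "n - k \<le> q" by simp
    have eq: "(\<lambda>x. word T c (n - k) ((T ^^ k) x)) = (\<lambda>x. take (n - k) (word T c q ((T ^^ k) x)))"
      using word_add[of T c "n - k" "q - (n - k)"] le by (simp add: fun_eq_iff)
    have "a k \<le> p k" unfolding a_def p_def eq
      by (rule ent_comp_le[OF \<sigma> labelling_iter[OF labelling_word[OF c]]])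
    then show ?thesis using False by (simp add: a0)
  qed
  have "word T c n -` {v} \<in> sets borel" for v using labelling_word[OF c, of n] by (simp add: labelling_def)
  then have ms: "measure \<sigma> (word T c n -` {v}) = card {x \<in> E. word T c n x = v} / card E" for v
    unfolding \<sigma>_def by (simp add: measure_point_average[OF E])
  have aE: "a 0 = ln (card E)"
  proof -
    have cE: "card E > 0" using E by (simp add: card_gt_0_iff)
    have "a 0 = (\<Sum>v\<in>range (word T c n). eta (measure \<sigma> (word T c n -` {v})))" by (simp add: a_def ent_def)
    also have "\<dots> = (\<Sum>v\<in>word T c n ` E. eta (measure \<sigma> (word T c n -` {v})))"
    proof (intro sum.mono_neutral_right labelling_finite[OF labelling_word[OF c]] ballI)
      fix v assume "v \<in> range (word T c n) - word T c n ` E"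
      then have "word T c n x \<noteq> v" if "x \<in> E" for x using that by blast
      then have emp: "{x \<in> E. word T c n x = v} = {}" by blast
      show "eta (measure \<sigma> (word T c n -` {v})) = 0" unfolding ms emp by simp
    qed auto
    also have "\<dots> = (\<Sum>x\<in>E. eta (1 / card E))"
    proof (subst sum.reindex[OF inj], rule sum.cong[OF refl])
      fix x assume x: "x \<in> E"
      then have "{y \<in> E. word T c n y = word T c n x} = {x}" using inj by (auto simp: inj_on_def)
      then show "((\<lambda>v. eta (measure \<sigma> (word T c n -` {v}))) \<circ> word T c n) x = eta (1 / card E)" by (simp add: ms)
    qed
    also have "\<dots> = ln (card E)" using cE by (simp add: eta_def ln_div)
    finally show ?thesis .
  qed
  \<comment> \<open>Dropping the first \<open>k\<close> letters loses at most \<open>k * l\<close>.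
    Summed over \<open>k < q\<close> this is the origin of the quadratic error term.\<close>
  have ak: "ln (card E) - q * l \<le> a k" if "k < q" for k
  proof -
    have "ln (card E) \<le> k * l + a k"
    proof (cases "k \<le> n")
      case True
      have "a 0 \<le> ent \<sigma> (\<lambda>x. word T c k ((T ^^ 0) x)) + a k"
        using split[of k "n - k" 0] True by (simp add: a_def)
      also have "ent \<sigma> (\<lambda>x. word T c k ((T ^^ 0) x)) \<le> k * l" unfolding l_def by (rule ent_word_le[OF \<sigma> c])
      finally show ?thesis by (simp add: aE)
    next
      case False
      have "a 0 \<le> n * l" unfolding a_def l_def using ent_word_le[OF \<sigma> c, of n 0] by simp
      also have "\<dots> \<le> k * l" using False l0 by (intro mult_right_mono) auto
      finally show ?thesis using False by (simp add: aE a0)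
    qed
    moreover have "k * l \<le> q * l" using that l0 by (intro mult_right_mono) auto
    ultimately show ?thesis by linarith
  qed
  have "(\<Sum>k<q. ln (card E) - q * l) \<le> (\<Sum>k<q. a k)" using ak by (intro sum_mono) auto
  \<comment> \<open>The difference telescopes to the first \<open>q\<close> terms because
    \<open>a\<close> vanishes from \<open>n\<close> on.\<close>
  also have "\<dots> = (\<Sum>k<n. a k) - (\<Sum>k<n. a (k + q))"
  proof -
    have "(\<Sum>k<q. a (k + n)) = 0" by (simp add: a0)
    then show ?thesis using sum_lessThan_split[of a n q] sum_lessThan_split[of a q n] by (simp add: add.commute)
  qed
  also have "\<dots> \<le> (\<Sum>k<n. p k)"
    using sum_mono[of "{..<n}" a "\<lambda>k. p k + a (k + q)"] step by (simp add: sum.distrib)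
  also have "\<dots> = n * (\<Sum>k<n. (1 / n) * ent (point_average E (T ^^ k)) (word T c q))"
    using n by (simp add: p_def \<sigma>_def ent_point_average[OF E labelling_word[OF c]] sum_distrib_left)
  \<comment> \<open>Concavity: the measure on pairs is the average of the images of \<sigma> under
    \<open>T ^^ k\<close> for \<open>k < n\<close>.\<close>
  also have "\<dots> \<le> n * ent (point_average (E \<times> {..<n}) (\<lambda>(x, k). (T ^^ k) x)) (word T c q)"
  proof (rule mult_left_mono[OF ent_mix_lower])
    fix v
    let ?A = "word T c q -` {v}"
    have A: "?A \<in> sets borel" using labelling_word[OF c, of q] by (simp add: labelling_def)
    have "{i \<in> E \<times> {..<n}. (case i of (x, k) \<Rightarrow> (T ^^ k) x) \<in> ?A} = (\<lambda>(k, x). (x, k)) ` (SIGMA k:{..<n}. {x \<in> E. (T ^^ k) x \<in> ?A})"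
      by auto
    then have "card {i \<in> E \<times> {..<n}. (case i of (x, k) \<Rightarrow> (T ^^ k) x) \<in> ?A} = card (SIGMA k:{..<n}. {x \<in> E. (T ^^ k) x \<in> ?A})"
      by (simp add: card_image inj_on_def)
    also have "\<dots> = (\<Sum>k<n. card {x \<in> E. (T ^^ k) x \<in> ?A})" using E(1) by (simp add: card_SigmaI)
    finally have eq: "real (card {i \<in> E \<times> {..<n}. (case i of (x, k) \<Rightarrow> (T ^^ k) x) \<in> ?A}) = (\<Sum>k<n. real (card {x \<in> E. (T ^^ k) x \<in> ?A}))"
      by simp
    show "measure (point_average (E \<times> {..<n}) (\<lambda>(x, k). (T ^^ k) x)) ?A
        = (\<Sum>k\<in>{..<n}. 1 / real n * measure (point_average E (T ^^ k)) ?A)"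
    proof -
      have fin: "finite (E \<times> {..<n})" "E \<times> {..<n} \<noteq> {}"
        using E n lessThan_empty_iff[of n] by (auto simp del: lessThan_empty_iff)
      show ?thesis
        unfolding measure_point_average[OF fin A] measure_point_average[OF E A] eq
        by (simp add: card_cartesian_product sum_divide_distrib mult.commute)
    qed
  qed (use n in auto)
  finally have "(\<Sum>k<q. ln (card E) - q * l) \<le> n * ent (point_average (E \<times> {..<n}) (\<lambda>(x, k). (T ^^ k) x)) (word T c q)" .
  moreover have "(\<Sum>k<q. ln (card E) - q * l) = q * ln (card E) - (real q)\<^sup>2 * l"
    by (simp add: power2_eq_square right_diff_distrib)
  ultimately show ?thesis unfolding l_def by linarith
qed

section \<open>Convergence of measures and entropies on Jordan sets\<close>

lemma jordan_convergence:
  assumes w: "wconv \<mu>s \<mu>" "\<mu> \<in> borel_prob" "\<And>k. \<mu>s k \<in> borel_prob"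
    and A: "A \<in> mean_functional.jordan (\<lambda>h::'a \<Rightarrow> real. integral\<^sup>L \<mu> h)" "A \<in> sets borel"
  shows "(\<lambda>k. measure (\<mu>s k) A) \<longlonglongrightarrow> measure \<mu> A"
proof (rule LIMSEQ_I)
  interpret M: mean_functional "\<lambda>h::'a \<Rightarrow> real. integral\<^sup>L \<mu> h" by (rule mean_functional_integral[OF w(2)])
  fix e :: real assume "e > 0"
  then have "e / 2 > 0" by simp
  then obtain u v where uv: "continuous_on UNIV u" "continuous_on UNIV v"
    "\<And>x. u x \<le> indicator A x \<and> indicator A x \<le> v x" "integral\<^sup>L \<mu> v - integral\<^sup>L \<mu> u < e / 2"
    using A(1) unfolding M.jordan_def mem_Collect_eq by metis
  \<comment> \<open>The squeeze by continuous functions holds for every measure; it replaces the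
    null-boundary condition of the portmanteau theorem.\<close>
  have bound: "integral\<^sup>L \<nu> u \<le> measure \<nu> A \<and> measure \<nu> A \<le> integral\<^sup>L \<nu> v" if \<nu>: "\<nu> \<in> borel_prob" for \<nu>
  proof -
    have "integrable \<nu> (indicator A :: 'a \<Rightarrow> real)"
      by (rule integrable_bounded[OF \<nu>, where B=1]) (use A(2) in \<open>auto simp: indicator_def\<close>)
    then have "integral\<^sup>L \<nu> u \<le> integral\<^sup>L \<nu> (indicator A)" "integral\<^sup>L \<nu> (indicator A) \<le> integral\<^sup>L \<nu> v"
      using integral_mono[OF integrable_cont[OF \<nu> uv(1)]] integral_mono[OF _ integrable_cont[OF \<nu> uv(2)]] uv(3) by blast+
    then show ?thesis by (simp add: borel_prob_space[OF \<nu>])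
  qed
  have "(\<lambda>k. integral\<^sup>L (\<mu>s k) u) \<longlonglongrightarrow> integral\<^sup>L \<mu> u" "(\<lambda>k. integral\<^sup>L (\<mu>s k) v) \<longlonglongrightarrow> integral\<^sup>L \<mu> v"
    using w(1) uv(1,2) by (auto simp: wconv_def)
  then have "eventually (\<lambda>k. integral\<^sup>L \<mu> u - e / 2 < integral\<^sup>L (\<mu>s k) u \<and> integral\<^sup>L (\<mu>s k) v < integral\<^sup>L \<mu> v + e / 2) sequentially"
    using \<open>e > 0\<close> by (intro eventually_conj order_tendstoD) auto
  then have "eventually (\<lambda>k. norm (measure (\<mu>s k) A - measure \<mu> A) < e) sequentially"
  proof eventually_elim
    case (elim k)
    then show ?case using bound[OF w(3)[of k]] bound[OF w(2)] uv(4) unfolding real_norm_def by linarith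
  qed
  then show "\<exists>no. \<forall>n\<ge>no. norm (measure (\<mu>s n) A - measure \<mu> A) < e" by (simp add: eventually_sequentially)
qed

text \<open>Composition with an iterate preserves the squeeze and, by invariance, the gap between
  the integrals. Hence words over a Jordan labelling form a Jordan labelling again.\<close>

lemma jordan_iter:
  assumes \<mu>: "\<mu> \<in> inv_prob T" and A: "A \<in> mean_functional.jordan (\<lambda>h::'a \<Rightarrow> real. integral\<^sup>L \<mu> h)"
  shows "(T ^^ k) -` A \<in> mean_functional.jordan (\<lambda>h::'a \<Rightarrow> real. integral\<^sup>L \<mu> h)"
proof -
  interpret M: mean_functional "\<lambda>h::'a \<Rightarrow> real. integral\<^sup>L \<mu> h"
    by (rule mean_functional_integral[OF inv_prob_borel_prob[OF \<mu>]])
  show ?thesis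
  proof (rule M.jordanI)
    fix e :: real assume "e > 0"
    then obtain u v where uv: "continuous_on UNIV u" "continuous_on UNIV v"
      "\<And>x. u x \<le> indicator A x \<and> indicator A x \<le> v x" "integral\<^sup>L \<mu> v - integral\<^sup>L \<mu> u < e"
      using A unfolding M.jordan_def mem_Collect_eq by metis
    show "\<exists>u v. continuous_on UNIV u \<and> continuous_on UNIV v \<and>
      (\<forall>x. u x \<le> indicator ((T ^^ k) -` A) x \<and> indicator ((T ^^ k) -` A) x \<le> v x) \<and> integral\<^sup>L \<mu> v - integral\<^sup>L \<mu> u < e"
    proof (intro exI conjI allI)
      show "continuous_on UNIV (\<lambda>x. u ((T ^^ k) x))" "continuous_on UNIV (\<lambda>x. v ((T ^^ k) x))"
        by (intro cont_comp_iter uv)+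
      show "u ((T ^^ k) x) \<le> indicator ((T ^^ k) -` A) x" "indicator ((T ^^ k) -` A) x \<le> v ((T ^^ k) x)" for x
        using uv(3)[of "(T ^^ k) x"] by (auto simp: indicator_def)
      show "integral\<^sup>L \<mu> (\<lambda>x. v ((T ^^ k) x)) - integral\<^sup>L \<mu> (\<lambda>x. u ((T ^^ k) x)) < e"
        using uv(4) integral_iter[OF \<mu> borel_cont[OF uv(1)]] integral_iter[OF \<mu> borel_cont[OF uv(2)]] by simp
    qed
  qed
qed

text \<open>Replaces partitions whose cells have \<open>\<mu>\<close>-null boundaries.\<close>

definition jordan_labelling :: "'a measure \<Rightarrow> ('a \<Rightarrow> 'l) \<Rightarrow> bool" where
  "jordan_labelling \<mu> X \<longleftrightarrow> labelling X \<and>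
     (\<forall>v. X -` {v} \<in> mean_functional.jordan (\<lambda>h::'a \<Rightarrow> real. integral\<^sup>L \<mu> h))"

lemma jordan_labelling_word:
  assumes \<mu>: "\<mu> \<in> inv_prob T" and c: "jordan_labelling \<mu> c"
  shows "jordan_labelling \<mu> (word T c n)"
proof -
  interpret M: mean_functional "\<lambda>h::'a \<Rightarrow> real. integral\<^sup>L \<mu> h"
    by (rule mean_functional_integral[OF inv_prob_borel_prob[OF \<mu>]])
  have e: "{} \<in> M.jordan" using M.jordan_Compl[OF M.jordan_UNIV] by simp
  have "word T c n -` {v} \<in> M.jordan" for v
  proof (induction n arbitrary: v)
    case 0
    have "word T c 0 -` {v} = (if v = [] then UNIV else {})" by (auto simp: word_def)
    then show ?case using M.jordan_UNIV e by simp
  next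
    case (Suc n)
    have "word T c (Suc n) -` {v} = (if v = [] then {} else word T c n -` {butlast v} \<inter> (T ^^ n) -` (c -` {last v}))"
      by (cases v rule: rev_cases) (auto simp: word_Suc)
    moreover have "c -` {last v} \<in> M.jordan" using c by (simp add: jordan_labelling_def)
    ultimately show ?case using Suc[of "butlast v"] jordan_iter[OF \<mu>] M.jordan_Int e by simp
  qed
  then show ?thesis using c labelling_word[of c n] by (simp add: jordan_labelling_def)
qed

lemma ent_convergence:
  assumes w: "wconv \<mu>s \<mu>" "\<mu> \<in> borel_prob" "\<And>k. \<mu>s k \<in> borel_prob" and X: "jordan_labelling \<mu> X"
  shows "(\<lambda>k. ent (\<mu>s k) X) \<longlonglongrightarrow> ent \<mu> X"
  unfolding ent_def
proof (rule tendsto_sum)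
  fix v
  have "(\<lambda>k. measure (\<mu>s k) (X -` {v})) \<longlonglongrightarrow> measure \<mu> (X -` {v})"
    using X by (intro jordan_convergence[OF w]) (auto simp: jordan_labelling_def labelling_def)
  then show "(\<lambda>k. eta (measure (\<mu>s k) (X -` {v}))) \<longlonglongrightarrow> eta (measure \<mu> (X -` {v}))"
    by (rule continuous_on_tendsto_compose[OF continuous_eta]) auto
qed

text \<open>Balls are sublevel sets of the distance, so all but countably many radii below
  \<open>d / 2\<close> are good. Finitely many such balls cover the space, and a point is labelled
  by the first one that contains it.\<close>

lemma small_jordan_labelling:
  assumes \<mu>: "\<mu> \<in> borel_prob" and d: "d > 0"
  obtains c :: "'a \<Rightarrow> nat" where "jordan_labelling \<mu> c" "\<And>x y. c x = c y \<Longrightarrow> dist x y < d"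
proof -
  interpret M: mean_functional "\<lambda>h::'a \<Rightarrow> real. integral\<^sup>L \<mu> h" by (rule mean_functional_integral[OF \<mu>])
  have "\<exists>r. 0 < r \<and> r < d / 2 \<and> {y. dist x y < r} \<in> M.jordan" for x
  proof -
    have "continuous_on UNIV (dist x)" by (intro continuous_intros)
    then obtain N where N: "countable N" "\<And>r. r \<notin> N \<Longrightarrow> {y. dist x y < r} \<in> M.jordan"
      using M.jordan_sublevel by blast
    have "0 < d / 2" using d by simp
    then obtain r where "0 < r" "r < d / 2" "r \<notin> N" using M.good_level_between[OF N(1)] by metis
    then show ?thesis using N(2) by blast
  qed
  then obtain r where r: "\<And>x. 0 < r x" "\<And>x. r x < d / 2" "\<And>x. {y. dist x y < r x} \<in> M.jordan" by metis
  obtain D where D: "D \<subseteq> UNIV" "finite D" "UNIV \<subseteq> (\<Union>x\<in>D. ball x (r x))"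
    by (rule compactE_image[OF cpt, of UNIV "\<lambda>x. ball x (r x)"]) (use r(1) in auto)
  obtain xs where xs: "set xs = D" using finite_list[OF D(2)] by blast
  define c where "c y = (LEAST i. i < length xs \<and> y \<in> ball (xs ! i) (r (xs ! i)))" for y
  have ex: "\<exists>i. i < length xs \<and> y \<in> ball (xs ! i) (r (xs ! i))" for y
  proof -
    obtain x where "x \<in> D" "y \<in> ball x (r x)" using D(3) by blast
    moreover then obtain i where "i < length xs" "xs ! i = x" using xs in_set_conv_nth[of x xs] by blast
    ultimately show ?thesis by blast
  qed
  have c: "c y < length xs \<and> y \<in> ball (xs ! c y) (r (xs ! c y))" for y
    unfolding c_def by (rule LeastI_ex[OF ex])
  let ?A = "\<lambda>i. ball (xs ! i) (r (xs ! i))"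
  have Aj: "?A i \<in> M.jordan" for i using r(3) by (simp add: ball_def)
  have fibre: "c -` {i} = (if i < length xs then ?A i \<inter> (\<Inter>j<i. - ?A j) else {})" for i
  proof (cases "i < length xs")
    case True
    have iff: "c y = i \<longleftrightarrow> y \<in> ?A i \<and> (\<forall>j<i. y \<notin> ?A j)" for y
    proof
      assume y: "c y = i"
      then have "y \<notin> ?A j" if "j < i" for j
        using not_less_Least[of j "\<lambda>i. i < length xs \<and> y \<in> ?A i"] that True unfolding c_def by simp
      then show "y \<in> ?A i \<and> (\<forall>j<i. y \<notin> ?A j)" using c[of y] y by blast
    next
      assume "y \<in> ?A i \<and> (\<forall>j<i. y \<notin> ?A j)"
      then show "c y = i" unfolding c_def using True by (intro Least_equality) (auto simp: not_less[symmetric])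
    qed
    show ?thesis unfolding if_P[OF True] by (rule set_eqI) (simp only: vimage_singleton_eq iff Int_iff INT_iff Compl_iff lessThan_iff Ball_def)
  next
    case False
    then show ?thesis using c by auto
  qed
  have fj: "c -` {i} \<in> M.jordan" for i
  proof -
    have "(\<Inter>j<k. - ?A j) \<in> M.jordan" for k :: nat
    proof (induction k)
      case (Suc k)
      have "(\<Inter>j<Suc k. - ?A j) = (- ?A k) \<inter> (\<Inter>j<k. - ?A j)" by (auto simp: less_Suc_eq)
      then show ?case using M.jordan_Int[OF M.jordan_Compl[OF Aj] Suc] by simp
    qed (use M.jordan_UNIV in simp)
    then show ?thesis unfolding fibre using Aj M.jordan_Int M.jordan_Compl[OF M.jordan_UNIV] by auto
  qed
  have fb: "c -` {i} \<in> sets borel" for i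
  proof -
    have "(\<Inter>j<k. - ?A j) \<in> sets borel" for k :: nat
      by (intro borel_closed closed_INT ballI) (simp add: closed_Compl)
    then show ?thesis unfolding fibre by auto
  qed
  have "range c \<subseteq> {..<length xs}" using c by auto
  then have "finite (range c)" by (rule finite_subset) simp
  then have "jordan_labelling \<mu> c" using fj fb by (simp add: jordan_labelling_def labelling_def)
  moreover have "dist x y < d" if "c x = c y" for x y
  proof -
    have "dist (xs ! c x) x < r (xs ! c x)" "dist (xs ! c x) y < r (xs ! c x)" using c[of x] c[of y] that by auto
    then show ?thesis using r(2)[of "xs ! c x"] dist_triangle3[of x y "xs ! c x"] by linarith
  qed
  ultimately show ?thesis by (rule that)
qed

section \<open>Covers of the points close to one invariant measure\<close>

definition bowen_separated :: "nat \<Rightarrow> real \<Rightarrow> 'a set \<Rightarrow> bool" where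
  "bowen_separated n \<epsilon> E \<longleftrightarrow> (\<forall>x\<in>E. \<forall>y\<in>E. x \<noteq> y \<longrightarrow> (\<exists>i<n. rho_dist f ((T ^^ i) x) ((T ^^ i) y) > \<epsilon>))"

definition near :: "'a measure \<Rightarrow> nat \<Rightarrow> real \<Rightarrow> nat \<Rightarrow> 'a set" where
  "near \<mu> P z n = {x. \<forall>p<P. \<bar>integral\<^sup>L (empirical T n x) (f p) - integral\<^sup>L \<mu> (f p)\<bar> < z}"

text \<open>By contradiction. One number \<open>K\<close> governs the length, the number of tests
  and the accuracy, so counterexamples form a sequence whose orbit measures converge to \<mu>. A
  Jordan labelling with cells below the separation scale codes each set injectively, and
  Misiurewicz's inequality forces \<open>r\<close> to be at most the entropy of \<mu>.\<close>

lemma separated_card_bound: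
  assumes \<mu>: "\<mu> \<in> inv_prob T" and \<epsilon>: "\<epsilon> > 0" and r: "metric_entropy T \<mu> < ereal r"
  obtains K :: nat where "\<And>n E. n \<ge> K \<Longrightarrow> finite E \<Longrightarrow> E \<subseteq> near \<mu> K (1 / real (K + 1)) n \<Longrightarrow>
      bowen_separated n \<epsilon> E \<Longrightarrow> card E \<le> exp (n * r)"
proof (rule ccontr)
  assume "\<not> thesis"
  then have neg: "\<not> (\<forall>n E. n \<ge> K \<longrightarrow> finite E \<longrightarrow> E \<subseteq> near \<mu> K (1 / real (K + 1)) n \<longrightarrow>
      bowen_separated n \<epsilon> E \<longrightarrow> card E \<le> exp (n * r))" for K using that[of K] by blast
  have "\<forall>K. \<exists>n E. n \<ge> Suc K \<and> finite E \<and> E \<subseteq> near \<mu> (Suc K) (1 / real (Suc K + 1)) n \<and> bowen_separated n \<epsilon> E \<and> \<not> card E \<le> exp (n * r)"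
    using neg[of "Suc K" for K] by blast
  then obtain n E where nE: "\<And>K. n K \<ge> Suc K" "\<And>K. finite (E K)" "\<And>K. E K \<subseteq> near \<mu> (Suc K) (1 / real (Suc K + 1)) (n K)"
      "\<And>K. bowen_separated (n K) \<epsilon> (E K)" "\<And>K. \<not> card (E K) \<le> exp (n K * r)" by metis
  note \<mu>' = inv_prob_borel_prob[OF \<mu>]
  have ne: "E K \<noteq> {}" for K
  proof
    assume "E K = {}"
    then show False using nE(5)[of K] by simp
  qed
  have n1: "n K \<ge> 1" for K using nE(1)[of K] by simp
  define \<nu> where "\<nu> K = point_average (E K \<times> {..<n K}) (\<lambda>(x, k). (T ^^ k) x)" for K
  have fin: "finite (E K \<times> {..<n K})" "E K \<times> {..<n K} \<noteq> {}" for K using nE(2) ne[of K] n1[of K] by (auto simp: lessThan_empty_iff)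
  have \<nu>b: "\<nu> K \<in> borel_prob" for K unfolding \<nu>_def by (rule point_average_borel_prob[OF fin])
  have \<nu>i: "\<bar>integral\<^sup>L (\<nu> K) (f p) - integral\<^sup>L \<mu> (f p)\<bar> \<le> 1 / real (Suc K + 1)" if p: "p < Suc K" for K p
  proof -
    have cE: "real (card (E K)) > 0" using nE(2) ne by (simp add: card_gt_0_iff)
    have "integral\<^sup>L (\<nu> K) (f p) = (\<Sum>x\<in>E K. \<Sum>k<n K. f p ((T ^^ k) x)) / (card (E K) * n K)"
      unfolding \<nu>_def by (subst integral_point_average[OF fin borel_cont[OF cont_f]])
        (simp add: card_cartesian_product sum.cartesian_product case_prod_beta)
    also have "\<dots> = (\<Sum>x\<in>E K. integral\<^sup>L (empirical T (n K) x) (f p)) / card (E K)"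
      using n1 by (simp add: integral_empirical[OF _ borel_cont[OF cont_f]] sum_divide_distrib mult.commute)
    finally have "integral\<^sup>L (\<nu> K) (f p) - integral\<^sup>L \<mu> (f p) = (\<Sum>x\<in>E K. integral\<^sup>L (empirical T (n K) x) (f p) - integral\<^sup>L \<mu> (f p)) / card (E K)"
      using cE by (simp add: sum_subtractf diff_divide_distrib)
    also have "\<bar>\<dots>\<bar> = \<bar>\<Sum>x\<in>E K. integral\<^sup>L (empirical T (n K) x) (f p) - integral\<^sup>L \<mu> (f p)\<bar> / card (E K)" by simp
    also have "\<dots> \<le> (\<Sum>x\<in>E K. 1 / real (Suc K + 1)) / card (E K)"
    proof (rule divide_right_mono)
      have "\<bar>\<Sum>x\<in>E K. integral\<^sup>L (empirical T (n K) x) (f p) - integral\<^sup>L \<mu> (f p)\<bar>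
          \<le> (\<Sum>x\<in>E K. \<bar>integral\<^sup>L (empirical T (n K) x) (f p) - integral\<^sup>L \<mu> (f p)\<bar>)" by (rule sum_abs)
      also have "\<dots> \<le> (\<Sum>x\<in>E K. 1 / real (Suc K + 1))"
        using nE(3)[of K] p by (intro sum_mono less_imp_le) (auto simp: near_def add.commute)
      finally show "\<bar>\<Sum>x\<in>E K. integral\<^sup>L (empirical T (n K) x) (f p) - integral\<^sup>L \<mu> (f p)\<bar> \<le> (\<Sum>x\<in>E K. 1 / real (Suc K + 1))" .
    qed simp
    also have "\<dots> = 1 / real (Suc K + 1)" using cE by simp
    finally show ?thesis .
  qed
  have w: "wconv \<nu> \<mu>"
  proof (rule wconvI[OF \<nu>b \<mu>'])
    fix p
    have "(\<lambda>K. integral\<^sup>L (\<nu> K) (f p) - integral\<^sup>L \<mu> (f p)) \<longlonglongrightarrow> 0"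
    proof (rule Lim_null_comparison)
      show "(\<lambda>K. 1 / real (Suc K + 1)) \<longlonglongrightarrow> 0"
        using LIMSEQ_ignore_initial_segment[OF lim_const_over_n[of 1], of 2] by (simp add: add.commute)
      show "\<forall>\<^sub>F K in sequentially. norm (integral\<^sup>L (\<nu> K) (f p) - integral\<^sup>L \<mu> (f p)) \<le> 1 / real (Suc K + 1)"
        unfolding eventually_sequentially real_norm_def using \<nu>i by (intro exI[of _ p]) (auto simp: less_Suc_eq_le)
    qed
    then show "(\<lambda>K. integral\<^sup>L (\<nu> K) (f p)) \<longlonglongrightarrow> integral\<^sup>L \<mu> (f p)" by (simp only: LIM_zero_iff)
  qed
  obtain d where d: "d > 0" "\<And>x y. dist x y < d \<Longrightarrow> rho_dist f x y \<le> \<epsilon>" using rho_small[OF \<epsilon>] by blast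
  obtain c :: "'a \<Rightarrow> nat" where c: "jordan_labelling \<mu> c" "\<And>x y. c x = c y \<Longrightarrow> dist x y < d"
    using small_jordan_labelling[OF \<mu>' d(1)] by blast
  have cl: "labelling c" using c(1) by (simp add: jordan_labelling_def)
  have inj: "inj_on (word T c (n K)) (E K)" for K
  proof (rule inj_onI, rule ccontr)
    fix x y assume xy: "x \<in> E K" "y \<in> E K" "word T c (n K) x = word T c (n K) y" "x \<noteq> y"
    then obtain i where i: "i < n K" "rho_dist f ((T ^^ i) x) ((T ^^ i) y) > \<epsilon>"
      using nE(4)[of K] unfolding bowen_separated_def by blast
    have "word T c (n K) x ! i = word T c (n K) y ! i" using xy(3) by simp
    then have "c ((T ^^ i) x) = c ((T ^^ i) y)" using i(1) by (simp add: word_def)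
    then show False using d(2)[OF c(2)] i(2) by fastforce
  qed
  define l where "l = ln (real (card (range c)))"
  \<comment> \<open>The limit in \<open>K\<close> for a fixed word length: the error term of
    \<open>misiurewicz\<close> is divided by \<open>n K\<close>, and the entropies converge because
    the words form a Jordan labelling.\<close>
  have rq: "r * q \<le> ent \<mu> (word T c q)" for q :: nat
  proof (rule LIMSEQ_le_const)
    have "(\<lambda>K. (real q)\<^sup>2 * l / real (n K)) \<longlonglongrightarrow> 0"
    proof (rule Lim_null_comparison)
      show "(\<lambda>K. \<bar>(real q)\<^sup>2 * l\<bar> / real (Suc K)) \<longlonglongrightarrow> 0"
        using LIMSEQ_Suc[OF lim_const_over_n[of "\<bar>(real q)\<^sup>2 * l\<bar>"]] by simp
      have "\<bar>(real q)\<^sup>2 * l\<bar> / real (n K) \<le> \<bar>(real q)\<^sup>2 * l\<bar> / real (Suc K)" for K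
        using nE(1)[of K] by (intro frac_le) auto
      then show "\<forall>\<^sub>F K in sequentially. norm ((real q)\<^sup>2 * l / real (n K)) \<le> \<bar>(real q)\<^sup>2 * l\<bar> / real (Suc K)"
        by (intro always_eventually allI) (simp add: abs_mult)
    qed
    then have "(\<lambda>K. ent (\<nu> K) (word T c q) + (real q)\<^sup>2 * l / real (n K)) \<longlonglongrightarrow> ent \<mu> (word T c q) + 0"
      by (intro tendsto_add ent_convergence[OF w \<mu>' \<nu>b jordan_labelling_word[OF \<mu> c(1)]])
    then show "(\<lambda>K. ent (\<nu> K) (word T c q) + (real q)\<^sup>2 * l / real (n K)) \<longlonglongrightarrow> ent \<mu> (word T c q)" by simp
    show "\<exists>N. \<forall>K\<ge>N. r * q \<le> ent (\<nu> K) (word T c q) + (real q)\<^sup>2 * l / real (n K)"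
    proof (intro exI[of _ 0] allI impI)
      fix K
      have "ln (exp (n K * r)) \<le> ln (card (E K))" using nE(5)[of K] by (intro ln_mono) auto
      then have "q * (n K * r) \<le> q * ln (card (E K))" by (intro mult_left_mono) auto
      also have "\<dots> \<le> n K * ent (\<nu> K) (word T c q) + (real q)\<^sup>2 * l"
        unfolding \<nu>_def l_def by (rule misiurewicz[OF nE(2) ne cl n1 inj])
      finally show "r * q \<le> ent (\<nu> K) (word T c q) + (real q)\<^sup>2 * l / real (n K)"
        using n1[of K] by (simp add: field_simps)
    qed
  qed
  have "r \<le> label_entropy T \<mu> c"
  proof (rule LIMSEQ_le_const[OF label_entropy_lim(1)[OF \<mu> cl]])
    show "\<exists>N. \<forall>q\<ge>N. r \<le> ent \<mu> (word T c q) / q" using rq by (intro exI[of _ 1]) (auto simp: field_simps)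
  qed
  then have "ereal r \<le> ereal (label_entropy T \<mu> c)" by simp
  also have "\<dots> \<le> metric_entropy T \<mu>" by (rule label_entropy_le_metric_entropy[OF compact_system_axioms \<mu> cl])
  finally have "ereal r \<le> metric_entropy T \<mu>" .
  from leD[OF this] r show False by (rule notE)
qed

lemma bowen_ball_self: "\<epsilon> \<ge> 0 \<Longrightarrow> x \<in> bowen_ball (rho_dist f) T n x \<epsilon>"
  by (simp add: bowen_ball_def)

text \<open>A separated set of maximal cardinality is spanning; the cardinality bound guarantees
  that the maximum exists.\<close>

lemma near_bowen_cover:
  assumes \<mu>: "\<mu> \<in> inv_prob T" and \<epsilon>: "\<epsilon> > 0" and r: "metric_entropy T \<mu> < ereal r"
  shows "\<exists>K. \<forall>n\<ge>K. \<exists>E. finite E \<and> E \<subseteq> near \<mu> K (1 / real (K + 1)) n \<and> card E \<le> exp (n * r) \<and>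
      near \<mu> K (1 / real (K + 1)) n \<subseteq> (\<Union>x\<in>E. bowen_ball (rho_dist f) T n x \<epsilon>)"
proof (rule separated_card_bound[OF \<mu> \<epsilon> r])
  fix K :: nat assume K: "\<And>n E. n \<ge> K \<Longrightarrow> finite E \<Longrightarrow> E \<subseteq> near \<mu> K (1 / real (K + 1)) n \<Longrightarrow>
      bowen_separated n \<epsilon> E \<Longrightarrow> card E \<le> exp (n * r)"
  show ?thesis
  proof (intro exI[of _ K] allI impI)
    fix n assume n: "n \<ge> K"
    let ?X = "near \<mu> K (1 / real (K + 1)) n"
    let ?S = "{E. finite E \<and> E \<subseteq> ?X \<and> bowen_separated n \<epsilon> E}"
    have "card E \<le> nat \<lceil>exp (n * r)\<rceil>" if "E \<in> ?S" for E
    proof -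
      have "real (card E) \<le> exp (n * r)" using K[OF n, of E] that by blast
      then show ?thesis using real_nat_ceiling_ge[of "exp (n * r)"] by linarith
    qed
    then have "card ` ?S \<subseteq> {..nat \<lceil>exp (n * r)\<rceil>}" by (intro image_subsetI) (simp only: atMost_iff)
    then have fS: "finite (card ` ?S)" by (rule finite_subset) simp
    have "{} \<in> ?S" by (simp add: bowen_separated_def)
    then have "card ` ?S \<noteq> {}" by blast
    from Max_in[OF fS this] obtain E where E: "E \<in> ?S" "card E = Max (card ` ?S)" by (metis (no_types, lifting) imageE)
    have "x \<in> (\<Union>y\<in>E. bowen_ball (rho_dist f) T n y \<epsilon>)" if x: "x \<in> ?X" for x
    proof (rule ccontr)
      assume no: "\<not> ?thesis"
      then have xE: "x \<notin> E" using bowen_ball_self[of \<epsilon> x n] \<epsilon> by auto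
      have "\<exists>i<n. rho_dist f ((T ^^ i) y) ((T ^^ i) x) > \<epsilon>" if "y \<in> E" for y
        using no that by (auto simp: bowen_ball_def not_le)
      then have "bowen_separated n \<epsilon> (insert x E)"
        using E(1) unfolding bowen_separated_def by (auto simp: rho_sym)
      then have "insert x E \<in> ?S" using E(1) x by simp
      then have "card (insert x E) \<le> Max (card ` ?S)" by (intro Max_ge[OF fS] imageI)
      then show False using E xE by simp
    qed
    then show "\<exists>E. finite E \<and> E \<subseteq> ?X \<and> card E \<le> exp (n * r) \<and> ?X \<subseteq> (\<Union>x\<in>E. bowen_ball (rho_dist f) T n x \<epsilon>)"
      using E(1) K[OF n, of E] by blast
  qed
qed

lemma near_mono:
  assumes "P \<le> P'" "z' \<le> z" shows "near \<mu> P' z' n \<subseteq> near \<mu> P z n"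
proof
  fix x assume x: "x \<in> near \<mu> P' z' n"
  show "x \<in> near \<mu> P z n"
    unfolding near_def mem_Collect_eq
  proof (intro allI impI)
    fix p assume "p < P"
    then have "\<bar>integral\<^sup>L (empirical T n x) (f p) - integral\<^sup>L \<mu> (f p)\<bar> < z'" using x assms by (simp add: near_def)
    then show "\<bar>integral\<^sup>L (empirical T n x) (f p) - integral\<^sup>L \<mu> (f p)\<bar> < z" using assms by linarith
  qed
qed

lemma birkhoff_sum_diff_le:
  assumes "\<And>x y. rho_dist f x y \<le> \<epsilon> \<Longrightarrow> \<bar>\<phi> x - \<phi> y\<bar> \<le> g" "y \<in> bowen_ball (rho_dist f) T n x \<epsilon>"
  shows "\<bar>birkhoff_sum T \<phi> n x - birkhoff_sum T \<phi> n y\<bar> \<le> n * g"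
proof -
  have "birkhoff_sum T \<phi> n x - birkhoff_sum T \<phi> n y = (\<Sum>i<n. \<phi> ((T ^^ i) x) - \<phi> ((T ^^ i) y))"
    by (simp add: birkhoff_sum_def sum_subtractf)
  also have "\<bar>\<dots>\<bar> \<le> (\<Sum>i<n. \<bar>\<phi> ((T ^^ i) x) - \<phi> ((T ^^ i) y)\<bar>)" by (rule sum_abs)
  also have "\<dots> \<le> (\<Sum>i<n. g)" using assms by (intro sum_mono) (auto simp: bowen_ball_def)
  finally show ?thesis by simp
qed

text \<open>The summand of \<open>cover_mass_at\<close> for the metric
  \<open>rho_dist f\<close>.\<close>

definition weight :: "real \<Rightarrow> ('a \<Rightarrow> real) \<Rightarrow> real \<Rightarrow> nat \<Rightarrow> 'a \<Rightarrow> real" where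
  "weight t \<phi> \<epsilon> n x = exp (- t * n + (SUP y\<in>bowen_ball (rho_dist f) T n x \<epsilon>. birkhoff_sum T \<phi> n y))"

text \<open>The radius \<open>2 / P\<close> leaves room for two errors of size \<open>1 / P\<close>:
  from the empirical measure to an invariant measure, and from that measure to its countable
  representative.\<close>

lemma local_cover:
  assumes \<mu>: "\<mu> \<in> inv_prob T" and \<phi>: "continuous_on UNIV \<phi>" and \<epsilon>: "\<epsilon> > 0"
    and t: "metric_entropy T \<mu> + ereal (integral\<^sup>L \<mu> \<phi>) < ereal t"
    and g: "\<And>x y. rho_dist f x y \<le> \<epsilon> \<Longrightarrow> \<bar>\<phi> x - \<phi> y\<bar> \<le> g"
  obtains P :: nat and \<theta> where "P \<ge> 1" "\<theta> > 0"
    "\<And>n. n \<ge> P \<Longrightarrow> \<exists>E. finite E \<and> near \<mu> P (2 / real P) n \<subseteq> (\<Union>x\<in>E. bowen_ball (rho_dist f) T n x \<epsilon>) \<and>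
       (\<Sum>x\<in>E. weight (t + 2 * g) \<phi> \<epsilon> n x) \<le> exp (- \<theta> * n)"
proof -
  let ?I = "integral\<^sup>L \<mu> \<phi>"
  have "metric_entropy T \<mu> < ereal (t - ?I)"
    using t by (cases "metric_entropy T \<mu>") auto
  then obtain r where r: "metric_entropy T \<mu> < ereal r" "r < t - ?I"
    using ereal_dense2[of "metric_entropy T \<mu>" "ereal (t - ?I)"] by auto
  \<comment> \<open>Half of the gap between \<open>r\<close> and \<open>t - ?I\<close> is spent on
    the Birkhoff averages; the other half remains as exponential decay.\<close>
  define \<theta> where "\<theta> = (t - ?I - r) / 2"
  have \<theta>: "\<theta> > 0" using r by (simp add: \<theta>_def)
  obtain K :: nat where K: "\<forall>n\<ge>K. \<exists>E. finite E \<and> E \<subseteq> near \<mu> K (1 / real (K + 1)) n \<and> card E \<le> exp (n * r) \<and>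
      near \<mu> K (1 / real (K + 1)) n \<subseteq> (\<Union>x\<in>E. bowen_ball (rho_dist f) T n x \<epsilon>)"
    using near_bowen_cover[OF \<mu> \<epsilon> r(1)] by blast
  have "\<exists>p d. d > 0 \<and> (\<forall>\<nu>\<in>borel_prob. \<bar>integral\<^sup>L \<nu> (f p) - integral\<^sup>L \<mu> (f p)\<bar> \<le> d \<longrightarrow> \<bar>integral\<^sup>L \<nu> \<phi> - ?I\<bar> \<le> \<theta>)"
  proof (rule integral_approx_compare[OF \<phi> \<theta>])
    fix p and d :: real assume "d > 0" and d: "\<And>\<mu> \<nu>. \<mu> \<in> borel_prob \<Longrightarrow> \<nu> \<in> borel_prob \<Longrightarrow>
     \<bar>integral\<^sup>L \<mu> (f p) - integral\<^sup>L \<nu> (f p)\<bar> \<le> d \<Longrightarrow> \<bar>integral\<^sup>L \<mu> \<phi> - integral\<^sup>L \<nu> \<phi>\<bar> \<le> \<theta>"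
    note m = inv_prob_borel_prob[OF \<mu>]
    show ?thesis
    proof (intro exI[of _ p] exI[of _ d] conjI ballI impI)
      show "d > 0" by fact
      fix \<nu> assume "\<nu> \<in> borel_prob" "\<bar>integral\<^sup>L \<nu> (f p) - integral\<^sup>L \<mu> (f p)\<bar> \<le> d"
      then show "\<bar>integral\<^sup>L \<nu> \<phi> - ?I\<bar> \<le> \<theta>" using m by (intro d)
    qed
  qed
  then obtain p d where d: "d > 0"
    "\<forall>\<nu>\<in>borel_prob. \<bar>integral\<^sup>L \<nu> (f p) - integral\<^sup>L \<mu> (f p)\<bar> \<le> d \<longrightarrow> \<bar>integral\<^sup>L \<nu> \<phi> - ?I\<bar> \<le> \<theta>" by blast
  \<comment> \<open>The demands are that \<open>near\<close> with parameter \<open>P\<close> refines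
    the one with \<open>K\<close>, that it tests \<open>f p\<close>, and that its radius
    \<open>2 / P\<close> is below \<open>1 / (K + 1)\<close> and \<open>d\<close>.\<close>
  obtain P :: nat where "max (max (real K) (real p + 1)) (max (2 * (real K + 1)) (2 / d)) \<le> real P"
    using real_arch_simple by blast
  then have P: "K \<le> P" "p < P" "2 * (real K + 1) \<le> P" "2 / d \<le> P" by auto
  have P1: "P \<ge> 1" using P(2) by simp
  have P2: "2 / real P \<le> 1 / real (K + 1)" "2 / real P \<le> d"
    using P P1 d(1) by (auto simp: field_simps)
  show ?thesis
  proof (rule that[of P \<theta>, OF P1 \<theta>])
    fix n assume n: "n \<ge> P"
    then have nK: "n \<ge> K" and n1: "n \<ge> 1" using P P1 by auto
    from K[rule_format, OF nK] obtain E where E0: "finite E \<and> E \<subseteq> near \<mu> K (1 / real (K + 1)) n \<and> card E \<le> exp (n * r) \<and>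
      near \<mu> K (1 / real (K + 1)) n \<subseteq> (\<Union>x\<in>E. bowen_ball (rho_dist f) T n x \<epsilon>)" ..
    then have E: "finite E" "card E \<le> exp (n * r)"
      "near \<mu> K (1 / real (K + 1)) n \<subseteq> (\<Union>x\<in>E. bowen_ball (rho_dist f) T n x \<epsilon>)"
      by - (elim conjE, assumption)+
    let ?N = "near \<mu> P (2 / real P) n"
    \<comment> \<open>Balls that miss \<open>?N\<close> are discarded, since their weights are not
      controlled. In a remaining ball the estimate passes from the good point \<open>z\<close>
      through the centre to any other point, which costs \<open>g\<close> twice per unit of
      time.\<close>
    define F where "F = {x \<in> E. bowen_ball (rho_dist f) T n x \<epsilon> \<inter> ?N \<noteq> {}}"
    have cov: "?N \<subseteq> (\<Union>x\<in>F. bowen_ball (rho_dist f) T n x \<epsilon>)"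
      using near_mono[OF P(1) P2(1), of \<mu> n] E(3) unfolding F_def by blast
    have wle: "weight (t + 2 * g) \<phi> \<epsilon> n x \<le> exp (n * (?I + \<theta> - t))" if x: "x \<in> F" for x
    proof -
      obtain z where z: "z \<in> bowen_ball (rho_dist f) T n x \<epsilon>" "z \<in> ?N" using x by (auto simp: F_def)
      have "\<bar>integral\<^sup>L (empirical T n z) (f p) - integral\<^sup>L \<mu> (f p)\<bar> \<le> d"
        using z(2) P(2) P2(2) by (force simp: near_def)
      then have "\<bar>integral\<^sup>L (empirical T n z) \<phi> - ?I\<bar> \<le> \<theta>"
        using d(2) empirical_borel_prob[OF n1, of z] by blast
      then have "\<bar>birkhoff_sum T \<phi> n z / n - ?I\<bar> \<le> \<theta>" by (simp add: integral_empirical_birkhoff[OF n1 \<phi>])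
      then have "birkhoff_sum T \<phi> n z / n \<le> ?I + \<theta>" by linarith
      then have z': "birkhoff_sum T \<phi> n z \<le> n * (?I + \<theta>)" using n1 by (simp add: divide_le_eq mult.commute)
      have "(SUP y\<in>bowen_ball (rho_dist f) T n x \<epsilon>. birkhoff_sum T \<phi> n y) \<le> n * (?I + \<theta>) + n * (2 * g)"
      proof (rule cSUP_least)
        show "bowen_ball (rho_dist f) T n x \<epsilon> \<noteq> {}" using z by blast
        fix y assume y: "y \<in> bowen_ball (rho_dist f) T n x \<epsilon>"
        have "\<bar>birkhoff_sum T \<phi> n x - birkhoff_sum T \<phi> n y\<bar> \<le> n * g" "\<bar>birkhoff_sum T \<phi> n x - birkhoff_sum T \<phi> n z\<bar> \<le> n * g"
          by (rule birkhoff_sum_diff_le[OF g y], assumption) (rule birkhoff_sum_diff_le[OF g z(1)])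
        then show "birkhoff_sum T \<phi> n y \<le> n * (?I + \<theta>) + n * (2 * g)" using z' by (simp add: abs_le_iff)
      qed
      then have "- (t + 2 * g) * n + (SUP y\<in>bowen_ball (rho_dist f) T n x \<epsilon>. birkhoff_sum T \<phi> n y) \<le> n * (?I + \<theta> - t)"
        by (simp add: algebra_simps)
      then show ?thesis by (simp add: weight_def)
    qed
    have "finite F" using E(1) by (simp add: F_def)
    moreover have "(\<Sum>x\<in>F. weight (t + 2 * g) \<phi> \<epsilon> n x) \<le> exp (- \<theta> * n)"
    proof -
      have "(\<Sum>x\<in>F. weight (t + 2 * g) \<phi> \<epsilon> n x) \<le> (\<Sum>x\<in>F. exp (n * (?I + \<theta> - t)))" by (intro sum_mono wle)
      also have "\<dots> = card F * exp (n * (?I + \<theta> - t))" by simp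
      also have "\<dots> \<le> exp (n * r) * exp (n * (?I + \<theta> - t))"
        using E(1,2) card_mono[of E F] by (intro mult_right_mono) (auto simp: F_def)
      also have "\<dots> = exp (n * (r + ?I + \<theta> - t))" by (simp add: exp_add[symmetric] algebra_simps)
      also have "r + ?I + \<theta> - t = - \<theta>" by (simp add: \<theta>_def field_simps)
      finally show ?thesis by (simp add: mult.commute)
    qed
    ultimately show "\<exists>E. finite E \<and> near \<mu> P (2 / real P) n \<subseteq> (\<Union>x\<in>E. bowen_ball (rho_dist f) T n x \<epsilon>) \<and>
       (\<Sum>x\<in>E. weight (t + 2 * g) \<phi> \<epsilon> n x) \<le> exp (- \<theta> * n)" using cov by blast
  qed
qed

section \<open>Summation of local covers over countably many measures\<close>

lemma exp_tail_small:
  assumes "\<theta> > 0" "e > 0"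
  obtains M where "M \<ge> N" "\<And>n. (\<Sum>i\<in>{M..<n}. exp (- \<theta> * real i)) \<le> e"
proof -
  have "norm (exp (- \<theta>)) < 1" using assms by simp
  then have "summable (\<lambda>i. exp (- \<theta>) ^ i)" by (rule summable_geometric)
  then have "summable (\<lambda>i. exp (- \<theta> * real i))" by (simp add: exp_of_nat_mult[symmetric] mult.commute)
  then obtain M where M: "\<And>m n. m \<ge> M \<Longrightarrow> norm (\<Sum>i\<in>{m..<n}. exp (- \<theta> * real i)) < e"
    using assms(2) unfolding summable_Cauchy by blast
  show ?thesis
  proof (rule that[of "max M N"])
    fix n
    show "(\<Sum>i\<in>{max M N..<n}. exp (- \<theta> * real i)) \<le> e"
      using M[OF max.cobounded1, of N n] unfolding real_norm_def by linarith
  qed simp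
qed

text \<open>A Borel-Cantelli argument: each point of \<open>Z\<close> is covered at infinitely many
  lengths by the family of one \<nu>, so any tail of the families still covers. The tail of \<nu>
  starts where its sum is at most \<open>e * (1/2) ^ Suc k\<close>, with \<open>k\<close> the index
  of \<nu> in an enumeration of \<open>D\<close>.\<close>

lemma cover_mass_at_le_sums:
  assumes D: "countable D" and z: "\<And>\<nu>. \<nu> \<in> D \<Longrightarrow> \<theta> \<nu> > (0::real)"
    and E: "\<And>\<nu> n. \<nu> \<in> D \<Longrightarrow> n \<ge> P \<nu> \<Longrightarrow> finite (E \<nu> n) \<and> (\<Sum>x\<in>E \<nu> n. weight t \<phi> \<epsilon> n x) \<le> exp (- \<theta> \<nu> * n)"
    and Z: "\<And>x. x \<in> Z \<Longrightarrow> \<exists>\<nu>\<in>D. \<forall>N. \<exists>n\<ge>max N (P \<nu>). \<exists>y\<in>E \<nu> n. x \<in> bowen_ball (rho_dist f) T n y \<epsilon>"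
    and e: "e > 0"
  shows "cover_mass_at (rho_dist f) T Z t \<phi> n0 \<epsilon> \<le> ennreal e"
proof -
  have "\<forall>\<nu>. \<exists>M. \<nu> \<in> D \<longrightarrow> M \<ge> max n0 (P \<nu>) \<and> (\<forall>n. (\<Sum>i\<in>{M..<n}. exp (- \<theta> \<nu> * real i)) \<le> e * (1/2) ^ Suc (to_nat_on D \<nu>))"
  proof
    fix \<nu>
    show "\<exists>M. \<nu> \<in> D \<longrightarrow> M \<ge> max n0 (P \<nu>) \<and> (\<forall>n. (\<Sum>i\<in>{M..<n}. exp (- \<theta> \<nu> * real i)) \<le> e * (1/2) ^ Suc (to_nat_on D \<nu>))"
    proof (cases "\<nu> \<in> D")
      case True
      have "e * (1/2) ^ Suc (to_nat_on D \<nu>) > 0" using e by simp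
      from exp_tail_small[OF z[OF True] this, of "max n0 (P \<nu>)"] show ?thesis by blast
    qed blast
  qed
  then obtain M where M: "\<And>\<nu>. \<nu> \<in> D \<Longrightarrow> M \<nu> \<ge> max n0 (P \<nu>)"
    "\<And>\<nu> n. \<nu> \<in> D \<Longrightarrow> (\<Sum>i\<in>{M \<nu>..<n}. exp (- \<theta> \<nu> * real i)) \<le> e * (1/2) ^ Suc (to_nat_on D \<nu>)" by metis
  \<comment> \<open>The measure is kept as a first index so that the sums split; forgetting it
    merges equal pairs and can only reduce the sum.\<close>
  define S where "S = (SIGMA \<nu>:D. SIGMA n:{M \<nu>..}. E \<nu> n)"
  define K where "K = snd ` S"
  have fE: "finite (E \<nu> n)" if "\<nu> \<in> D" "n \<ge> M \<nu>" for \<nu> n using E[of \<nu> n] M(1)[of \<nu>] that by auto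
  have "countable S" unfolding S_def using fE
    by (intro countable_SIGMA D) (auto intro: countable_finite)
  then have "countable K" unfolding K_def by (rule countable_image)
  moreover have "\<forall>(m, x)\<in>K. m \<ge> n0" using M(1) by (force simp: K_def S_def)
  moreover have "Z \<subseteq> (\<Union>(m, x)\<in>K. bowen_ball (rho_dist f) T m x \<epsilon>)"
  proof
    fix x assume "x \<in> Z"
    from Z[OF this] obtain \<nu> where \<nu>: "\<nu> \<in> D" "\<forall>N. \<exists>n\<ge>max N (P \<nu>). \<exists>y\<in>E \<nu> n. x \<in> bowen_ball (rho_dist f) T n y \<epsilon>" by blast
    then obtain n y where ny: "n \<ge> max (M \<nu>) (P \<nu>)" "y \<in> E \<nu> n" "x \<in> bowen_ball (rho_dist f) T n y \<epsilon>" by blast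
    then have "(\<nu>, n, y) \<in> S" using \<nu>(1) by (simp add: S_def)
    then have "(n, y) \<in> K" unfolding K_def by (force intro: image_eqI[of _ _ "(\<nu>, n, y)"])
    then show "x \<in> (\<Union>(m, x)\<in>K. bowen_ball (rho_dist f) T m x \<epsilon>)" using ny(3) by blast
  qed
  ultimately have KC: "K \<in> ball_covers (rho_dist f) T Z n0 \<epsilon>" by (simp add: ball_covers_def)
  have wnn: "0 \<le> weight t \<phi> \<epsilon> n x" for n x by (simp add: weight_def)
  have fin: "(\<Sum>p\<in>F. weight t \<phi> \<epsilon> (fst p) (snd p)) \<le> e" if F: "finite F" "F \<subseteq> K" for F
  proof -
    obtain C where C: "C \<subseteq> S" "finite C" "F = snd ` C" using finite_subset_image[OF F(1)] F(2) unfolding K_def by blast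
    define N where "N = Suc (Max (insert 0 ((\<lambda>c. fst (snd c)) ` C)))"
    have N: "fst (snd c) < N" if "c \<in> C" for c
    proof -
      have "fst (snd c) \<le> Max (insert 0 ((\<lambda>c. fst (snd c)) ` C))" using C(2) that by (intro Max_ge) auto
      then show ?thesis by (simp add: N_def)
    qed
    define D0 where "D0 = fst ` C"
    have D0: "finite D0" "D0 \<subseteq> D" using C by (auto simp: D0_def S_def)
    have "C \<subseteq> (SIGMA \<nu>:D0. SIGMA n:{M \<nu>..<N}. E \<nu> n)"
    proof
      fix c assume c: "c \<in> C"
      obtain \<nu> n x where cc: "c = (\<nu>, n, x)" by (cases c)
      show "c \<in> (SIGMA \<nu>:D0. SIGMA n:{M \<nu>..<N}. E \<nu> n)"
        using c C(1) N[OF c] cc by (force simp: D0_def S_def image_iff)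
    qed
    moreover have fS: "finite (SIGMA \<nu>:D0. SIGMA n:{M \<nu>..<N}. E \<nu> n)"
      using D0 fE by (intro finite_SigmaI) auto
    ultimately have "(\<Sum>c\<in>C. weight t \<phi> \<epsilon> (fst (snd c)) (snd (snd c)))
        \<le> (\<Sum>c\<in>(SIGMA \<nu>:D0. SIGMA n:{M \<nu>..<N}. E \<nu> n). weight t \<phi> \<epsilon> (fst (snd c)) (snd (snd c)))"
      using wnn by (intro sum_mono2) auto
    also have "\<dots> = (\<Sum>\<nu>\<in>D0. \<Sum>c\<in>(SIGMA n:{M \<nu>..<N}. E \<nu> n). weight t \<phi> \<epsilon> (fst c) (snd c))"
      using D0 fE by (subst sum.Sigma) (auto simp: case_prod_beta intro!: finite_SigmaI)
    also have "\<dots> = (\<Sum>\<nu>\<in>D0. \<Sum>n\<in>{M \<nu>..<N}. \<Sum>x\<in>E \<nu> n. weight t \<phi> \<epsilon> n x)"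
      using D0 fE by (intro sum.cong refl) (subst sum.Sigma, auto simp: case_prod_beta)
    also have "\<dots> \<le> (\<Sum>\<nu>\<in>D0. \<Sum>n\<in>{M \<nu>..<N}. exp (- \<theta> \<nu> * real n))"
      using E M(1) D0(2) by (intro sum_mono) (fastforce)
    also have "\<dots> \<le> (\<Sum>\<nu>\<in>D0. e * (1/2) ^ Suc (to_nat_on D \<nu>))"
      using M(2) D0(2) by (intro sum_mono) blast
    also have "\<dots> = e * (\<Sum>k\<in>to_nat_on D ` D0. (1/2) ^ Suc k)"
      using inj_on_subset[OF inj_on_to_nat_on[OF D] D0(2)] by (simp add: sum.reindex sum_distrib_left)
    also have "(\<Sum>k\<in>to_nat_on D ` D0. (1/2::real) ^ Suc k) \<le> (\<Sum>k. (1/2) ^ Suc k)"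
      using summable_geometric[of "1/2::real"] D0(1) by (intro sum_le_suminf) (auto intro: summable_mult)
    also have "(\<Sum>k. (1/2::real) ^ Suc k) = 1" using power_half_series by (simp add: sums_iff)
    finally have "(\<Sum>c\<in>C. weight t \<phi> \<epsilon> (fst (snd c)) (snd (snd c))) \<le> e" using e by simp
    moreover have "(\<Sum>p\<in>snd ` C. weight t \<phi> \<epsilon> (fst p) (snd p)) \<le> (\<Sum>c\<in>C. weight t \<phi> \<epsilon> (fst (snd c)) (snd (snd c)))"
      using sum_image_le[OF C(2), of "\<lambda>p. weight t \<phi> \<epsilon> (fst p) (snd p)" snd] wnn by (simp add: o_def)
    ultimately show ?thesis using C(3) by simp
  qed
  have "cover_mass_at (rho_dist f) T Z t \<phi> n0 \<epsilon> \<le> (\<Sum>\<^sub>\<infinity>(m, x)\<in>K. ennreal (weight t \<phi> \<epsilon> m x))"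
    unfolding cover_mass_at_def weight_def using KC by (rule INF_lower)
  also have "\<dots> \<le> ennreal e"
    unfolding nonneg_infsum_complete[OF zero_le]
  proof (rule SUP_least)
    fix F assume "F \<in> {F. finite F \<and> F \<subseteq> K}"
    then have "ennreal (\<Sum>p\<in>F. weight t \<phi> \<epsilon> (fst p) (snd p)) \<le> ennreal e" using fin[of F] by (intro ennreal_leI) auto
    then show "(\<Sum>(m, x)\<in>F. ennreal (weight t \<phi> \<epsilon> m x)) \<le> ennreal e"
      using wnn by (simp add: case_prod_beta sum_ennreal)
  qed
  finally show ?thesis .
qed

lemma pressure_at_le:
  assumes "\<And>n e. e > 0 \<Longrightarrow> cover_mass_at d T Z t \<phi> n \<epsilon> \<le> ennreal e"
  shows "pressure_at d T Z \<phi> \<epsilon> \<le> ereal t"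
proof -
  have "cover_mass_at d T Z t \<phi> n \<epsilon> = 0" for n
  proof -
    have "cover_mass_at d T Z t \<phi> n \<epsilon> \<le> 0 + ennreal e" if "e > 0" for e :: real using assms[OF that] by simp
    then have "cover_mass_at d T Z t \<phi> n \<epsilon> \<le> 0" by (rule ennreal_le_epsilon)
    then show ?thesis by simp
  qed
  then have "cover_mass d T Z t \<phi> \<epsilon> = 0" by (simp add: cover_mass_def)
  then show ?thesis unfolding pressure_at_def by (intro INF_lower2[of t]) auto
qed

text \<open>The size \<open>P\<close> of the controlled neighbourhood depends on the measure. The
  measures over \<open>y\<close> are therefore sorted by \<open>P\<close>, and each class receives
  countably many representatives at its own accuracy \<open>1 / P\<close>. The term
  \<open>2 * g\<close> is the price for working at a fixed radius.\<close>

theorem pressure_upper_bound: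
  fixes \<Xi> :: "'a measure \<Rightarrow> 'b::metric_space"
  assumes \<Xi>: "continuous_map weak_star euclidean \<Xi>" and \<phi>: "continuous_on UNIV \<phi>" and \<epsilon>: "\<epsilon> > 0"
    and y: "y \<in> C"
    and t: "\<And>\<mu>. \<mu> \<in> inv_prob T \<Longrightarrow> \<Xi> \<mu> = y \<Longrightarrow> metric_entropy T \<mu> + ereal (integral\<^sup>L \<mu> \<phi>) < ereal t"
    and g: "\<And>x y. rho_dist f x y \<le> \<epsilon> \<Longrightarrow> \<bar>\<phi> x - \<phi> y\<bar> \<le> g"
  shows "pressure_at (rho_dist f) T (Delta_sub T \<Xi> C) \<phi> \<epsilon> \<le> ereal (t + 2 * g)"
proof -
  define K where "K = {\<mu> \<in> inv_prob T. \<Xi> \<mu> = y}"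
  have "\<forall>\<mu>. \<exists>P \<theta>. \<mu> \<in> K \<longrightarrow> P \<ge> 1 \<and> \<theta> > 0 \<and> (\<forall>n\<ge>P. \<exists>E. finite E \<and>
       near \<mu> P (2 / real P) n \<subseteq> (\<Union>x\<in>E. bowen_ball (rho_dist f) T n x \<epsilon>) \<and>
       (\<Sum>x\<in>E. weight (t + 2 * g) \<phi> \<epsilon> n x) \<le> exp (- \<theta> * n))"
  proof
    fix \<mu>
    show "\<exists>P \<theta>. \<mu> \<in> K \<longrightarrow> P \<ge> 1 \<and> \<theta> > 0 \<and> (\<forall>n\<ge>P. \<exists>E. finite E \<and>
       near \<mu> P (2 / real P) n \<subseteq> (\<Union>x\<in>E. bowen_ball (rho_dist f) T n x \<epsilon>) \<and>
       (\<Sum>x\<in>E. weight (t + 2 * g) \<phi> \<epsilon> n x) \<le> exp (- \<theta> * n))"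
    proof (cases "\<mu> \<in> K")
      case True
      then have \<mu>: "\<mu> \<in> inv_prob T" "metric_entropy T \<mu> + ereal (integral\<^sup>L \<mu> \<phi>) < ereal t" using t by (auto simp: K_def)
      from local_cover[OF \<mu>(1) \<phi> \<epsilon> \<mu>(2) g] show ?thesis by metis
    qed blast
  qed
  then obtain P \<theta> where P: "\<And>\<mu>. \<mu> \<in> K \<Longrightarrow> P \<mu> \<ge> (1::nat)" and \<theta>: "\<And>\<mu>. \<mu> \<in> K \<Longrightarrow> \<theta> \<mu> > (0::real)"
    and EX: "\<And>\<mu> n. \<mu> \<in> K \<Longrightarrow> n \<ge> P \<mu> \<Longrightarrow> \<exists>E. finite E \<and>
       near \<mu> (P \<mu>) (2 / real (P \<mu>)) n \<subseteq> (\<Union>x\<in>E. bowen_ball (rho_dist f) T n x \<epsilon>) \<and>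
       (\<Sum>x\<in>E. weight (t + 2 * g) \<phi> \<epsilon> n x) \<le> exp (- \<theta> \<mu> * n)" by metis
  then obtain E where E: "\<And>\<mu> n. \<mu> \<in> K \<Longrightarrow> n \<ge> P \<mu> \<Longrightarrow> finite (E \<mu> n) \<and>
       near \<mu> (P \<mu>) (2 / real (P \<mu>)) n \<subseteq> (\<Union>x\<in>E \<mu> n. bowen_ball (rho_dist f) T n x \<epsilon>) \<and>
       (\<Sum>x\<in>E \<mu> n. weight (t + 2 * g) \<phi> \<epsilon> n x) \<le> exp (- \<theta> \<mu> * n)" by metis
  have "\<forall>p. \<exists>D. countable D \<and> D \<subseteq> {\<mu> \<in> K. P \<mu> = Suc p} \<and>
    (\<forall>\<mu>. \<mu> \<in> {\<mu> \<in> K. P \<mu> = Suc p} \<longrightarrow> (\<exists>\<nu>\<in>D. \<forall>k<Suc p. \<bar>integral\<^sup>L \<nu> (f k) - integral\<^sup>L \<mu> (f k)\<bar> < 1 / real (Suc p)))"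
  proof
    fix p
    have "Suc p \<ge> 1" by simp
    show "\<exists>D. countable D \<and> D \<subseteq> {\<mu> \<in> K. P \<mu> = Suc p} \<and>
      (\<forall>\<mu>. \<mu> \<in> {\<mu> \<in> K. P \<mu> = Suc p} \<longrightarrow> (\<exists>\<nu>\<in>D. \<forall>k<Suc p. \<bar>integral\<^sup>L \<nu> (f k) - integral\<^sup>L \<mu> (f k)\<bar> < 1 / real (Suc p)))"
    proof (rule countable_representatives[OF \<open>Suc p \<ge> 1\<close>, of "{\<mu> \<in> K. P \<mu> = Suc p}"])
      fix D assume D: "countable D" "D \<subseteq> {\<mu> \<in> K. P \<mu> = Suc p}"
        "\<And>\<mu>. \<mu> \<in> {\<mu> \<in> K. P \<mu> = Suc p} \<Longrightarrow> \<exists>\<nu>\<in>D. \<forall>k<Suc p. \<bar>integral\<^sup>L \<nu> (f k) - integral\<^sup>L \<mu> (f k)\<bar> < 1 / real (Suc p)"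
      show ?thesis by (intro exI[of _ D] conjI allI impI D)
    qed
  qed
  from choice[OF this] obtain Dp where Dp0: "\<forall>p. countable (Dp p) \<and> Dp p \<subseteq> {\<mu> \<in> K. P \<mu> = Suc p} \<and>
    (\<forall>\<mu>. \<mu> \<in> {\<mu> \<in> K. P \<mu> = Suc p} \<longrightarrow> (\<exists>\<nu>\<in>Dp p. \<forall>k<Suc p. \<bar>integral\<^sup>L \<nu> (f k) - integral\<^sup>L \<mu> (f k)\<bar> < 1 / real (Suc p)))" ..
  have Dp: "countable (Dp p)" "Dp p \<subseteq> {\<mu> \<in> K. P \<mu> = Suc p}"
    "\<forall>\<mu>. \<mu> \<in> {\<mu> \<in> K. P \<mu> = Suc p} \<longrightarrow> (\<exists>\<nu>\<in>Dp p. \<forall>k<Suc p. \<bar>integral\<^sup>L \<nu> (f k) - integral\<^sup>L \<mu> (f k)\<bar> < 1 / real (Suc p))" for p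
    by (rule conjunct1[OF spec[OF Dp0]], rule conjunct1[OF conjunct2[OF spec[OF Dp0]]], rule conjunct2[OF conjunct2[OF spec[OF Dp0]]])
  let ?D = "\<Union>p. Dp p"
  have DK: "?D \<subseteq> K" using Dp(2) by auto
  show ?thesis
  proof (rule pressure_at_le, rule cover_mass_at_le_sums[where D="?D" and \<theta>=\<theta> and P=P and E=E])
    show "countable ?D" using Dp(1) by auto
    show "\<theta> \<nu> > 0" if "\<nu> \<in> ?D" for \<nu> using \<theta> DK that by blast
    show "finite (E \<nu> n) \<and> (\<Sum>x\<in>E \<nu> n. weight (t + 2 * g) \<phi> \<epsilon> n x) \<le> exp (- \<theta> \<nu> * n)"
      if "\<nu> \<in> ?D" "n \<ge> P \<nu>" for \<nu> n using E[of \<nu> n] DK that by blast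
    fix x assume "x \<in> Delta_sub T \<Xi> C"
    then have "y \<in> emp_accumulation T \<Xi> x" using y by (auto simp: Delta_sub_def)
    from emp_accumulation_limit[OF \<Xi> this] obtain r \<mu> where r: "strict_mono r" "\<And>n. r n \<ge> 1"
      "wconv (\<lambda>n. empirical T (r n) x) \<mu>" "\<mu> \<in> inv_prob T" "\<Xi> \<mu> = y" by blast
    then have \<mu>K: "\<mu> \<in> K" by (simp add: K_def)
    obtain p where p: "P \<mu> = Suc p" using P[OF \<mu>K] by (cases "P \<mu>") auto
    obtain \<nu> where \<nu>: "\<nu> \<in> Dp p" "\<And>k. k < Suc p \<Longrightarrow> \<bar>integral\<^sup>L \<nu> (f k) - integral\<^sup>L \<mu> (f k)\<bar> < 1 / real (Suc p)"
      using Dp(3)[of p] \<mu>K p by auto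
    have P\<nu>: "P \<nu> = Suc p" "\<nu> \<in> K" using Dp(2)[of p] \<nu>(1) by auto
    have "eventually (\<lambda>n. \<bar>integral\<^sup>L (empirical T (r n) x) (f k) - integral\<^sup>L \<mu> (f k)\<bar> < 1 / real (Suc p)) sequentially" for k
    proof -
      have "(\<lambda>n. integral\<^sup>L (empirical T (r n) x) (f k)) \<longlonglongrightarrow> integral\<^sup>L \<mu> (f k)" using r(3) cont_f by (simp add: wconv_def)
      from tendstoD[OF this, of "1 / real (Suc p)"] show ?thesis by (simp add: dist_real_def)
    qed
    then have ev: "eventually (\<lambda>n. \<forall>k\<in>{..<Suc p}. \<bar>integral\<^sup>L (empirical T (r n) x) (f k) - integral\<^sup>L \<mu> (f k)\<bar> < 1 / real (Suc p)) sequentially"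
      by (intro eventually_ball_finite) auto
    have "\<exists>n\<ge>max N (P \<nu>). \<exists>y\<in>E \<nu> n. x \<in> bowen_ball (rho_dist f) T n y \<epsilon>" for N
    proof -
      obtain m where m: "\<And>n. n \<ge> m \<Longrightarrow> \<forall>k\<in>{..<Suc p}. \<bar>integral\<^sup>L (empirical T (r n) x) (f k) - integral\<^sup>L \<mu> (f k)\<bar> < 1 / real (Suc p)"
        using ev by (auto simp: eventually_sequentially)
      define nn where "nn = r (max m (max N (P \<nu>)))"
      have n: "nn \<ge> max N (P \<nu>)" unfolding nn_def using seq_suble[OF r(1), of "max m (max N (P \<nu>))"] by simp
      have "x \<in> near \<nu> (P \<nu>) (2 / real (P \<nu>)) nn"
        unfolding near_def mem_Collect_eq P\<nu>(1)
      proof (intro allI impI)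
        fix k assume k: "k < Suc p"
        have "\<bar>integral\<^sup>L (empirical T nn x) (f k) - integral\<^sup>L \<mu> (f k)\<bar> < 1 / real (Suc p)" unfolding nn_def using m[of "max m (max N (P \<nu>))"] k by auto
        moreover have "2 / real (Suc p) = 1 / real (Suc p) + 1 / real (Suc p)" by (simp add: add_divide_distrib[symmetric])
        ultimately show "\<bar>integral\<^sup>L (empirical T nn x) (f k) - integral\<^sup>L \<nu> (f k)\<bar> < 2 / real (Suc p)" using \<nu>(2)[OF k] by linarith
      qed
      moreover have "near \<nu> (P \<nu>) (2 / real (P \<nu>)) nn \<subseteq> (\<Union>x\<in>E \<nu> nn. bowen_ball (rho_dist f) T nn x \<epsilon>)"
        using E[OF P\<nu>(2), of nn] n by simp
      ultimately obtain z where "z \<in> E \<nu> nn" "x \<in> bowen_ball (rho_dist f) T nn z \<epsilon>" by blast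
      then show ?thesis using n by blast
    qed
    then show "\<exists>\<nu>\<in>?D. \<forall>N. \<exists>n\<ge>max N (P \<nu>). \<exists>y\<in>E \<nu> n. x \<in> bowen_ball (rho_dist f) T n y \<epsilon>" using \<nu>(1) by blast
  qed
qed

end

section \<open>Gluing orbit segments\<close>

text \<open>\<open>B\<close> holds the admissible blocks as pairs of a length and the set of points
  that follow the block. A derived pair carries the total length because this is the time at which
  the next block starts.\<close>

inductive glued :: "('a \<Rightarrow> 'a) \<Rightarrow> (nat \<times> 'a set) set \<Rightarrow> nat \<Rightarrow> 'a set \<Rightarrow> bool"
  for T :: "'a \<Rightarrow> 'a" and B :: "(nat \<times> 'a set) set" where
  glued_empty: "glued T B 0 UNIV"
| glued_snoc: "glued T B k S \<Longrightarrow> (n, R) \<in> B \<Longrightarrow> glued T B (k + n) (S \<inter> (T ^^ k) -` R)"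

lemma glued_append:
  assumes "glued T B n S" "glued T B m R"
  shows "glued T B (m + n) (R \<inter> (T ^^ m) -` S)"
  using assms(1)
proof induction
  case glued_empty
  then show ?case using assms(2) by simp
next
  case (glued_snoc k S n Q)
  have "R \<inter> (T ^^ m) -` (S \<inter> (T ^^ k) -` Q) = (R \<inter> (T ^^ m) -` S) \<inter> (T ^^ (m + k)) -` Q"
    by (auto simp: add.commute[of m k] funpow_add)
  moreover have "glued T B (m + k + n) ((R \<inter> (T ^^ m) -` S) \<inter> (T ^^ (m + k)) -` Q)"
    using glued.glued_snoc[OF glued_snoc.IH glued_snoc.hyps(2)] .
  ultimately show ?case by (simp add: add.assoc)
qed

lemma glued_single: "(n, R) \<in> B \<Longrightarrow> glued T B n R"
  using glued_snoc[OF glued_empty, of n R B T] by simp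

definition shadow_blocks ::
    "('a \<Rightarrow> 'a \<Rightarrow> real) \<Rightarrow> ('a \<Rightarrow> 'a) \<Rightarrow> (nat \<Rightarrow> nat) \<Rightarrow> (real \<Rightarrow> nat) \<Rightarrow> (nat \<times> 'a set) set" where
  "shadow_blocks d T g m = {(n, g_ball d T g n x \<epsilon>) | n x \<epsilon>. \<epsilon> > 0 \<and> n \<ge> m \<epsilon> \<and> n \<ge> 1}"

text \<open>Translates derivations into the indexed form of \<open>almost_product\<close>, with
  indices from 1; an appended block becomes a function update at \<open>Suc k\<close>.\<close>

lemma glued_shadow_blocks:
  assumes "glued T (shadow_blocks d T g m) N S"
  shows "\<exists>k x \<epsilon> n. (\<forall>j\<in>{1..k}. \<epsilon> j > 0 \<and> n j \<ge> m (\<epsilon> j) \<and> n j \<ge> (1::nat)) \<and> N = (\<Sum>i\<in>{1..<Suc k}. n i) \<and>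
     S = (\<Inter>j\<in>{1..k}. (T ^^ (\<Sum>i\<in>{1..<j}. n i)) -` g_ball d T g (n j) (x j) (\<epsilon> j))"
  using assms
proof induction
  case glued_empty
  show ?case by (rule exI[of _ 0]) auto
next
  case (glued_snoc N S n0 R)
  then obtain x0 \<epsilon>0 where R: "R = g_ball d T g n0 x0 \<epsilon>0" "\<epsilon>0 > 0" "n0 \<ge> m \<epsilon>0" "n0 \<ge> 1"
    by (auto simp: shadow_blocks_def)
  from glued_snoc.IH obtain k x \<epsilon> n where IH:
    "\<forall>j\<in>{1..k}. \<epsilon> j > 0 \<and> n j \<ge> m (\<epsilon> j) \<and> n j \<ge> (1::nat)" "N = (\<Sum>i\<in>{1..<Suc k}. n i)"
    "S = (\<Inter>j\<in>{1..k}. (T ^^ (\<Sum>i\<in>{1..<j}. n i)) -` g_ball d T g (n j) (x j) (\<epsilon> j))"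
    by (elim exE conjE) (rule that; assumption)
  let ?x = "x(Suc k := x0)" and ?\<epsilon> = "\<epsilon>(Suc k := \<epsilon>0)" and ?n = "n(Suc k := n0)"
  have I: "{1..Suc k} = insert (Suc k) {1..k}" by auto
  have s: "(\<Sum>i\<in>{1..<j}. ?n i) = (\<Sum>i\<in>{1..<j}. n i)" if "j \<le> Suc k" for j
    using that by (intro sum.cong) auto
  have "\<forall>j\<in>{1..Suc k}. ?\<epsilon> j > 0 \<and> ?n j \<ge> m (?\<epsilon> j) \<and> ?n j \<ge> 1"
    unfolding I using IH(1) R by auto
  moreover have "N + n0 = (\<Sum>i\<in>{1..<Suc (Suc k)}. ?n i)"
    using s[of "Suc k"] IH(2) by simp
  moreover have "S \<inter> (T ^^ N) -` R = (\<Inter>j\<in>{1..Suc k}. (T ^^ (\<Sum>i\<in>{1..<j}. ?n i)) -` g_ball d T g (?n j) (?x j) (?\<epsilon> j))"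
  proof -
    have "(\<Inter>j\<in>{1..k}. (T ^^ (\<Sum>i\<in>{1..<j}. ?n i)) -` g_ball d T g (?n j) (?x j) (?\<epsilon> j)) = S"
      unfolding IH(3) by (rule INF_cong) (simp_all add: s)
    then show ?thesis unfolding I using s[of "Suc k"] by (simp add: IH(2) R(1) Int_commute)
  qed
  ultimately show ?case by (intro exI[of _ "Suc k"] exI[of _ ?x] exI[of _ ?\<epsilon>] exI[of _ ?n] conjI)
qed

locale specification_system = compact_system T f
  for T :: "'a::metric_space \<Rightarrow> 'a" and f +
  fixes g :: "nat \<Rightarrow> nat" and m :: "real \<Rightarrow> nat"
  assumes g: "blow_up g"
    and m: "\<And>k (x :: nat \<Rightarrow> 'a) (\<epsilon> :: nat \<Rightarrow> real) (n :: nat \<Rightarrow> nat).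
      k \<ge> 1 \<Longrightarrow> \<forall>j\<in>{1..k}. \<epsilon> j > 0 \<and> n j \<ge> m (\<epsilon> j) \<and> n j \<ge> 1 \<Longrightarrow>
      (\<Inter>j\<in>{1..k}. (T ^^ (\<Sum>i\<in>{1..<j}. n i)) -` g_ball (rho_dist f) T g (n j) (x j) (\<epsilon> j)) \<noteq> {}"
begin

abbreviation "Glued \<equiv> glued T (shadow_blocks (rho_dist f) T g m)"

lemma glued_nonempty:
  assumes "Glued n S" shows "S \<noteq> {}"
proof -
  from glued_shadow_blocks[OF assms] obtain k x \<epsilon> l where *:
    "\<forall>j\<in>{1..k}. \<epsilon> j > 0 \<and> l j \<ge> m (\<epsilon> j) \<and> l j \<ge> (1::nat)" "n = (\<Sum>i\<in>{1..<Suc k}. l i)"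
    "S = (\<Inter>j\<in>{1..k}. (T ^^ (\<Sum>i\<in>{1..<j}. l i)) -` g_ball (rho_dist f) T g (l j) (x j) (\<epsilon> j))"
    by (elim exE conjE) (rule that; assumption)
  show ?thesis
  \<comment> \<open>The almost product property speaks of at least one block; the empty
    concatenation is the whole space.\<close>
  proof (cases "k = 0")
    case False
    then show ?thesis unfolding *(3) by (intro m *(1)) simp
  qed (use * in simp)
qed

lemma glued_closed:
  assumes "Glued n S" shows "closed S"
  using assms
proof induction
  case (glued_snoc k S n R)
  then have "closed R" using closed_g_ball by (auto simp: shadow_blocks_def)
  then have "closed ((T ^^ k) -` R)"
    using continuous_closed_vimage[of R "T ^^ k"] cont_iter[of k] by (simp add: continuous_on_eq_continuous_at)
  then show ?case using glued_snoc by blast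
qed simp

text \<open>The members are the letters of the construction: by separation an orbit determines the letters
  it visits, and \<open>ln (card U) / l\<close> plays the role of the entropy.\<close>

definition unit_family :: "real \<Rightarrow> nat \<Rightarrow> 'a set set \<Rightarrow> bool" where
  "unit_family \<epsilon> l U \<longleftrightarrow> finite U \<and> U \<noteq> {} \<and> (\<forall>R\<in>U. Glued l R) \<and>
     (\<forall>R\<in>U. \<forall>Q\<in>U. R \<noteq> Q \<longrightarrow> (\<forall>u\<in>R. \<forall>v\<in>Q. \<exists>i<l. rho_dist f ((T ^^ i) u) ((T ^^ i) v) > \<epsilon>))"

lemma unit_family_sep:
  assumes "unit_family \<epsilon> l U" "R \<in> U" "Q \<in> U" "R \<noteq> Q" "u \<in> R" "v \<in> Q"
  shows "\<exists>i<l. rho_dist f ((T ^^ i) u) ((T ^^ i) v) > \<epsilon>"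
  using assms by (simp add: unit_family_def)

lemma unit_family_unique:
  assumes "unit_family \<epsilon> l U" "\<epsilon> > 0" "R \<in> U" "Q \<in> U" "z \<in> R" "z \<in> Q"
  shows "R = Q"
proof (rule ccontr)
  assume "R \<noteq> Q"
  then obtain i where "rho_dist f ((T ^^ i) z) ((T ^^ i) z) > \<epsilon>"
    using unit_family_sep[OF assms(1,3,4) _ assms(5,6)] by blast
  then show False using assms(2) by simp
qed

text \<open>Concatenations are nonempty, and by separation a common point determines both letters,
  so distinct pairs give distinct sets. Cardinalities multiply and gluing loses no entropy.\<close>

lemma unit_family_concat:
  assumes U: "unit_family \<epsilon> l U" and V: "unit_family \<epsilon> k V" and \<epsilon>: "\<epsilon> > 0"
  defines "W \<equiv> (\<lambda>(R, Q). R \<inter> (T ^^ l) -` Q) ` (U \<times> V)"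
  shows "unit_family \<epsilon> (l + k) W" "card W = card U * card V"
proof -
  have gl: "Glued (l + k) (R \<inter> (T ^^ l) -` Q)" if "R \<in> U" "Q \<in> V" for R Q
    using that U V by (intro glued_append) (auto simp: unit_family_def)
  have sep: "\<exists>i<l + k. rho_dist f ((T ^^ i) u) ((T ^^ i) v) > \<epsilon>"
    if A: "R \<in> U" "Q \<in> V" "R' \<in> U" "Q' \<in> V" "(R, Q) \<noteq> (R', Q')" "u \<in> R \<inter> (T ^^ l) -` Q" "v \<in> R' \<inter> (T ^^ l) -` Q'"
    for R Q R' Q' u v
  proof (cases "R = R'")
    case False
    then obtain i where "i < l" "rho_dist f ((T ^^ i) u) ((T ^^ i) v) > \<epsilon>"
      using unit_family_sep[OF U A(1,3) False, of u v] A(6,7) by blast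
    then show ?thesis by (intro exI[of _ i]) simp
  next
    case True
    then have ne: "Q \<noteq> Q'" using A by simp
    have "(T ^^ l) u \<in> Q" "(T ^^ l) v \<in> Q'" using A by auto
    then obtain i where i: "i < k" "rho_dist f ((T ^^ i) ((T ^^ l) u)) ((T ^^ i) ((T ^^ l) v)) > \<epsilon>"
      using unit_family_sep[OF V A(2,4) ne] by blast
    then show ?thesis by (intro exI[of _ "i + l"]) (simp add: funpow_add)
  qed
  have inj: "inj_on (\<lambda>(R, Q). R \<inter> (T ^^ l) -` Q) (U \<times> V)"
  proof (rule inj_onI, clarify)
    fix R Q R' Q' assume a: "R \<in> U" "Q \<in> V" "R' \<in> U" "Q' \<in> V"
      and eq: "R \<inter> (T ^^ l) -` Q = R' \<inter> (T ^^ l) -` Q'"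
    obtain z where z: "z \<in> R \<inter> (T ^^ l) -` Q" using glued_nonempty[OF gl[OF a(1,2)]] by blast
    then have z': "z \<in> R' \<inter> (T ^^ l) -` Q'" using eq by simp
    have "R = R'" by (rule unit_family_unique[OF U \<epsilon> a(1,3)]) (use z z' in auto)
    moreover have "Q = Q'" by (rule unit_family_unique[OF V \<epsilon> a(2,4)]) (use z z' in auto)
    ultimately show "R = R' \<and> Q = Q'" by simp
  qed
  show "card W = card U * card V" unfolding W_def by (simp add: card_image[OF inj] card_cartesian_product)
  show "unit_family \<epsilon> (l + k) W"
    unfolding unit_family_def
  proof (intro conjI ballI impI)
    show "finite W" "W \<noteq> {}" using U V by (auto simp: W_def unit_family_def)
    fix S assume "S \<in> W"
    then obtain R Q where S: "R \<in> U" "Q \<in> V" "S = R \<inter> (T ^^ l) -` Q" by (auto simp: W_def)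
    then show "Glued (l + k) S" using gl by simp
    fix S' u v assume "S' \<in> W" "S \<noteq> S'" and uv: "u \<in> S" "v \<in> S'"
    then obtain R' Q' where S': "R' \<in> U" "Q' \<in> V" "S' = R' \<inter> (T ^^ l) -` Q'" by (auto simp: W_def)
    then have "(R, Q) \<noteq> (R', Q')" using S \<open>S \<noteq> S'\<close> by auto
    then show "\<exists>i<l + k. rho_dist f ((T ^^ i) u) ((T ^^ i) v) > \<epsilon>"
      using sep[OF S(1,2) S'(1,2)] uv S(3) S'(3) by simp
  qed
qed

lemma unit_family_empty: "\<epsilon> > 0 \<Longrightarrow> unit_family \<epsilon> 0 {UNIV}"
  by (simp add: unit_family_def glued_empty)

lemma abs_add_diff_le: "\<bar>a - x\<bar> \<le> d \<Longrightarrow> \<bar>b - y\<bar> \<le> e \<Longrightarrow> \<bar>a + b - (x + y)\<bar> \<le> d + (e :: real)"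
  by linarith

lemma unit_families_concat:
  assumes I: "finite I" and \<epsilon>: "\<epsilon> > 0"
    and U: "\<And>i. i \<in> I \<Longrightarrow> unit_family \<epsilon> (n i) (U i)"
    and b: "\<And>i R u h. i \<in> I \<Longrightarrow> R \<in> U i \<Longrightarrow> u \<in> R \<Longrightarrow> h \<in> H \<Longrightarrow> \<bar>birkhoff_sum T h (n i) u - J i h\<bar> \<le> (e i :: real)"
  shows "\<exists>W. unit_family \<epsilon> (\<Sum>i\<in>I. n i) W \<and> ln (card W) = (\<Sum>i\<in>I. ln (card (U i))) \<and>
    (\<forall>R\<in>W. \<forall>u\<in>R. \<forall>h\<in>H. \<bar>birkhoff_sum T h (\<Sum>i\<in>I. n i) u - (\<Sum>i\<in>I. J i h)\<bar> \<le> (\<Sum>i\<in>I. e i))"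
  using I U b
proof (induction I rule: finite_induct)
  case empty
  show ?case by (rule exI[of _ "{UNIV}"]) (simp add: unit_family_empty \<epsilon> birkhoff_sum_def)
next
  case (insert i I)
  have "\<exists>W. unit_family \<epsilon> (\<Sum>i\<in>I. n i) W \<and> ln (card W) = (\<Sum>i\<in>I. ln (card (U i))) \<and>
    (\<forall>R\<in>W. \<forall>u\<in>R. \<forall>h\<in>H. \<bar>birkhoff_sum T h (\<Sum>i\<in>I. n i) u - (\<Sum>i\<in>I. J i h)\<bar> \<le> (\<Sum>i\<in>I. e i))"
    using insert.prems by (intro insert.IH) auto
  then obtain W where W: "unit_family \<epsilon> (\<Sum>i\<in>I. n i) W" "ln (card W) = (\<Sum>i\<in>I. ln (card (U i)))"
    "\<forall>R\<in>W. \<forall>u\<in>R. \<forall>h\<in>H. \<bar>birkhoff_sum T h (\<Sum>i\<in>I. n i) u - (\<Sum>i\<in>I. J i h)\<bar> \<le> (\<Sum>i\<in>I. e i)"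
    by (elim exE conjE) (rule that; assumption)
  have Ui: "unit_family \<epsilon> (n i) (U i)" by (rule insert.prems) simp
  let ?W = "(\<lambda>(R, Q). R \<inter> (T ^^ n i) -` Q) ` (U i \<times> W)"
  note c = unit_family_concat[OF Ui W(1) \<epsilon>]
  have s: "(\<Sum>i\<in>insert i I. n i) = n i + (\<Sum>i\<in>I. n i)" using insert.hyps by simp
  show ?case
  proof (intro exI[of _ ?W] conjI ballI)
    show "unit_family \<epsilon> (\<Sum>i\<in>insert i I. n i) ?W" unfolding s by (rule c)
    have "card (U i) > 0" "card W > 0" using Ui W(1) by (auto simp: unit_family_def card_gt_0_iff)
    then show "ln (card ?W) = (\<Sum>i\<in>insert i I. ln (card (U i)))"
      unfolding c(2) using insert.hyps W(2) by (simp add: ln_mult)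
    fix S u h assume "S \<in> ?W" and u: "u \<in> S" and h: "h \<in> H"
    then obtain R Q where S: "R \<in> U i" "Q \<in> W" "S = R \<inter> (T ^^ n i) -` Q" by auto
    have "\<bar>birkhoff_sum T h (n i) u - J i h\<bar> \<le> e i" using u S h by (intro insert.prems(2)[of i R]) auto
    moreover have "\<bar>birkhoff_sum T h (\<Sum>i\<in>I. n i) ((T ^^ n i) u) - (\<Sum>i\<in>I. J i h)\<bar> \<le> (\<Sum>i\<in>I. e i)"
      using W(3) S u h by auto
    moreover have "(\<Sum>i\<in>insert i I. J i h) = J i h + (\<Sum>i\<in>I. J i h)" "(\<Sum>i\<in>insert i I. e i) = e i + (\<Sum>i\<in>I. e i)"
      using insert.hyps by simp_all
    ultimately show "\<bar>birkhoff_sum T h (\<Sum>i\<in>insert i I. n i) u - (\<Sum>i\<in>insert i I. J i h)\<bar> \<le> (\<Sum>i\<in>insert i I. e i)"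
      unfolding s birkhoff_sum_add by (simp only: abs_add_diff_le)
  qed
qed

section \<open>Letters obtained from one ergodic measure\<close>

lemma g_ball_birkhoff:
  fixes h :: "'a \<Rightarrow> real" and z B :: real
  assumes y: "y \<in> g_ball (rho_dist f) T g n x \<epsilon>"
    and h: "\<And>u v. rho_dist f u v \<le> \<epsilon> \<Longrightarrow> \<bar>h u - h v\<bar> \<le> z" "\<And>u. \<bar>h u\<bar> \<le> B" and z: "z \<ge> 0"
  shows "\<bar>birkhoff_sum T h n x - birkhoff_sum T h n y\<bar> \<le> n * z + 2 * B * g n"
proof -
  obtain L where L: "L \<subseteq> {..<n}" "card ({..<n} - L) \<le> g n" "\<And>j. j \<in> L \<Longrightarrow> rho_dist f ((T ^^ j) x) ((T ^^ j) y) \<le> \<epsilon>"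
    using y by (auto simp: g_ball_def)
  have B: "B \<ge> 0" using h(2)[of x] by linarith
  have "birkhoff_sum T h n x - birkhoff_sum T h n y = (\<Sum>i<n. h ((T ^^ i) x) - h ((T ^^ i) y))"
    by (simp add: birkhoff_sum_def sum_subtractf)
  also have "\<bar>\<dots>\<bar> \<le> (\<Sum>i<n. \<bar>h ((T ^^ i) x) - h ((T ^^ i) y)\<bar>)" by (rule sum_abs)
  also have "\<dots> \<le> (\<Sum>i<n. z + (if i \<in> L then 0 else 2 * B))"
  proof (rule sum_mono)
    fix i
    have "\<bar>h ((T ^^ i) x) - h ((T ^^ i) y)\<bar> \<le> 2 * B" using h(2)[of "(T ^^ i) x"] h(2)[of "(T ^^ i) y"] by linarith
    then show "\<bar>h ((T ^^ i) x) - h ((T ^^ i) y)\<bar> \<le> z + (if i \<in> L then 0 else 2 * B)"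
      using h(1)[OF L(3), of i] z by auto
  qed
  also have "\<dots> = n * z + (\<Sum>i<n. if i \<in> L then 0 else 2 * B)" by (simp add: sum.distrib)
  also have "(\<Sum>i<n. if i \<in> L then 0 else 2 * B) = (\<Sum>i\<in>{..<n} - L. 2 * B)"
    by (intro sum.mono_neutral_cong_right) auto
  also have "\<dots> \<le> 2 * B * g n" using L(2) B by (simp add: mult_left_mono mult.commute)
  finally show ?thesis by simp
qed

text \<open>This is why separation at a positive proportion of times is required. Two shadowing
  orbits spoil at most \<open>2 * g n\<close> times, fewer than \<delta> n, and at a remaining time
  the triangle inequality leaves \<epsilon> - 2 e, which is at least \<epsilon> / 3.\<close>

lemma g_ball_separated:
  fixes \<delta> \<epsilon> e :: real
  assumes sep: "separated_pts (rho_dist f) T \<delta> n \<epsilon> x y" and gn: "2 * g n < \<delta> * n"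
    and u: "u \<in> g_ball (rho_dist f) T g n x e" and v: "v \<in> g_ball (rho_dist f) T g n y e" and e: "3 * e \<le> \<epsilon>"
  shows "\<exists>i<n. rho_dist f ((T ^^ i) u) ((T ^^ i) v) > \<epsilon> / 3"
proof -
  obtain L where L: "L \<subseteq> {..<n}" "card ({..<n} - L) \<le> g n" "\<And>j. j \<in> L \<Longrightarrow> rho_dist f ((T ^^ j) x) ((T ^^ j) u) \<le> e"
    using u by (auto simp: g_ball_def)
  obtain M where M: "M \<subseteq> {..<n}" "card ({..<n} - M) \<le> g n" "\<And>j. j \<in> M \<Longrightarrow> rho_dist f ((T ^^ j) y) ((T ^^ j) v) \<le> e"
    using v by (auto simp: g_ball_def)
  let ?S = "{j. j < n \<and> rho_dist f ((T ^^ j) x) ((T ^^ j) y) > \<epsilon>}"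
  have "\<not> ?S \<subseteq> ({..<n} - L) \<union> ({..<n} - M)"
  proof
    assume "?S \<subseteq> ({..<n} - L) \<union> ({..<n} - M)"
    then have "card ?S \<le> card (({..<n} - L) \<union> ({..<n} - M))" by (intro card_mono) auto
    also have "\<dots> \<le> card ({..<n} - L) + card ({..<n} - M)" by (rule card_Un_le)
    also have "\<dots> \<le> 2 * g n" using L(2) M(2) by simp
    finally have "real (card ?S) \<le> real (2 * g n)" by (simp only: of_nat_le_iff)
    then show False using sep gn unfolding separated_pts_def by simp
  qed
  then obtain j where j: "j < n" "rho_dist f ((T ^^ j) x) ((T ^^ j) y) > \<epsilon>" "j \<in> L" "j \<in> M" by blast
  have "rho_dist f ((T ^^ j) x) ((T ^^ j) y) \<le> rho_dist f ((T ^^ j) x) ((T ^^ j) u) + rho_dist f ((T ^^ j) u) ((T ^^ j) v) + rho_dist f ((T ^^ j) v) ((T ^^ j) y)"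
    using rho_triangle[of "(T ^^ j) x" "(T ^^ j) y" "(T ^^ j) u"] rho_triangle[of "(T ^^ j) u" "(T ^^ j) y" "(T ^^ j) v"] by linarith
  then have "rho_dist f ((T ^^ j) u) ((T ^^ j) v) > \<epsilon> / 3"
    using L(3)[OF j(3)] M(3)[OF j(4)] j(2) e by (simp add: rho_sym[of "(T ^^ j) v"])
  then show ?thesis using j(1) by blast
qed

lemma g_ball_self: "\<epsilon> \<ge> 0 \<Longrightarrow> x \<in> g_ball (rho_dist f) T g n x \<epsilon>"
  unfolding g_ball_def by (auto intro!: exI[of _ "{..<n}"])

lemma eventually_g_small:
  fixes c :: real
  assumes c: "c > 0"
  shows "eventually (\<lambda>n. real (g n) < c * n) sequentially"
proof -
  have "(\<lambda>n. real (g n) / n) \<longlonglongrightarrow> 0" using g by (simp add: blow_up_def)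
  from order_tendstoD(2)[OF this c] have "eventually (\<lambda>n. real (g n) / n < c) sequentially" .
  then show ?thesis
    using eventually_gt_at_top[of 0] by eventually_elim (simp add: divide_less_eq)
qed

text \<open>The letters are g-balls around a large separated set of points with the right empirical
  measure. Shadowing costs a factor of three in the scale and sublinearly many times in the
  averages.\<close>

lemma ergodic_block:
  assumes sepn: "\<forall>F. weak_star_nhd \<nu> F \<longrightarrow> (\<exists>N. \<forall>n\<ge>N. sep_number (rho_dist f) T F \<delta> n \<epsilon>
                \<ge> exp_ereal (ereal (real n) * (metric_entropy T \<nu> - ereal \<eta>)))"
    and pos: "\<delta> > 0" "\<epsilon> > 0" "\<eta> > 0" and \<nu>: "\<nu> \<in> borel_prob"
    and r: "ereal r \<le> metric_entropy T \<nu>"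
    and H: "finite H" "\<And>h. h \<in> H \<Longrightarrow> continuous_on UNIV h" and z: "z > 0"
  shows "\<exists>N. \<forall>n\<ge>N. \<exists>U. unit_family (\<epsilon> / 3) n U \<and> ln (card U) \<ge> n * (r - 2 * \<eta>) \<and>
    (\<forall>R\<in>U. \<forall>u\<in>R. \<forall>h\<in>H. \<bar>birkhoff_sum T h n u - n * integral\<^sup>L \<nu> h\<bar> \<le> n * z)"
proof -
  define F where "F = {\<nu>' \<in> borel_prob. \<forall>h\<in>H. \<bar>integral\<^sup>L \<nu>' h - integral\<^sup>L \<nu> h\<bar> < z / 3}"
  have "weak_star_nhd \<nu> F" unfolding F_def using z by (intro weak_star_nhdI H \<nu>) auto
  with sepn obtain N1 where N1: "\<forall>n\<ge>N1. sep_number (rho_dist f) T F \<delta> n \<epsilon> \<ge> exp_ereal (ereal (real n) * (metric_entropy T \<nu> - ereal \<eta>))" by blast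
  have "\<forall>h. \<exists>B d. h \<in> H \<longrightarrow> B > 0 \<and> (\<forall>x. \<bar>h x\<bar> \<le> B) \<and> d > 0 \<and> (\<forall>x y. rho_dist f x y \<le> d \<longrightarrow> \<bar>h x - h y\<bar> \<le> z / 3)"
  proof
    fix h
    show "\<exists>B d. h \<in> H \<longrightarrow> B > 0 \<and> (\<forall>x. \<bar>h x\<bar> \<le> B) \<and> d > 0 \<and> (\<forall>x y. rho_dist f x y \<le> d \<longrightarrow> \<bar>h x - h y\<bar> \<le> z / 3)"
    proof (cases "h \<in> H")
      case True
      obtain B where "B > 0" "\<And>x. \<bar>h x\<bar> \<le> B" using bounded_cont[OF H(2)[OF True]] by blast
      moreover have "z / 3 > 0" using z by simp
      then obtain d where "d > 0" "\<And>x y. rho_dist f x y \<le> d \<Longrightarrow> \<bar>h x - h y\<bar> \<le> z / 3"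
        using cont_rho_modulus[OF H(2)[OF True]] by blast
      ultimately show ?thesis by blast
    qed blast
  qed
  then obtain Bf df where Bd: "\<And>h. h \<in> H \<Longrightarrow> Bf h > (0::real) \<and> (\<forall>x. \<bar>h x\<bar> \<le> Bf h) \<and> df h > (0::real) \<and> (\<forall>x y. rho_dist f x y \<le> df h \<longrightarrow> \<bar>h x - h y\<bar> \<le> z / 3)"
    by metis
  \<comment> \<open>Small enough for the separation to survive and for every \<open>h\<close> in
    \<open>H\<close> to vary by at most \<open>z / 3\<close>.\<close>
  define e where "e = Min (insert (\<epsilon> / 3) (df ` H))"
  have e: "e > 0" "3 * e \<le> \<epsilon>" "\<And>h. h \<in> H \<Longrightarrow> e \<le> df h"
  proof -
    show "e > 0" unfolding e_def using H(1) pos Bd by (subst Min_gr_iff) auto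
    have "e \<le> \<epsilon> / 3" unfolding e_def using H(1) by (intro Min_le) auto
    then show "3 * e \<le> \<epsilon>" by simp
    show "e \<le> df h" if "h \<in> H" for h unfolding e_def using H(1) that by (intro Min_le) auto
  qed
  \<comment> \<open>The added one lets \<open>B\<close> serve as a divisor even for empty
    \<open>H\<close>.\<close>
  define B where "B = 1 + (\<Sum>h\<in>H. Bf h)"
  have B1: "B \<ge> 1" unfolding B_def using Bd by (simp add: sum_nonneg less_imp_le)
  have B: "\<bar>h x\<bar> \<le> B" if "h \<in> H" for h x
  proof -
    have "Bf h \<le> (\<Sum>h\<in>H. Bf h)" using that Bd H(1) by (intro member_le_sum) (auto intro: less_imp_le)
    moreover have "\<bar>h x\<bar> \<le> Bf h" using Bd[OF that] by blast
    ultimately show ?thesis by (simp add: B_def)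
  qed
  have "eventually (\<lambda>n. n \<ge> N1 \<and> n \<ge> m e \<and> n \<ge> 1 \<and> real (g n) < (\<delta> / 2) * n \<and> real (g n) < (z / (6 * B)) * n) sequentially"
    by (intro eventually_conj eventually_ge_at_top eventually_g_small) (use pos z B1 in simp_all)
  then obtain N where N: "\<And>n. n \<ge> N \<Longrightarrow> n \<ge> N1 \<and> n \<ge> m e \<and> n \<ge> 1 \<and> real (g n) < (\<delta> / 2) * n \<and> real (g n) < (z / (6 * B)) * n"
    by (auto simp: eventually_sequentially)
  show ?thesis
  proof (rule exI[of _ N], intro allI impI)
    fix n assume n: "n \<ge> N"
    from N[OF n] have n1: "n \<ge> N1" "n \<ge> m e" "n \<ge> 1" and gd: "2 * g n < \<delta> * n" and gz0: "real (g n) < (z / (6 * B)) * n" by auto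
    have gz: "2 * B * g n \<le> n * (z / 3)"
    proof -
      have "2 * B * g n \<le> 2 * B * ((z / (6 * B)) * n)" using gz0 B1 by (intro mult_left_mono) auto
      also have "\<dots> = n * (z / 3)" using B1 by simp
      finally show ?thesis .
    qed
    \<comment> \<open>Infinite entropy is allowed here; then \<open>n\<close> has to be positive,
      because \<open>0 * \<infinity>\<close> is 0.\<close>
    have "ereal (exp (n * (r - \<eta>))) \<le> exp_ereal (ereal (real n) * (metric_entropy T \<nu> - ereal \<eta>))"
    proof (cases "metric_entropy T \<nu>")
      case (real h)
      then have "n * (r - \<eta>) \<le> n * (h - \<eta>)" using r by (intro mult_left_mono) auto
      then show ?thesis by (simp add: real exp_ereal_def)
    next
      case PInf
      then show ?thesis using n1(3) by (simp add: exp_ereal_def)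
    next
      case MInf
      then show ?thesis using r by simp
    qed
    also have "\<dots> \<le> sep_number (rho_dist f) T F \<delta> n \<epsilon>" using N1 n1(1) by blast
    finally have "ereal (exp (n * (r - \<eta>))) \<le> sep_number (rho_dist f) T F \<delta> n \<epsilon>" .
    \<comment> \<open>A supremum need not be attained. The second \<eta> buys the strict inequality
      that yields an actual finite set.\<close>
    moreover have "n * (r - 2 * \<eta>) < n * (r - \<eta>)" using n1(3) pos by (intro mult_strict_left_mono) auto
    then have "ereal (exp (n * (r - 2 * \<eta>))) < ereal (exp (n * (r - \<eta>)))" by simp
    ultimately have "ereal (exp (n * (r - 2 * \<eta>))) < sep_number (rho_dist f) T F \<delta> n \<epsilon>" by (rule less_le_trans[rotated])
    then obtain E where E: "finite E" "E \<subseteq> emp_set T n F" "separated_set (rho_dist f) T \<delta> n \<epsilon> E" "exp (n * (r - 2 * \<eta>)) < card E"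
      unfolding sep_number_def less_SUP_iff by auto
    let ?b = "\<lambda>x. g_ball (rho_dist f) T g n x e"
    have sp: "\<exists>i<n. rho_dist f ((T ^^ i) u) ((T ^^ i) v) > \<epsilon> / 3"
      if "x \<in> E" "y \<in> E" "x \<noteq> y" "u \<in> ?b x" "v \<in> ?b y" for x y u v
      using E(3) that(1-3) by (intro g_ball_separated[OF _ gd that(4,5) e(2)]) (auto simp: separated_set_def pairwise_def)
    have self: "x \<in> ?b x" for x using e(1) by (intro g_ball_self) simp
    have inj: "inj_on ?b E"
    proof (rule inj_onI, rule ccontr)
      fix x y assume xy: "x \<in> E" "y \<in> E" "?b x = ?b y" "x \<noteq> y"
      have "x \<in> ?b y" using self[of x] xy(3) by simp
      then obtain i where "rho_dist f ((T ^^ i) x) ((T ^^ i) x) > \<epsilon> / 3" using sp[OF xy(1,2,4) self] by blast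
      then show False using pos by simp
    qed
    show "\<exists>U. unit_family (\<epsilon> / 3) n U \<and> ln (card U) \<ge> n * (r - 2 * \<eta>) \<and>
      (\<forall>R\<in>U. \<forall>u\<in>R. \<forall>h\<in>H. \<bar>birkhoff_sum T h n u - n * integral\<^sup>L \<nu> h\<bar> \<le> n * z)"
    proof (intro exI[of _ "?b ` E"] conjI ballI)
      have "E \<noteq> {}"
      proof
        assume "E = {}"
        then show False using E(4) exp_gt_zero[of "n * (r - 2 * \<eta>)"] by simp
      qed
      moreover have "Glued n (?b x)" for x
        by (rule glued_single) (use n1 e(1) in \<open>auto simp: shadow_blocks_def\<close>)
      ultimately show "unit_family (\<epsilon> / 3) n (?b ` E)"
        unfolding unit_family_def using E(1) sp by blast
      have "ln (exp (n * (r - 2 * \<eta>))) \<le> ln (card E)" using E(4) by (intro ln_mono) auto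
      then show "ln (card (?b ` E)) \<ge> n * (r - 2 * \<eta>)" by (simp add: card_image[OF inj])
      fix R u h assume "R \<in> ?b ` E" and u: "u \<in> R" and h: "h \<in> H"
      then obtain x where x: "x \<in> E" "R = ?b x" by blast
      have "empirical T n x \<in> F" using E(2) x by (auto simp: emp_set_def)
      then have "\<bar>birkhoff_sum T h n x / n - integral\<^sup>L \<nu> h\<bar> < z / 3"
        using h integral_empirical_birkhoff[OF n1(3) H(2)[OF h]] by (auto simp: F_def)
      then have "n * \<bar>birkhoff_sum T h n x / n - integral\<^sup>L \<nu> h\<bar> \<le> n * (z / 3)" by (intro mult_left_mono) auto
      then have "\<bar>n * (birkhoff_sum T h n x / n - integral\<^sup>L \<nu> h)\<bar> \<le> n * (z / 3)" by (simp add: abs_mult)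
      then have 1: "\<bar>birkhoff_sum T h n x - n * integral\<^sup>L \<nu> h\<bar> \<le> n * (z / 3)" using n1(3) by (simp add: right_diff_distrib)
      have "\<bar>birkhoff_sum T h n x - birkhoff_sum T h n u\<bar> \<le> n * (z / 3) + 2 * B * g n"
      proof (rule g_ball_birkhoff)
        show "u \<in> ?b x" using u x by simp
        show "\<bar>h a - h b\<bar> \<le> z / 3" if "rho_dist f a b \<le> e" for a b
          using Bd[OF h] e(3)[OF h] that by (meson order_trans)
      qed (use B[OF h] z in auto)
      then show "\<bar>birkhoff_sum T h n u - n * integral\<^sup>L \<nu> h\<bar> \<le> n * z" using 1 gz by linarith
    qed
  qed
qed

end

section \<open>Lower bound for the pressure\<close>

text \<open>The error does not depend on \<open>n\<close>, so it is negligible against the total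
  length. Rounding up makes each \<open>k i\<close> as large as a block threshold requires once
  \<open>n\<close> is large and \<open>a i\<close> is positive.\<close>

lemma rounding:
  fixes a x :: "'i \<Rightarrow> real" and n :: nat
  assumes I: "finite I" "\<And>i. i \<in> I \<Longrightarrow> 0 \<le> a i" "(\<Sum>i\<in>I. a i) = 1"
  defines "k \<equiv> \<lambda>i. nat \<lceil>a i * n\<rceil>"
  shows "n \<le> (\<Sum>i\<in>I. k i)"
    "\<bar>(\<Sum>i\<in>I. k i * x i) - real (\<Sum>i\<in>I. k i) * (\<Sum>i\<in>I. a i * x i)\<bar> \<le> (1 + card I) * (\<Sum>i\<in>I. \<bar>x i\<bar>)"
proof -
  have k: "a i * n \<le> k i" "k i \<le> a i * n + 1" if "i \<in> I" for i
  proof -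
    have "0 \<le> a i * n" using I(2)[OF that] by simp
    then have "real (k i) = of_int \<lceil>a i * n\<rceil>" by (simp add: k_def)
    then show "a i * n \<le> k i" "k i \<le> a i * n + 1" by linarith+
  qed
  define l where "l = (\<Sum>i\<in>I. k i)"
  let ?l = "real l"
  have "(\<Sum>i\<in>I. a i * n) \<le> (\<Sum>i\<in>I. real (k i))" using k by (intro sum_mono) auto
  then have l1: "n \<le> ?l" using I(3) by (simp add: l_def sum_distrib_right[symmetric])
  then show "n \<le> (\<Sum>i\<in>I. k i)" unfolding l_def of_nat_le_iff .
  have "(\<Sum>i\<in>I. real (k i)) \<le> (\<Sum>i\<in>I. a i * n + 1)" using k by (intro sum_mono) auto
  then have l2: "?l \<le> real n + real (card I)" using I(3) by (simp add: l_def sum.distrib sum_distrib_right[symmetric])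
  have d: "\<bar>k i - ?l * a i\<bar> \<le> 1 + card I" if i: "i \<in> I" for i
  proof -
    have aux: "\<bar>y - L * b\<bar> \<le> 1 + C" if "b * N \<le> y" "y \<le> b * N + 1" "N \<le> L" "L \<le> N + C" "0 \<le> b" "b \<le> 1" for y L b N C :: real
    proof -
      have "(L - N) * b \<le> (L - N) * 1" "0 \<le> (L - N) * b" using that by (intro mult_left_mono mult_nonneg_nonneg; simp)+
      then have "L * b - b * N \<le> L - N" "0 \<le> L * b - b * N" by (simp_all add: algebra_simps)
      then show ?thesis using that by linarith
    qed
    have "a i \<le> 1" using member_le_sum[OF i, of a] I by simp
    from aux[OF k[OF i] l1 l2 I(2)[OF i] this] show ?thesis by simp
  qed
  have "(\<Sum>i\<in>I. k i * x i) - ?l * (\<Sum>i\<in>I. a i * x i) = (\<Sum>i\<in>I. (k i - ?l * a i) * x i)"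
    by (simp add: sum_distrib_left left_diff_distrib sum_subtractf mult.assoc)
  also have "\<bar>\<dots>\<bar> \<le> (\<Sum>i\<in>I. \<bar>(k i - ?l * a i) * x i\<bar>)" by (rule sum_abs)
  also have "\<dots> \<le> (\<Sum>i\<in>I. (1 + card I) * \<bar>x i\<bar>)"
    unfolding abs_mult using d by (intro sum_mono mult_right_mono) auto
  also have "\<dots> = (1 + card I) * (\<Sum>i\<in>I. \<bar>x i\<bar>)" by (rule sum_distrib_left[symmetric])
  finally show "\<bar>(\<Sum>i\<in>I. k i * x i) - real (\<Sum>i\<in>I. k i) * (\<Sum>i\<in>I. a i * x i)\<bar> \<le> (1 + card I) * (\<Sum>i\<in>I. \<bar>x i\<bar>)"
    by (simp add: l_def)
qed

context specification_system
begin

text \<open>Uniform separation only concerns ergodic measures, so \<open>\<mu>\<close> is replaced by a finite convex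
  combination of ergodic measures and the corresponding blocks are concatenated in proportion to
  the coefficients.\<close>

lemma stage_unit:
  assumes sepn: "\<And>\<nu> F. \<nu> \<in> ergodic_prob T \<Longrightarrow> weak_star_nhd \<nu> F \<Longrightarrow> (\<exists>N. \<forall>n\<ge>N. sep_number (rho_dist f) T F \<delta> n \<epsilon>
                \<ge> exp_ereal (ereal (real n) * (metric_entropy T \<nu> - ereal \<eta>)))"
    and pos: "\<delta> > 0" "\<epsilon> > 0" "\<eta> > 0" and \<mu>: "\<mu> \<in> inv_prob T" and c: "labelling c"
    and \<phi>: "continuous_on UNIV \<phi>" and t: "t < label_entropy T \<mu> c + integral\<^sup>L \<mu> \<phi>" and z: "z > 0" "z \<le> \<eta>"
  shows "\<exists>l U. l \<ge> 1 \<and> unit_family (\<epsilon> / 3) l U \<and>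
    (\<forall>R\<in>U. \<forall>u\<in>R. l * (t - 6 * \<eta>) \<le> ln (card U) + birkhoff_sum T \<phi> l u) \<and>
    (\<forall>R\<in>U. \<forall>u\<in>R. \<forall>p<k. \<bar>birkhoff_sum T (f p) l u - l * integral\<^sup>L \<mu> (f p)\<bar> \<le> l * (3 * z))"
proof -
  define H where "H = insert \<phi> (f ` {..<k})"
  have H: "finite H" "\<And>h. h \<in> H \<Longrightarrow> continuous_on UNIV h" using \<phi> cont_f by (auto simp: H_def)
  obtain I :: "(('a \<Rightarrow> real) \<Rightarrow> int) set" and a \<nu> where I:
    "finite I" "I \<noteq> {}" "\<And>i. i \<in> I \<Longrightarrow> a i > 0" "(\<Sum>i\<in>I. a i) = 1" and \<nu>: "\<And>i. i \<in> I \<Longrightarrow> \<nu> i \<in> ergodic_prob T"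
    and app: "\<And>h. h \<in> H \<Longrightarrow> \<bar>(\<Sum>i\<in>I. a i * integral\<^sup>L (\<nu> i) h) - integral\<^sup>L \<mu> h\<bar> \<le> z"
    and ent: "label_entropy T \<mu> c \<le> (\<Sum>i\<in>I. a i * label_entropy T (\<nu> i) c)"
    by (rule ergodic_approximation[OF \<mu> c H(1) _ z(1)], erule H(2)) (rule that; assumption)
  define h where "h i = label_entropy T (\<nu> i) c" for i
  have \<nu>i: "\<nu> i \<in> inv_prob T" "\<nu> i \<in> borel_prob" if "i \<in> I" for i
    using \<nu>[OF that] by (auto simp: ergodic_prob_def inv_prob_def)
  have "\<forall>i. \<exists>N. i \<in> I \<longrightarrow> (\<forall>n\<ge>N. \<exists>U. unit_family (\<epsilon> / 3) n U \<and> ln (card U) \<ge> n * (h i - 2 * \<eta>) \<and>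
    (\<forall>R\<in>U. \<forall>u\<in>R. \<forall>k\<in>H. \<bar>birkhoff_sum T k n u - n * integral\<^sup>L (\<nu> i) k\<bar> \<le> n * z))"
  proof
    fix i
    show "\<exists>N. i \<in> I \<longrightarrow> (\<forall>n\<ge>N. \<exists>U. unit_family (\<epsilon> / 3) n U \<and> ln (card U) \<ge> n * (h i - 2 * \<eta>) \<and>
      (\<forall>R\<in>U. \<forall>u\<in>R. \<forall>k\<in>H. \<bar>birkhoff_sum T k n u - n * integral\<^sup>L (\<nu> i) k\<bar> \<le> n * z))"
    proof (cases "i \<in> I")
      case True
      have "ereal (h i) \<le> metric_entropy T (\<nu> i)"
        unfolding h_def by (rule label_entropy_le_metric_entropy[OF compact_system_axioms \<nu>i(1)[OF True] c])
      from ergodic_block[OF _ pos \<nu>i(2)[OF True] this H z(1)] sepn[OF \<nu>[OF True]] show ?thesis by blast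
    qed blast
  qed
  from choice[OF this] obtain N where N: "\<forall>i. i \<in> I \<longrightarrow> (\<forall>n\<ge>N i. \<exists>U. unit_family (\<epsilon> / 3) n U \<and> ln (card U) \<ge> n * (h i - 2 * \<eta>) \<and>
    (\<forall>R\<in>U. \<forall>u\<in>R. \<forall>k\<in>H. \<bar>birkhoff_sum T k n u - n * integral\<^sup>L (\<nu> i) k\<bar> \<le> n * z))" ..
  \<comment> \<open>Bounds all coefficient vectors to which \<open>rounding\<close> is applied: the
    entropies \<open>h i\<close> and the integrals of each test function.\<close>
  define X where "X = (\<Sum>i\<in>I. \<bar>h i\<bar>) + (\<Sum>k\<in>H. \<Sum>i\<in>I. \<bar>integral\<^sup>L (\<nu> i) k\<bar>)"
  \<comment> \<open>The first summand makes the rounding error at most \<open>z * n\<close>; the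
    second makes every block length \<open>q i\<close> at least its threshold
    \<open>N i\<close>.\<close>
  obtain n :: nat where "max 1 ((1 + card I) * X / z + (\<Sum>i\<in>I. N i / a i)) \<le> real n" using real_arch_simple by blast
  then have n1: "1 \<le> real n" and n2: "(1 + card I) * X / z + (\<Sum>i\<in>I. N i / a i) \<le> n" by auto
  have X0: "0 \<le> X" by (auto simp: X_def intro!: add_nonneg_nonneg sum_nonneg)
  have Na: "0 \<le> N i / a i" if "i \<in> I" for i using I(3)[OF that] by simp
  have nX: "(1 + card I) * X \<le> z * n"
  proof -
    have "(1 + card I) * X / z \<le> n" using n2 sum_nonneg[of I "\<lambda>i. N i / a i"] Na by simp
    then show ?thesis using z(1) by (simp add: divide_le_eq mult.commute)
  qed
  define q where "q i = nat \<lceil>a i * n\<rceil>" for i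
  have qN: "q i \<ge> N i" if i: "i \<in> I" for i
  proof -
    have "0 \<le> (1 + card I) * X / z" using X0 z(1) by simp
    moreover have "N i / a i \<le> (\<Sum>i\<in>I. N i / a i)" using i Na I(1) by (intro member_le_sum) auto
    ultimately have "N i / a i \<le> n" using n2 by linarith
    then have "real (N i) \<le> a i * n" using I(3)[OF i] by (simp add: divide_le_eq mult.commute)
    also have "\<dots> \<le> q i" unfolding q_def by (rule real_nat_ceiling_ge)
    finally show ?thesis by simp
  qed
  define l where "l = (\<Sum>i\<in>I. q i)"
  have a0: "0 \<le> a i" if "i \<in> I" for i using I(3)[OF that] by simp
  note rnd = rounding[OF I(1) a0 I(4), of n, folded q_def l_def]
  have l1: "l \<ge> 1" using rnd(1) n1 by linarith
  have rx: "\<bar>(\<Sum>i\<in>I. q i * x i) - l * (\<Sum>i\<in>I. a i * x i)\<bar> \<le> l * z" if "(\<Sum>i\<in>I. \<bar>x i\<bar>) \<le> X" for x :: "_ \<Rightarrow> real"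
  proof -
    have "\<bar>(\<Sum>i\<in>I. q i * x i) - l * (\<Sum>i\<in>I. a i * x i)\<bar> \<le> (1 + card I) * (\<Sum>i\<in>I. \<bar>x i\<bar>)" using rnd(2)[of x] by (simp add: l_def)
    also have "\<dots> \<le> (1 + card I) * X" using that by (intro mult_left_mono) auto
    also have "\<dots> \<le> z * n" by (rule nX)
    also have "\<dots> \<le> z * l" using rnd(1) z(1) by (intro mult_left_mono) auto
    finally show ?thesis by (simp add: mult.commute)
  qed
  have "\<forall>i. \<exists>U. i \<in> I \<longrightarrow> unit_family (\<epsilon> / 3) (q i) U \<and> ln (card U) \<ge> q i * (h i - 2 * \<eta>) \<and>
    (\<forall>R\<in>U. \<forall>u\<in>R. \<forall>k\<in>H. \<bar>birkhoff_sum T k (q i) u - q i * integral\<^sup>L (\<nu> i) k\<bar> \<le> q i * z)"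
    using N qN by blast
  from choice[OF this] obtain U where U0: "\<forall>i. i \<in> I \<longrightarrow> unit_family (\<epsilon> / 3) (q i) (U i) \<and> ln (card (U i)) \<ge> q i * (h i - 2 * \<eta>) \<and>
    (\<forall>R\<in>U i. \<forall>u\<in>R. \<forall>k\<in>H. \<bar>birkhoff_sum T k (q i) u - q i * integral\<^sup>L (\<nu> i) k\<bar> \<le> q i * z)" ..
  have U: "unit_family (\<epsilon> / 3) (q i) (U i)" "ln (card (U i)) \<ge> q i * (h i - 2 * \<eta>)"
    "\<And>R u k. R \<in> U i \<Longrightarrow> u \<in> R \<Longrightarrow> k \<in> H \<Longrightarrow> \<bar>birkhoff_sum T k (q i) u - q i * integral\<^sup>L (\<nu> i) k\<bar> \<le> q i * z" if "i \<in> I" for i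
    using U0[rule_format, OF that] by simp_all
  have e3: "\<epsilon> / 3 > 0" using pos by simp
  have "\<exists>W. unit_family (\<epsilon> / 3) l W \<and> ln (card W) = (\<Sum>i\<in>I. ln (card (U i))) \<and>
    (\<forall>R\<in>W. \<forall>u\<in>R. \<forall>k\<in>H. \<bar>birkhoff_sum T k l u - (\<Sum>i\<in>I. q i * integral\<^sup>L (\<nu> i) k)\<bar> \<le> (\<Sum>i\<in>I. q i * z))"
    unfolding l_def
  proof (rule unit_families_concat[OF I(1) e3 U(1)])
    show "\<bar>birkhoff_sum T k (q i) u - real (q i) * integral\<^sup>L (\<nu> i) k\<bar> \<le> real (q i) * z"
      if "i \<in> I" "R \<in> U i" "u \<in> R" "k \<in> H" for i R u k by (rule U(3)[OF that])
  qed
  then obtain W where W: "unit_family (\<epsilon> / 3) l W" "ln (card W) = (\<Sum>i\<in>I. ln (card (U i)))"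
    "\<forall>R\<in>W. \<forall>u\<in>R. \<forall>k\<in>H. \<bar>birkhoff_sum T k l u - (\<Sum>i\<in>I. q i * integral\<^sup>L (\<nu> i) k)\<bar> \<le> (\<Sum>i\<in>I. q i * z)"
    by (elim exE conjE)
  have ez: "(\<Sum>i\<in>I. q i * z) = l * z" by (simp add: l_def sum_distrib_right)
  \<comment> \<open>Three errors of size \<open>l * z\<close>: inside the blocks, from rounding
    their lengths, and from the ergodic approximation of \<mu>.\<close>
  have est: "\<bar>birkhoff_sum T k l u - l * integral\<^sup>L \<mu> k\<bar> \<le> l * (3 * z)" if "R \<in> W" "u \<in> R" and k: "k \<in> H" for R u k
  proof -
    have "(\<Sum>i\<in>I. \<bar>integral\<^sup>L (\<nu> i) k\<bar>) \<le> (\<Sum>k\<in>H. \<Sum>i\<in>I. \<bar>integral\<^sup>L (\<nu> i) k\<bar>)"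
      using k H(1) by (intro member_le_sum[where f="\<lambda>k. \<Sum>i\<in>I. \<bar>integral\<^sup>L (\<nu> i) k\<bar>"]) (auto intro: sum_nonneg)
    moreover have "0 \<le> (\<Sum>i\<in>I. \<bar>h i\<bar>)" by (rule sum_nonneg) simp
    ultimately have "(\<Sum>i\<in>I. \<bar>integral\<^sup>L (\<nu> i) k\<bar>) \<le> X" unfolding X_def by linarith
    from rx[OF this] have 1: "\<bar>(\<Sum>i\<in>I. q i * integral\<^sup>L (\<nu> i) k) - l * (\<Sum>i\<in>I. a i * integral\<^sup>L (\<nu> i) k)\<bar> \<le> l * z" .
    have "l * \<bar>(\<Sum>i\<in>I. a i * integral\<^sup>L (\<nu> i) k) - integral\<^sup>L \<mu> k\<bar> \<le> l * z" using app[OF k] by (intro mult_left_mono) auto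
    then have "\<bar>l * ((\<Sum>i\<in>I. a i * integral\<^sup>L (\<nu> i) k) - integral\<^sup>L \<mu> k)\<bar> \<le> l * z" by (simp add: abs_mult)
    then have 2: "\<bar>l * (\<Sum>i\<in>I. a i * integral\<^sup>L (\<nu> i) k) - l * integral\<^sup>L \<mu> k\<bar> \<le> l * z" by (simp only: right_diff_distrib)
    have 3: "\<bar>birkhoff_sum T k l u - (\<Sum>i\<in>I. q i * integral\<^sup>L (\<nu> i) k)\<bar> \<le> l * z"
      using W(3) that unfolding ez by blast
    have "l * (3 * z) = l * z + l * z + l * z" by simp
    then show ?thesis using 1 2 3 by linarith
  qed
  have "l * (t - 6 * \<eta>) \<le> ln (card W) + birkhoff_sum T \<phi> l u" if "R \<in> W" "u \<in> R" for R u
  proof -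
    have "\<bar>birkhoff_sum T \<phi> l u - l * integral\<^sup>L \<mu> \<phi>\<bar> \<le> l * (3 * z)" by (rule est[OF that]) (simp add: H_def)
    then have b: "l * integral\<^sup>L \<mu> \<phi> - l * (3 * z) \<le> birkhoff_sum T \<phi> l u" by linarith
    have "0 \<le> (\<Sum>k\<in>H. \<Sum>i\<in>I. \<bar>integral\<^sup>L (\<nu> i) k\<bar>)" by (intro sum_nonneg) simp
    then have "(\<Sum>i\<in>I. \<bar>h i\<bar>) \<le> X" unfolding X_def by linarith
    from rx[OF this] have "l * (\<Sum>i\<in>I. a i * h i) - l * z \<le> (\<Sum>i\<in>I. q i * h i)" by linarith
    moreover have "l * label_entropy T \<mu> c \<le> l * (\<Sum>i\<in>I. a i * h i)" using ent by (intro mult_left_mono) (simp_all add: h_def)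
    moreover have "(\<Sum>i\<in>I. q i * (h i - 2 * \<eta>)) \<le> (\<Sum>i\<in>I. ln (card (U i)))" using U(2) by (intro sum_mono)
    moreover have "(\<Sum>i\<in>I. q i * (h i - 2 * \<eta>)) = (\<Sum>i\<in>I. q i * h i) - l * (2 * \<eta>)"
      by (simp add: l_def right_diff_distrib sum_subtractf sum_distrib_right)
    ultimately have "l * label_entropy T \<mu> c - l * z - l * (2 * \<eta>) \<le> ln (card W)" unfolding W(2) by linarith
    with b have "l * label_entropy T \<mu> c - l * z - l * (2 * \<eta>) + (l * integral\<^sup>L \<mu> \<phi> - l * (3 * z)) \<le> ln (card W) + birkhoff_sum T \<phi> l u" by linarith
    moreover have "l * label_entropy T \<mu> c - l * z - l * (2 * \<eta>) + (l * integral\<^sup>L \<mu> \<phi> - l * (3 * z))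
       = l * (label_entropy T \<mu> c + integral\<^sup>L \<mu> \<phi> - 4 * z - 2 * \<eta>)" by (simp add: algebra_simps)
    \<comment> \<open>Account of the losses: \<open>2 * \<eta>\<close> from separation,
      \<open>z\<close> from rounding and \<open>3 * z\<close> from the Birkhoff sum, where
      \<open>z\<close> is at most \<eta>.\<close>
    moreover have "l * (t - 6 * \<eta>) \<le> l * (label_entropy T \<mu> c + integral\<^sup>L \<mu> \<phi> - 4 * z - 2 * \<eta>)"
      using t z by (intro mult_left_mono) auto
    ultimately show ?thesis by linarith
  qed
  moreover have "\<forall>R\<in>W. \<forall>u\<in>R. \<forall>p<k. \<bar>birkhoff_sum T (f p) l u - l * integral\<^sup>L \<mu> (f p)\<bar> \<le> l * (3 * z)"
    using est by (simp add: H_def)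
  ultimately show ?thesis using l1 W(1) by blast
qed

section \<open>Orbits that realise infinite sequences of letters\<close>

lemma orbit_point:
  fixes l :: "nat \<Rightarrow> nat" and \<omega> :: "nat \<Rightarrow> 'a set"
  assumes "\<And>i. Glued (l i) (\<omega> i)"
  shows "\<exists>z. \<forall>i. (T ^^ (\<Sum>j<i. l j)) z \<in> \<omega> i"
proof -
  define S where "S k = (\<Inter>i<k. (T ^^ (\<Sum>j<i. l j)) -` \<omega> i)" for k :: nat
  have G: "Glued (\<Sum>j<k. l j) (S k)" for k
  proof (induction k)
    case 0
    then show ?case by (simp add: S_def glued_empty)
  next
    case (Suc k)
    have "S (Suc k) = S k \<inter> (T ^^ (\<Sum>j<k. l j)) -` \<omega> k" by (auto simp: S_def less_Suc_eq)
    then show ?case using glued_append[OF assms Suc] by simp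
  qed
  have mono: "S n \<subseteq> S k" if "k \<le> n" for k n using that by (force simp: S_def)
  \<comment> \<open>The almost product property handles finitely many blocks. For infinitely many,
    the glued sets are nonempty, closed and nested, and the finite intersection property
    applies.\<close>
  have "UNIV \<inter> (\<Inter>k\<in>UNIV. S k) \<noteq> {}"
  proof (rule compact_imp_fip_image[OF cpt glued_closed[OF G]])
    fix K :: "nat set" assume "finite K"
    then have "S (Max (insert 0 K)) \<subseteq> (\<Inter>k\<in>K. S k)" by (intro INT_greatest mono) simp
    then show "UNIV \<inter> (\<Inter>k\<in>K. S k) \<noteq> {}" using glued_nonempty[OF G] by blast
  qed
  then obtain z where "z \<in> (\<Inter>k. S k)" by blast
  then have "z \<in> S (Suc i)" for i by blast
  then have "(T ^^ (\<Sum>j<i. l j)) z \<in> \<omega> i" for i unfolding S_def by blast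
  then show ?thesis by blast
qed

lemma birkhoff_sum_blocks:
  fixes j :: nat
  shows "birkhoff_sum T h (\<Sum>i<j. l i) z = (\<Sum>i<j. birkhoff_sum T h (l i) ((T ^^ (\<Sum>j<i. l j)) z))"
proof (induction j)
  case 0 then show ?case by (simp add: birkhoff_sum_def)
next
  case (Suc j)
  then show ?case by (simp add: birkhoff_sum_add)
qed

end

section \<open>Mass distribution and lower bounds for cover sums\<close>

lemma emeasure_UN_le_infsum:
  assumes "countable K" "\<And>p. p \<in> K \<Longrightarrow> C p \<in> sets M"
  shows "emeasure M (\<Union>p\<in>K. C p) \<le> (\<Sum>\<^sub>\<infinity>p\<in>K. emeasure M (C p))"
proof -
  define A where "A i = (if i \<in> to_nat_on K ` K then C (from_nat_into K i) else {})" for i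
  have A: "A (to_nat_on K p) = C p" if "p \<in> K" for p using that assms(1) by (simp add: A_def)
  have As: "A i \<in> sets M" for i using assms by (auto simp: A_def)
  have "(\<Union>p\<in>K. C p) \<subseteq> (\<Union>i. A i)" using A by blast
  then have "emeasure M (\<Union>p\<in>K. C p) \<le> emeasure M (\<Union>i. A i)" using As by (intro emeasure_mono) auto
  also have "\<dots> \<le> (\<Sum>i. emeasure M (A i))" using As by (intro emeasure_subadditive_countably) auto
  also have "\<dots> \<le> (\<Sum>\<^sub>\<infinity>p\<in>K. emeasure M (C p))"
  proof (rule suminf_le_const[OF summableI])
    fix n
    let ?F = "{p \<in> K. to_nat_on K p < n}"
    have inj: "inj_on (to_nat_on K) ?F" by (rule inj_on_subset[OF inj_on_to_nat_on[OF assms(1)]]) auto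
    have fin: "finite ?F" by (rule finite_imageD[OF _ inj], rule finite_subset[of _ "{..<n}"]) auto
    have "(\<Sum>i<n. emeasure M (A i)) = (\<Sum>i\<in>to_nat_on K ` ?F. emeasure M (A i))"
    proof (intro sum.mono_neutral_right ballI)
      fix i assume "i \<in> {..<n} - to_nat_on K ` ?F"
      then have "i \<notin> to_nat_on K ` K" by auto
      then show "emeasure M (A i) = 0" by (simp add: A_def)
    qed auto
    also have "\<dots> = (\<Sum>p\<in>?F. emeasure M (C p))" by (subst sum.reindex[OF inj]) (simp add: A)
    also have "\<dots> \<le> (\<Sum>\<^sub>\<infinity>p\<in>K. emeasure M (C p))"
      unfolding nonneg_infsum_complete[OF zero_le] by (rule SUP_upper) (use fin in auto)
    finally show "(\<Sum>i<n. emeasure M (A i)) \<le> (\<Sum>\<^sub>\<infinity>p\<in>K. emeasure M (C p))" .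
  qed
  finally show ?thesis .
qed

text \<open>Fewer covers are admissible as \<open>n\<close> grows, so the limit is a supremum and
  inherits a lower bound that holds from some \<open>N\<close> on.\<close>

lemma cover_mass_ge:
  assumes "\<And>n. n \<ge> N \<Longrightarrow> 1 \<le> cover_mass_at d T Z t \<phi> n \<epsilon>"
  shows "cover_mass d T Z t \<phi> \<epsilon> \<noteq> 0"
proof -
  have "incseq (\<lambda>n. cover_mass_at d T Z t \<phi> n \<epsilon>)"
    unfolding cover_mass_at_def incseq_def
    by (intro allI impI INF_superset_mono) (auto simp: ball_covers_def)
  then have "(\<lambda>n. cover_mass_at d T Z t \<phi> n \<epsilon>) \<longlonglongrightarrow> (SUP n. cover_mass_at d T Z t \<phi> n \<epsilon>)" by (rule LIMSEQ_SUP)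
  then have "cover_mass d T Z t \<phi> \<epsilon> = (SUP n. cover_mass_at d T Z t \<phi> n \<epsilon>)" unfolding cover_mass_def by (rule limI)
  moreover have "1 \<le> (SUP n. cover_mass_at d T Z t \<phi> n \<epsilon>)" by (rule SUP_upper2[of N]) (use assms in auto)
  ultimately show ?thesis by auto
qed

context specification_system
begin

text \<open>Mass distribution principle for the product of the uniform measures on the letters.\<close>

lemma fractal_cover:
  fixes l :: "nat \<Rightarrow> nat" and U :: "nat \<Rightarrow> 'a set set" and t t' :: real
  assumes U: "\<And>i. unit_family \<epsilon>1 (l i) (U i)" and l1: "\<And>i. l i \<ge> 1" and \<phi>: "continuous_on UNIV \<phi>"
    and w: "\<And>i R u. R \<in> U i \<Longrightarrow> u \<in> R \<Longrightarrow> l i * t \<le> ln (card (U i)) + birkhoff_sum T \<phi> (l i) u"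
    and small: "\<And>\<kappa>. \<kappa> > 0 \<Longrightarrow> \<exists>J. \<forall>i\<ge>J. real (l i) \<le> \<kappa> * real (\<Sum>j<i. l j)"
    and z: "\<And>\<omega>. (\<And>i. \<omega> i \<in> U i) \<Longrightarrow> z \<omega> \<in> Z \<and> (\<forall>i. (T ^^ (\<Sum>j<i. l j)) (z \<omega>) \<in> \<omega> i)"
    and \<epsilon>: "\<epsilon> > 0" "2 * \<epsilon> \<le> \<epsilon>1" and t': "t' < t"
  shows "\<exists>N. \<forall>n\<ge>N. 1 \<le> cover_mass_at (rho_dist f) T Z t' \<phi> n \<epsilon>"
proof -
  define s where "s i = (\<Sum>j<i. l j)" for i
  have s_mono: "s i \<le> s j" if "i \<le> j" for i j unfolding s_def using that by (intro sum_mono2) auto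
  have s_ge: "i \<le> s i" for i
  proof -
    have "(\<Sum>j<i. 1) \<le> (\<Sum>j<i. l j)" by (intro sum_mono l1)
    then show ?thesis by (simp add: s_def)
  qed
  obtain B where B: "B > 0" "\<And>x. \<bar>\<phi> x\<bar> \<le> B" using bounded_cont[OF \<phi>] by blast
  \<comment> \<open>An incomplete block will occupy at most the fraction \<kappa> of the elapsed
    time; its cost per unit of time, at most \<open>\<bar>t'\<bar> + B\<close>, is then absorbed by
    the gap \<open>t - t'\<close>.\<close>
  define \<kappa> where "\<kappa> = (t - t') / (\<bar>t'\<bar> + B + 1)"
  have \<kappa>: "\<kappa> > 0" using t' B by (simp add: \<kappa>_def)
  have \<kappa>': "(\<bar>t'\<bar> + B) * \<kappa> \<le> t - t'"
  proof -
    have "(\<bar>t'\<bar> + B) * \<kappa> \<le> (\<bar>t'\<bar> + B + 1) * \<kappa>" using \<kappa> by (intro mult_right_mono) auto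
    also have "\<dots> = t - t'" using B by (simp add: \<kappa>_def)
    finally show ?thesis .
  qed
  obtain J where J: "\<And>i. i \<ge> J \<Longrightarrow> real (l i) \<le> \<kappa> * real (s i)" using small[OF \<kappa>] unfolding s_def by blast
  let ?M = "\<lambda>i. uniform_count_measure (U i)"
  have fU: "finite (U i)" "U i \<noteq> {}" for i using U[of i] by (auto simp: unit_family_def)
  have pM: "prob_space (?M i)" for i by (rule prob_space_uniform_count_measure[OF fU])
  interpret product_prob_space ?M UNIV
    by (rule product_prob_spaceI) (rule pM)
  let ?P = "PiM UNIV ?M"
  have sp: "space ?P = {\<omega>. \<forall>i. \<omega> i \<in> U i}" by (auto simp: space_PiM space_uniform_count_measure PiE_def Pi_def)
  define cyl where "cyl j \<omega> = {\<omega>' \<in> space ?P. \<forall>i<j. \<omega>' i = \<omega> i}" for j :: nat and \<omega> :: "nat \<Rightarrow> 'a set"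
  have cyl: "cyl j \<omega> \<in> sets ?P \<and> emeasure ?P (cyl j \<omega>) = ennreal (exp (- (\<Sum>i<j. ln (card (U i)))))"
    if \<omega>: "\<omega> \<in> space ?P" for j \<omega>
  proof -
    have em: "cyl j \<omega> = prod_emb UNIV ?M {..<j} (Pi\<^sub>E {..<j} (\<lambda>i. {\<omega> i}))"
      unfolding cyl_def prod_emb_def using \<omega> by (auto simp: space_PiM PiE_def Pi_def extensional_def restrict_def space_uniform_count_measure)
    have X: "{\<omega> i} \<in> sets (?M i)" for i using \<omega> by (simp add: sp sets_uniform_count_measure)
    have "emeasure ?P (cyl j \<omega>) = (\<Prod>i<j. emeasure (?M i) {\<omega> i})"
      unfolding em by (rule emeasure_PiM_emb) (use X in auto)
    also have "\<dots> = (\<Prod>i<j. ennreal (1 / card (U i)))"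
      using \<omega> fU by (intro prod.cong) (auto simp: emeasure_uniform_count_measure sp)
    also have "\<dots> = ennreal (\<Prod>i<j. 1 / card (U i))" by (rule prod_ennreal) simp
    also have "(\<Prod>i<j. 1 / card (U i)) = exp (- (\<Sum>i<j. ln (card (U i))))"
    proof -
      have "1 / real (card (U i)) = exp (- ln (card (U i)))" for i using fU[of i] by (simp add: exp_minus card_gt_0_iff inverse_eq_divide)
      then show ?thesis by (simp add: exp_sum sum_negf[symmetric])
    qed
    finally have "emeasure ?P (cyl j \<omega>) = ennreal (exp (- (\<Sum>i<j. ln (card (U i)))))" .
    moreover have "cyl j \<omega> \<in> sets ?P" unfolding em using X by (intro sets_PiM_I) auto
    ultimately show ?thesis by blast
  qed
  \<comment> \<open>Two points of one Bowen ball are within \<open>2 * \<epsilon>\<close> of each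
    other up to time \<open>n\<close>, hence not separated in any completed block, so their letters
    agree there.\<close>
  have ball_cyl: "\<omega>' \<in> cyl j \<omega>"
    if "\<omega> \<in> space ?P" "\<omega>' \<in> space ?P" "z \<omega> \<in> bowen_ball (rho_dist f) T n x \<epsilon>" "z \<omega>' \<in> bowen_ball (rho_dist f) T n x \<epsilon>" "s j \<le> n"
    for \<omega> \<omega>' n x j
  proof -
    note that' = that
    have "\<omega>' i = \<omega> i" if i: "i < j" for i
    proof (rule ccontr)
      assume ne: "\<omega>' i \<noteq> \<omega> i"
      have in': "\<omega>' i \<in> U i" "\<omega> i \<in> U i" "(T ^^ s i) (z \<omega>') \<in> \<omega>' i" "(T ^^ s i) (z \<omega>) \<in> \<omega> i"
        using \<open>\<omega> \<in> space ?P\<close> \<open>\<omega>' \<in> space ?P\<close> z unfolding sp s_def by auto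
      from unit_family_sep[OF U in'(1,2) ne in'(3,4)] obtain k where k: "k < l i"
        "rho_dist f ((T ^^ k) ((T ^^ s i) (z \<omega>'))) ((T ^^ k) ((T ^^ s i) (z \<omega>))) > \<epsilon>1" by blast
      have "s i + l i = s (Suc i)" by (simp add: s_def)
      also have "\<dots> \<le> n" using s_mono[of "Suc i" j] i \<open>s j \<le> n\<close> by simp
      finally have kn: "k + s i < n" using k(1) by simp
      have "rho_dist f ((T ^^ (k + s i)) (z \<omega>')) ((T ^^ (k + s i)) (z \<omega>)) \<le> \<epsilon> + \<epsilon>"
        using rho_triangle[of "(T ^^ (k + s i)) (z \<omega>')" "(T ^^ (k + s i)) (z \<omega>)" "(T ^^ (k + s i)) x"]
          that'(3,4) kn by (force simp: bowen_ball_def rho_sym)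
      then show False using k(2) \<epsilon>(2) by (simp add: funpow_add)
    qed
    then show ?thesis using that(2) by (simp add: cyl_def)
  qed
  \<comment> \<open>The left side is the measure of a cylinder. Hypothesis \<open>w\<close> pays for
    the logarithms of the letter counts block by block.\<close>
  have weight_ge: "ennreal (exp (- (\<Sum>i<j. ln (card (U i))))) \<le> ennreal (weight t' \<phi> \<epsilon> n x)"
    if \<omega>: "\<omega> \<in> space ?P" and zb: "z \<omega> \<in> bowen_ball (rho_dist f) T n x \<epsilon>" and j: "s j \<le> n" "n < s (Suc j)" "j \<ge> J"
    for \<omega> n x j
  proof -
    have bb: "\<bar>birkhoff_sum T \<phi> k y\<bar> \<le> k * B" for k y
    proof -
      have "\<bar>birkhoff_sum T \<phi> k y\<bar> \<le> (\<Sum>i<k. \<bar>\<phi> ((T ^^ i) y)\<bar>)" unfolding birkhoff_sum_def by (rule sum_abs)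
      also have "\<dots> \<le> (\<Sum>i<k. B)" by (intro sum_mono B)
      finally show ?thesis by simp
    qed
    have "bdd_above (birkhoff_sum T \<phi> n ` bowen_ball (rho_dist f) T n x \<epsilon>)"
      using bb[of n] by (intro bdd_aboveI2[of _ _ "n * B"]) (simp add: abs_le_iff)
    then have S: "birkhoff_sum T \<phi> n (z \<omega>) \<le> (SUP y\<in>bowen_ball (rho_dist f) T n x \<epsilon>. birkhoff_sum T \<phi> n y)"
      using zb by (rule cSUP_upper[rotated])
    have "birkhoff_sum T \<phi> n (z \<omega>) = birkhoff_sum T \<phi> (s j) (z \<omega>) + birkhoff_sum T \<phi> (n - s j) ((T ^^ s j) (z \<omega>))"
      using birkhoff_sum_add[of \<phi> "s j" "n - s j"] j(1) by simp
    moreover have "- ((n - s j) * B) \<le> birkhoff_sum T \<phi> (n - s j) ((T ^^ s j) (z \<omega>))" using bb[of "n - s j"] by (simp add: abs_le_iff minus_le_iff)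
    moreover have "s j * t - (\<Sum>i<j. ln (card (U i))) \<le> birkhoff_sum T \<phi> (s j) (z \<omega>)"
    proof -
      have "(\<Sum>i<j. real (l i) * t) \<le> (\<Sum>i<j. ln (card (U i)) + birkhoff_sum T \<phi> (l i) ((T ^^ s i) (z \<omega>)))"
      proof (rule sum_mono)
        fix i assume "i \<in> {..<j}"
        have "\<omega> i \<in> U i" "(T ^^ s i) (z \<omega>) \<in> \<omega> i" using \<omega> z unfolding sp s_def by auto
        then show "l i * t \<le> ln (card (U i)) + birkhoff_sum T \<phi> (l i) ((T ^^ s i) (z \<omega>))" by (rule w)
      qed
      also have "\<dots> = (\<Sum>i<j. ln (card (U i))) + birkhoff_sum T \<phi> (s j) (z \<omega>)"
        unfolding s_def birkhoff_sum_blocks by (rule sum.distrib)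
      finally show ?thesis by (simp add: s_def sum_distrib_right)
    qed
    \<comment> \<open>After the last completed block at most \<open>l j\<close> steps have passed,
      and \<open>j \<ge> J\<close> makes them at most the fraction \<kappa> of
      \<open>s j\<close>.\<close>
    moreover have "0 \<le> s j * t - t' * n - (n - s j) * B"
    proof -
      have nj: "real (n - s j) = real n - real (s j)" using j(1) by simp
      have "n - s j \<le> l j" using j(1,2) by (simp add: s_def)
      then have "real (n - s j) \<le> \<kappa> * s j" using J[OF j(3)] by linarith
      then have "(\<bar>t'\<bar> + B) * (n - s j) \<le> (\<bar>t'\<bar> + B) * (\<kappa> * s j)" using B by (intro mult_left_mono) auto
      also have "\<dots> \<le> (t - t') * s j" using \<kappa>' by (simp add: mult.assoc[symmetric] mult_right_mono)
      finally have 1: "(\<bar>t'\<bar> + B) * (n - s j) \<le> (t - t') * s j" .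
      have "t' * (n - s j) \<le> \<bar>t'\<bar> * (n - s j)" by (intro mult_right_mono) auto
      with 1 show ?thesis unfolding nj by (simp add: algebra_simps)
    qed
    ultimately have "- (\<Sum>i<j. ln (card (U i))) \<le> - t' * n + (SUP y\<in>bowen_ball (rho_dist f) T n x \<epsilon>. birkhoff_sum T \<phi> n y)"
      using S by linarith
    then show ?thesis unfolding weight_def by (intro ennreal_leI) simp
  qed
  show ?thesis
  proof (rule exI[of _ "s J"], intro allI impI)
    fix n0 assume n0: "n0 \<ge> s J"
    show "1 \<le> cover_mass_at (rho_dist f) T Z t' \<phi> n0 \<epsilon>"
      unfolding cover_mass_at_def
    proof (rule INF_greatest)
      fix K assume K: "K \<in> ball_covers (rho_dist f) T Z n0 \<epsilon>"
      define hit where "hit p = {\<omega> \<in> space ?P. z \<omega> \<in> bowen_ball (rho_dist f) T (fst p) (snd p) \<epsilon>}" for p :: "nat \<times> 'a"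
      \<comment> \<open>The number of blocks completed by time \<open>n\<close>, finite because
        every block has positive length.\<close>
      define jj where "jj n = (GREATEST j. s j \<le> n)" for n
      have jj: "s (jj n) \<le> n" "n < s (Suc (jj n))" for n
      proof -
        have b: "j \<le> n" if "s j \<le> n" for j using s_ge[of j] that by simp
        have "s 0 \<le> n" by (simp add: s_def)
        then show "s (jj n) \<le> n" unfolding jj_def using b by (rule GreatestI_nat)
        show "n < s (Suc (jj n))"
        proof (rule ccontr)
          assume "\<not> ?thesis"
          then have "s (Suc (jj n)) \<le> n" by simp
          then have "Suc (jj n) \<le> jj n" unfolding jj_def using b by (rule Greatest_le_nat)
          then show False by simp
        qed
      qed
      \<comment> \<open>\<open>z\<close> comes without measurability, so \<open>hit p\<close> may
        not be an event. It is replaced by the cylinder of one of its members, which by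
        \<open>ball_cyl\<close> contains all the others.\<close>
      define C where "C p = (if hit p = {} then {} else cyl (jj (fst p)) (SOME \<omega>. \<omega> \<in> hit p))" for p
      have some: "(SOME \<omega>. \<omega> \<in> hit p) \<in> hit p" if "hit p \<noteq> {}" for p using that some_in_eq by blast
      have Cs: "C p \<in> sets ?P" for p using cyl some[of p] by (auto simp: C_def hit_def)
      have Cw: "emeasure ?P (C p) \<le> ennreal (weight t' \<phi> \<epsilon> (fst p) (snd p))" if p: "p \<in> K" for p
      proof (cases "hit p = {}")
        case False
        have h: "(SOME \<omega>. \<omega> \<in> hit p) \<in> space ?P" "z (SOME \<omega>. \<omega> \<in> hit p) \<in> bowen_ball (rho_dist f) T (fst p) (snd p) \<epsilon>"
          using some[OF False] by (auto simp: hit_def)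
        have "fst p \<ge> n0" using K p by (auto simp: ball_covers_def)
        then have "s J < s (Suc (jj (fst p)))" using jj(2)[of "fst p"] n0 by linarith
        then have "J \<le> jj (fst p)" using s_mono[of "Suc (jj (fst p))" J] by (meson not_less not_less_eq_eq)
        from weight_ge[OF h jj this] show ?thesis using False cyl[OF h(1)] by (simp add: C_def)
      qed (simp add: C_def)
      have "space ?P \<subseteq> (\<Union>p\<in>K. C p)"
      proof
        fix \<omega> assume \<omega>: "\<omega> \<in> space ?P"
        then have "z \<omega> \<in> Z" using z[of \<omega>] by (simp add: sp)
        then obtain p where p: "p \<in> K" "z \<omega> \<in> bowen_ball (rho_dist f) T (fst p) (snd p) \<epsilon>"
          using K by (fastforce simp: ball_covers_def)
        then have ne: "\<omega> \<in> hit p" using \<omega> by (simp add: hit_def)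
        then have ne': "hit p \<noteq> {}" by blast
        have "\<omega> \<in> cyl (jj (fst p)) (SOME \<omega>. \<omega> \<in> hit p)"
          using some[OF ne'] ne unfolding hit_def mem_Collect_eq by (intro ball_cyl[OF _ _ _ _ jj(1)]) blast+
        then show "\<omega> \<in> (\<Union>p\<in>K. C p)" using p(1) ne' by (auto simp: C_def)
      qed
      then have "emeasure ?P (space ?P) \<le> emeasure ?P (\<Union>p\<in>K. C p)"
        using Cs K by (intro emeasure_mono sets.countable_UN') (auto simp: ball_covers_def)
      also have "\<dots> \<le> (\<Sum>\<^sub>\<infinity>p\<in>K. emeasure ?P (C p))"
        using Cs K by (intro emeasure_UN_le_infsum) (auto simp: ball_covers_def)
      also have "\<dots> \<le> (\<Sum>\<^sub>\<infinity>p\<in>K. ennreal (weight t' \<phi> \<epsilon> (fst p) (snd p)))"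
        unfolding nonneg_infsum_complete[OF zero_le]
        by (rule SUP_subset_mono[OF order_refl], rule sum_mono, rule Cw) blast
      finally show "1 \<le> (\<Sum>\<^sub>\<infinity>(m, x)\<in>K. ennreal (exp (- t' * real m + (SUP y\<in>bowen_ball (rho_dist f) T m x \<epsilon>. birkhoff_sum T \<phi> m y))))"
        unfolding P.emeasure_space_1 weight_def case_prod_beta .
    qed
  qed
qed

end

text \<open>Stage \<open>k\<close> lasts so long that everything before it is negligible and that the first unit of the
  next stage is negligible as well.\<close>

lemma schedule:
  fixes l :: "nat \<Rightarrow> nat"
  assumes l: "\<And>k. l k \<ge> 1"
  shows "\<exists>(st :: nat \<Rightarrow> nat) a. (\<forall>\<kappa>>0. \<exists>J. \<forall>i\<ge>J. real (l (st i)) \<le> \<kappa> * real (\<Sum>j<i. l (st j))) \<and>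
    (\<forall>k i. a k \<le> i \<and> i < a (Suc k) \<longrightarrow> st i = k) \<and> (\<forall>k. a k \<le> a (Suc k)) \<and>
    (\<forall>k. Suc k * ((\<Sum>j<a k. l (st j)) + 1) \<le> (\<Sum>j<a (Suc k). l (st j)))"
proof -
  \<comment> \<open>The number of repetitions of unit \<open>k\<close> when time \<open>S\<close>
    has passed. The summands \<open>S + 1\<close> and \<open>l (Suc k)\<close> make the past and the
    first unit of the next stage negligible, through the growing factor
    \<open>Suc k\<close>.\<close>
  define len where "len k S = Suc k * (S + l (Suc k) + 1)" for k S
  define S where "S = rec_nat 0 (\<lambda>k S. S + len k S * l k)"
  define a where "a k = (\<Sum>j<k. len j (S j))" for k
  define st where "st i = (LEAST k. i < a (Suc k))" for i
  have S: "S 0 = 0" "S (Suc k) = S k + len k (S k) * l k" for k by (simp_all add: S_def)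
  have a_mono: "a i \<le> a j" if "i \<le> j" for i j unfolding a_def using that by (intro sum_mono2) auto
  have a_Suc: "a (Suc k) = a k + len k (S k)" for k by (simp add: a_def)
  have a_ge: "k \<le> a k" for k
  proof (induction k)
    case (Suc k)
    then show ?case unfolding a_Suc by (simp add: len_def)
  qed simp
  have st: "st i = k" if "a k \<le> i" "i < a (Suc k)" for i k
    unfolding st_def
  proof (rule Least_equality, rule that(2))
    fix j assume "i < a (Suc j)"
    then have "\<not> Suc j \<le> k" using a_mono[of "Suc j" k] that(1) by auto
    then show "k \<le> j" by simp
  qed
  have st_a: "a (st i) \<le> i" for i
  proof (cases "st i")
    case (Suc k)
    then have "\<not> i < a (Suc k)" unfolding st_def by (intro not_less_Least) simp
    then show ?thesis using Suc by simp
  qed (simp add: a_def)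
  define s where "s i = (\<Sum>j<i. l (st j))" for i
  have s_mono: "s i \<le> s j" if "i \<le> j" for i j unfolding s_def using that by (intro sum_mono2) auto
  have s_a: "s (a k) = S k" for k
  proof (induction k)
    case 0
    show ?case by (simp add: s_def a_def S)
  next
    case (Suc k)
    have "s (a (Suc k)) = s (a k) + (\<Sum>j\<in>{a k..<a (Suc k)}. l (st j))"
      using a_mono[of k "Suc k"] unfolding s_def by (simp add: sum.atLeastLessThan_concat lessThan_atLeast0)
    also have "(\<Sum>j\<in>{a k..<a (Suc k)}. l (st j)) = (\<Sum>j\<in>{a k..<a (Suc k)}. l k)"
      by (intro sum.cong refl) (simp add: st[of k])
    finally show ?case using Suc by (simp add: S a_Suc)
  qed
  have step: "Suc k * (S k + l (Suc k) + 1) \<le> S (Suc k)" for k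
  proof -
    have "len k (S k) * 1 \<le> len k (S k) * l k" by (intro mult_le_mono le_refl l)
    then show ?thesis by (simp add: S len_def)
  qed
  have 1: "\<exists>J. \<forall>i\<ge>J. real (l (st i)) \<le> \<kappa> * real (s i)" if \<kappa>: "\<kappa> > 0" for \<kappa> :: real
  proof -
    obtain J :: nat where J: "1 / \<kappa> < real J" using reals_Archimedean2 by blast
    have "real (l (st i)) \<le> \<kappa> * real (s i)" if i: "i \<ge> a (Suc J)" for i
    proof -
      \<comment> \<open>The current stage is then not the first one, so the length of its unit was
        already charged to the preceding stage.\<close>
      have "Suc J \<le> st i"
      proof (rule ccontr)
        assume "\<not> ?thesis"
        then have "a (Suc (st i)) \<le> i" using a_mono[of "Suc (st i)" "Suc J"] i by simp
        moreover have "i < a (Suc (st i))"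
          unfolding st_def by (rule LeastI[of _ i]) (use a_ge[of "Suc i"] in simp)
        ultimately show False by simp
      qed
      then obtain k where k: "st i = Suc k" "J \<le> k" by (cases "st i") auto
      have "k * l (Suc k) \<le> Suc k * (S k + l (Suc k) + 1)" by (intro mult_le_mono) auto
      also have "\<dots> \<le> S (Suc k)" by (rule step)
      also have "\<dots> \<le> s i" using s_mono[OF st_a[of i]] by (simp add: k s_a)
      finally have "real k * real (l (Suc k)) \<le> real (s i)" by (simp flip: of_nat_mult)
      then have "\<kappa> * (real k * real (l (Suc k))) \<le> \<kappa> * real (s i)" using \<kappa> by (intro mult_left_mono) auto
      moreover have "1 \<le> \<kappa> * real k"
      proof -
        have "1 / \<kappa> \<le> real k" using J k(2) by simp
        then show ?thesis using \<kappa> by (simp add: divide_le_eq mult.commute)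
      qed
      then have "1 * real (l (Suc k)) \<le> \<kappa> * real k * real (l (Suc k))" by (rule mult_right_mono) simp
      ultimately show ?thesis unfolding k by (simp add: mult.assoc)
    qed
    then show ?thesis by blast
  qed
  have 2: "Suc k * (s (a k) + 1) \<le> s (a (Suc k))" for k
  proof -
    have "Suc k * (S k + 1) \<le> Suc k * (S k + l (Suc k) + 1)" by (intro mult_le_mono) auto
    then show ?thesis using step[of k] unfolding s_a by linarith
  qed
  show ?thesis
  proof (rule exI[of _ st], rule exI[of _ a], intro conjI allI impI)
    show "\<exists>J. \<forall>i\<ge>J. real (l (st i)) \<le> \<kappa> * real (\<Sum>j<i. l (st j))" if "0 < \<kappa>" for \<kappa> :: real
      using 1[OF that] unfolding s_def .
    show "st i = k" if "a k \<le> i \<and> i < a (Suc k)" for k i using that st by blast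
    show "a k \<le> a (Suc k)" for k by (rule a_mono) simp
    show "Suc k * ((\<Sum>j<a k. l (st j)) + 1) \<le> (\<Sum>j<a (Suc k). l (st j))" for k using 2 unfolding s_def .
  qed
qed

section \<open>Approach to the target measures at the ends of the stages\<close>

lemma block_average:
  fixes B L :: "nat \<Rightarrow> real"
  assumes "\<And>i. i < a \<Longrightarrow> \<bar>B i - L i * I\<bar> \<le> L i" "\<And>i. a \<le> i \<Longrightarrow> i < b \<Longrightarrow> \<bar>B i - L i * I\<bar> \<le> L i * e"
    and "a \<le> b" "\<And>i. 0 \<le> L i" "0 \<le> e"
  shows "\<bar>(\<Sum>i<b. B i) - (\<Sum>i<b. L i) * I\<bar> \<le> (\<Sum>i<a. L i) + e * (\<Sum>i<b. L i)"
proof -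
  have "(\<Sum>i<b. B i) - (\<Sum>i<b. L i) * I = (\<Sum>i<b. B i - L i * I)" by (simp add: sum_subtractf sum_distrib_right)
  also have "\<bar>\<dots>\<bar> \<le> (\<Sum>i<b. \<bar>B i - L i * I\<bar>)" by (rule sum_abs)
  \<comment> \<open>Blocks before \<open>a\<close> only have the trivial bound; in the application
    their total length is negligible.\<close>
  also have "\<dots> \<le> (\<Sum>i<b. (if i < a then L i else 0) + L i * e)"
  proof (rule sum_mono)
    fix i assume "i \<in> {..<b}"
    then show "\<bar>B i - L i * I\<bar> \<le> (if i < a then L i else 0) + L i * e"
      using assms(1,2)[of i] mult_nonneg_nonneg[OF assms(4,5), of i] by (cases "i < a") auto
  qed
  also have "\<dots> = (\<Sum>i<a. L i) + e * (\<Sum>i<b. L i)"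
  proof -
    have "{..<b} \<inter> {i. i < a} = {..<a}" using assms(3) by auto
    then show ?thesis by (simp add: sum.distrib sum.If_cases sum_distrib_left mult.commute)
  qed
  finally show ?thesis .
qed

context compact_system
begin

lemma metric_entropy_gt_label:
  assumes "ereal t < metric_entropy T \<mu> + ereal p"
  shows "\<exists>P. labelling (part_label P) \<and> t < label_entropy T \<mu> (part_label P) + p"
proof -
  have "ereal (t - p) < metric_entropy T \<mu>"
    using assms by (cases "metric_entropy T \<mu>") auto
  then obtain P where P: "partition_on UNIV P" "finite P" "P \<subseteq> sets borel" "ereal (t - p) < ereal (label_entropy T \<mu> (part_label P))"
    unfolding metric_entropy_eq less_SUP_iff by blast
  then show ?thesis using labelling_part_label[OF P(1-3)] by (intro exI[of _ P]) auto
qed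

end

context specification_system
begin

text \<open>\<open>C\<close> may be uncountable while only countably many stages exist. Countable
  representatives at every accuracy suffice, since each target measure has to be reached only in the
  limit.\<close>

lemma pressure_lower_bound:
  fixes \<Xi> :: "'a measure \<Rightarrow> 'b::metric_space" and t \<eta> :: real
  assumes sep: "uniform_separation (rho_dist f) T" and \<Xi>: "continuous_map weak_star euclidean \<Xi>"
    and \<phi>: "continuous_on UNIV \<phi>" and C: "C \<noteq> {}"
    and t: "\<And>y. y \<in> C \<Longrightarrow> \<exists>\<mu>\<in>inv_prob T. \<Xi> \<mu> = y \<and> ereal t < metric_entropy T \<mu> + ereal (integral\<^sup>L \<mu> \<phi>)"
    and \<eta>: "\<eta> > 0"
  shows "\<exists>\<epsilon>0>0. \<forall>\<epsilon>>0. \<epsilon> \<le> \<epsilon>0 \<longrightarrow> ereal (t - 6 * \<eta>) \<le> pressure_at (rho_dist f) T (Delta_sub T \<Xi> C) \<phi> \<epsilon>"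
proof -
  obtain \<delta> \<epsilon>1 where \<delta>: "\<delta> > 0" "\<epsilon>1 > 0" and sepn: "\<forall>\<nu>\<in>ergodic_prob T. \<forall>F. weak_star_nhd \<nu> F \<longrightarrow>
        (\<exists>N. \<forall>n\<ge>N. sep_number (rho_dist f) T F \<delta> n \<epsilon>1 \<ge> exp_ereal (ereal (real n) * (metric_entropy T \<nu> - ereal \<eta>)))"
    using sep[unfolded uniform_separation_def, rule_format, OF \<eta>] by (elim exE conjE)
  \<comment> \<open>Representatives are drawn from \<open>D\<close>, so each retains the lower bound
    \<open>t\<close>; closeness to a good measure would not give it, as entropy is not
    continuous.\<close>
  define D where "D = {\<mu> \<in> inv_prob T. \<Xi> \<mu> \<in> C \<and> ereal t < metric_entropy T \<mu> + ereal (integral\<^sup>L \<mu> \<phi>)}"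
  have "\<forall>p. \<exists>D'. countable D' \<and> D' \<subseteq> D \<and>
      (\<forall>\<mu>\<in>D. \<exists>\<nu>\<in>D'. \<forall>q<Suc p. \<bar>integral\<^sup>L \<nu> (f q) - integral\<^sup>L \<mu> (f q)\<bar> < 1 / real (Suc p))"
  proof
    fix p
    have le_Suc_p: "1 \<le> Suc p" by simp
    obtain D' where D': "countable D'" "D' \<subseteq> D"
      "\<And>\<mu>. \<mu> \<in> D \<Longrightarrow> \<exists>\<nu>\<in>D'. \<forall>q<Suc p. \<bar>integral\<^sup>L \<nu> (f q) - integral\<^sup>L \<mu> (f q)\<bar> < 1 / real (Suc p)"
      by (rule countable_representatives[OF le_Suc_p, of D]) (rule that; assumption)
    show "\<exists>D'. countable D' \<and> D' \<subseteq> D \<and>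
      (\<forall>\<mu>\<in>D. \<exists>\<nu>\<in>D'. \<forall>q<Suc p. \<bar>integral\<^sup>L \<nu> (f q) - integral\<^sup>L \<mu> (f q)\<bar> < 1 / real (Suc p))"
      by (intro exI[of _ D'] conjI ballI D')
  qed
  from choice[OF this] obtain R where R: "\<forall>p. countable (R p) \<and> R p \<subseteq> D \<and>
      (\<forall>\<mu>\<in>D. \<exists>\<nu>\<in>R p. \<forall>q<Suc p. \<bar>integral\<^sup>L \<nu> (f q) - integral\<^sup>L \<mu> (f q)\<bar> < 1 / real (Suc p))" ..
  define D' where "D' = (\<Union>p. R p)"
  have cD': "countable D'" unfolding D'_def using R by (intro countable_UN) auto
  have D'D: "D' \<subseteq> D" unfolding D'_def using R by blast
  have D'ne: "D' \<noteq> {}"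
  proof -
    obtain y where "y \<in> C" using C by blast
    then obtain \<mu> where "\<mu> \<in> D" using t[of y] by (auto simp: D_def)
    then obtain \<nu> where "\<nu> \<in> R 0" using R[rule_format, of 0] by blast
    then show ?thesis by (auto simp: D'_def)
  qed
  \<comment> \<open>The first component of the pairing repeats every representative infinitely
    often.\<close>
  define M where "M k = from_nat_into D' (fst (prod_decode k))" for k
  have M: "M k \<in> D" for k using from_nat_into[OF D'ne] D'D by (auto simp: M_def)
  \<comment> \<open>The second bound cancels the factor 3 in the output of
    \<open>stage_unit\<close>; the bound \<eta> is among its hypotheses.\<close>
  define e where "e k = min \<eta> (1 / (3 * real (Suc k)))" for k
  have e: "e k > 0" "e k \<le> \<eta>" "3 * e k \<le> 1 / real (Suc k)" for k using \<eta> by (auto simp: e_def min_def field_simps)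
  have "\<forall>k. \<exists>l U. l \<ge> 1 \<and> unit_family (\<epsilon>1 / 3) l U \<and>
    (\<forall>R\<in>U. \<forall>u\<in>R. l * (t - 6 * \<eta>) \<le> ln (card U) + birkhoff_sum T \<phi> l u) \<and>
    (\<forall>R\<in>U. \<forall>u\<in>R. \<forall>p<Suc k. \<bar>birkhoff_sum T (f p) l u - l * integral\<^sup>L (M k) (f p)\<bar> \<le> l * (3 * e k))"
  proof
    fix k
    have Mk: "M k \<in> inv_prob T" "ereal t < metric_entropy T (M k) + ereal (integral\<^sup>L (M k) \<phi>)"
      using M[of k] by (auto simp: D_def)
    from metric_entropy_gt_label[OF Mk(2)] obtain P where P: "labelling (part_label P)"
      "t < label_entropy T (M k) (part_label P) + integral\<^sup>L (M k) \<phi>" by (elim exE conjE)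
    show "\<exists>l U. l \<ge> 1 \<and> unit_family (\<epsilon>1 / 3) l U \<and>
      (\<forall>R\<in>U. \<forall>u\<in>R. l * (t - 6 * \<eta>) \<le> ln (card U) + birkhoff_sum T \<phi> l u) \<and>
      (\<forall>R\<in>U. \<forall>u\<in>R. \<forall>p<Suc k. \<bar>birkhoff_sum T (f p) l u - l * integral\<^sup>L (M k) (f p)\<bar> \<le> l * (3 * e k))"
      by (rule stage_unit[OF _ \<delta> \<eta> Mk(1) P(1) \<phi> P(2) e(1,2)]) (rule sepn[rule_format])
  qed
  from choice[OF this] obtain l where "\<forall>k. \<exists>U. l k \<ge> 1 \<and> unit_family (\<epsilon>1 / 3) (l k) U \<and>
    (\<forall>R\<in>U. \<forall>u\<in>R. l k * (t - 6 * \<eta>) \<le> ln (card U) + birkhoff_sum T \<phi> (l k) u) \<and>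
    (\<forall>R\<in>U. \<forall>u\<in>R. \<forall>p<Suc k. \<bar>birkhoff_sum T (f p) (l k) u - l k * integral\<^sup>L (M k) (f p)\<bar> \<le> l k * (3 * e k))" ..
  from choice[OF this] obtain U where lU: "\<forall>k. l k \<ge> 1 \<and> unit_family (\<epsilon>1 / 3) (l k) (U k) \<and>
    (\<forall>R\<in>U k. \<forall>u\<in>R. l k * (t - 6 * \<eta>) \<le> ln (card (U k)) + birkhoff_sum T \<phi> (l k) u) \<and>
    (\<forall>R\<in>U k. \<forall>u\<in>R. \<forall>p<Suc k. \<bar>birkhoff_sum T (f p) (l k) u - l k * integral\<^sup>L (M k) (f p)\<bar> \<le> l k * (3 * e k))" ..
  have l: "l k \<ge> 1" and U: "unit_family (\<epsilon>1 / 3) (l k) (U k)"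
    and U\<phi>: "\<And>Q u. Q \<in> U k \<Longrightarrow> u \<in> Q \<Longrightarrow> l k * (t - 6 * \<eta>) \<le> ln (card (U k)) + birkhoff_sum T \<phi> (l k) u"
    and Uf: "\<And>Q u p. Q \<in> U k \<Longrightarrow> u \<in> Q \<Longrightarrow> p < Suc k \<Longrightarrow>
      \<bar>birkhoff_sum T (f p) (l k) u - l k * integral\<^sup>L (M k) (f p)\<bar> \<le> l k * (3 * e k)" for k
    using lU[rule_format, of k] by simp_all
  from schedule[of l, OF l] obtain st a :: "nat \<Rightarrow> nat" where
    small: "\<forall>\<kappa>>0. \<exists>J. \<forall>i\<ge>J. real (l (st i)) \<le> \<kappa> * real (\<Sum>j<i. l (st j))" and
    st: "\<forall>k i. a k \<le> i \<and> i < a (Suc k) \<longrightarrow> st i = k" and a: "\<forall>k. a k \<le> a (Suc k)" and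
    sa: "\<forall>k. Suc k * ((\<Sum>j<a k. l (st j)) + 1) \<le> (\<Sum>j<a (Suc k). l (st j))" by (elim exE conjE)
  define s where "s i = (\<Sum>j<i. l (st j))" for i
  define w where "w \<omega> = (SOME z. \<forall>i. (T ^^ s i) z \<in> \<omega> i)" for \<omega>
  have w: "(T ^^ s i) (w \<omega>) \<in> \<omega> i" if \<omega>: "\<And>i. \<omega> i \<in> U (st i)" for \<omega> i
  proof -
    have "Glued (l (st i)) (\<omega> i)" for i using U[of "st i"] \<omega>[of i] by (simp add: unit_family_def)
    from orbit_point[of "\<lambda>i. l (st i)" \<omega>, OF this] have "\<exists>z. \<forall>i. (T ^^ s i) z \<in> \<omega> i" unfolding s_def .
    then have "\<forall>i. (T ^^ s i) (w \<omega>) \<in> \<omega> i" unfolding w_def by (rule someI_ex)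
    then show ?thesis ..
  qed
  \<comment> \<open>The end of stage \<open>k\<close>, the only time at which the averages are
    controlled.\<close>
  define n where "n k = s (a (Suc k))" for k
  have n_ge: "Suc k * (s (a k) + 1) \<le> n k" for k using sa unfolding n_def s_def by blast
  have n_gt: "k < n k" for k
  proof -
    have "k < Suc k * (s (a k) + 1)" by simp
    then show ?thesis using n_ge[of k] by (rule less_le_trans)
  qed
  have stage_end: "\<bar>integral\<^sup>L (empirical T (n k) (w \<omega>)) (f p) - integral\<^sup>L (M k) (f p)\<bar> \<le> 2 / real (Suc k)"
    if \<omega>: "\<And>i. \<omega> i \<in> U (st i)" and p: "p < Suc k" for \<omega> k p
  proof -
    let ?I = "integral\<^sup>L (M k) (f p)" and ?z = "w \<omega>"
    have "M k \<in> inv_prob T" using M[of k] by (simp add: D_def)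
    then have I01: "0 \<le> ?I" "?I \<le> 1" using integral_f_range inv_prob_borel_prob by blast+
    let ?B = "\<lambda>i. birkhoff_sum T (f p) (l (st i)) ((T ^^ s i) ?z)"
    have "\<bar>(\<Sum>i<a (Suc k). ?B i) - (\<Sum>i<a (Suc k). real (l (st i))) * ?I\<bar>
        \<le> (\<Sum>i<a k. real (l (st i))) + 3 * e k * (\<Sum>i<a (Suc k). real (l (st i)))"
    proof (rule block_average)
      show "\<bar>?B i - real (l (st i)) * ?I\<bar> \<le> real (l (st i))" for i
      proof -
        have "0 \<le> ?B i" unfolding birkhoff_sum_def by (intro sum_nonneg f_range)
        moreover have "?B i \<le> (\<Sum>j<l (st i). 1)" unfolding birkhoff_sum_def by (intro sum_mono f_range)
        moreover have "0 \<le> real (l (st i)) * ?I" "real (l (st i)) * ?I \<le> real (l (st i)) * 1"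
          using I01 by (intro mult_nonneg_nonneg mult_left_mono; simp)+
        ultimately show ?thesis by simp
      qed
      show "\<bar>?B i - real (l (st i)) * ?I\<bar> \<le> real (l (st i)) * (3 * e k)" if i: "a k \<le> i" "i < a (Suc k)" for i
      proof -
        have si: "st i = k" using st i by blast
        show ?thesis using Uf[OF \<omega>[of i, unfolded si] w[OF \<omega>, of i] p] unfolding si .
      qed
    qed (use a e(1)[of k] in simp_all)
    \<comment> \<open>The past before the stage and the inaccuracy of its letters each contribute at
      most \<open>n k / Suc k\<close>, which gives \<open>2 / Suc k\<close> after division.\<close>
    then have 1: "\<bar>birkhoff_sum T (f p) (n k) ?z - n k * ?I\<bar> \<le> s (a k) + 3 * e k * n k"
      unfolding n_def s_def birkhoff_sum_blocks by simp
    have n0: "real (n k) > 0" using n_gt[of k] by simp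
    have "real (Suc k) * real (s (a k)) \<le> real (n k)"
    proof -
      have "Suc k * s (a k) \<le> Suc k * (s (a k) + 1)" by (intro mult_le_mono) auto
      also note n_ge[of k]
      finally show ?thesis unfolding of_nat_mult[symmetric] of_nat_le_iff .
    qed
    then have 2: "s (a k) \<le> n k * (1 / real (Suc k))" by (simp add: field_simps)
    have 3: "3 * e k * n k \<le> 1 / real (Suc k) * n k" by (rule mult_right_mono[OF e(3)]) simp
    have "birkhoff_sum T (f p) (n k) ?z / n k - ?I = (birkhoff_sum T (f p) (n k) ?z - n k * ?I) / n k"
      using n0 by (simp add: diff_divide_distrib)
    then have "\<bar>birkhoff_sum T (f p) (n k) ?z / n k - ?I\<bar> = \<bar>birkhoff_sum T (f p) (n k) ?z - n k * ?I\<bar> / n k"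
      by (simp only: abs_divide abs_of_nat)
    also have "\<dots> \<le> (n k * (1 / real (Suc k)) + 1 / real (Suc k) * n k) / n k"
      using 1 2 3 by (intro divide_right_mono) linarith+
    also have "\<dots> = 2 / real (Suc k)" using n0 by (simp add: add_divide_distrib)
    finally show ?thesis using integral_empirical_birkhoff[OF _ cont_f[of p], of "n k" ?z] n_gt[of k] by simp
  qed
  have Delta: "w \<omega> \<in> Delta_sub T \<Xi> C" if \<omega>: "\<And>i. \<omega> i \<in> U (st i)" for \<omega>
    unfolding Delta_sub_def mem_Collect_eq
  proof
    fix y assume "y \<in> C"
    then obtain \<mu> where \<mu>: "\<mu> \<in> D" "\<Xi> \<mu> = y" using t[of y] by (auto simp: D_def)
    then have \<mu>': "\<mu> \<in> borel_prob" by (simp add: D_def inv_prob_borel_prob)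
    \<comment> \<open>Each accuracy uses its own representative. It occurs as \<open>M k\<close> for
      arbitrarily late \<open>k\<close>, because \<open>prod_encode (i, P)\<close> is at least
      \<open>P\<close>.\<close>
    have "\<forall>P. \<exists>k\<ge>P. \<forall>q<Suc P. \<bar>integral\<^sup>L (M k) (f q) - integral\<^sup>L \<mu> (f q)\<bar> < 1 / real (Suc P)"
    proof
      fix P
      obtain \<nu> where \<nu>: "\<nu> \<in> R P" "\<forall>q<Suc P. \<bar>integral\<^sup>L \<nu> (f q) - integral\<^sup>L \<mu> (f q)\<bar> < 1 / real (Suc P)"
        using R[rule_format, of P] \<mu>(1) by blast
      then have "\<nu> \<in> D'" by (auto simp: D'_def)
      then obtain i where i: "from_nat_into D' i = \<nu>" using from_nat_into_surj[OF cD'] by blast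
      show "\<exists>k\<ge>P. \<forall>q<Suc P. \<bar>integral\<^sup>L (M k) (f q) - integral\<^sup>L \<mu> (f q)\<bar> < 1 / real (Suc P)"
        by (rule exI[of _ "prod_encode (i, P)"]) (use \<nu>(2) i le_prod_encode_2[of P i] in \<open>simp add: M_def\<close>)
    qed
    from choice[OF this] obtain k where k: "\<forall>P. k P \<ge> P \<and> (\<forall>q<Suc P. \<bar>integral\<^sup>L (M (k P)) (f q) - integral\<^sup>L \<mu> (f q)\<bar> < 1 / real (Suc P))" ..
    define N where "N P = n (k P)" for P
    have N: "P < N P" for P using n_gt[of "k P"] k[rule_format, of P] by (simp add: N_def)
    have eb: "empirical T (N P) (w \<omega>) \<in> borel_prob" for P using N[of P] by (intro empirical_borel_prob) simp
    have conv: "wconv (\<lambda>P. empirical T (N P) (w \<omega>)) \<mu>"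
    proof (rule wconvI[OF eb \<mu>'])
      fix q
      have "(\<lambda>P. integral\<^sup>L (empirical T (N P) (w \<omega>)) (f q) - integral\<^sup>L \<mu> (f q)) \<longlonglongrightarrow> 0"
      proof (rule tendsto_rabs_zero_cancel, rule tendsto_sandwich[where f="\<lambda>_. 0" and h="\<lambda>P. 3 * (1 / real (Suc P))"])
        show "(\<lambda>P. 3 * (1 / real (Suc P))) \<longlonglongrightarrow> 0"
          by (rule tendsto_mult_right_zero) (use LIMSEQ_inverse_real_of_nat in \<open>simp add: inverse_eq_divide\<close>)
        show "\<forall>\<^sub>F P in sequentially. \<bar>integral\<^sup>L (empirical T (N P) (w \<omega>)) (f q) - integral\<^sup>L \<mu> (f q)\<bar> \<le> 3 * (1 / real (Suc P))"
        proof (rule eventually_sequentiallyI[of q])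
          fix P assume P: "q \<le> P"
          have kP: "P \<le> k P" "\<bar>integral\<^sup>L (M (k P)) (f q) - integral\<^sup>L \<mu> (f q)\<bar> < 1 / real (Suc P)"
            using k P by auto
          have "\<bar>integral\<^sup>L (empirical T (N P) (w \<omega>)) (f q) - integral\<^sup>L (M (k P)) (f q)\<bar> \<le> 2 / real (Suc (k P))"
            unfolding N_def by (rule stage_end[OF \<omega>]) (use P kP(1) in simp)
          also have "\<dots> \<le> 2 * (1 / real (Suc P))" using kP(1) by (simp add: frac_le)
          finally show "\<bar>integral\<^sup>L (empirical T (N P) (w \<omega>)) (f q) - integral\<^sup>L \<mu> (f q)\<bar> \<le> 3 * (1 / real (Suc P))"
            using kP(2) by linarith
        qed
      qed simp_all
      then show "(\<lambda>P. integral\<^sup>L (empirical T (N P) (w \<omega>)) (f q)) \<longlonglongrightarrow> integral\<^sup>L \<mu> (f q)" by (simp add: LIM_zero_iff)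
    qed
    \<comment> \<open>The times \<open>N P\<close> need not increase with \<open>P\<close>.
      Iterating \<open>N\<close> from 0 selects an increasing subsequence, since \<open>N P\<close>
      exceeds \<open>P\<close>.\<close>
    define r where "r i = (N ^^ i) 0" for i
    have r_Suc: "r (Suc i) = N (r i)" for i by (simp add: r_def)
    have r: "strict_mono r" unfolding strict_mono_Suc_iff r_Suc using N by simp
    from wconv_subseq[OF conv r] have "wconv (\<lambda>i. empirical T (r (Suc i)) (w \<omega>)) \<mu>" unfolding r_Suc .
    from Xi_wconv[OF \<Xi> this \<mu>'] have lim: "(\<lambda>i. \<Xi> (empirical T (r (Suc i)) (w \<omega>))) \<longlonglongrightarrow> y"
      unfolding \<mu>(2) r_Suc using eb by blast
    have pos: "0 < r (Suc i)" for i unfolding r_Suc using N[of "r i"] by simp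
    \<comment> \<open>The subtraction compensates the \<open>Suc\<close> in
      \<open>emp_accumulation\<close>.\<close>
    have "strict_mono (\<lambda>i. r (Suc i) - 1)"
      unfolding strict_mono_Suc_iff
    proof
      fix i
      show "r (Suc i) - 1 < r (Suc (Suc i)) - 1" using strict_monoD[OF r, of "Suc i" "Suc (Suc i)"] pos[of i] by simp
    qed
    then show "y \<in> emp_accumulation T \<Xi> (w \<omega>)"
      unfolding emp_accumulation_def accumulation_points_def mem_Collect_eq
      using lim pos by (intro exI[of _ "\<lambda>i. r (Suc i) - 1"]) (simp add: o_def)
  qed
  \<comment> \<open>The letters are separated at scale \<open>\<epsilon>1 / 3\<close>, and
    \<open>fractal_cover\<close> needs twice the radius to be at most this.\<close>
  have "ereal (t - 6 * \<eta>) \<le> pressure_at (rho_dist f) T (Delta_sub T \<Xi> C) \<phi> \<epsilon>" if \<epsilon>: "\<epsilon> > 0" "\<epsilon> \<le> \<epsilon>1 / 6" for \<epsilon>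
    unfolding pressure_at_def
  proof (rule INF_greatest)
    fix t' assume "t' \<in> {t. cover_mass (rho_dist f) T (Delta_sub T \<Xi> C) t \<phi> \<epsilon> = 0}"
    then have z: "cover_mass (rho_dist f) T (Delta_sub T \<Xi> C) t' \<phi> \<epsilon> = 0" by simp
    have "\<not> t' < t - 6 * \<eta>"
    proof
      assume t': "t' < t - 6 * \<eta>"
      have "\<exists>N. \<forall>n\<ge>N. 1 \<le> cover_mass_at (rho_dist f) T (Delta_sub T \<Xi> C) t' \<phi> n \<epsilon>"
      proof (rule fractal_cover[where l="\<lambda>i. l (st i)" and U="\<lambda>i. U (st i)" and z=w and t="t - 6 * \<eta>" and ?\<epsilon>1.0="\<epsilon>1 / 3"])
        show "real (l (st i)) * (t - 6 * \<eta>) \<le> ln (real (card (U (st i)))) + birkhoff_sum T \<phi> (l (st i)) u"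
          if "Q \<in> U (st i)" "u \<in> Q" for i Q u by (rule U\<phi>[OF that])
        show "\<exists>J. \<forall>i\<ge>J. real (l (st i)) \<le> \<kappa> * real (\<Sum>j<i. l (st j))" if "\<kappa> > 0" for \<kappa> :: real
          using small that by blast
        show "w \<omega> \<in> Delta_sub T \<Xi> C \<and> (\<forall>i. (T ^^ (\<Sum>j<i. l (st j))) (w \<omega>) \<in> \<omega> i)" if "\<And>i. \<omega> i \<in> U (st i)" for \<omega>
          using Delta[OF that] w[OF that] by (simp add: s_def)
      qed (use U l \<phi> \<epsilon> t' in auto)
      then obtain N where "\<And>n. n \<ge> N \<Longrightarrow> 1 \<le> cover_mass_at (rho_dist f) T (Delta_sub T \<Xi> C) t' \<phi> n \<epsilon>" by blast
      from cover_mass_ge[OF this] z show False by simp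
    qed
    then show "ereal (t - 6 * \<eta>) \<le> ereal t'" by simp
  qed
  then show ?thesis using \<delta>(2) by (intro exI[of _ "\<epsilon>1 / 6"]) simp
qed

section \<open>The limit as the radius tends to zero\<close>

lemma pressure_at_tendsto:
  fixes \<Xi> :: "'a measure \<Rightarrow> 'b::metric_space"
  assumes sep: "uniform_separation (rho_dist f) T" and \<Xi>: "continuous_map weak_star euclidean \<Xi>"
    and \<phi>: "continuous_on UNIV \<phi>" and C: "C \<noteq> {}"
  shows "((\<lambda>\<epsilon>. pressure_at (rho_dist f) T (Delta_sub T \<Xi> C) \<phi> \<epsilon>) \<longlongrightarrow>
    (INF y\<in>C. SUP \<mu> \<in> {\<mu> \<in> inv_prob T. \<Xi> \<mu> = y}. metric_entropy T \<mu> + ereal (integral\<^sup>L \<mu> \<phi>))) (at_right 0)"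
    (is "(?p \<longlongrightarrow> (INF y\<in>C. ?S y)) _")
proof (rule order_tendstoI)
  fix a assume "a < (INF y\<in>C. ?S y)"
  then obtain t where t: "a < ereal t" "ereal t < (INF y\<in>C. ?S y)" using ereal_dense2 by blast
  \<comment> \<open>The room between \<open>b\<close> and \<open>t\<close> pays for the losses: with
    \<eta> equal to \<open>(t - b) / 6\<close> the bound \<open>t - 6 * \<eta>\<close> is exactly
    \<open>b\<close>.\<close>
  then obtain b where b: "a < ereal b" "b < t" using ereal_dense2[of a "ereal t"] by auto
  have "\<exists>\<mu>\<in>inv_prob T. \<Xi> \<mu> = y \<and> ereal t < metric_entropy T \<mu> + ereal (integral\<^sup>L \<mu> \<phi>)" if "y \<in> C" for y
  proof -
    have "ereal t < ?S y" using t(2) INF_lower[OF that, of ?S] by (rule less_le_trans)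
    then show ?thesis unfolding less_SUP_iff by blast
  qed
  moreover have "(t - b) / 6 > 0" using b by simp
  ultimately have "\<exists>\<epsilon>0>0. \<forall>\<epsilon>>0. \<epsilon> \<le> \<epsilon>0 \<longrightarrow> ereal (t - 6 * ((t - b) / 6)) \<le> ?p \<epsilon>"
    by (intro pressure_lower_bound[OF sep \<Xi> \<phi> C])
  moreover have "t - 6 * ((t - b) / 6) = b" by (simp add: field_simps)
  ultimately obtain \<epsilon>0 where \<epsilon>0: "\<epsilon>0 > 0" "\<And>\<epsilon>. \<epsilon> > 0 \<Longrightarrow> \<epsilon> \<le> \<epsilon>0 \<Longrightarrow> ereal b \<le> ?p \<epsilon>" by metis
  show "\<forall>\<^sub>F \<epsilon> in at_right 0. a < ?p \<epsilon>"
    unfolding eventually_at_right_field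
  proof (intro exI[of _ \<epsilon>0] conjI allI impI \<epsilon>0(1))
    fix \<epsilon> :: real assume "\<epsilon> > 0" "\<epsilon> < \<epsilon>0"
    then have "ereal b \<le> ?p \<epsilon>" using \<epsilon>0(2) by simp
    with b(1) show "a < ?p \<epsilon>" by (rule less_le_trans)
  qed
next
  fix a assume "(INF y\<in>C. ?S y) < a"
  then obtain y where y: "y \<in> C" "?S y < a" unfolding INF_less_iff by blast
  then obtain t where t: "?S y < ereal t" "ereal t < a" using ereal_dense2 by blast
  then obtain b where b: "t < b" "ereal b < a" using ereal_dense2[of "ereal t" a] by auto
  have bt: "(b - t) / 2 > 0" using b by simp
  \<comment> \<open>The modulus \<open>(b - t) / 2\<close> turns the loss \<open>2 * g\<close> of
    the upper bound into exactly \<open>b - t\<close>, and every radius below \<open>d\<close>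
    inherits it.\<close>
  obtain d where d: "d > 0" "\<And>x y. rho_dist f x y \<le> d \<Longrightarrow> \<bar>\<phi> x - \<phi> y\<bar> \<le> (b - t) / 2"
    by (rule cont_rho_modulus[OF \<phi> bt]) (rule that; assumption)
  have lt: "metric_entropy T \<mu> + ereal (integral\<^sup>L \<mu> \<phi>) < ereal t" if "\<mu> \<in> inv_prob T" "\<Xi> \<mu> = y" for \<mu>
  proof -
    have "metric_entropy T \<mu> + ereal (integral\<^sup>L \<mu> \<phi>) \<le> ?S y" using that by (intro SUP_upper) simp
    then show ?thesis using t(1) by (rule le_less_trans)
  qed
  show "\<forall>\<^sub>F \<epsilon> in at_right 0. ?p \<epsilon> < a"
    unfolding eventually_at_right_field
  proof (intro exI[of _ d] conjI allI impI d(1))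
    fix \<epsilon> :: real assume \<epsilon>: "\<epsilon> > 0" "\<epsilon> < d"
    have "?p \<epsilon> \<le> ereal (t + 2 * ((b - t) / 2))"
    proof (rule pressure_upper_bound[OF \<Xi> \<phi> \<epsilon>(1) y(1) lt])
      show "\<bar>\<phi> x - \<phi> x'\<bar> \<le> (b - t) / 2" if "rho_dist f x x' \<le> \<epsilon>" for x x' using that \<epsilon> by (intro d(2)) simp
    qed
    moreover have "t + 2 * ((b - t) / 2) = b" by (simp add: field_simps)
    ultimately have "?p \<epsilon> \<le> ereal b" by metis
    then show "?p \<epsilon> < a" using b(2) by (rule le_less_trans)
  qed
qed

end

theorem theorem1p2:
  fixes T :: "'a::metric_space \<Rightarrow> 'a"
    and f :: "nat \<Rightarrow> 'a \<Rightarrow> real"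
    and \<Xi> :: "'a measure \<Rightarrow> 'b::{real_vector, metric_space}"
    and g :: "nat \<Rightarrow> nat"
    and \<phi> :: "'a \<Rightarrow> real"
    and C :: "'b set"
  assumes "compact (UNIV :: 'a set)"
    and "continuous_on UNIV T"
    and "dense_sequence f"
    and "\<And>x1 x2 y1 y2 :: 'b. dist (x1 + x2) (y1 + y2) \<le> dist x1 y1 + dist x2 y2"
    and "\<And>(c :: real) (x :: 'b) y. dist (c *\<^sub>R x) (c *\<^sub>R y) \<le> \<bar>c\<bar> * dist x y"
    and "continuous_map weak_star euclidean \<Xi>"
    and "affine_on_prob \<Xi>"
    and "blow_up g"
    and "almost_product (rho_dist f) T g"
    and "uniform_separation (rho_dist f) T"
    and "continuous_on UNIV \<phi>"
  shows "(\<not> C \<subseteq> \<Xi> ` inv_prob T \<longrightarrow> {x. C \<subseteq> emp_accumulation T \<Xi> x} = {}) \<and>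
    (C \<noteq> {} \<and> C \<subseteq> \<Xi> ` inv_prob T \<longrightarrow>
       top_pressure (rho_dist f) T (Delta_sub T \<Xi> C) \<phi>
         = (INF y\<in>C. SUP \<mu> \<in> {\<mu> \<in> inv_prob T. \<Xi> \<mu> = y}.
              metric_entropy T \<mu> + ereal (integral\<^sup>L \<mu> \<phi>)) \<and>
       (INF y\<in>C. SUP \<mu> \<in> {\<mu> \<in> inv_prob T. \<Xi> \<mu> = y}.
              metric_entropy T \<mu> + ereal (integral\<^sup>L \<mu> \<phi>))
         = (INF y\<in>C. Lambda_fun T \<Xi> \<phi> y))"
proof -
  obtain m :: "real \<Rightarrow> nat" where m: "\<forall>(k::nat) (x :: nat \<Rightarrow> 'a) (\<epsilon> :: nat \<Rightarrow> real) (n :: nat \<Rightarrow> nat).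
      k \<ge> 1 \<and> (\<forall>j\<in>{1..k}. \<epsilon> j > 0 \<and> n j \<ge> m (\<epsilon> j) \<and> n j \<ge> 1) \<longrightarrow>
      (\<Inter>j\<in>{1..k}. (T ^^ (\<Sum>i\<in>{1..<j}. n i)) -` g_ball (rho_dist f) T g (n j) (x j) (\<epsilon> j)) \<noteq> {}"
    using assms(9) unfolding almost_product_def by (elim exE conjE)
  interpret specification_system T f g m
  proof
    show "(\<Inter>j\<in>{1..k}. (T ^^ (\<Sum>i\<in>{1..<j}. n i)) -` g_ball (rho_dist f) T g (n j) (x j) (\<epsilon> j)) \<noteq> {}"
      if "k \<ge> 1" "\<forall>j\<in>{1..k}. \<epsilon> j > 0 \<and> n j \<ge> m (\<epsilon> j) \<and> n j \<ge> 1"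
      for k and x :: "nat \<Rightarrow> 'a" and \<epsilon> :: "nat \<Rightarrow> real" and n :: "nat \<Rightarrow> nat"
      by (rule m[rule_format], intro conjI that)
  qed (fact assms)+
  have acc: "y \<in> \<Xi> ` inv_prob T" if "y \<in> emp_accumulation T \<Xi> x" for x y
  proof -
    note y = that
    obtain \<mu> where "\<mu> \<in> inv_prob T" "\<Xi> \<mu> = y" by (rule emp_accumulation_limit[OF assms(6) y]) (rule that; assumption)
    then show ?thesis by blast
  qed
  show ?thesis
  proof (intro conjI impI)
    assume "\<not> C \<subseteq> \<Xi> ` inv_prob T"
    then show "{x. C \<subseteq> emp_accumulation T \<Xi> x} = {}" using acc by blast
  next
    assume C: "C \<noteq> {} \<and> C \<subseteq> \<Xi> ` inv_prob T"
    then show "top_pressure (rho_dist f) T (Delta_sub T \<Xi> C) \<phi>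
        = (INF y\<in>C. SUP \<mu> \<in> {\<mu> \<in> inv_prob T. \<Xi> \<mu> = y}. metric_entropy T \<mu> + ereal (integral\<^sup>L \<mu> \<phi>))"
      unfolding top_pressure_def
      by (intro tendsto_Lim pressure_at_tendsto assms) auto
    show "(INF y\<in>C. SUP \<mu> \<in> {\<mu> \<in> inv_prob T. \<Xi> \<mu> = y}. metric_entropy T \<mu> + ereal (integral\<^sup>L \<mu> \<phi>))
        = (INF y\<in>C. Lambda_fun T \<Xi> \<phi> y)"
      using C by (intro INF_cong refl) (auto simp: Lambda_fun_def)
  qed
qed

end
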